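(* Let $R$, $R_\mu$, and $\eta$ be given positive constants and consider $(f_0,g_0)\in\mathcal K^2$. Let $(f,g)$ be a weak solution of (RS) with initial data $(f_0,g_0)$ having the properties (i)–(vi) listed in the context. Then there are $\ell\in\Lambda$ and a stationary solution $(F_\ell,G_\ell)$ of (RS) such that $$\lim_{t\to\infty}(f(t),g(t))=(F_\ell,G_\ell)\quad\text{in}\quad L_1(\mathbb R,(1+x^2)dx,\mathbb R^2)\cap L_2(\mathbb R,\mathbb R^2).$$ Additionally, if $f_0$ and $g_0$ are both even, then $\ell=0$.
   Context: $\mathcal K:=\{w\in L_1(\mathbb R,(1+x^2)dx)\cap L_2(\mathbb R): w\ge0\text{ a.e. and }\|w\|_1=1\}$. System (RS): $$\partial_tf=\partial_x\big(f\,\partial_x(\eta^2(1+R)f+Rg+x^2/6)\big),\qquad \partial_tg=\partial_x\big(g\,\partial_x(\eta^2R_\mu f+R_\mu g+x^2/6)\big),\quad (t,x)\in(0,\infty)\times\mathbb R.$$ A stationary solution of (RS) is a pair $(F,G)\in\mathcal K^2\cap H^1(\mathbb R,\mathbb R^2)$ with $F\,\partial_x((1+R)\eta^2F+RG+x^2/6)=0$ and $G\,\partial_x(R_\mu\eta^2F+R_\mu G+x^2/6)=0$ a.e. in $\mathbb R$. The stationary solutions of (RS) are exactly the members of a one-parameter family $(F_\ell,G_\ell)_{\ell\in\Lambda}$, where $\Lambda=[\ell_-,\ell_+]$ is a bounded interval containing $0$ (possibly reduced to $\{0\}$); $(F_0,G_0)$ is the unique stationary solution with both components even, and for $\ell\neq0$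 at least one of $F_\ell,G_\ell$ is not even. Functionals: with $\Theta:=R/(\eta^2R_\mu)$ and $(u,v)\in\mathcal K^2$, $$\mathcal M_2(u,v):=\int_{\mathbb R}(u+\Theta v)x^2dx,\quad \mathcal E_*(u,v):=\frac{\eta^2}2\|u\|_2^2+\frac R2\|\eta u+\eta^{-1}v\|_2^2+\frac16\mathcal M_2(u,v),\quad \mathcal H(u,v):=\int_{\mathbb R}(u\ln u+\Theta v\ln v)dx.$$ Weak solution with initial data $(f_0,g_0)\in\mathcal K^2$: a pair $(f,g):[0,\infty)\to\mathcal K^2$ such that (i) $(f,g)\in L_\infty(0,\infty;\mathcal K^2)$ and $(f,g)\in L_2(0,t;H^1(\mathbb R;\mathbb R^2))$ for all $t>0$; (ii) $(f,g)\in C([0,\infty);H^{-3}(\mathbb R;\mathbb R^2))$ with $(f,g)(0)=(f_0,g_0)$; and for all $\xi\in C_0^\infty(\mathbb R)$ and $t\ge0$, $$\int_{\mathbb R}f(t)\xi dx-\int_{\mathbb R}f_0\xi dx+\int_0^t\!\!\int_{\mathbb R}f\,\partial_x\Big(\eta^2(1+R)f+Rg+\frac{x^2}6\Big)\partial_x\xi\,dxd\sigma=0,$$ $$\int_{\mathbb R}g(t)\xi dx-\int_{\mathbb R}g_0\xi dx+\int_0^t\!\!\int_{\mathbb R}g\,\partial_x\Big(\eta^2R_\mu f+R_\mu g+\frac{x^2}6\Big)\partial_x\xi\,dxd\sigma=0;$$ and, for some Lebesgue-null measurable set $\mathcal N\subset(0,\infty)$ and all $s\in[0,\infty)\setminus\mathcal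 N$, $t\in[0,\infty)$ with $s\le t$: (iii) $\mathcal H(f(t),g(t))+\int_s^t\big(\eta^2\|\partial_xf\|_2^2+R\eta^{-2}\|\eta^2\partial_xf+\partial_xg\|_2^2\big)d\sigma\le\mathcal H(f(s),g(s))+\frac{1+\Theta}3(t-s)$; (iv) $\mathcal E_*(f(t),g(t))+\frac12\int_s^t\int_{\mathbb R}f\big(\eta^2(1+R)\partial_xf+R\partial_xg+\frac x3\big)^2dxd\sigma+\frac\Theta2\int_s^t\int_{\mathbb R}g\big(\eta^2R_\mu\partial_xf+R_\mu\partial_xg+\frac x3\big)^2dxd\sigma\le\mathcal E_*(f(s),g(s))$; (v) $\mathcal M_2(f(t),g(t))+\int_s^t\mathcal M_2(f(\sigma),g(\sigma))d\sigma=\mathcal M_2(f(s),g(s))+2\int_s^t\mathcal E_*(f(\sigma),g(\sigma))d\sigma$; and (vi) if $f_0$ and $g_0$ are even, then $f(t)$ and $g(t)$ are even for all $t\in(0,\infty)$. At least one such weak solution exists for every $(f_0,g_0)\in\mathcal K^2$. *)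

theory Defs
  imports "HOL-Analysis.Analysis"
begin

text \<open>
  Elements of Lebesgue and Sobolev spaces on the real line are represented by functions
  of type \<open>real \<Rightarrow> real\<close>, identified up to equality almost everywhere. All integrals are taken
  with respect to the completed measure \<^term>\<open>lebesgue\<close>, since integrands in \<open>x\<close> or in \<open>t\<close>
  are in general only Lebesgue measurable.
\<close>

section \<open>Function spaces in the space variable\<close>

definition ae_eq :: "(real \<Rightarrow> real) \<Rightarrow> (real \<Rightarrow> real) \<Rightarrow> bool" where
  "ae_eq u v \<longleftrightarrow> (AE x in lebesgue. u x = v x)"

definition ae_even :: "(real \<Rightarrow> real) \<Rightarrow> bool" where
  "ae_even u \<longleftrightarrow> (AE x in lebesgue. u (- x) = u x)"

definition L2 :: "(real \<Rightarrow> real) set" where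
  "L2 = {w. w \<in> borel_measurable lebesgue \<and> integrable lebesgue (\<lambda>x. (w x)\<^sup>2)}"

definition norm_L2 :: "(real \<Rightarrow> real) \<Rightarrow> real" where
  "norm_L2 w = sqrt (\<integral>x. (w x)\<^sup>2 \<partial>lebesgue)"

text \<open>The space \<open>X = L\<^sub>1(\<real>, (1 + x\<^sup>2) dx) \<inter> L\<^sub>2(\<real>)\<close> with its natural norm.\<close>

definition spX :: "(real \<Rightarrow> real) set" where
  "spX = {w \<in> L2. integrable lebesgue (\<lambda>x. (1 + x\<^sup>2) * w x)}"

definition norm_X :: "(real \<Rightarrow> real) \<Rightarrow> real" where
  "norm_X w = (\<integral>x. (1 + x\<^sup>2) * \<bar>w x\<bar> \<partial>lebesgue) + norm_L2 w"

definition setK :: "(real \<Rightarrow> real) set" where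
  "setK = {w \<in> spX. (AE x in lebesgue. 0 \<le> w x) \<and> (\<integral>x. \<bar>w x\<bar> \<partial>lebesgue) = 1}"

definition test_functions :: "(real \<Rightarrow> real) set" where
  "test_functions =
    {\<phi>. (\<forall>n x. ((deriv ^^ n) \<phi>) differentiable (at x)) \<and> compact (closure {x. \<phi> x \<noteq> 0})}"

definition locally_integrable :: "(real \<Rightarrow> real) \<Rightarrow> bool" where
  "locally_integrable w \<longleftrightarrow> (\<forall>a b. set_integrable lebesgue {a..b} w)"

definition has_weak_deriv :: "(real \<Rightarrow> real) \<Rightarrow> (real \<Rightarrow> real) \<Rightarrow> bool" where
  "has_weak_deriv w v \<longleftrightarrow> locally_integrable w \<and> locally_integrable v \<and>
    (\<forall>\<phi>\<in>test_functions. (\<integral>x. w x * deriv \<phi> x \<partial>lebesgue) = - (\<integral>x. v x * \<phi> x \<partial>lebesgue))"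

text \<open>
  A chosen representative of the weak derivative (which is unique up to a null set);
  arbitrary if there is no weak derivative.
\<close>

definition weak_deriv :: "(real \<Rightarrow> real) \<Rightarrow> real \<Rightarrow> real" where
  "weak_deriv w = (SOME v. has_weak_deriv w v)"

text \<open>The Sobolev space \<open>H\<^sup>k(\<real>)\<close>.\<close>

definition sobolev :: "nat \<Rightarrow> (real \<Rightarrow> real) set" where
  "sobolev k =
    {w. (\<forall>j\<le>k. (weak_deriv ^^ j) w \<in> L2) \<and>
        (\<forall>j<k. has_weak_deriv ((weak_deriv ^^ j) w) ((weak_deriv ^^ Suc j) w))}"

definition norm_H :: "nat \<Rightarrow> (real \<Rightarrow> real) \<Rightarrow> real" where
  "norm_H k w = sqrt (\<Sum>j\<le>k. (norm_L2 ((weak_deriv ^^ j) w))\<^sup>2)"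

text \<open>
  The norm of \<open>H\<^sup>-\<^sup>k(\<real>)\<close>, the dual space of \<open>H\<^sup>k(\<real>)\<close>, restricted to functions \<open>w\<close> in \<open>L\<^sub>2(\<real>)\<close>,
  which are regarded as functionals by means of the scalar product of \<open>L\<^sub>2(\<real>)\<close>. For such \<open>w\<close> the
  set below is bounded by the \<open>L\<^sub>2\<close>-norm of \<open>w\<close>.
\<close>

definition norm_H_dual :: "nat \<Rightarrow> (real \<Rightarrow> real) \<Rightarrow> real" where
  "norm_H_dual k w =
    Sup {\<bar>\<integral>x. w x * \<phi> x \<partial>lebesgue\<bar> | \<phi>. \<phi> \<in> sobolev k \<and> norm_H k \<phi> \<le> 1}"

section \<open>Spaces of functions of time\<close>

text \<open>
  Bochner (strong) measurability on \<open>I\<close> with values in the function space \<open>V\<close> with norm \<open>N\<close>: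
  almost everywhere limit, in the sense of \<open>N\<close>, of simple \<open>V\<close>-valued functions.
\<close>

definition bochner_measurable ::
  "real set \<Rightarrow> (real \<Rightarrow> real) set \<Rightarrow> ((real \<Rightarrow> real) \<Rightarrow> real) \<Rightarrow> (real \<Rightarrow> real \<Rightarrow> real) \<Rightarrow> bool" where
  "bochner_measurable I V N u \<longleftrightarrow>
    (AE t in lebesgue_on I. u t \<in> V) \<and>
    (\<exists>s :: nat \<Rightarrow> real \<Rightarrow> real \<Rightarrow> real.
      (\<forall>n. finite (s n ` I) \<and> s n ` I \<subseteq> V \<and> (\<forall>w. {t \<in> I. s n t = w} \<in> sets lebesgue)) \<and>
      (AE t in lebesgue_on I. (\<lambda>n. N (\<lambda>x. s n t x - u t x)) \<longlonglongrightarrow> 0))"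

definition bochner_Linf ::
  "real set \<Rightarrow> (real \<Rightarrow> real) set \<Rightarrow> ((real \<Rightarrow> real) \<Rightarrow> real) \<Rightarrow> (real \<Rightarrow> real \<Rightarrow> real) \<Rightarrow> bool" where
  "bochner_Linf I V N u \<longleftrightarrow>
    bochner_measurable I V N u \<and> (\<exists>C. AE t in lebesgue_on I. N (u t) \<le> C)"

definition bochner_L2 ::
  "real set \<Rightarrow> (real \<Rightarrow> real) set \<Rightarrow> ((real \<Rightarrow> real) \<Rightarrow> real) \<Rightarrow> (real \<Rightarrow> real \<Rightarrow> real) \<Rightarrow> bool" where
  "bochner_L2 I V N u \<longleftrightarrow>
    bochner_measurable I V N u \<and> integrable (lebesgue_on I) (\<lambda>t. (N (u t))\<^sup>2)"

definition continuous_H_dual :: "nat \<Rightarrow> (real \<Rightarrow> real \<Rightarrow> real) \<Rightarrow> bool" where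
  "continuous_H_dual k u \<longleftrightarrow>
    (\<forall>t\<ge>0. ((\<lambda>s. norm_H_dual k (\<lambda>x. u s x - u t x)) \<longlongrightarrow> 0) (at t within {0..}))"

section \<open>The system\<close>

definition press_f ::
  "real \<Rightarrow> real \<Rightarrow> (real \<Rightarrow> real) \<Rightarrow> (real \<Rightarrow> real) \<Rightarrow> real \<Rightarrow> real" where
  "press_f R \<eta> u v = (\<lambda>x. \<eta>\<^sup>2 * (1 + R) * u x + R * v x + x\<^sup>2 / 6)"

definition press_g ::
  "real \<Rightarrow> real \<Rightarrow> (real \<Rightarrow> real) \<Rightarrow> (real \<Rightarrow> real) \<Rightarrow> real \<Rightarrow> real" where
  "press_g R\<^sub>\<mu> \<eta> u v = (\<lambda>x. \<eta>\<^sup>2 * R\<^sub>\<mu> * u x + R\<^sub>\<mu> * v x + x\<^sup>2 / 6)"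

definition stationary_solution ::
  "real \<Rightarrow> real \<Rightarrow> real \<Rightarrow> (real \<Rightarrow> real) \<Rightarrow> (real \<Rightarrow> real) \<Rightarrow> bool" where
  "stationary_solution R R\<^sub>\<mu> \<eta> F G \<longleftrightarrow>
    F \<in> setK \<and> G \<in> setK \<and> F \<in> sobolev 1 \<and> G \<in> sobolev 1 \<and>
    (AE x in lebesgue. F x * weak_deriv (press_f R \<eta> F G) x = 0) \<and>
    (AE x in lebesgue. G x * weak_deriv (press_g R\<^sub>\<mu> \<eta> F G) x = 0)"

text \<open>
  \<open>(Fs l, Gs l)\<close>, for \<open>l\<close> in \<open>\<Lambda> = [lm, lp]\<close>, is an enumeration of all stationary solutions,
  normalised such that the even ones are exactly those with index \<open>0\<close>.
\<close>

definition stationary_family ::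
  "real \<Rightarrow> real \<Rightarrow> real \<Rightarrow> real \<Rightarrow> real \<Rightarrow> (real \<Rightarrow> real \<Rightarrow> real) \<Rightarrow> (real \<Rightarrow> real \<Rightarrow> real) \<Rightarrow> bool"
  where
  "stationary_family R R\<^sub>\<mu> \<eta> lm lp Fs Gs \<longleftrightarrow>
    lm \<le> 0 \<and> 0 \<le> lp \<and>
    (\<forall>l\<in>{lm..lp}. stationary_solution R R\<^sub>\<mu> \<eta> (Fs l) (Gs l)) \<and>
    (\<forall>F G. stationary_solution R R\<^sub>\<mu> \<eta> F G \<longrightarrow>
      (\<exists>l\<in>{lm..lp}. ae_eq F (Fs l) \<and> ae_eq G (Gs l))) \<and>
    ae_even (Fs 0) \<and> ae_even (Gs 0) \<and>
    (\<forall>l\<in>{lm..lp}. l \<noteq> 0 \<longrightarrow> \<not> (ae_even (Fs l) \<and> ae_even (Gs l)))"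

definition Theta :: "real \<Rightarrow> real \<Rightarrow> real \<Rightarrow> real" where
  "Theta R R\<^sub>\<mu> \<eta> = R / (\<eta>\<^sup>2 * R\<^sub>\<mu>)"

definition M2 :: "real \<Rightarrow> real \<Rightarrow> real \<Rightarrow> (real \<Rightarrow> real) \<Rightarrow> (real \<Rightarrow> real) \<Rightarrow> real" where
  "M2 R R\<^sub>\<mu> \<eta> u v = (\<integral>x. (u x + Theta R R\<^sub>\<mu> \<eta> * v x) * x\<^sup>2 \<partial>lebesgue)"

definition Estar :: "real \<Rightarrow> real \<Rightarrow> real \<Rightarrow> (real \<Rightarrow> real) \<Rightarrow> (real \<Rightarrow> real) \<Rightarrow> real" where
  "Estar R R\<^sub>\<mu> \<eta> u v =
    \<eta>\<^sup>2 / 2 * (norm_L2 u)\<^sup>2 + R / 2 * (norm_L2 (\<lambda>x. \<eta> * u x + inverse \<eta> * v x))\<^sup>2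
      + 1 / 6 * M2 R R\<^sub>\<mu> \<eta> u v"

text \<open>Here \<open>0 ln 0 = 0\<close>, as usual for the entropy; in any case the factor \<open>u x\<close> vanishes.\<close>

definition Hfun :: "real \<Rightarrow> real \<Rightarrow> real \<Rightarrow> (real \<Rightarrow> real) \<Rightarrow> (real \<Rightarrow> real) \<Rightarrow> real" where
  "Hfun R R\<^sub>\<mu> \<eta> u v = (\<integral>x. (u x * ln (u x) + Theta R R\<^sub>\<mu> \<eta> * (v x * ln (v x))) \<partial>lebesgue)"

section \<open>Weak solutions\<close>

definition entropy_ineq ::
  "real \<Rightarrow> real \<Rightarrow> real \<Rightarrow> (real \<Rightarrow> real \<Rightarrow> real) \<Rightarrow> (real \<Rightarrow> real \<Rightarrow> real) \<Rightarrow> real \<Rightarrow> real \<Rightarrow> bool" where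
  "entropy_ineq R R\<^sub>\<mu> \<eta> f g s t \<longleftrightarrow>
    Hfun R R\<^sub>\<mu> \<eta> (f t) (g t)
      + (LINT \<sigma>:{s..t}|lebesgue.
          \<eta>\<^sup>2 * (norm_L2 (weak_deriv (f \<sigma>)))\<^sup>2
          + R * inverse (\<eta>\<^sup>2)
            * (norm_L2 (\<lambda>x. \<eta>\<^sup>2 * weak_deriv (f \<sigma>) x + weak_deriv (g \<sigma>) x))\<^sup>2)
    \<le> Hfun R R\<^sub>\<mu> \<eta> (f s) (g s) + (1 + Theta R R\<^sub>\<mu> \<eta>) / 3 * (t - s)"

text \<open>
  The finiteness of the dissipation integrals is part of the energy inequality and is not
  implied by the regularity of \<open>f\<close> and \<open>g\<close>; hence the inequality is stated in \<^typ>\<open>ennreal\<close>.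
\<close>

definition energy_ineq ::
  "real \<Rightarrow> real \<Rightarrow> real \<Rightarrow> (real \<Rightarrow> real \<Rightarrow> real) \<Rightarrow> (real \<Rightarrow> real \<Rightarrow> real) \<Rightarrow> real \<Rightarrow> real \<Rightarrow> bool" where
  "energy_ineq R R\<^sub>\<mu> \<eta> f g s t \<longleftrightarrow>
    ennreal (Estar R R\<^sub>\<mu> \<eta> (f t) (g t))
      + ennreal (1 / 2) *
        (\<integral>\<^sup>+\<sigma>\<in>{s..t}. (\<integral>\<^sup>+x. ennreal (f \<sigma> x *
          (\<eta>\<^sup>2 * (1 + R) * weak_deriv (f \<sigma>) x + R * weak_deriv (g \<sigma>) x + x / 3)\<^sup>2)
          \<partial>lebesgue) \<partial>lebesgue)
      + ennreal (Theta R R\<^sub>\<mu> \<eta> / 2) *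
        (\<integral>\<^sup>+\<sigma>\<in>{s..t}. (\<integral>\<^sup>+x. ennreal (g \<sigma> x *
          (\<eta>\<^sup>2 * R\<^sub>\<mu> * weak_deriv (f \<sigma>) x + R\<^sub>\<mu> * weak_deriv (g \<sigma>) x + x / 3)\<^sup>2)
          \<partial>lebesgue) \<partial>lebesgue)
    \<le> ennreal (Estar R R\<^sub>\<mu> \<eta> (f s) (g s))"

definition moment_eq ::
  "real \<Rightarrow> real \<Rightarrow> real \<Rightarrow> (real \<Rightarrow> real \<Rightarrow> real) \<Rightarrow> (real \<Rightarrow> real \<Rightarrow> real) \<Rightarrow> real \<Rightarrow> real \<Rightarrow> bool" where
  "moment_eq R R\<^sub>\<mu> \<eta> f g s t \<longleftrightarrow>
    M2 R R\<^sub>\<mu> \<eta> (f t) (g t) + (LINT \<sigma>:{s..t}|lebesgue. M2 R R\<^sub>\<mu> \<eta> (f \<sigma>) (g \<sigma>))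
    = M2 R R\<^sub>\<mu> \<eta> (f s) (g s) + 2 * (LINT \<sigma>:{s..t}|lebesgue. Estar R R\<^sub>\<mu> \<eta> (f \<sigma>) (g \<sigma>))"

definition weak_solution ::
  "real \<Rightarrow> real \<Rightarrow> real \<Rightarrow> (real \<Rightarrow> real) \<Rightarrow> (real \<Rightarrow> real) \<Rightarrow>
    (real \<Rightarrow> real \<Rightarrow> real) \<Rightarrow> (real \<Rightarrow> real \<Rightarrow> real) \<Rightarrow> bool" where
  "weak_solution R R\<^sub>\<mu> \<eta> f\<^sub>0 g\<^sub>0 f g \<longleftrightarrow>
    (\<forall>t\<ge>0. f t \<in> setK \<and> g t \<in> setK) \<and>
    bochner_Linf {0<..} spX norm_X f \<and> bochner_Linf {0<..} spX norm_X g \<and>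
    (\<forall>t>0. bochner_L2 {0<..<t} (sobolev 1) (norm_H 1) f \<and>
           bochner_L2 {0<..<t} (sobolev 1) (norm_H 1) g) \<and>
    continuous_H_dual 3 f \<and> continuous_H_dual 3 g \<and>
    ae_eq (f 0) f\<^sub>0 \<and> ae_eq (g 0) g\<^sub>0 \<and>
    (\<forall>\<xi>\<in>test_functions. \<forall>t\<ge>0.
      (\<integral>x. f t x * \<xi> x \<partial>lebesgue) - (\<integral>x. f\<^sub>0 x * \<xi> x \<partial>lebesgue)
        + (LINT \<sigma>:{0..t}|lebesgue.
            (\<integral>x. f \<sigma> x * weak_deriv (press_f R \<eta> (f \<sigma>) (g \<sigma>)) x * deriv \<xi> x \<partial>lebesgue)) = 0 \<and>
      (\<integral>x. g t x * \<xi> x \<partial>lebesgue) - (\<integral>x. g\<^sub>0 x * \<xi> x \<partial>lebesgue)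
        + (LINT \<sigma>:{0..t}|lebesgue.
            (\<integral>x. g \<sigma> x * weak_deriv (press_g R\<^sub>\<mu> \<eta> (f \<sigma>) (g \<sigma>)) x * deriv \<xi> x \<partial>lebesgue)) = 0) \<and>
    (\<exists>N \<in> null_sets lebesgue. N \<subseteq> {0<..} \<and>
      (\<forall>s\<in>{0..} - N. \<forall>t\<ge>s.
        entropy_ineq R R\<^sub>\<mu> \<eta> f g s t \<and>
        energy_ineq R R\<^sub>\<mu> \<eta> f g s t \<and>
        moment_eq R R\<^sub>\<mu> \<eta> f g s t)) \<and>
    (ae_even f\<^sub>0 \<and> ae_even g\<^sub>0 \<longrightarrow> (\<forall>t>0. ae_even (f t) \<and> ae_even (g t)))"

end

theory Submission
  imports Defs "HOL-Complex_Analysis.Great_Picard"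
begin

text \<open>
  A stationary pair satisfies the Euler--Lagrange relations of the strictly convex energy
  \<open>E(u, v) = \<integral> a u\<^sup>2 / 2 + b u v + c v\<^sup>2 / 2 + p x\<^sup>2 u + r x\<^sup>2 v\<close> with
  \<open>a = \<eta>\<^sup>2 (1 + R)\<close>, \<open>b = R\<close>, \<open>c = R / \<eta>\<^sup>2\<close>, \<open>p = 1 / 6\<close>, \<open>r = \<Theta> / 6\<close>, separately on the two
  half-lines for the component whose support may be disconnected. It is therefore the unique minimiser
  of \<open>E\<close> for given masses on \<open>(0, \<infinity>)\<close>, and by strict convexity an energy level contains at most two values
  of the half-line mass of that component.

  Along a weak solution the energy decreases to a limit \<open>E\<^sub>\<infinity>\<close>. The entropy inequality bounds the
  derivatives in \<open>L\<^sub>2\<close> and the energy inequality makes the dissipation small at suitable times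
  \<open>s n \<in> [n, n + 1]\<close>; the second-moment identity is a relaxation equation that forces the potential energy to
  converge to \<open>E\<^sub>\<infinity> / 3\<close>, which is the virial relation of stationary pairs. Hence the states at the times
  \<open>s n\<close> are relatively compact and cluster only at stationary pairs of energy \<open>E\<^sub>\<infinity>\<close>. The half-line mass varies
  slowly in time and has at most two cluster values, so it converges, which determines the limit. Between
  the times \<open>s n\<close>, weak continuity in time together with convergence of the quadratic and the
  potential energy gives strong convergence.
\<close>

section \<open>Test functions\<close>

text \<open>Energy alone cannot select the limit, since several stationary pairs may share a level.
  The half-line mass enters because the potential of one component may be constant with different
  values on the two sides of 0. The condition \<open>b * r \<le> p * c\<close> singles out the other
  component: it is nonincreasing away from 0 and has a single constant. Positivity of
  \<open>a * c - b * b\<close> guarantees this condition or its mirror image, so one orientation is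
  treated and \<open>swap\<close> transports the result.

  Bounded second moments prevent loss of mass, but second moment itself may escape to infinity along
  a sequence, and a cluster point could then carry less energy than the limit level. The quadratic
  energy does converge strongly, and its limit, two thirds of the level, is known once the potential
  energy is known to tend to one third. The virial identity of the cluster point then returns its
  exact potential energy, so no energy is lost.

  "At most two" cluster values of the half-line mass suffices because slow variation makes the set
  of cluster values an interval, and an interval with at most two points is a single point.\<close>

definition smooth_upto :: "nat \<Rightarrow> (real \<Rightarrow> real) \<Rightarrow> bool" where
  "smooth_upto n f \<longleftrightarrow> (\<forall>j<n. \<forall>x. ((deriv ^^ j) f) differentiable (at x))"

lemma smooth_upto_0 [simp]: "smooth_upto 0 f"
  by (simp add: smooth_upto_def)

text \<open>Grading smoothness by a finite order makes this recursion available: closure under sums,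
  products and affine substitutions follows by induction on the order, once the derivative is
  written in closed form.\<close>

lemma smooth_upto_Suc:
  "smooth_upto (Suc n) f \<longleftrightarrow> (\<forall>x. f differentiable (at x)) \<and> smooth_upto n (deriv f)"
  unfolding smooth_upto_def
  by (auto simp: less_Suc_eq_0_disj funpow_swap1)

lemma smooth_upto_mono: "smooth_upto n f \<Longrightarrow> m \<le> n \<Longrightarrow> smooth_upto m f"
  by (auto simp: smooth_upto_def)

lemma smooth_upto_SucD: "smooth_upto (Suc n) f \<Longrightarrow> smooth_upto n f"
  by (rule smooth_upto_mono) auto

lemma test_functions_iff:
  "\<phi> \<in> test_functions \<longleftrightarrow> (\<forall>n. smooth_upto n \<phi>) \<and> compact (closure {x. \<phi> x \<noteq> 0})"
  unfolding test_functions_def smooth_upto_def by auto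

lemma differentiable_DERIV_deriv: "(f :: real \<Rightarrow> real) differentiable (at x) \<Longrightarrow> (f has_real_derivative deriv f x) (at x)"
  using DERIV_deriv_iff_real_differentiable by blast

lemma deriv_eqI_all: "(\<And>x. (f has_real_derivative f' x) (at x)) \<Longrightarrow> deriv f = f'"
  by (rule ext) (rule DERIV_imp_deriv)

lemma smooth_upto_add: "smooth_upto n f \<Longrightarrow> smooth_upto n g \<Longrightarrow> smooth_upto n (\<lambda>x. f x + g x)"
proof (induction n arbitrary: f g)
  case (Suc n)
  have "deriv (\<lambda>x. f x + g x) = (\<lambda>x. deriv f x + deriv g x)"
    using Suc.prems by (intro deriv_eqI_all DERIV_add) (auto simp: smooth_upto_Suc intro: differentiable_DERIV_deriv)
  then show ?case using Suc by (auto simp: smooth_upto_Suc intro!: differentiable_add)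
qed simp

lemma smooth_upto_mult: "smooth_upto n f \<Longrightarrow> smooth_upto n g \<Longrightarrow> smooth_upto n (\<lambda>x. f x * g x)"
proof (induction n arbitrary: f g)
  case (Suc n)
  have "deriv (\<lambda>x. f x * g x) = (\<lambda>x. deriv f x * g x + deriv g x * f x)"
    using Suc.prems by (intro deriv_eqI_all DERIV_mult) (auto simp: smooth_upto_Suc intro: differentiable_DERIV_deriv)
  moreover have "smooth_upto n (\<lambda>x. deriv f x * g x + deriv g x * f x)"
    using Suc.prems by (intro smooth_upto_add Suc.IH) (auto simp: smooth_upto_Suc dest: smooth_upto_SucD
      intro: smooth_upto_SucD[unfolded smooth_upto_Suc])
  ultimately show ?case using Suc.prems by (auto simp: smooth_upto_Suc intro!: differentiable_mult)
qed simp

lemma smooth_upto_const: "smooth_upto n (\<lambda>x. c)"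
proof (induction n arbitrary: c)
  case (Suc n)
  have "deriv (\<lambda>x. c :: real) = (\<lambda>x. 0)" by (intro deriv_eqI_all) simp
  then show ?case using Suc by (auto simp: smooth_upto_Suc)
qed simp

lemma smooth_upto_affine: "smooth_upto n f \<Longrightarrow> smooth_upto n (\<lambda>x. f (c * x + d))"
proof (induction n arbitrary: f)
  case (Suc n)
  have D: "((\<lambda>x. f (c * x + d)) has_real_derivative c * deriv f (c * x + d)) (at x)" for x
  proof -
    have "(f has_real_derivative deriv f (c * x + d)) (at (c * x + d))"
      using Suc.prems by (auto simp: smooth_upto_Suc intro: differentiable_DERIV_deriv)
    then have "((\<lambda>x. f (c * x + d)) has_real_derivative deriv f (c * x + d) * c) (at x)"
      by (intro DERIV_chain'[of "\<lambda>x. c * x + d" c x UNIV f]) (auto intro!: derivative_eq_intros)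
    then show ?thesis by (simp add: mult.commute)
  qed
  have "deriv (\<lambda>x. f (c * x + d)) = (\<lambda>x. c * deriv f (c * x + d))"
    by (intro deriv_eqI_all D)
  moreover have "smooth_upto n (\<lambda>x. c * deriv f (c * x + d))"
    using Suc by (intro smooth_upto_mult smooth_upto_const Suc.IH) (auto simp: smooth_upto_Suc)
  ultimately show ?case using D by (auto simp: smooth_upto_Suc real_differentiable_def)
qed simp

section \<open>Smooth cutoffs built from exp(-1/x)\<close>

definition exp_cutoff :: "real poly \<Rightarrow> real \<Rightarrow> real" where
  "exp_cutoff P x = (if x \<le> 0 then 0 else poly P (inverse x) * exp (- inverse x))"

lemma poly_exp_decay: "((\<lambda>y. poly P y * exp (- y)) \<longlongrightarrow> (0::real)) at_top"
proof -
  have "((\<lambda>y. \<Sum>i\<le>degree P. coeff P i * (y ^ i / exp y)) \<longlongrightarrow> (\<Sum>i\<le>degree P. coeff P i * 0)) at_top"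
    by (intro tendsto_sum tendsto_mult tendsto_const tendsto_power_div_exp_0)
  moreover have "(\<Sum>i\<le>degree P. coeff P i * (y ^ i / exp y)) = poly P y * exp (- y)" for y :: real
    by (simp add: poly_altdef exp_minus sum_distrib_right divide_inverse mult.assoc)
  ultimately show ?thesis by simp
qed

lemma exp_cutoff_at_0: "((\<lambda>x. poly P (inverse x) * exp (- inverse x)) \<longlongrightarrow> (0::real)) (at_right 0)"
  by (rule filterlim_compose[OF poly_exp_decay filterlim_inverse_at_top_right])

text \<open>With \<open>y = 1 / x\<close> the derivative of \<open>P(y) exp(-y)\<close> is
  \<open>y^2 (P - P')(y) exp(-y)\<close>. Keeping the polynomial as a parameter therefore makes the
  family closed under differentiation, which yields smoothness of every order at once, also at
  0.\<close>

lemma DERIV_exp_cutoff: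
  "(exp_cutoff P has_real_derivative exp_cutoff ([:0, 0, 1:] * (P - pderiv P)) x) (at x)"
proof (cases x "0::real" rule: linorder_cases)
  case less
  have "((\<lambda>_. 0) has_real_derivative exp_cutoff ([:0, 0, 1:] * (P - pderiv P)) x) (at x)"
    using less by (simp add: exp_cutoff_def)
  then show ?thesis
    by (rule has_field_derivative_transform_within_open[where S="{..<0}"]) (use less in \<open>auto simp: exp_cutoff_def\<close>)
next
  case greater
  have "((\<lambda>x. poly P (inverse x) * exp (- inverse x)) has_real_derivative
      poly (pderiv P) (inverse x) * (- (inverse x)\<^sup>2) * exp (- inverse x)
       + poly P (inverse x) * (exp (- inverse x) * (inverse x)\<^sup>2)) (at x)"
    using greater
    by (auto intro!: derivative_eq_intros DERIV_chain'[OF _ poly_DERIV] simp: power2_eq_square)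
  also have "poly (pderiv P) (inverse x) * (- (inverse x)\<^sup>2) * exp (- inverse x)
       + poly P (inverse x) * (exp (- inverse x) * (inverse x)\<^sup>2)
     = exp_cutoff ([:0, 0, 1:] * (P - pderiv P)) x"
    using greater by (simp add: exp_cutoff_def power2_eq_square algebra_simps)
  finally show ?thesis
    by (rule has_field_derivative_transform_within_open[where S="{0<..}"]) (use greater in \<open>auto simp: exp_cutoff_def\<close>)
next
  case equal
  \<comment> \<open>The difference quotient at 0 multiplies the polynomial by one more factor
    \<open>1 / x\<close>, which the exponential still absorbs.\<close>
  have R: "((\<lambda>y. (exp_cutoff P y - exp_cutoff P 0) / (y - 0)) \<longlongrightarrow> 0) (at_right 0)"
    using exp_cutoff_at_0[of "[:0,1:] * P"]
    by (rule Lim_transform_eventually)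
      (auto simp: exp_cutoff_def eventually_at_right_less field_simps intro!: eventually_at_rightI[of 0 1])
  have L: "((\<lambda>y. (exp_cutoff P y - exp_cutoff P 0) / (y - 0)) \<longlongrightarrow> 0) (at_left 0)"
    by (rule Lim_transform_eventually[OF tendsto_const])
      (auto simp: exp_cutoff_def intro!: eventually_at_leftI[of "-1" 0])
  show ?thesis
    unfolding equal has_field_derivative_iff
    using filterlim_split_at[OF L R] by (simp add: exp_cutoff_def)
qed

lemma smooth_upto_exp_cutoff: "smooth_upto n (exp_cutoff P)"
proof (induction n arbitrary: P)
  case (Suc n)
  have "deriv (exp_cutoff P) = exp_cutoff ([:0, 0, 1:] * (P - pderiv P))"
    by (intro deriv_eqI_all DERIV_exp_cutoff)
  then show ?case using Suc DERIV_exp_cutoff[of P] by (auto simp: smooth_upto_Suc real_differentiable_def)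
qed simp

definition plateau :: "real \<Rightarrow> real \<Rightarrow> nat \<Rightarrow> real \<Rightarrow> real" where
  "plateau \<alpha> \<beta> m x = exp_cutoff 1 (real (Suc m) * (x - \<alpha>)) * exp_cutoff 1 (real (Suc m) * (\<beta> - x))"

lemma plateau_outside: "x \<notin> {\<alpha><..<\<beta>} \<Longrightarrow> plateau \<alpha> \<beta> m x = 0"
  by (auto simp: plateau_def exp_cutoff_def not_less mult_le_0_iff)

lemma plateau_pos: "x \<in> {\<alpha><..<\<beta>} \<Longrightarrow> plateau \<alpha> \<beta> m x > 0"
  by (auto simp: plateau_def exp_cutoff_def not_le mult_le_0_iff)

lemma plateau_nonneg: "0 \<le> plateau \<alpha> \<beta> m x"
  by (auto simp: plateau_def exp_cutoff_def)

lemma plateau_le_1: "plateau \<alpha> \<beta> m x \<le> 1"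
proof -
  have "exp_cutoff 1 y \<le> 1" "0 \<le> exp_cutoff 1 y" for y
    by (auto simp: exp_cutoff_def)
  then show ?thesis unfolding plateau_def by (intro mult_le_one) auto
qed

lemma plateau_le_indicator: "plateau \<alpha> \<beta> m x \<le> indicator {\<alpha><..<\<beta>} x"
  using plateau_outside[of x \<alpha> \<beta> m] plateau_le_1[of \<alpha> \<beta> m x] by (auto simp: indicator_def)

lemma plateau_test: "plateau \<alpha> \<beta> m \<in> test_functions"
proof -
  have "smooth_upto n (plateau \<alpha> \<beta> m)" for n
    using smooth_upto_mult[OF smooth_upto_affine[OF smooth_upto_exp_cutoff, of n 1 "real (Suc m)" "- real (Suc m) * \<alpha>"]
        smooth_upto_affine[OF smooth_upto_exp_cutoff, of n 1 "- real (Suc m)" "real (Suc m) * \<beta>"]]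
    unfolding plateau_def[abs_def] by (simp add: algebra_simps)
  moreover have "{x. plateau \<alpha> \<beta> m x \<noteq> 0} \<subseteq> {\<alpha>..\<beta>}"
    by (intro subsetI) (metis (mono_tags) greaterThanLessThan_subseteq_atLeastAtMost_iff mem_Collect_eq order_refl plateau_outside subsetD)
  then have "bounded {x. plateau \<alpha> \<beta> m x \<noteq> 0}" by (rule bounded_subset[rotated]) simp
  then have "compact (closure {x. plateau \<alpha> \<beta> m x \<noteq> 0})"
    by (simp add: compact_closure)
  ultimately show ?thesis by (simp add: test_functions_iff)
qed

text \<open>Scaling the argument by \<open>Suc m\<close> moves
  \<open>exp (- 1 / ((m + 1) * z))\<close> towards 1 at each fixed \<open>z > 0\<close>, while the
  support stays within the same interval.\<close>

lemma plateau_tendsto: "(\<lambda>m. plateau \<alpha> \<beta> m x) \<longlonglongrightarrow> indicator {\<alpha><..<\<beta>} x"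
proof (cases "x \<in> {\<alpha><..<\<beta>}")
  case True
  have *: "(\<lambda>m. exp_cutoff 1 (real (Suc m) * z)) \<longlonglongrightarrow> 1" if "z > 0" for z
  proof -
    have "(\<lambda>m. exp (- (inverse (real (Suc m)) * inverse z))) \<longlonglongrightarrow> exp (- (0 * inverse z))"
      by (intro tendsto_intros LIMSEQ_inverse_real_of_nat)
    then show ?thesis using that by (simp add: exp_cutoff_def mult_le_0_iff)
  qed
  have "(\<lambda>m. plateau \<alpha> \<beta> m x) \<longlonglongrightarrow> 1 * 1"
    unfolding plateau_def using True by (intro tendsto_mult *) auto
  then show ?thesis using True by simp
next
  case False
  then show ?thesis using plateau_outside[OF False] by simp
qed

section \<open>Weak derivatives\<close>

lemma AE_lebesgue_uminus: "AE x in lebesgue. P x \<Longrightarrow> AE x in lebesgue. P (- x :: real)"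
proof -
  assume "AE x in lebesgue. P x"
  then obtain N where N: "N \<in> null_sets lebesgue" "{x. \<not> P x} \<subseteq> N"
    by (auto simp: eventually_ae_filter)
  have "(\<lambda>x. - x) ` N \<in> null_sets lebesgue"
  proof -
    have "(*\<^sub>R) (- 1) -` N \<inter> space lebesgue \<in> sets lebesgue"
      using N(1) by (intro measurable_sets[OF lebesgue_measurable_scaling]) auto
    moreover have "(*\<^sub>R) (- 1) -` N \<inter> space lebesgue = (\<lambda>x. - x) ` N"
      by (force simp: image_iff)
    moreover have "emeasure lebesgue ((\<lambda>x. - x) ` N) = 0"
      using N(1) emeasure_lebesgue_affine[of "- 1" 0 N] by (simp add: null_setsD1)
    ultimately show ?thesis by (intro null_setsI) simp_all
  qed
  moreover have "{x. \<not> P (- x)} \<subseteq> (\<lambda>x. - x) ` N"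
    using N(2) by (force simp: image_iff)
  ultimately show ?thesis by (auto simp: eventually_ae_filter)
qed

lemma test_continuous: "\<phi> \<in> test_functions \<Longrightarrow> continuous_on S \<phi>"
  using smooth_upto_Suc[of 0 \<phi>]
  by (meson continuous_at_imp_continuous_on differentiable_imp_continuous_within test_functions_iff)

lemma test_DERIV: "\<phi> \<in> test_functions \<Longrightarrow> (\<phi> has_real_derivative deriv \<phi> x) (at x)"
  using smooth_upto_Suc[of 0 \<phi>] by (auto simp: test_functions_iff intro!: differentiable_DERIV_deriv)

lemma test_support:
  assumes "\<phi> \<in> test_functions"
  obtains A where "A > 0" "\<And>x. A \<le> \<bar>x\<bar> \<Longrightarrow> \<phi> x = 0" "\<And>x. A \<le> \<bar>x\<bar> \<Longrightarrow> deriv \<phi> x = 0"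
proof -
  have "bounded {x. \<phi> x \<noteq> 0}"
    using assms by (auto simp: test_functions_iff intro: bounded_subset[OF compact_imp_bounded closure_subset])
  then obtain B where B: "\<And>x. \<phi> x \<noteq> 0 \<Longrightarrow> \<bar>x\<bar> \<le> B"
    by (auto simp: bounded_iff)
  define A where "A = \<bar>B\<bar> + 1"
  have z: "\<phi> x = 0" if "\<bar>B\<bar> < \<bar>x\<bar>" for x
    using B[of x] that by force
  have "deriv \<phi> x = 0" if "A \<le> \<bar>x\<bar>" for x
  proof -
    have "((\<lambda>_. 0 :: real) has_real_derivative 0) (at x)" by simp
    then have "(\<phi> has_real_derivative 0) (at x)"
      by (rule has_field_derivative_transform_within_open[where S="{y. \<bar>B\<bar> < \<bar>y\<bar>}"])
        (use that z in \<open>auto simp: A_def intro!: open_Collect_less continuous_intros\<close>)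
    then show ?thesis by (rule DERIV_imp_deriv)
  qed
  then show thesis using z by (intro that[of A]) (auto simp: A_def)
qed

lemma test_deriv: "\<phi> \<in> test_functions \<Longrightarrow> deriv \<phi> \<in> test_functions"
proof -
  assume \<phi>: "\<phi> \<in> test_functions"
  obtain A where A: "A > 0" "\<And>x. A \<le> \<bar>x\<bar> \<Longrightarrow> deriv \<phi> x = 0" using test_support[OF \<phi>] by metis
  have "{x. deriv \<phi> x \<noteq> 0} \<subseteq> {-A..A}" using A by force
  then have "compact (closure {x. deriv \<phi> x \<noteq> 0})"
    by (meson bounded_closed_interval bounded_subset compact_closure)
  then show ?thesis using \<phi> smooth_upto_Suc by (auto simp: test_functions_iff)
qed

lemma test_bounded:
  assumes "\<phi> \<in> test_functions"
  obtains B where "B > 0" "\<And>x. \<bar>\<phi> x\<bar> \<le> B"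
proof -
  obtain A where A: "A > 0" "\<And>x. A \<le> \<bar>x\<bar> \<Longrightarrow> \<phi> x = 0" using test_support[OF assms] by metis
  have "bounded (\<phi> ` {-A..A})"
    by (intro compact_imp_bounded compact_continuous_image test_continuous assms) auto
  then obtain B where B: "B > 0" "\<And>x. x \<in> {-A..A} \<Longrightarrow> \<bar>\<phi> x\<bar> \<le> B"
    by (auto simp: bounded_pos)
  have "\<bar>\<phi> x\<bar> \<le> B" for x using A(2)[of x] B(1) B(2)[of x] by (cases "x \<in> {-A..A}") auto
  then show thesis using that B by auto
qed

lemma continuous_lebesgue_measurable:
  "continuous_on UNIV (f :: real \<Rightarrow> real) \<Longrightarrow> f \<in> borel_measurable lebesgue"
  by (intro measurable_completion) (simp add: borel_measurable_continuous_onI)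

lemma test_measurable: "\<phi> \<in> test_functions \<Longrightarrow> \<phi> \<in> borel_measurable lebesgue"
  by (intro continuous_lebesgue_measurable test_continuous)

lemma locally_integrable_measurable:
  assumes "locally_integrable w"
  shows "w \<in> borel_measurable lebesgue"
proof (rule borel_measurable_LIMSEQ_real)
  show "(\<lambda>n. indicator {- real n..real n} x * w x) \<longlonglongrightarrow> w x" for x
  proof (rule tendsto_eventually)
    obtain N where "\<bar>x\<bar> \<le> real N" using real_arch_simple by blast
    then show "eventually (\<lambda>n. indicator {- real n..real n} x * w x = w x) sequentially"
      by (intro eventually_sequentiallyI[of N]) (auto simp: indicator_def)
  qed
  show "(\<lambda>x. indicator {- real n..real n} x * w x) \<in> borel_measurable lebesgue" for n
    using assms unfolding locally_integrable_def set_integrable_def by auto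
qed

lemma locally_integrable_mult_test:
  assumes w: "locally_integrable w" and \<phi>: "\<phi> \<in> test_functions"
  shows "integrable lebesgue (\<lambda>x. w x * \<phi> x)"
proof -
  obtain A where A: "A > 0" "\<And>x. A \<le> \<bar>x\<bar> \<Longrightarrow> \<phi> x = 0" using test_support[OF \<phi>] by metis
  obtain B where B: "B > 0" "\<And>x. \<bar>\<phi> x\<bar> \<le> B" using test_bounded[OF \<phi>] by metis
  have [measurable]: "w \<in> borel_measurable lebesgue" by (rule locally_integrable_measurable[OF w])
  have "integrable lebesgue (\<lambda>x. indicator {-A..A} x * w x)"
    using w unfolding locally_integrable_def set_integrable_def by auto
  then have "integrable lebesgue (\<lambda>x. B * (indicator {-A..A} x * w x))" by simp
  then show ?thesis
  proof (rule Bochner_Integration.integrable_bound)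
    show "(\<lambda>x. w x * \<phi> x) \<in> borel_measurable lebesgue" using test_measurable[OF \<phi>] by measurable
    have "\<bar>w x * \<phi> x\<bar> \<le> \<bar>B * (indicator {-A..A} x * w x)\<bar>" for x
    proof (cases "x \<in> {-A..A}")
      case True
      then show ?thesis using mult_left_mono[OF B(2)[of x], of "\<bar>w x\<bar>"] B(1) by (simp add: abs_mult mult.commute)
    next
      case False
      then have "\<phi> x = 0" by (intro A(2)) auto
      then show ?thesis by simp
    qed
    then show "AE x in lebesgue. norm (w x * \<phi> x) \<le> norm (B * (indicator {-A..A} x * w x))" by simp
  qed
qed

text \<open>The sets over which a Borel representative integrates to 0 contain the intervals and are
  closed under complements and disjoint countable unions, so they are all Borel sets. Truncation to
  \<open>(-N, N)\<close> makes the function integrable on the whole line, which the complement step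
  requires.\<close>

lemma AE_zero_if_intervals:
  assumes W: "locally_integrable W"
    and 0: "\<And>a b. a < b \<Longrightarrow> (LINT x:{a<..<b}|lebesgue. W x) = 0"
  shows "AE x in lebesgue. W x = 0"
proof -
  have "AE x in lebesgue. x \<in> {-real N<..<real N} \<longrightarrow> W x = 0" for N
  proof -
    have "set_integrable lebesgue {-real N..real N} W"
      using W by (auto simp: locally_integrable_def)
    then have "set_integrable lebesgue {-real N<..<real N} W"
      by (rule set_integrable_subset) auto
    then have gi: "integrable lebesgue (\<lambda>x. indicator {-real N<..<real N} x * W x)" (is "integrable _ ?g0")
      by (simp add: set_integrable_def)
    then obtain g where g[measurable]: "g \<in> borel_measurable lborel" and ge: "AE x in lborel. ?g0 x = g x"
      using completion_ex_borel_measurable_real borel_measurable_integrable by blast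
    have ge': "AE x in lebesgue. ?g0 x = g x" by (rule AE_completion[OF ge])
    have gint: "integrable lborel g"
    proof -
      have "integrable lebesgue g"
        by (rule integrable_cong_AE_imp[OF gi measurable_completion[OF g]]) (use ge' in auto)
      then show ?thesis using integrable_completion[OF g] by simp
    qed
    have eq: "(LINT x:A|lborel. g x) = (LINT x:A|lebesgue. ?g0 x)" if [measurable]: "A \<in> sets borel" for A
    proof -
      have "(LINT x:A|lborel. g x) = (LINT x|lebesgue. indicator A x * g x)"
        unfolding set_lebesgue_integral_def by (subst integral_completion) auto
      also have "\<dots> = (LINT x:A|lebesgue. ?g0 x)"
        unfolding set_lebesgue_integral_def
      proof (rule integral_cong_AE)
        have [measurable]: "?g0 \<in> borel_measurable lebesgue" using gi by auto
        have A': "A \<in> sets lebesgue" using that by auto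
        show "(\<lambda>x. indicator A x * g x) \<in> borel_measurable lebesgue" by (intro measurable_completion) measurable
        show "(\<lambda>x. indicator A x *\<^sub>R ?g0 x) \<in> borel_measurable lebesgue" using A' by measurable
      qed (use ge' in auto)
      finally show ?thesis .
    qed
    have int0: "(LINT x:{a<..<b}|lborel. g x) = 0" for a b
    proof -
      have "(LINT x:{a<..<b}|lebesgue. ?g0 x) = (LINT x:{max a (-real N)<..<min b (real N)}|lebesgue. W x)"
        unfolding set_lebesgue_integral_def by (intro Bochner_Integration.integral_cong) (auto simp: indicator_def)
      also have "\<dots> = 0"
        using 0[of "max a (-real N)" "min b (real N)"]
        by (cases "max a (-real N) < min b (real N)") (auto simp: set_lebesgue_integral_def)
      finally show ?thesis by (subst eq) auto
    qed
    have "(LINT x:A|lborel. g x) = 0" if "A \<in> sets borel" for A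
      using that
    proof (induction rule: borel_set_induct)
      case (interval a b)
      have "(LINT x:{a..b}|lborel. g x) = (LINT x:{a<..<b}|lborel. g x)"
        unfolding set_lebesgue_integral_def using AE_lborel_singleton[of a] AE_lborel_singleton[of b]
        by (intro integral_cong_AE) (auto simp: indicator_def)
      then show ?case using int0 by simp
    next
      case (compl A)
      have "(LINT x|lborel. g x) = (LINT x:{-real N<..<real N}|lborel. g x)"
        using ge unfolding set_lebesgue_integral_def by (intro integral_cong_AE) (auto simp: indicator_def)
      then have u: "(LINT x|lborel. g x) = 0" using int0 by simp
      have "(LINT x:-A|lborel. g x) = (LINT x|lborel. g x - indicator A x *\<^sub>R g x)"
        unfolding set_lebesgue_integral_def by (intro Bochner_Integration.integral_cong) (auto simp: indicator_def)
      also have "\<dots> = (LINT x|lborel. g x) - (LINT x:A|lborel. g x)"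
        unfolding set_lebesgue_integral_def using gint compl integrable_mult_indicator[of A lborel g]
        by (intro Bochner_Integration.integral_diff) auto
      finally show ?case using u compl by simp
    next
      case (union A)
      then have "(LINT x:(\<Union>i. A i)|lborel. g x) = (\<Sum>i. (LINT x:(A i)|lborel. g x))"
        using integrable_mult_indicator[of "\<Union>i. A i" lborel g] gint by (intro lebesgue_integral_countable_add)
          (auto simp: disjoint_family_on_def set_integrable_def intro!: integrable_mult_indicator gint)
      then show ?case using union by simp
    qed (simp add: set_lebesgue_integral_def)
    then have "AE x in lborel. g x = 0" by (intro density_unique_real gint) auto
    then have "AE x in lebesgue. g x = 0" by (rule AE_completion)
    then show ?thesis using ge' by eventually_elim (auto simp: indicator_def split: if_splits)
  qed
  then have "AE x in lebesgue. \<forall>N. x \<in> {-real N<..<real N} \<longrightarrow> W x = 0"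
    unfolding AE_all_countable by blast
  then show ?thesis
  proof eventually_elim
    case (elim x)
    obtain N where "\<bar>x\<bar> < real N" using reals_Archimedean2 by blast
    then show ?case using elim by (auto simp: abs_less_iff)
  qed
qed

text \<open>The fundamental lemma of the calculus of variations: plateaus are admissible test
  functions and converge boundedly to the indicator of an interval.\<close>

lemma AE_zero_if_test:
  assumes W: "locally_integrable W"
    and 0: "\<And>\<phi>. \<phi> \<in> test_functions \<Longrightarrow> (\<integral>x. W x * \<phi> x \<partial>lebesgue) = 0"
  shows "AE x in lebesgue. W x = 0"
proof (rule AE_zero_if_intervals[OF W])
  fix a b :: real assume "a < b"
  have [measurable]: "W \<in> borel_measurable lebesgue" by (rule locally_integrable_measurable[OF W])
  have "(\<lambda>m. \<integral>x. W x * plateau a b m x \<partial>lebesgue) \<longlonglongrightarrow> (\<integral>x. W x * indicator {a<..<b} x \<partial>lebesgue)"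
  proof (rule integral_dominated_convergence)
    show "integrable lebesgue (\<lambda>x. \<bar>indicator {a..b} x * W x\<bar>)"
      using W unfolding locally_integrable_def set_integrable_def by (intro integrable_abs) auto
    show "(\<lambda>x. W x * plateau a b m x) \<in> borel_measurable lebesgue" for m
      using test_measurable[OF plateau_test, of a b m] by measurable
    show "AE x in lebesgue. (\<lambda>m. W x * plateau a b m x) \<longlonglongrightarrow> W x * indicator {a<..<b} x"
      by (intro AE_I2 tendsto_mult tendsto_const plateau_tendsto)
    show "AE x in lebesgue. norm (W x * plateau a b m x) \<le> \<bar>indicator {a..b} x * W x\<bar>" for m
    proof (rule AE_I2)
      fix x show "norm (W x * plateau a b m x) \<le> \<bar>indicator {a..b} x * W x\<bar>"
        using plateau_le_1[of a b m x] plateau_nonneg[of a b m x] plateau_outside[of x a b m]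
        by (cases "x \<in> {a<..<b}") (auto simp: abs_mult mult_left_le)
    qed
  qed (auto intro!: borel_measurable_times borel_measurable_indicator)
  then have "(\<integral>x. W x * indicator {a<..<b} x \<partial>lebesgue) = 0"
    using 0[OF plateau_test] by (simp add: LIMSEQ_const_iff)
  then show "(LINT x:{a<..<b}|lebesgue. W x) = 0"
    by (simp add: set_lebesgue_integral_def mult.commute)
qed

lemma locally_integrable_add: "locally_integrable v \<Longrightarrow> locally_integrable w \<Longrightarrow> locally_integrable (\<lambda>x. v x + w x)"
  unfolding locally_integrable_def by (auto intro: set_integral_add)

lemma locally_integrable_diff: "locally_integrable v \<Longrightarrow> locally_integrable w \<Longrightarrow> locally_integrable (\<lambda>x. v x - w x)"
  unfolding locally_integrable_def by (auto intro: set_integral_diff)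

lemma locally_integrable_cmult: "locally_integrable v \<Longrightarrow> locally_integrable (\<lambda>x. c * v x)"
  unfolding locally_integrable_def by (auto intro: set_integrable_mult_right)

lemma locally_integrable_continuous: "continuous_on UNIV (v :: real \<Rightarrow> real) \<Longrightarrow> locally_integrable v"
  unfolding locally_integrable_def
  by (metis absolutely_integrable_continuous_real continuous_on_subset top_greatest)

lemma has_weak_deriv_unique:
  assumes "has_weak_deriv w v" "has_weak_deriv w v'"
  shows "AE x in lebesgue. v x = v' x"
proof -
  have l: "locally_integrable v" "locally_integrable v'" using assms by (auto simp: has_weak_deriv_def)
  have "AE x in lebesgue. v x - v' x = 0"
  proof (rule AE_zero_if_test)
    fix \<phi> assume \<phi>: "\<phi> \<in> test_functions"
    have "(\<integral>x. (v x - v' x) * \<phi> x \<partial>lebesgue) = (\<integral>x. v x * \<phi> x \<partial>lebesgue) - (\<integral>x. v' x * \<phi> x \<partial>lebesgue)"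
      unfolding left_diff_distrib
      by (intro Bochner_Integration.integral_diff locally_integrable_mult_test l \<phi>)
    also have "\<dots> = 0" using assms \<phi> by (auto simp: has_weak_deriv_def)
    finally show "(\<integral>x. (v x - v' x) * \<phi> x \<partial>lebesgue) = 0" .
  qed (intro locally_integrable_diff l)
  then show ?thesis by simp
qed

lemma has_weak_deriv_weak_deriv: "has_weak_deriv w v \<Longrightarrow> has_weak_deriv w (weak_deriv w)"
  unfolding weak_deriv_def by (rule someI[where P="has_weak_deriv w"])

text \<open>\<open>weak_deriv\<close> is a mere choice, so identities for it hold only almost
  everywhere. They are obtained by exhibiting some weak derivative and comparing.\<close>

lemma weak_deriv_AE: "has_weak_deriv w v \<Longrightarrow> AE x in lebesgue. weak_deriv w x = v x"
  using has_weak_deriv_unique has_weak_deriv_weak_deriv by blast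

lemma has_weak_deriv_lincomb:
  assumes "has_weak_deriv w v" "has_weak_deriv w' v'"
  shows "has_weak_deriv (\<lambda>x. a * w x + b * w' x) (\<lambda>x. a * v x + b * v' x)"
  unfolding has_weak_deriv_def
proof (intro conjI ballI)
  note l = assms[unfolded has_weak_deriv_def]
  show "locally_integrable (\<lambda>x. a * w x + b * w' x)" "locally_integrable (\<lambda>x. a * v x + b * v' x)"
    using l by (auto intro!: locally_integrable_add locally_integrable_cmult)
  fix \<phi> assume \<phi>: "\<phi> \<in> test_functions"
  have *: "(\<integral>x. (a * u x + b * u' x) * \<psi> x \<partial>lebesgue) = a * (\<integral>x. u x * \<psi> x \<partial>lebesgue) + b * (\<integral>x. u' x * \<psi> x \<partial>lebesgue)"
    if "locally_integrable u" "locally_integrable u'" "\<psi> \<in> test_functions" for u u' \<psi>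
    using that locally_integrable_mult_test[of _ \<psi>]
    by (simp add: distrib_right mult.assoc)
  show "(\<integral>x. (a * w x + b * w' x) * deriv \<phi> x \<partial>lebesgue) = - (\<integral>x. (a * v x + b * v' x) * \<phi> x \<partial>lebesgue)"
    using l \<phi> test_deriv[OF \<phi>] by (simp add: *)
qed

section \<open>Inner product and norm estimates in L2\<close>

lemma L2_mult_integrable:
  assumes "u \<in> L2" "v \<in> L2"
  shows "integrable lebesgue (\<lambda>x. u x * v x)"
proof (rule Bochner_Integration.integrable_bound)
  show "integrable lebesgue (\<lambda>x. (u x)\<^sup>2 + (v x)\<^sup>2)" using assms by (auto simp: L2_def)
  show "(\<lambda>x. u x * v x) \<in> borel_measurable lebesgue" using assms by (auto simp: L2_def)
  have "\<bar>u x * v x\<bar> \<le> (u x)\<^sup>2 + (v x)\<^sup>2" for x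
  proof -
    have "2 * (\<bar>u x\<bar> * \<bar>v x\<bar>) \<le> (u x)\<^sup>2 + (v x)\<^sup>2"
      using sum_squares_bound[of "\<bar>u x\<bar>" "\<bar>v x\<bar>"] by (simp add: mult.assoc)
    moreover have "0 \<le> \<bar>u x\<bar> * \<bar>v x\<bar>" by simp
    ultimately show ?thesis unfolding abs_mult by linarith
  qed
  then show "AE x in lebesgue. norm (u x * v x) \<le> norm ((u x)\<^sup>2 + (v x)\<^sup>2)" by simp
qed

lemma L2_lincomb:
  assumes "u \<in> L2" "v \<in> L2"
  shows "(\<lambda>x. a * u x + b * v x) \<in> L2"
proof -
  have "integrable lebesgue (\<lambda>x. a\<^sup>2 * (u x)\<^sup>2 + 2 * a * b * (u x * v x) + b\<^sup>2 * (v x)\<^sup>2)"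
    using assms L2_mult_integrable[OF assms] by (auto simp: L2_def)
  then have "integrable lebesgue (\<lambda>x. (a * u x + b * v x)\<^sup>2)"
    by (simp add: power2_eq_square algebra_simps)
  then show ?thesis using assms by (auto simp: L2_def)
qed

lemma L2_diff: "u \<in> L2 \<Longrightarrow> v \<in> L2 \<Longrightarrow> (\<lambda>x. u x - v x) \<in> L2"
  using L2_lincomb[of u v 1 "-1"] by simp

lemma norm_L2_nonneg [simp]: "0 \<le> norm_L2 u"
  by (simp add: norm_L2_def)

lemma norm_L2_sq: "(norm_L2 u)\<^sup>2 = (\<integral>x. (u x)\<^sup>2 \<partial>lebesgue)"
  by (simp add: norm_L2_def)

lemma L2_Cauchy_Schwarz:
  assumes "u \<in> L2" "v \<in> L2"
  shows "\<bar>\<integral>x. u x * v x \<partial>lebesgue\<bar> \<le> norm_L2 u * norm_L2 v"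
proof -
  define A B C where "A = (\<integral>x. (u x)\<^sup>2 \<partial>lebesgue)" and "B = (\<integral>x. u x * v x \<partial>lebesgue)" and "C = (\<integral>x. (v x)\<^sup>2 \<partial>lebesgue)"
  have q: "0 \<le> A + 2 * t * B + t\<^sup>2 * C" for t
  proof -
    have "0 \<le> (\<integral>x. (u x + t * v x)\<^sup>2 \<partial>lebesgue)" by simp
    also have "\<dots> = (\<integral>x. (u x)\<^sup>2 + 2 * t * (u x * v x) + t\<^sup>2 * (v x)\<^sup>2 \<partial>lebesgue)"
      by (simp add: power2_eq_square algebra_simps)
    also have "\<dots> = A + 2 * t * B + t\<^sup>2 * C"
      unfolding A_def B_def C_def using assms L2_mult_integrable[OF assms]
      by (subst Bochner_Integration.integral_add; (subst Bochner_Integration.integral_add)?) (auto simp: L2_def)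
    finally show ?thesis .
  qed
  have C0: "0 \<le> C" and A0: "0 \<le> A" by (auto simp: C_def A_def)
  have "B\<^sup>2 \<le> A * C"
  proof (cases "C = 0")
    case True
    have "B = 0"
    proof (rule ccontr)
      assume "B \<noteq> 0"
      \<comment> \<open>This \<open>t\<close> makes \<open>A + 2 * t * B\<close> equal to
        -1.\<close>
      then show False using q[of "- (A + 1) / (2 * B)"] True by (simp add: field_simps)
    qed
    then show ?thesis using True by simp
  next
    case False
    then have "0 \<le> A - B\<^sup>2 / C" using q[of "- B / C"] by (simp add: power2_eq_square field_simps)
    then show ?thesis using False C0 by (simp add: field_simps)
  qed
  then have "\<bar>B\<bar> \<le> sqrt (A * C)" by (metis real_sqrt_abs real_sqrt_le_mono)
  then show ?thesis by (simp add: A_def B_def C_def norm_L2_def real_sqrt_mult)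
qed

lemma L2_abs: "u \<in> L2 \<Longrightarrow> (\<lambda>x. \<bar>u x\<bar>) \<in> L2"
  by (auto simp: L2_def)

lemma norm_L2_abs: "norm_L2 (\<lambda>x. \<bar>u x\<bar>) = norm_L2 u"
  by (simp add: norm_L2_def)

lemma L2_Cauchy_Schwarz_abs:
  assumes "u \<in> L2" "v \<in> L2"
  shows "(\<integral>x. \<bar>u x * v x\<bar> \<partial>lebesgue) \<le> norm_L2 u * norm_L2 v"
  using L2_Cauchy_Schwarz[OF L2_abs L2_abs, OF assms] by (simp add: norm_L2_abs abs_mult)

lemma norm_L2_triangle:
  assumes "u \<in> L2" "v \<in> L2"
  shows "norm_L2 (\<lambda>x. u x + v x) \<le> norm_L2 u + norm_L2 v"
proof -
  have "(norm_L2 (\<lambda>x. u x + v x))\<^sup>2 = (\<integral>x. (u x)\<^sup>2 + 2 * (u x * v x) + (v x)\<^sup>2 \<partial>lebesgue)"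
    unfolding norm_L2_sq by (simp add: power2_eq_square algebra_simps)
  also have "\<dots> = (norm_L2 u)\<^sup>2 + 2 * (\<integral>x. u x * v x \<partial>lebesgue) + (norm_L2 v)\<^sup>2"
    unfolding norm_L2_sq using assms L2_mult_integrable[OF assms]
    by (subst Bochner_Integration.integral_add; (subst Bochner_Integration.integral_add)?) (auto simp: L2_def)
  also have "\<dots> \<le> (norm_L2 u + norm_L2 v)\<^sup>2"
    using L2_Cauchy_Schwarz[OF assms] by (simp add: power2_sum)
  finally show ?thesis by (rule power2_le_imp_le) simp
qed

lemma norm_L2_cmult: "norm_L2 (\<lambda>x. c * u x) = \<bar>c\<bar> * norm_L2 u"
  by (simp add: norm_L2_def power_mult_distrib real_sqrt_mult)

lemma norm_L2_cong_AE:
  assumes "AE x in lebesgue. u x = v x" "u \<in> borel_measurable lebesgue" "v \<in> borel_measurable lebesgue"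
  shows "norm_L2 u = norm_L2 v"
  unfolding norm_L2_def using assms by (intro arg_cong[where f=sqrt] integral_cong_AE) auto

lemma L2_cong_AE:
  assumes "AE x in lebesgue. u x = v x" "u \<in> L2" "v \<in> borel_measurable lebesgue"
  shows "v \<in> L2"
proof -
  have "integrable lebesgue (\<lambda>x. (v x)\<^sup>2)"
    by (rule integrable_cong_AE_imp[of lebesgue "\<lambda>x. (u x)\<^sup>2"]) (use assms in \<open>auto simp: L2_def\<close>)
  then show ?thesis using assms by (simp add: L2_def)
qed

lemma norm_L2_triangle_diff:
  assumes "u \<in> L2" "v \<in> L2"
  shows "\<bar>norm_L2 u - norm_L2 v\<bar> \<le> norm_L2 (\<lambda>x. u x - v x)"
proof -
  have "norm_L2 u \<le> norm_L2 (\<lambda>x. u x - v x) + norm_L2 v"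
    using norm_L2_triangle[OF L2_diff[OF assms] assms(2)] by simp
  moreover have "norm_L2 v \<le> norm_L2 (\<lambda>x. v x - u x) + norm_L2 u"
    using norm_L2_triangle[OF L2_diff[OF assms(2,1)] assms(1)] by simp
  moreover have "norm_L2 (\<lambda>x. v x - u x) = norm_L2 (\<lambda>x. u x - v x)"
    by (simp add: norm_L2_def power2_commute)
  ultimately show ?thesis by linarith
qed

lemma L2_indicator: "(indicator {a..b} :: real \<Rightarrow> real) \<in> L2"
proof -
  have "integrable lebesgue (indicator {a..b} :: real \<Rightarrow> real)"
    by (intro integrable_real_indicator) (auto simp: emeasure_lborel_Icc_eq)
  moreover have "(\<lambda>x. (indicator {a..b} x :: real)\<^sup>2) = indicator {a..b}" by (auto simp: indicator_def)
  ultimately show ?thesis by (simp add: L2_def)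
qed

lemma norm_L2_indicator: "a \<le> b \<Longrightarrow> norm_L2 (indicator {a..b}) = sqrt (b - a)"
proof -
  have "(\<lambda>x. (indicator {a..b} x :: real)\<^sup>2) = indicator {a..b}" by (auto simp: indicator_def)
  moreover assume "a \<le> b"
  ultimately show ?thesis by (simp add: norm_L2_def)
qed

lemma L2_locally_integrable: "u \<in> L2 \<Longrightarrow> locally_integrable u"
  unfolding locally_integrable_def set_integrable_def
  using L2_mult_integrable[OF L2_indicator, of u] by auto

lemma test_lincomb:
  assumes "\<phi> \<in> test_functions" "\<psi> \<in> test_functions"
  shows "(\<lambda>x. a * \<phi> x + b * \<psi> x) \<in> test_functions"
proof -
  obtain A where A: "\<And>x. A \<le> \<bar>x\<bar> \<Longrightarrow> \<phi> x = 0" using test_support[OF assms(1)] by metis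
  obtain B where B: "\<And>x. B \<le> \<bar>x\<bar> \<Longrightarrow> \<psi> x = 0" using test_support[OF assms(2)] by metis
  have "{x. a * \<phi> x + b * \<psi> x \<noteq> 0} \<subseteq> {- max A B..max A B}"
  proof
    fix x assume "x \<in> {x. a * \<phi> x + b * \<psi> x \<noteq> 0}"
    then have "\<phi> x \<noteq> 0 \<or> \<psi> x \<noteq> 0" by auto
    then have "\<not> A \<le> \<bar>x\<bar> \<or> \<not> B \<le> \<bar>x\<bar>" using A[of x] B[of x] by blast
    then have "\<bar>x\<bar> \<le> max A B" by linarith
    then show "x \<in> {- max A B..max A B}" by auto
  qed
  then have "compact (closure {x. a * \<phi> x + b * \<psi> x \<noteq> 0})"
    by (meson bounded_closed_interval bounded_subset compact_closure)
  moreover have "smooth_upto n (\<lambda>x. a * \<phi> x + b * \<psi> x)" for n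
    using assms by (intro smooth_upto_add smooth_upto_mult[OF smooth_upto_const]) (simp_all add: test_functions_iff)
  ultimately show ?thesis by (simp add: test_functions_iff)
qed

lemma test_integral_interval:
  assumes \<phi>: "continuous_on UNIV \<phi>" and A: "\<And>x::real. A \<le> \<bar>x\<bar> \<Longrightarrow> \<phi> x = (0::real)"
    and "a \<le> -A" "A \<le> b" "0 < A"
  shows "(\<integral>x. \<phi> x \<partial>lebesgue) = integral {a..b} \<phi>"
proof -
  have "set_integrable lebesgue {a..b} \<phi>"
    using \<phi> by (metis absolutely_integrable_continuous_real continuous_on_subset top_greatest)
  then have "integral {a..b} \<phi> = (LINT x:{a..b}|lebesgue. \<phi> x)"
    by (simp add: set_lebesgue_integral_eq_integral(2))
  also have "\<dots> = (\<integral>x. \<phi> x \<partial>lebesgue)"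
    unfolding set_lebesgue_integral_def
  proof (intro Bochner_Integration.integral_cong refl)
    fix x
    show "indicator {a..b} x *\<^sub>R \<phi> x = \<phi> x"
      using A[of x] assms(3-) by (cases "x \<in> {a..b}") (auto simp: abs_if)
  qed
  finally show ?thesis by simp
qed

text \<open>A primitive that vanishes left of the support is constant to the right of it, and that
  constant is the total integral. Hence mean zero is exactly what makes the primitive compactly
  supported.\<close>

lemma test_antiderivative:
  assumes \<psi>: "\<psi> \<in> test_functions" and 0: "(\<integral>x. \<psi> x \<partial>lebesgue) = 0"
  obtains \<Psi> where "\<Psi> \<in> test_functions" "deriv \<Psi> = \<psi>"
proof -
  obtain A where A: "A > 0" "\<And>x. A \<le> \<bar>x\<bar> \<Longrightarrow> \<psi> x = 0" using test_support[OF \<psi>] by metis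
  note cont = test_continuous[OF \<psi>]
  \<comment> \<open>Starting one unit left of the support makes every \<open>x \<ge> - A\<close> an
    interior point of an interval of integration, where the fundamental theorem applies. Further
    left \<open>\<Psi>\<close> is locally 0.\<close>
  define \<Psi> where "\<Psi> x = integral {- A - 1..x} \<psi>" for x
  have low: "\<Psi> x = 0" if "x \<le> - A" for x
  proof -
    have "integral {- A - 1..x} \<psi> = integral {- A - 1..x} (\<lambda>_. 0)"
      using A that by (intro integral_cong) auto
    then show ?thesis by (simp add: \<Psi>_def)
  qed
  have high: "\<Psi> x = 0" if "A \<le> x" for x
    using test_integral_interval[OF cont A(2), of A "- A - 1" x] 0 that A(1) by (simp add: \<Psi>_def)
  have D: "(\<Psi> has_real_derivative \<psi> x) (at x)" for x
  proof (cases "x < - A")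
    case True
    have "((\<lambda>_. 0) has_real_derivative \<psi> x) (at x)" using A True by simp
    then show ?thesis
      by (rule has_field_derivative_transform_within_open[where S="{..<-A}"]) (use low True in auto)
  next
    case False
    have "(\<Psi> has_vector_derivative \<psi> x) (at x within {- A - 1..x + 1})"
      unfolding \<Psi>_def[abs_def] using False by (intro integral_has_vector_derivative cont) auto
    then have "(\<Psi> has_vector_derivative \<psi> x) (at x within {- A - 1<..<x + 1})"
      by (rule has_vector_derivative_within_subset) auto
    then show ?thesis
      using False by (subst (asm) has_vector_derivative_within_open)
        (auto simp: has_real_derivative_iff_has_vector_derivative)
  qed
  have d: "deriv \<Psi> = \<psi>" by (intro deriv_eqI_all D)
  have sm: "smooth_upto n \<Psi>" for n
  proof (cases n)
    case (Suc m)
    then show ?thesis using \<psi> D by (auto simp: smooth_upto_Suc d test_functions_iff real_differentiable_def)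
  qed simp
  have "{x. \<Psi> x \<noteq> 0} \<subseteq> {- A..A}"
  proof
    fix x assume "x \<in> {x. \<Psi> x \<noteq> 0}"
    then have "\<not> x \<le> - A" "\<not> A \<le> x" using low high by blast+
    then show "x \<in> {- A..A}" by simp
  qed
  then have "compact (closure {x. \<Psi> x \<noteq> 0})"
    by (meson bounded_closed_interval bounded_subset compact_closure)
  then have "\<Psi> \<in> test_functions" using sm by (simp add: test_functions_iff)
  then show thesis using d that by blast
qed

section \<open>Functions with a weak derivative as primitives, up to null sets\<close>

definition primitive :: "(real \<Rightarrow> real) \<Rightarrow> real \<Rightarrow> real" where
  "primitive v x = (if 0 \<le> x then LINT y:{0..x}|lebesgue. v y else - (LINT y:{x..0}|lebesgue. v y))"

lemma locally_integrable_combine: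
  assumes "locally_integrable v" "a \<le> b" "b \<le> c"
  shows "(LINT y:{a..b}|lebesgue. v y) + (LINT y:{b..c}|lebesgue. v y) = (LINT y:{a..c}|lebesgue. v y)"
  using assms unfolding locally_integrable_def
  by (simp add: set_lebesgue_integral_eq_integral Henstock_Kurzweil_Integration.integral_combine)

lemma primitive_diff:
  assumes "locally_integrable v" "x \<le> y"
  shows "primitive v y - primitive v x = (LINT t:{x..y}|lebesgue. v t)"
  using locally_integrable_combine[OF assms(1), of 0 x y] locally_integrable_combine[OF assms(1), of x 0 y]
    locally_integrable_combine[OF assms(1), of x y 0] assms(2)
  by (auto simp: primitive_def not_le)

lemma primitive_continuous:
  assumes v: "locally_integrable v"
  shows "continuous_on UNIV (primitive v)"
proof -
  have "isCont (primitive v) x" for x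
  proof -
    define a b where "a = x - 1" and "b = x + 1"
    have "v integrable_on {a..b}"
      using v set_lebesgue_integral_eq_integral(1) by (auto simp: locally_integrable_def)
    then have "continuous_on {a..b} (\<lambda>y. primitive v a + integral {a..y} v)"
      by (intro continuous_intros indefinite_integral_continuous_1)
    moreover have "primitive v a + integral {a..y} v = primitive v y" if "y \<in> {a..b}" for y
      using primitive_diff[OF v, of a y] v that
      by (simp add: locally_integrable_def set_lebesgue_integral_eq_integral)
    ultimately have "continuous_on {a..b} (primitive v)" by (rule continuous_on_eq)
    then have "continuous_on {a<..<b} (primitive v)" by (rule continuous_on_subset) auto
    then show ?thesis by (simp add: continuous_on_eq_continuous_at a_def b_def)
  qed
  then show ?thesis by (simp add: continuous_at_imp_continuous_on)
qed

text \<open>Integration by parts for a primitive of a merely locally integrable function, by Fubini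
  on the region \<open>x \<le> y\<close>. The Borel representative \<open>g\<close> replaces
  \<open>v\<close> on the support of the test function in order to have joint measurability.\<close>

lemma primitive_has_weak_deriv:
  assumes v: "locally_integrable v"
  shows "has_weak_deriv (primitive v) v"
  unfolding has_weak_deriv_def
proof (intro conjI ballI)
  show "locally_integrable (primitive v)" by (intro locally_integrable_continuous primitive_continuous v)
  show "locally_integrable v" by fact
  fix \<Psi> assume \<Psi>: "\<Psi> \<in> test_functions"
  note \<psi> = test_deriv[OF \<Psi>]
  obtain A where A: "A > 0" "\<And>x. A \<le> \<bar>x\<bar> \<Longrightarrow> \<Psi> x = 0" "\<And>x. A \<le> \<bar>x\<bar> \<Longrightarrow> deriv \<Psi> x = 0"
    using test_support[OF \<Psi>] by metis
  obtain B where B: "B > 0" "\<And>x. \<bar>deriv \<Psi> x\<bar> \<le> B" using test_bounded[OF \<psi>] by metis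
  have [measurable]: "\<Psi> \<in> borel_measurable borel" "deriv \<Psi> \<in> borel_measurable borel"
    using test_continuous[OF \<Psi>, of UNIV] test_continuous[OF \<psi>, of UNIV] by (auto intro: borel_measurable_continuous_onI)
  have vA: "integrable lebesgue (\<lambda>x. indicator {-A..A} x * v x)"
    using v by (auto simp: locally_integrable_def set_integrable_def)
  obtain g where g[measurable]: "g \<in> borel_measurable lborel" and "AE x in lborel. indicator {-A..A} x * v x = g x"
    using completion_ex_borel_measurable_real borel_measurable_integrable vA by blast
  then have ge: "AE x in lebesgue. indicator {-A..A} x * v x = g x" by (intro AE_completion)
  have "integrable lebesgue g"
    by (rule integrable_cong_AE_imp[OF vA measurable_completion[OF g]]) (use ge in auto)
  then have gi: "integrable lborel g" using integrable_completion[OF g] by simp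
  have [measurable]: "v \<in> borel_measurable lebesgue" by (rule locally_integrable_measurable[OF v])
  have I1: "(\<integral>x. indicator {..y} x * g x \<partial>lborel) = (LINT x:{-A..y}|lebesgue. v x)" if "y \<in> {-A..A}" for y
  proof -
    have "(\<integral>x. indicator {..y} x * g x \<partial>lborel) = (\<integral>x. indicator {..y} x * g x \<partial>lebesgue)"
      by (subst integral_completion) auto
    also have "\<dots> = (LINT x:{-A..y}|lebesgue. v x)"
      unfolding set_lebesgue_integral_def
    proof (rule integral_cong_AE)
      show "(\<lambda>x. indicator {..y} x * g x) \<in> borel_measurable lebesgue" by (intro measurable_completion) simp
      show "AE x in lebesgue. indicator {..y} x * g x = indicator {-A..y} x *\<^sub>R v x"
        using ge by eventually_elim (use that in \<open>auto simp: indicator_def split: if_splits\<close>)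
    qed (auto intro!: borel_measurable_times borel_measurable_indicator)
    finally show ?thesis .
  qed
  have FT: "(deriv \<Psi> has_integral (\<Psi> b - \<Psi> a)) {a..b}" if "a \<le> b" for a b
    using that test_DERIV[OF \<Psi>]
    by (intro fundamental_theorem_of_calculus)
      (auto simp: has_real_derivative_iff_has_vector_derivative[symmetric] intro: has_field_derivative_at_within)
  have I2: "(\<integral>x. indicator {y..} x * deriv \<Psi> x \<partial>lborel) = - \<Psi> y" if "y \<in> {-A..A}" for y
  proof -
    have "(\<integral>x. indicator {y..} x * deriv \<Psi> x \<partial>lborel) = (LINT x:{y..A}|lborel. deriv \<Psi> x)"
      unfolding set_lebesgue_integral_def using A by (intro Bochner_Integration.integral_cong) (auto simp: indicator_def)
    also have "\<dots> = integral {y..A} (deriv \<Psi>)"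
      by (intro set_borel_integral_eq_integral borel_integrable_atLeastAtMost')
        (rule test_continuous[OF \<psi>])
    also have "\<dots> = \<Psi> A - \<Psi> y" using FT that by (intro integral_unique) auto
    finally show ?thesis using A by simp
  qed
  have "(\<integral>x. deriv \<Psi> x \<partial>lebesgue) = integral {-A..A} (deriv \<Psi>)"
    using A by (intro test_integral_interval test_continuous \<psi>) auto
  also have "\<dots> = \<Psi> A - \<Psi> (-A)" using FT A(1) by (intro integral_unique) auto
  finally have z: "(\<integral>x. deriv \<Psi> x \<partial>lebesgue) = 0" using A by simp
  \<comment> \<open>Integrating in \<open>x\<close> first produces the increment of the primitive
    times \<open>deriv \<Psi> y\<close>; integrating in \<open>y\<close> first produces
    \<open>- (g x * \<Psi> x)\<close>.\<close>
  define k where "k y x = deriv \<Psi> y * (indicator {..y} x * g x)" for y x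
  have [measurable]: "(\<lambda>p. k (fst p) (snd p)) \<in> borel_measurable (lborel \<Otimes>\<^sub>M lborel)"
  proof -
    have "(\<lambda>p. k (fst p) (snd p)) = (\<lambda>p. deriv \<Psi> (fst p) * ((if snd p \<le> fst p then 1 else 0) * g (snd p)))"
      by (auto simp: k_def indicator_def)
    then show ?thesis by simp
  qed
  have [measurable]: "(\<lambda>x. \<integral>y. k y x \<partial>lborel) \<in> borel_measurable lborel"
  proof -
    have "(\<lambda>p. k (snd p) (fst p)) = (\<lambda>p. deriv \<Psi> (snd p) * ((if fst p \<le> snd p then 1 else 0) * g (fst p)))"
      by (auto simp: k_def indicator_def)
    then have "(\<lambda>p. k (snd p) (fst p)) \<in> borel_measurable (lborel \<Otimes>\<^sub>M lborel)" by simp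
    then have "(\<lambda>(x, y). k y x) \<in> borel_measurable (lborel \<Otimes>\<^sub>M lborel)" by (simp add: case_prod_unfold)
    then show ?thesis by (rule lborel.borel_measurable_lebesgue_integral)
  qed
  have i1: "integrable lborel (k y)" for y
    unfolding k_def using gi integrable_mult_indicator[of "{..y}" lborel g] by auto
  have "integrable lborel (\<lambda>y. B * (indicator {-A..A} y * (\<integral>x. \<bar>g x\<bar> \<partial>lborel)))"
    by (intro integrable_mult_right integrable_mult_left integrable_real_indicator) (auto simp: emeasure_lborel_Icc_eq)
  then have i2: "integrable lborel (\<lambda>y. \<integral>x. norm (k y x) \<partial>lborel)"
  proof (rule Bochner_Integration.integrable_bound)
    show "AE y in lborel. norm (\<integral>x. norm (k y x) \<partial>lborel) \<le> norm (B * (indicator {-A..A} y * (\<integral>x. \<bar>g x\<bar> \<partial>lborel)))"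
    proof (rule AE_I2)
      fix y
      show "norm (\<integral>x. norm (k y x) \<partial>lborel) \<le> norm (B * (indicator {-A..A} y * (\<integral>x. \<bar>g x\<bar> \<partial>lborel)))"
      proof (cases "y \<in> {-A..A}")
        case True
        have "(\<integral>x. norm (k y x) \<partial>lborel) \<le> (\<integral>x. B * \<bar>g x\<bar> \<partial>lborel)"
        proof (rule integral_mono)
          show "integrable lborel (\<lambda>x. norm (k y x))" by (intro integrable_norm i1)
          show "integrable lborel (\<lambda>x. B * \<bar>g x\<bar>)" using gi by simp
          show "norm (k y x) \<le> B * \<bar>g x\<bar>" for x
            using B by (auto simp: k_def indicator_def abs_mult intro!: mult_right_mono)
        qed
        then show ?thesis using True B(1) by simp
      qed (use A(3)[of y] in \<open>auto simp: k_def\<close>)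
    qed
  qed (simp add: case_prod_unfold)
  have ki: "integrable (lborel \<Otimes>\<^sub>M lborel) (\<lambda>(y, x). k y x)"
    by (rule lborel_pair.Fubini_integrable) (use i1 i2 in \<open>auto simp: case_prod_unfold\<close>)
  \<comment> \<open>Subtracting the value at \<open>- A\<close> costs nothing because
    \<open>deriv \<Psi>\<close> has integral 0. It turns the primitive into an integral over
    \<open>[-A, y]\<close>.\<close>
  have "(\<integral>y. primitive v y * deriv \<Psi> y \<partial>lebesgue) = (\<integral>y. (primitive v y - primitive v (-A)) * deriv \<Psi> y \<partial>lebesgue)"
  proof -
    have "(\<integral>y. (primitive v y - primitive v (-A)) * deriv \<Psi> y \<partial>lebesgue)
      = (\<integral>y. primitive v y * deriv \<Psi> y \<partial>lebesgue) - (\<integral>y. primitive v (-A) * deriv \<Psi> y \<partial>lebesgue)"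
      unfolding left_diff_distrib
      by (intro Bochner_Integration.integral_diff locally_integrable_mult_test \<psi> locally_integrable_continuous primitive_continuous v) auto
    then show ?thesis using z by simp
  qed
  also have "\<dots> = (\<integral>y. (\<integral>x. k y x \<partial>lborel) \<partial>lebesgue)"
  proof (rule Bochner_Integration.integral_cong[OF refl])
    fix y :: real
    show "(primitive v y - primitive v (-A)) * deriv \<Psi> y = (\<integral>x. k y x \<partial>lborel)"
    proof (cases "y \<in> {-A..A}")
      case True
      then show ?thesis using I1[OF True] primitive_diff[OF v, of "-A" y] by (simp add: k_def)
    qed (use A(3)[of y] in \<open>auto simp: k_def\<close>)
  qed
  also have "\<dots> = (\<integral>y. (\<integral>x. k y x \<partial>lborel) \<partial>lborel)"
    by (intro integral_completion) (simp add: case_prod_unfold)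
  also have "\<dots> = (\<integral>x. (\<integral>y. k y x \<partial>lborel) \<partial>lborel)"
    using lborel_pair.Fubini_integral[OF ki] by simp
  also have "\<dots> = (\<integral>x. - (g x * \<Psi> x) \<partial>lborel)"
  proof (intro integral_cong_AE)
    show "AE x in lborel. (\<integral>y. k y x \<partial>lborel) = - (g x * \<Psi> x)"
    proof -
      have "AE x in lborel. indicator {-A..A} x * v x = g x"
        using \<open>AE x in lborel. indicator {-A..A} x * v x = g x\<close> .
      then show ?thesis
      proof eventually_elim
        case (elim x)
        show ?case
        proof (cases "x \<in> {-A..A}")
          case True
          have "(\<integral>y. k y x \<partial>lborel) = (\<integral>y. g x * (indicator {x..} y * deriv \<Psi> y) \<partial>lborel)"
            by (intro Bochner_Integration.integral_cong) (auto simp: k_def indicator_def)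
          then show ?thesis using I2[OF True] by simp
        next
          case False
          then have "g x = 0" using elim by simp
          then show ?thesis by (simp add: k_def)
        qed
      qed
    qed
  qed (auto simp: case_prod_unfold)
  also have "\<dots> = (\<integral>x. - (g x * \<Psi> x) \<partial>lebesgue)"
    by (intro integral_completion[symmetric]) simp
  also have "\<dots> = (\<integral>x. - (v x * \<Psi> x) \<partial>lebesgue)"
  proof (rule integral_cong_AE)
    show "(\<lambda>x. - (g x * \<Psi> x)) \<in> borel_measurable lebesgue" by (intro measurable_completion) simp
    show "(\<lambda>x. - (v x * \<Psi> x)) \<in> borel_measurable lebesgue"
      using test_measurable[OF \<Psi>] by simp
    show "AE x in lebesgue. - (g x * \<Psi> x) = - (v x * \<Psi> x)"
      using ge
    proof eventually_elim
      case (elim x)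
      show ?case
      proof (cases "x \<in> {-A..A}")
        case False
        then have "\<Psi> x = 0" by (intro A(2)) auto
        then show ?thesis by simp
      qed (use elim in auto)
    qed
  qed
  finally show "(\<integral>y. primitive v y * deriv \<Psi> y \<partial>lebesgue) = - (\<integral>x. v x * \<Psi> x \<partial>lebesgue)" by simp
qed

text \<open>The lemma of du Bois-Reymond: \<open>w - primitive v\<close> has weak derivative 0, so
  it annihilates every test function of mean 0, since those are derivatives of test functions. What
  remains is a constant.\<close>

theorem has_weak_deriv_primitive:
  assumes "has_weak_deriv w v"
  obtains C where "AE x in lebesgue. w x = C + primitive v x"
proof -
  define z where "z x = w x - primitive v x" for x
  have lv: "locally_integrable v" using assms by (auto simp: has_weak_deriv_def)
  have zw: "has_weak_deriv z (\<lambda>x. 0)"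
    using has_weak_deriv_lincomb[OF assms primitive_has_weak_deriv[OF lv], of 1 "-1"] by (simp add: z_def[abs_def])
  then have lz: "locally_integrable z" by (auto simp: has_weak_deriv_def)
  define P where "P = plateau 0 1 0"
  have P: "P \<in> test_functions" by (simp add: P_def plateau_test)
  have Pint: "integrable lebesgue P" using locally_integrable_mult_test[OF locally_integrable_continuous P, of "\<lambda>_. 1"] by simp
  have "(\<integral>x. P x \<partial>lebesgue) \<noteq> 0"
  proof
    assume "(\<integral>x. P x \<partial>lebesgue) = 0"
    then have "AE x in lebesgue. P x = 0"
      using integral_nonneg_eq_0_iff_AE[OF Pint] plateau_nonneg by (auto simp: P_def)
    then have "AE x in lebesgue. x \<in> - {0<..<1::real}"
      by eventually_elim (metis ComplI P_def less_irrefl plateau_pos)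
    then have "1/2 \<in> - {0<..<1::real}" by (intro mem_closed_if_AE_lebesgue) auto
    then show False by simp
  qed
  \<comment> \<open>A bump of mass 1; the summand \<open>0 * P x\<close> only gives it the form
    treated by \<open>test_lincomb\<close>. The constant sought is the average of \<open>z\<close>
    against this bump.\<close>
  define \<theta> where "\<theta> x = 1 / (\<integral>x. P x \<partial>lebesgue) * P x + 0 * P x" for x
  have \<theta>: "\<theta> \<in> test_functions" unfolding \<theta>_def[abs_def] by (intro test_lincomb P)
  have \<theta>1: "(\<integral>x. \<theta> x \<partial>lebesgue) = 1" using \<open>(\<integral>x. P x \<partial>lebesgue) \<noteq> 0\<close> by (simp add: \<theta>_def)
  define C where "C = (\<integral>x. z x * \<theta> x \<partial>lebesgue)"
  have "AE x in lebesgue. z x - C = 0"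
  proof (rule AE_zero_if_test)
    show "locally_integrable (\<lambda>x. z x - C)"
      by (intro locally_integrable_diff lz locally_integrable_continuous) auto
    fix \<phi> assume \<phi>: "\<phi> \<in> test_functions"
    have int: "integrable lebesgue \<phi>" "integrable lebesgue \<theta>"
      using locally_integrable_mult_test[OF locally_integrable_continuous, of "\<lambda>_. 1"] \<phi> \<theta> by auto
    define I where "I = (\<integral>x. \<phi> x \<partial>lebesgue)"
    \<comment> \<open>Removing the multiple \<open>I\<close> of the normalised bump leaves a test
      function of mean 0.\<close>
    define \<psi> where "\<psi> x = 1 * \<phi> x + (- I) * \<theta> x" for x
    have \<psi>: "\<psi> \<in> test_functions" unfolding \<psi>_def[abs_def] by (intro test_lincomb \<phi> \<theta>)
    have "(\<integral>x. \<psi> x \<partial>lebesgue) = 0" using int by (simp add: \<psi>_def I_def \<theta>1)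
    then obtain \<Psi> where \<Psi>: "\<Psi> \<in> test_functions" "deriv \<Psi> = \<psi>" using test_antiderivative[OF \<psi>] by metis
    have "0 = (\<integral>x. z x * \<psi> x \<partial>lebesgue)" using zw \<Psi> by (auto simp: has_weak_deriv_def)
    also have "\<dots> = (\<integral>x. z x * \<phi> x - I * (z x * \<theta> x) \<partial>lebesgue)"
      by (intro Bochner_Integration.integral_cong) (auto simp: \<psi>_def algebra_simps)
    also have "\<dots> = (\<integral>x. z x * \<phi> x \<partial>lebesgue) - I * C"
      using locally_integrable_mult_test[OF lz] \<phi> \<theta> by (simp add: C_def)
    also have "\<dots> = (\<integral>x. (z x - C) * \<phi> x \<partial>lebesgue)"
      using locally_integrable_mult_test[OF lz \<phi>] int by (simp add: I_def left_diff_distrib)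
    finally show "(\<integral>x. (z x - C) * \<phi> x \<partial>lebesgue) = 0" by simp
  qed
  then show thesis by (intro that[of C]) (auto simp: z_def)
qed

section \<open>The space H^1 on the line and its continuous representatives\<close>

lemma sobolev_1_iff: "w \<in> sobolev 1 \<longleftrightarrow> w \<in> L2 \<and> weak_deriv w \<in> L2 \<and> has_weak_deriv w (weak_deriv w)"
proof -
  have "(\<forall>j\<le>1::nat. P j) \<longleftrightarrow> P 0 \<and> P 1" for P :: "nat \<Rightarrow> bool"
    by (metis One_nat_def le_SucE le_zero_eq zero_le order_refl)
  then show ?thesis unfolding sobolev_def by auto
qed

lemma norm_H_1: "norm_H 1 w = sqrt ((norm_L2 w)\<^sup>2 + (norm_L2 (weak_deriv w))\<^sup>2)"
  by (simp add: norm_H_def)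

lemma sobolev_1I:
  assumes "w \<in> L2" "v \<in> L2" "has_weak_deriv w v"
  shows "w \<in> sobolev 1"
proof -
  have h: "has_weak_deriv w (weak_deriv w)" using assms by (rule_tac has_weak_deriv_weak_deriv)
  then have "weak_deriv w \<in> borel_measurable lebesgue"
    by (auto simp: has_weak_deriv_def intro: locally_integrable_measurable)
  then have "weak_deriv w \<in> L2"
    using L2_cong_AE[of v "weak_deriv w"] weak_deriv_AE[OF assms(3)] assms(2) by (simp add: eq_commute)
  then show ?thesis unfolding sobolev_1_iff using h assms by blast
qed

lemma sobolev_1_lincomb:
  assumes "u \<in> sobolev 1" "v \<in> sobolev 1"
  shows "(\<lambda>x. a * u x + b * v x) \<in> sobolev 1"
    "AE x in lebesgue. weak_deriv (\<lambda>x. a * u x + b * v x) x = a * weak_deriv u x + b * weak_deriv v x"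
proof -
  note u = assms(1)[unfolded sobolev_1_iff] and v = assms(2)[unfolded sobolev_1_iff]
  have h: "has_weak_deriv (\<lambda>x. a * u x + b * v x) (\<lambda>x. a * weak_deriv u x + b * weak_deriv v x)"
    using u v by (intro has_weak_deriv_lincomb) auto
  show "(\<lambda>x. a * u x + b * v x) \<in> sobolev 1"
    by (rule sobolev_1I[OF _ _ h]) (use u v in \<open>auto intro: L2_lincomb\<close>)
  show "AE x in lebesgue. weak_deriv (\<lambda>x. a * u x + b * v x) x = a * weak_deriv u x + b * weak_deriv v x"
    by (rule weak_deriv_AE[OF h])
qed

lemma L2_local_integral_bound:
  assumes "v \<in> L2" "x \<le> y"
  shows "\<bar>LINT t:{x..y}|lebesgue. v t\<bar> \<le> sqrt (y - x) * norm_L2 v"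
  using L2_Cauchy_Schwarz[OF L2_indicator assms(1), of x y] norm_L2_indicator[OF assms(2)]
  by (simp add: set_lebesgue_integral_def)

text \<open>Cauchy-Schwarz against the indicator of \<open>[x, y]\<close> turns an L2 bound for the
  derivative into a Hoelder bound of exponent 1/2. All later equicontinuity comes from here.\<close>

lemma sobolev_1_continuous_rep:
  assumes "w \<in> sobolev 1"
  obtains U where "continuous_on UNIV U" "AE x in lebesgue. w x = U x"
    "\<And>x y. x \<le> y \<Longrightarrow> U y - U x = (LINT t:{x..y}|lebesgue. weak_deriv w t)"
    "\<And>x y. x \<le> y \<Longrightarrow> \<bar>U y - U x\<bar> \<le> sqrt (y - x) * norm_L2 (weak_deriv w)"
proof -
  have h: "has_weak_deriv w (weak_deriv w)" and v: "weak_deriv w \<in> L2"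
    using assms unfolding sobolev_1_iff by auto
  note lv = L2_locally_integrable[OF v]
  obtain C where C: "AE x in lebesgue. w x = C + primitive (weak_deriv w) x"
    using has_weak_deriv_primitive[OF h] by blast
  show thesis
  proof (rule that[of "\<lambda>x. C + primitive (weak_deriv w) x"])
    show "continuous_on UNIV (\<lambda>x. C + primitive (weak_deriv w) x)"
      by (intro continuous_intros primitive_continuous lv)
    show *: "C + primitive (weak_deriv w) y - (C + primitive (weak_deriv w) x) = (LINT t:{x..y}|lebesgue. weak_deriv w t)"
      if "x \<le> y" for x y
      using primitive_diff[OF lv that] by simp
    show "\<bar>C + primitive (weak_deriv w) y - (C + primitive (weak_deriv w) x)\<bar> \<le> sqrt (y - x) * norm_L2 (weak_deriv w)"
      if "x \<le> y" for x y
      unfolding *[OF that] by (rule L2_local_integral_bound[OF v that])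
  qed (rule C)
qed

lemma has_weak_deriv_if_DERIV:
  assumes w: "continuous_on UNIV w" and v: "locally_integrable v" and S: "finite S"
    and D: "\<And>x. x \<notin> S \<Longrightarrow> (w has_real_derivative v x) (at x)"
  shows "has_weak_deriv w v"
  unfolding has_weak_deriv_def
proof (intro conjI ballI)
  show lw: "locally_integrable w" by (intro locally_integrable_continuous w)
  show "locally_integrable v" by fact
  fix \<phi> assume \<phi>: "\<phi> \<in> test_functions"
  obtain A where A: "A > 0" "\<And>x. A \<le> \<bar>x\<bar> \<Longrightarrow> \<phi> x = 0" "\<And>x. A \<le> \<bar>x\<bar> \<Longrightarrow> deriv \<phi> x = 0"
    using test_support[OF \<phi>] by metis
  let ?h = "\<lambda>x. v x * \<phi> x + w x * deriv \<phi> x"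
  have i1: "integrable lebesgue (\<lambda>x. v x * \<phi> x)" by (intro locally_integrable_mult_test v \<phi>)
  have i2: "integrable lebesgue (\<lambda>x. w x * deriv \<phi> x)" by (intro locally_integrable_mult_test lw test_deriv \<phi>)
  have "(?h has_integral (w A * \<phi> A - w (-A) * \<phi> (-A))) {-A..A}"
  proof (rule fundamental_theorem_of_calculus_interior_strong[OF S])
    show "continuous_on {-A..A} (\<lambda>x. w x * \<phi> x)"
      using continuous_on_subset[OF w] test_continuous[OF \<phi>] by (intro continuous_intros) auto
    fix x assume "x \<in> {-A<..<A} - S"
    then have "((\<lambda>x. w x * \<phi> x) has_real_derivative v x * \<phi> x + deriv \<phi> x * w x) (at x)"
      by (intro DERIV_mult D test_DERIV \<phi>) auto
    then show "((\<lambda>x. w x * \<phi> x) has_vector_derivative ?h x) (at x)"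
      by (simp add: has_real_derivative_iff_has_vector_derivative mult.commute)
  qed (use A in auto)
  then have "integral {-A..A} ?h = 0" using A by (simp add: integral_unique)
  moreover have "integral {-A..A} ?h = (LINT x:{-A..A}|lebesgue. ?h x)"
    using i1 i2 integrable_mult_indicator[of "{-A..A}" lebesgue ?h]
    by (intro set_lebesgue_integral_eq_integral(2)[symmetric]) (auto simp: set_integrable_def)
  moreover have "(LINT x:{-A..A}|lebesgue. ?h x) = (\<integral>x. ?h x \<partial>lebesgue)"
    unfolding set_lebesgue_integral_def
  proof (intro Bochner_Integration.integral_cong refl)
    fix x show "indicator {-A..A} x *\<^sub>R ?h x = ?h x"
      using A(2,3)[of x] by (cases "x \<in> {-A..A}") (auto simp: abs_if)
  qed
  ultimately have "(\<integral>x. v x * \<phi> x \<partial>lebesgue) + (\<integral>x. w x * deriv \<phi> x \<partial>lebesgue) = 0" using i1 i2 by simp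
  then show "(\<integral>x. w x * deriv \<phi> x \<partial>lebesgue) = - (\<integral>x. v x * \<phi> x \<partial>lebesgue)" by simp
qed

lemma weak_deriv_pressure:
  assumes "has_weak_deriv u u'" "has_weak_deriv v v'"
  shows "has_weak_deriv (\<lambda>x. a * u x + b * v x + x\<^sup>2 / 6) (\<lambda>x. a * u' x + b * v' x + x / 3)"
proof -
  have "has_weak_deriv (\<lambda>x. x\<^sup>2 / 6) (\<lambda>x. x / 3)"
    by (rule has_weak_deriv_if_DERIV[where S="{}"])
      (auto intro!: locally_integrable_continuous continuous_intros derivative_eq_intros)
  then show ?thesis
    using has_weak_deriv_lincomb[OF has_weak_deriv_lincomb[OF assms, of a b], of "\<lambda>x. x\<^sup>2 / 6" "\<lambda>x. x / 3" 1 1]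
    by simp
qed

section \<open>Stationary pairs\<close>

text \<open>Stationarity without derivatives: the potential of a component takes equal values at the
  ends of every interval on which that component is positive. This form passes to pointwise limits
  of approximately stationary profiles, and it allows the end points to be zeros.\<close>

definition stationary_pair ::
  "real \<Rightarrow> real \<Rightarrow> real \<Rightarrow> real \<Rightarrow> real \<Rightarrow> (real \<Rightarrow> real) \<Rightarrow> (real \<Rightarrow> real) \<Rightarrow> bool" where
  "stationary_pair a b c p r F G \<longleftrightarrow>
    continuous_on UNIV F \<and> continuous_on UNIV G \<and> (\<forall>x. 0 \<le> F x) \<and> (\<forall>x. 0 \<le> G x) \<and>
    (\<forall>x y. x < y \<longrightarrow> (\<forall>z\<in>{x<..<y}. 0 < F z) \<longrightarrow> a * F x + b * G x + p * x\<^sup>2 = a * F y + b * G y + p * y\<^sup>2) \<and>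
    (\<forall>x y. x < y \<longrightarrow> (\<forall>z\<in>{x<..<y}. 0 < G z) \<longrightarrow> b * F x + c * G x + r * x\<^sup>2 = b * F y + c * G y + r * y\<^sup>2)"

lemma stationary_pair_swap: "stationary_pair a b c p r F G \<Longrightarrow> stationary_pair c b a r p G F"
  unfolding stationary_pair_def by (simp add: add.commute)

lemma stationary_pair_reflect:
  assumes "stationary_pair a b c p r F G"
  shows "stationary_pair a b c p r (\<lambda>x. F (- x)) (\<lambda>x. G (- x))"
proof -
  have "continuous_on UNIV (\<lambda>x. H (- x))" if "continuous_on UNIV H" for H :: "real \<Rightarrow> real"
    by (rule continuous_on_compose2[OF that]) (auto intro!: continuous_intros)
  moreover have "\<phi> (- x) = \<phi> (- y)"
    if *: "\<And>x y. x < y \<Longrightarrow> (\<And>z. z \<in> {x<..<y} \<Longrightarrow> 0 < H z) \<Longrightarrow> \<phi> x = \<phi> y"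
      and "x < y" "\<forall>z\<in>{x<..<y}. 0 < H (- z)" for H \<phi> :: "real \<Rightarrow> real" and x y
  proof -
    have "\<phi> (- y) = \<phi> (- x)"
    proof (rule *)
      fix z assume "z \<in> {- y<..<- x}"
      then show "0 < H z" using that(3)[rule_format, of "- z"] by auto
    qed (use that in auto)
    then show ?thesis by simp
  qed
  from this[of F "\<lambda>x. a * F x + b * G x + p * x\<^sup>2"] this[of G "\<lambda>x. b * F x + c * G x + r * x\<^sup>2"]
  have "\<lbrakk>x < y; \<forall>z\<in>{x<..<y}. 0 < F (- z)\<rbrakk> \<Longrightarrow> a * F (- x) + b * G (- x) + p * x\<^sup>2 = a * F (- y) + b * G (- y) + p * y\<^sup>2"
    "\<lbrakk>x < y; \<forall>z\<in>{x<..<y}. 0 < G (- z)\<rbrakk> \<Longrightarrow> b * F (- x) + c * G (- x) + r * x\<^sup>2 = b * F (- y) + c * G (- y) + r * y\<^sup>2" for x y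
    using assms unfolding stationary_pair_def by auto
  ultimately show ?thesis using assms unfolding stationary_pair_def by blast
qed

lemma first_zero:
  fixes H :: "real \<Rightarrow> real"
  assumes H: "continuous_on UNIV H" "\<And>x. 0 \<le> H x" and "0 < H x" "x \<le> y" "H y = 0"
  obtains z where "x < z" "z \<le> y" "H z = 0" "\<And>t. x \<le> t \<Longrightarrow> t < z \<Longrightarrow> 0 < H t"
proof -
  let ?S = "{x..y} \<inter> {t. H t = 0}"
  have "compact ?S"
    by (intro compact_Int_closed compact_Icc closed_Collect_eq H continuous_intros)
  moreover have "y \<in> ?S" using assms by auto
  ultimately obtain z where z: "z \<in> ?S" "\<And>t. t \<in> ?S \<Longrightarrow> z \<le> t"
    using compact_attains_inf[of ?S] by blast
  show thesis
  proof (rule that[of z])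
    show "0 < H t" if "x \<le> t" "t < z" for t
    proof -
      have "t \<notin> ?S" using z(2)[of t] that(2) by auto
      then have "H t \<noteq> 0" using that z(1) by auto
      then show ?thesis using H(2)[of t] by linarith
    qed
    show "x < z" using z(1) assms(3) by (cases "x = z") auto
  qed (use z in auto)
qed

lemma last_zero:
  fixes H :: "real \<Rightarrow> real"
  assumes H: "continuous_on UNIV H" "\<And>x. 0 \<le> H x" and "0 < H y" "x \<le> y" "H x = 0"
  obtains z where "x \<le> z" "z < y" "H z = 0" "\<And>t. z < t \<Longrightarrow> t \<le> y \<Longrightarrow> 0 < H t"
proof -
  have c: "continuous_on UNIV (\<lambda>x. H (- x))"
    by (rule continuous_on_compose2[OF H(1)]) (auto intro!: continuous_intros)
  obtain z where z: "- y < z" "z \<le> - x" "H (- z) = 0" "\<And>t. - y \<le> t \<Longrightarrow> t < z \<Longrightarrow> 0 < H (- t)"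
    using first_zero[OF c H(2), of "- y" "- x"] assms by auto
  show thesis
    by (rule that[of "- z"]) (use z z(4)[of "- t" for t] in \<open>auto simp: minus_less_iff\<close>)
qed

lemma first_exit:
  fixes H :: "real \<Rightarrow> real"
  assumes H: "continuous_on UNIV H" "\<And>x. 0 \<le> H x" and "0 < H x" "x < y"
  obtains z where "x < z" "z \<le> y" "z = y \<or> H z = 0" "\<And>t. x \<le> t \<Longrightarrow> t < z \<Longrightarrow> 0 < H t"
proof (cases "\<exists>w\<in>{x..y}. H w = 0")
  case True
  then obtain w where w: "x \<le> w" "w \<le> y" "H w = 0" by auto
  then show thesis using first_zero[OF H assms(3) w(1) w(3)] that by (metis order_trans)
next
  case False
  then have "0 < H t" if "t \<in> {x..y}" for t using H(2)[of t] that by force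
  then show thesis using that[of y] assms by auto
qed

lemma last_entry:
  fixes H :: "real \<Rightarrow> real"
  assumes H: "continuous_on UNIV H" "\<And>x. 0 \<le> H x" and "0 < H y" "x < y"
  obtains z where "x \<le> z" "z < y" "z = x \<or> H z = 0" "\<And>t. z < t \<Longrightarrow> t \<le> y \<Longrightarrow> 0 < H t"
proof (cases "\<exists>w\<in>{x..y}. H w = 0")
  case True
  then obtain w where w: "x \<le> w" "w \<le> y" "H w = 0" by auto
  then show thesis using last_zero[OF H assms(3) w(2) w(3)] that by (metis order_trans)
next
  case False
  then have "0 < H t" if "t \<in> {x..y}" for t using H(2)[of t] that by force
  then show thesis using that[of x] assms by auto
qed

section \<open>Monotonicity of the potentials and Lagrange multipliers\<close>

locale stationary =
  fixes a b c p r :: real and F G :: "real \<Rightarrow> real"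
  assumes pos: "0 < a" "0 < b" "0 < c" "0 < p" "0 < r"
    and det: "b * b < a * c"
    and sp: "stationary_pair a b c p r F G"
begin

definition "\<phi>F x = a * F x + b * G x + p * x\<^sup>2"
definition "\<phi>G x = b * F x + c * G x + r * x\<^sup>2"

lemma contF: "continuous_on UNIV F" and contG: "continuous_on UNIV G"
  and F_nonneg: "0 \<le> F x" and G_nonneg: "0 \<le> G x"
  using sp by (auto simp: stationary_pair_def)

lemma \<phi>F_const: "x < y \<Longrightarrow> (\<And>z. x < z \<Longrightarrow> z < y \<Longrightarrow> 0 < F z) \<Longrightarrow> \<phi>F x = \<phi>F y"
  and \<phi>G_const: "x < y \<Longrightarrow> (\<And>z. x < z \<Longrightarrow> z < y \<Longrightarrow> 0 < G z) \<Longrightarrow> \<phi>G x = \<phi>G y"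
  using sp unfolding stationary_pair_def \<phi>F_def \<phi>G_def by auto

lemma swap: "stationary c b a r p G F"
  using pos det sp by unfold_locales (auto intro: stationary_pair_swap simp: mult.commute)

lemma reflect: "stationary a b c p r (\<lambda>x. F (- x)) (\<lambda>x. G (- x))"
  using pos det sp by unfold_locales (auto intro: stationary_pair_reflect)

text \<open>Cramer's rule for the two potentials. Where both components are positive they are affine
  in \<open>x^2\<close>, falling or growing according to the signs of \<open>p * c - b * r\<close>
  and \<open>a * r - b * p\<close>; this is where the orientation condition comes from.\<close>

lemma both_const:
  assumes "\<phi>F x = \<phi>F y" "\<phi>G x = \<phi>G y"
  shows "(a * c - b * b) * (F y - F x) = - (p * c - b * r) * (y\<^sup>2 - x\<^sup>2)"
    "(a * c - b * b) * (G y - G x) = - (a * r - b * p) * (y\<^sup>2 - x\<^sup>2)"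
  using assms unfolding \<phi>F_def \<phi>G_def by algebra+

lemma both_const_F_le:
  assumes "\<phi>F x = \<phi>F y" "\<phi>G x = \<phi>G y" "b * r \<le> p * c" "0 \<le> x" "x \<le> y"
  shows "F y \<le> F x"
proof -
  have "x\<^sup>2 \<le> y\<^sup>2" using assms by (intro power_mono) auto
  then have "- (p * c - b * r) * (y\<^sup>2 - x\<^sup>2) \<le> 0" using assms(3) by (intro mult_nonpos_nonneg) auto
  then have "(a * c - b * b) * (F y - F x) \<le> 0" using both_const(1)[OF assms(1,2)] by linarith
  then show ?thesis using det by (simp add: mult_le_0_iff)
qed

text \<open>A rise of \<open>F\<close> on a stretch where it is positive must be paid for by a fall
  of \<open>G\<close>, because \<open>p * x^2\<close> grows while \<open>\<phi>F\<close> is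
  constant. So \<open>G\<close> is positive at the start \<open>w\<close> of the stretch. Up to the
  first zero of \<open>G\<close>, or up to \<open>y\<close>, both potentials are constant and the
  orientation forbids \<open>F\<close> to rise; after that zero \<open>G\<close> cannot lie above
  its value at \<open>y\<close> by having something left to lose.\<close>

lemma F_antimono:
  assumes K: "b * r \<le> p * c" and "0 \<le> x" "x < y"
  shows "F y \<le> F x"
proof (rule ccontr)
  assume "\<not> F y \<le> F x"
  then have "0 < F y" using F_nonneg[of x] by linarith
  obtain w where w: "x \<le> w" "w < y" "w = x \<or> F w = 0" "\<And>t. w < t \<Longrightarrow> t \<le> y \<Longrightarrow> 0 < F t"
    using last_entry[OF contF F_nonneg \<open>0 < F y\<close> \<open>x < y\<close>] by blast
  have less: "F w < F y" using w(3) \<open>\<not> F y \<le> F x\<close> \<open>0 < F y\<close> by auto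
  \<comment> \<open>If \<open>G\<close> is not larger at \<open>z\<close> than at \<open>y\<close>,
    constancy of \<open>\<phi>F\<close> forces \<open>F\<close> to be larger at
    \<open>z\<close>.\<close>
  have dec: "F y < F z" if "w \<le> z" "z < y" "G z \<le> G y" for z
  proof -
    have "\<phi>F z = \<phi>F y" using that w(4) by (intro \<phi>F_const) auto
    moreover have "z\<^sup>2 < y\<^sup>2" using that w(1) assms by (intro power_strict_mono) auto
    moreover have "b * G z \<le> b * G y" using that pos by simp
    moreover have "p * z\<^sup>2 < p * y\<^sup>2" using \<open>z\<^sup>2 < y\<^sup>2\<close> pos by simp
    ultimately have "a * F y < a * F z" by (simp add: \<phi>F_def)
    then show ?thesis using pos by simp
  qed
  have "0 < G w" using dec[of w] less w(2) G_nonneg[of w] G_nonneg[of y] by force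
  then obtain z where z: "w < z" "z \<le> y" "z = y \<or> G z = 0" "\<And>t. w \<le> t \<Longrightarrow> t < z \<Longrightarrow> 0 < G t"
    using first_exit[OF contG G_nonneg _ \<open>w < y\<close>] by blast
  have "F z \<le> F w"
  proof (rule both_const_F_le[OF _ _ K])
    show "\<phi>F w = \<phi>F z" using z w by (intro \<phi>F_const) auto
    show "\<phi>G w = \<phi>G z" using z w by (intro \<phi>G_const) auto
  qed (use z w assms in auto)
  then show False using dec[of z] less z G_nonneg[of y] by force
qed

lemma F_pos_left: "b * r \<le> p * c \<Longrightarrow> 0 \<le> x \<Longrightarrow> x \<le> y \<Longrightarrow> 0 < F y \<Longrightarrow> 0 < F x"
  using F_antimono[of x y] by (cases "x = y") auto

text \<open>Past the support of \<open>F\<close> the potential is \<open>b * G + p * x^2\<close>.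
  Where \<open>G\<close> is positive there, it falls at rate \<open>r / c\<close> in
  \<open>x^2\<close>, so \<open>b * G\<close> loses \<open>b * r / c\<close> per unit of
  \<open>x^2\<close>, and the orientation bounds this by the gain \<open>p\<close>.\<close>

lemma \<phi>F_mono:
  assumes K: "b * r \<le> p * c" and "0 \<le> x" "x < y"
  shows "\<phi>F x \<le> \<phi>F y"
proof (cases "0 < F y")
  case True
  then show ?thesis using \<phi>F_const[of x y] F_pos_left[OF K _ _ True] assms by force
next
  case False
  then have Fy: "F y = 0" using F_nonneg[of y] by simp
  \<comment> \<open>The end of the stretch starting at \<open>x\<close> on which
    \<open>\<phi>F\<close> is constant. By monotonicity \<open>F\<close> vanishes from there
    on.\<close>
  obtain \<beta> where \<beta>: "x \<le> \<beta>" "\<beta> \<le> y" "F \<beta> = 0" "\<phi>F x = \<phi>F \<beta>"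
  proof (cases "F x = 0")
    case True
    then show thesis using that[of x] assms by auto
  next
    case False
    then have "0 < F x" using F_nonneg[of x] by simp
    then obtain z where "x < z" "z \<le> y" "F z = 0" "\<And>t. x \<le> t \<Longrightarrow> t < z \<Longrightarrow> 0 < F t"
      using first_zero[OF contF F_nonneg, of x y] assms Fy by auto
    then show thesis using that[of z] \<phi>F_const[of x z] by auto
  qed
  have zero: "F t = 0" if "\<beta> \<le> t" for t
    using F_antimono[OF K, of \<beta> t] \<beta> assms that F_nonneg[of t] by (cases "\<beta> = t") auto
  have "b * G \<beta> + p * \<beta>\<^sup>2 \<le> b * G y + p * y\<^sup>2"
  proof -
    have y2: "p * \<beta>\<^sup>2 \<le> p * y\<^sup>2" using \<beta> assms pos by (intro mult_left_mono power_mono) auto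
    show ?thesis
    proof (cases "G \<beta> \<le> G y")
      case True
      then have "b * G \<beta> \<le> b * G y" using pos by simp
      then show ?thesis using y2 by linarith
    next
      case False
      then have "0 < G \<beta>" "\<beta> < y" using G_nonneg[of y] \<beta> by (auto simp: order.order_iff_strict)
      then obtain z where z: "\<beta> < z" "z \<le> y" "z = y \<or> G z = 0" "\<And>t. \<beta> \<le> t \<Longrightarrow> t < z \<Longrightarrow> 0 < G t"
        using first_exit[OF contG G_nonneg] by blast
      have "\<phi>G \<beta> = \<phi>G z" using z by (intro \<phi>G_const) auto
      then have e: "c * (G \<beta> - G z) = r * (z\<^sup>2 - \<beta>\<^sup>2)" using zero[of z] zero[of \<beta>] z by (simp add: \<phi>G_def algebra_simps)
      have z2: "\<beta>\<^sup>2 \<le> z\<^sup>2" "z\<^sup>2 \<le> y\<^sup>2" using z \<beta> assms by (auto intro!: power_mono)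
      have "c * (b * (G \<beta> - G z)) = b * r * (z\<^sup>2 - \<beta>\<^sup>2)" using e by algebra
      also have "\<dots> \<le> p * c * (z\<^sup>2 - \<beta>\<^sup>2)" using K z2 by (intro mult_right_mono) auto
      finally have "c * (b * (G \<beta> - G z)) \<le> c * (p * (z\<^sup>2 - \<beta>\<^sup>2))" by (simp add: algebra_simps)
      then have "b * (G \<beta> - G z) \<le> p * (z\<^sup>2 - \<beta>\<^sup>2)" using pos by simp
      moreover have "p * z\<^sup>2 \<le> p * y\<^sup>2" using z2 pos by simp
      moreover have "b * G z \<le> b * G y" using z(3) G_nonneg[of y] pos by auto
      ultimately show ?thesis by (simp add: algebra_simps)
    qed
  qed
  then show ?thesis using \<beta> Fy by (simp add: \<phi>F_def)
qed

lemma \<phi>F_right: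
  assumes K: "b * r \<le> p * c" and "0 \<le> x"
  shows "\<phi>F 0 \<le> \<phi>F x" "0 < F x \<Longrightarrow> \<phi>F x = \<phi>F 0"
proof -
  show "\<phi>F 0 \<le> \<phi>F x" using \<phi>F_mono[OF K, of 0 x] assms by (cases "x = 0") auto
  assume F: "0 < F x"
  show "\<phi>F x = \<phi>F 0"
  proof (cases "x = 0")
    case False
    then show ?thesis using F_pos_left[OF K _ _ F] assms by (intro \<phi>F_const[symmetric]) auto
  qed simp
qed

lemma F_bounded_support_right:
  assumes K: "b * r \<le> p * c" and "0 \<le> x" "0 < F x"
  shows "p * x\<^sup>2 \<le> \<phi>F 0"
proof -
  have "\<phi>F x = \<phi>F 0" using \<phi>F_right assms by auto
  moreover have "0 \<le> a * F x" "0 \<le> b * G x" using pos F_nonneg G_nonneg by auto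
  ultimately show ?thesis by (simp add: \<phi>F_def)
qed

text \<open>Here \<open>G\<close> grows while both components are positive and may vanish near 0, so
  its constant is read off at the right end \<open>\<beta>\<close> of the support of
  \<open>F\<close> rather than at 0. A positive \<open>G\<close> inside the support of
  \<open>F\<close> stays positive on the way to \<open>\<beta>\<close>; past \<open>\<beta>\<close>
  it is a falling parabola until it reaches 0 for good.\<close>

lemma \<phi>G_right_aux:
  assumes K: "b * r \<le> p * c" and L: "a * r < b * p"
  shows "\<exists>k. \<forall>x\<ge>0. k \<le> \<phi>G x \<and> (0 < G x \<longrightarrow> \<phi>G x = k)"
proof -
  obtain \<beta> where \<beta>: "0 \<le> \<beta>" "\<And>t. 0 \<le> t \<Longrightarrow> t < \<beta> \<Longrightarrow> 0 < F t" "\<And>t. \<beta> \<le> t \<Longrightarrow> F t = 0"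
  proof (cases "F 0 = 0")
    case True
    then have "F t = 0" if "0 \<le> t" for t using F_antimono[OF K, of 0 t] F_nonneg[of t] that by (cases "t = 0") auto
    then show thesis using that[of 0] by auto
  next
    case False
    then have F0: "0 < F 0" using F_nonneg[of 0] by simp
    \<comment> \<open>Chosen so that \<open>p * Y^2\<close> exceeds \<open>\<phi>F 0\<close>, the
      bound for \<open>p * x^2\<close> on the support of \<open>F\<close>. The added 1 gives
      \<open>Y \<le> Y^2\<close>.\<close>
    define Y where "Y = \<bar>\<phi>F 0\<bar> / p + 1"
    have Y0: "0 < Y" "1 \<le> Y" using pos by (auto simp: Y_def add_nonneg_pos)
    have "\<phi>F 0 < p * Y" using pos by (simp add: Y_def distrib_left)
    also have "\<dots> \<le> p * Y\<^sup>2" using pos Y0 by (simp add: power2_eq_square)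
    finally have "F Y = 0" using F_bounded_support_right[OF K, of Y] Y0 F_nonneg[of Y] by force
    then obtain z where z: "0 < z" "z \<le> Y" "F z = 0" "\<And>t. 0 \<le> t \<Longrightarrow> t < z \<Longrightarrow> 0 < F t"
      using first_zero[OF contF F_nonneg F0, of Y] Y0 by auto
    have "F t = 0" if "z \<le> t" for t
      using F_antimono[OF K, of z t] z that F_nonneg[of t] by (cases "z = t") auto
    then show thesis using that[of z] z by auto
  qed
  have "\<phi>G \<beta> \<le> \<phi>G x \<and> (0 < G x \<longrightarrow> \<phi>G x = \<phi>G \<beta>)" if x: "\<beta> \<le> x" for x
  proof (cases "x = \<beta>")
    case False
    then have x: "\<beta> < x" using x by simp
    then have x2: "r * \<beta>\<^sup>2 < r * x\<^sup>2" using \<beta>(1) pos by (intro mult_strict_left_mono power_strict_mono) auto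
    show ?thesis
    proof (cases "0 < G x")
      case True
      obtain w where w: "\<beta> \<le> w" "w < x" "w = \<beta> \<or> G w = 0" "\<And>t. w < t \<Longrightarrow> t \<le> x \<Longrightarrow> 0 < G t"
        using last_entry[OF contG G_nonneg True x] by blast
      have e: "\<phi>G w = \<phi>G x" using w by (intro \<phi>G_const) auto
      have "w = \<beta>"
      proof (rule ccontr)
        assume "w \<noteq> \<beta>"
        then have "G w = 0" using w by auto
        moreover have "r * w\<^sup>2 < r * x\<^sup>2" using w \<beta>(1) pos by (intro mult_strict_left_mono power_strict_mono) auto
        moreover have "0 < c * G x" using True pos by simp
        ultimately show False using e \<beta>(3)[of w] \<beta>(3)[of x] w x by (simp add: \<phi>G_def)
      qed
      then show ?thesis using e by simp
    next
      case False
      then have Gx: "G x = 0" using G_nonneg[of x] by simp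
      have "\<phi>G \<beta> \<le> \<phi>G x"
      proof (cases "0 < G \<beta>")
        case True
        obtain z where z: "\<beta> < z" "z \<le> x" "G z = 0" "\<And>t. \<beta> \<le> t \<Longrightarrow> t < z \<Longrightarrow> 0 < G t"
          using first_zero[OF contG G_nonneg True, of x] x Gx by auto
        have "\<phi>G \<beta> = \<phi>G z" using z by (intro \<phi>G_const) auto
        moreover have "r * z\<^sup>2 \<le> r * x\<^sup>2" using z \<beta>(1) pos by (intro mult_left_mono power_mono) auto
        ultimately show ?thesis using z Gx \<beta>(3)[of z] \<beta>(3)[of x] x by (simp add: \<phi>G_def)
      next
        case False
        then show ?thesis using G_nonneg[of \<beta>] Gx \<beta>(3) x x2 by (simp add: \<phi>G_def)
      qed
      then show ?thesis using False by simp
    qed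
  qed simp
  moreover have "\<phi>G \<beta> \<le> \<phi>G x \<and> (0 < G x \<longrightarrow> \<phi>G x = \<phi>G \<beta>)" if x: "0 \<le> x" "x < \<beta>" for x
  proof (cases "0 < G x")
    case True
    obtain z where z: "x < z" "z \<le> \<beta>" "z = \<beta> \<or> G z = 0" "\<And>t. x \<le> t \<Longrightarrow> t < z \<Longrightarrow> 0 < G t"
      using first_exit[OF contG G_nonneg True x(2)] by blast
    have e: "\<phi>G x = \<phi>G z" using z by (intro \<phi>G_const) auto
    have e': "\<phi>F x = \<phi>F z" using z x \<beta>(2) by (intro \<phi>F_const) auto
    \<comment> \<open>A zero before \<open>\<beta>\<close> would mean that \<open>G\<close> falls
      where both potentials are constant, against \<open>a * r < b * p\<close>.\<close>
    have "z = \<beta>"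
    proof (rule ccontr)
      assume "z \<noteq> \<beta>"
      then have "G z = 0" using z by auto
      moreover have "x\<^sup>2 \<le> z\<^sup>2" using x z by (intro power_mono) auto
      then have "0 \<le> - (a * r - b * p) * (z\<^sup>2 - x\<^sup>2)" using L by simp
      then have "0 \<le> (a * c - b * b) * (G z - G x)" using both_const(2)[OF e' e] by simp
      then have "G x \<le> G z" using det by (simp add: zero_le_mult_iff)
      ultimately show False using True by simp
    qed
    then show ?thesis using e by simp
  next
    case False
    then have Gx: "G x = 0" using G_nonneg[of x] by simp
    \<comment> \<open>At zeros of \<open>G\<close> the potential \<open>\<phi>G\<close> is
      \<open>b * F + r * x^2\<close>. Since \<open>a * F + p * x^2\<close> is constant up to
      \<open>\<beta>\<close>, its change has the sign of \<open>a * r - b * p\<close>.\<close>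
    have dec: "\<phi>G w \<le> \<phi>G x" if w: "x \<le> w" "w \<le> \<beta>" "G w = 0" for w
    proof (cases "x = w")
      case False
      have "\<phi>F x = \<phi>F w" using w x \<beta>(2) False by (intro \<phi>F_const) auto
      then have e: "a * (F x - F w) = p * (w\<^sup>2 - x\<^sup>2)" using Gx w by (simp add: \<phi>F_def algebra_simps)
      have w2: "x\<^sup>2 \<le> w\<^sup>2" using w x by (intro power_mono) auto
      have "a * (r * (w\<^sup>2 - x\<^sup>2)) = a * r * (w\<^sup>2 - x\<^sup>2)" by simp
      also have "\<dots> \<le> b * p * (w\<^sup>2 - x\<^sup>2)" using L w2 by (intro mult_right_mono) auto
      also have "\<dots> = a * (b * (F x - F w))" using e by algebra
      finally have "r * (w\<^sup>2 - x\<^sup>2) \<le> b * (F x - F w)" using pos by simp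
      then show ?thesis using Gx w by (simp add: \<phi>G_def algebra_simps)
    qed simp
    have "\<phi>G \<beta> \<le> \<phi>G x"
    proof (cases "0 < G \<beta>")
      case True
      obtain w where w: "x \<le> w" "w < \<beta>" "w = x \<or> G w = 0" "\<And>t. w < t \<Longrightarrow> t \<le> \<beta> \<Longrightarrow> 0 < G t"
        using last_entry[OF contG G_nonneg True x(2)] by blast
      have "\<phi>G w = \<phi>G \<beta>" using w by (intro \<phi>G_const) auto
      then show ?thesis using dec[of w] w Gx by auto
    next
      case False
      then show ?thesis using dec[of \<beta>] x G_nonneg[of \<beta>] by auto
    qed
    then show ?thesis using False by simp
  qed
  ultimately show ?thesis by (intro exI[of _ "\<phi>G \<beta>"]) (metis not_le)
qed

text \<open>If \<open>b * p \<le> a * r\<close>, the exchanged pair satisfies the orientation under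
  which \<open>\<phi>F_right\<close> already gives the claim, with the constant taken at 0.\<close>

lemma \<phi>G_right:
  assumes K: "b * r \<le> p * c"
  shows "\<exists>k. \<forall>x\<ge>0. k \<le> \<phi>G x \<and> (0 < G x \<longrightarrow> \<phi>G x = k)"
proof (cases "a * r < b * p")
  case True
  then show ?thesis using \<phi>G_right_aux[OF K] by blast
next
  case False
  interpret s: stationary c b a r p G F by (rule swap)
  have "s.\<phi>F = \<phi>G" by (auto simp: s.\<phi>F_def \<phi>G_def)
  then show ?thesis using s.\<phi>F_right False by (metis mult.commute not_le)
qed

text \<open>One constant serves \<open>F\<close> because both half-lines are anchored at
  \<open>\<phi>F 0\<close>. The anchors of \<open>G\<close> on the two sides may differ. Asymmetric
  pairs depend on this freedom, since with \<open>k1 = k2\<close> the pair is the unique minimiser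
  of the energy and hence symmetric.\<close>

theorem multipliers:
  assumes K: "b * r \<le> p * c"
  obtains k k1 k2 where
    "\<And>x. k \<le> \<phi>F x" "\<And>x. 0 < F x \<Longrightarrow> \<phi>F x = k"
    "\<And>x. 0 \<le> x \<Longrightarrow> k1 \<le> \<phi>G x" "\<And>x. 0 \<le> x \<Longrightarrow> 0 < G x \<Longrightarrow> \<phi>G x = k1"
    "\<And>x. x \<le> 0 \<Longrightarrow> k2 \<le> \<phi>G x" "\<And>x. x \<le> 0 \<Longrightarrow> 0 < G x \<Longrightarrow> \<phi>G x = k2"
proof -
  interpret s: stationary a b c p r "\<lambda>x. F (- x)" "\<lambda>x. G (- x)" by (rule reflect)
  have e: "s.\<phi>F x = \<phi>F (- x)" "s.\<phi>G x = \<phi>G (- x)" for x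
    by (auto simp: s.\<phi>F_def \<phi>F_def s.\<phi>G_def \<phi>G_def)
  obtain k1 where k1: "\<forall>x\<ge>0. k1 \<le> \<phi>G x \<and> (0 < G x \<longrightarrow> \<phi>G x = k1)" using \<phi>G_right[OF K] by blast
  obtain k2 where k2: "\<forall>x\<ge>0. k2 \<le> \<phi>G (- x) \<and> (0 < G (- x) \<longrightarrow> \<phi>G (- x) = k2)" using s.\<phi>G_right[OF K] e by auto
  have F1: "\<phi>F 0 \<le> \<phi>F x" "0 < F x \<Longrightarrow> \<phi>F x = \<phi>F 0" for x
    using \<phi>F_right[OF K, of x] s.\<phi>F_right[OF K, of "- x"] e by (cases "0 \<le> x"; simp)+
  show thesis
    by (rule that[of "\<phi>F 0" k1 k2]) (use F1 k1 k2[rule_format, of "- x" for x] in auto)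
qed

end

section \<open>The energy and its minimisers\<close>

definition quad_energy :: "real \<Rightarrow> real \<Rightarrow> real \<Rightarrow> (real \<Rightarrow> real) \<Rightarrow> (real \<Rightarrow> real) \<Rightarrow> real" where
  "quad_energy a b c u v = (\<integral>x. a / 2 * (u x)\<^sup>2 + b * (u x * v x) + c / 2 * (v x)\<^sup>2 \<partial>lebesgue)"

definition pot_energy :: "real \<Rightarrow> real \<Rightarrow> (real \<Rightarrow> real) \<Rightarrow> (real \<Rightarrow> real) \<Rightarrow> real" where
  "pot_energy p r u v = (\<integral>x. p * (x\<^sup>2 * u x) + r * (x\<^sup>2 * v x) \<partial>lebesgue)"

definition energy :: "real \<Rightarrow> real \<Rightarrow> real \<Rightarrow> real \<Rightarrow> real \<Rightarrow> (real \<Rightarrow> real) \<Rightarrow> (real \<Rightarrow> real) \<Rightarrow> real" where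
  "energy a b c p r u v = quad_energy a b c u v + pot_energy p r u v"

definition right_mass :: "(real \<Rightarrow> real) \<Rightarrow> real" where
  "right_mass v = (\<integral>x. indicator {0<..} x * v x \<partial>lebesgue)"

lemma spX_integrable:
  assumes "u \<in> spX"
  shows "u \<in> L2" "u \<in> borel_measurable lebesgue" "integrable lebesgue u" "integrable lebesgue (\<lambda>x. x\<^sup>2 * u x)"
proof -
  show "u \<in> L2" and [measurable]: "u \<in> borel_measurable lebesgue" using assms by (auto simp: spX_def L2_def)
  have i: "integrable lebesgue (\<lambda>x. (1 + x\<^sup>2) * u x)" using assms by (auto simp: spX_def)
  show "integrable lebesgue u"
    by (rule Bochner_Integration.integrable_bound[OF i]) (auto simp: abs_mult mult_le_cancel_right1 intro!: AE_I2)
  have [measurable]: "(\<lambda>x::real. x\<^sup>2) \<in> borel_measurable lebesgue"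
    by (intro continuous_lebesgue_measurable continuous_intros)
  show "integrable lebesgue (\<lambda>x. x\<^sup>2 * u x)"
    by (rule Bochner_Integration.integrable_bound[OF i]) (auto simp: abs_mult intro!: AE_I2 mult_right_mono)
qed

lemma spX_I:
  assumes "u \<in> L2" "integrable lebesgue u" "integrable lebesgue (\<lambda>x. x\<^sup>2 * u x)"
  shows "u \<in> spX"
proof -
  have "integrable lebesgue (\<lambda>x. u x + x\<^sup>2 * u x)" using assms by auto
  then show ?thesis using assms by (simp add: spX_def distrib_right)
qed

lemma setK_D:
  assumes "u \<in> setK"
  shows "u \<in> spX" "AE x in lebesgue. 0 \<le> u x" "(\<integral>x. u x \<partial>lebesgue) = 1"
proof -
  show "u \<in> spX" and ae: "AE x in lebesgue. 0 \<le> u x" using assms by (auto simp: setK_def)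
  have "(\<integral>x. u x \<partial>lebesgue) = (\<integral>x. \<bar>u x\<bar> \<partial>lebesgue)"
    using ae spX_integrable(2)[OF \<open>u \<in> spX\<close>] by (intro integral_cong_AE) auto
  then show "(\<integral>x. u x \<partial>lebesgue) = 1" using assms by (auto simp: setK_def)
qed

lemma setK_I:
  assumes "u \<in> spX" "AE x in lebesgue. 0 \<le> u x" "(\<integral>x. u x \<partial>lebesgue) = 1"
  shows "u \<in> setK"
proof -
  have "(\<integral>x. u x \<partial>lebesgue) = (\<integral>x. \<bar>u x\<bar> \<partial>lebesgue)"
    using assms(2) spX_integrable(2)[OF assms(1)] by (intro integral_cong_AE) auto
  then show ?thesis using assms by (auto simp: setK_def)
qed

lemma setK_integrable:
  assumes "u \<in> setK"
  shows "u \<in> L2" "u \<in> borel_measurable lebesgue" "integrable lebesgue u" "integrable lebesgue (\<lambda>x. x\<^sup>2 * u x)"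
  using spX_integrable[OF setK_D(1)[OF assms]] .

lemma moment_nonneg: "u \<in> setK \<Longrightarrow> 0 \<le> (\<integral>x. x\<^sup>2 * u x \<partial>lebesgue)"
proof -
  assume "u \<in> setK"
  from setK_D(2)[OF this] have "AE x in lebesgue. 0 \<le> x\<^sup>2 * u x" by eventually_elim simp
  then show ?thesis by (rule integral_nonneg_AE)
qed

lemma quad_integrable:
  assumes "u \<in> L2" "v \<in> L2"
  shows "integrable lebesgue (\<lambda>x. a / 2 * (u x)\<^sup>2 + b * (u x * v x) + c / 2 * (v x)\<^sup>2)"
  using assms L2_mult_integrable[OF assms] by (auto simp: L2_def)

lemma quad_energy_eq:
  assumes "u \<in> L2" "v \<in> L2"
  shows "quad_energy a b c u v = a / 2 * (norm_L2 u)\<^sup>2 + b * (\<integral>x. u x * v x \<partial>lebesgue) + c / 2 * (norm_L2 v)\<^sup>2"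
  unfolding quad_energy_def norm_L2_sq using assms L2_mult_integrable[OF assms]
  by (simp add: L2_def)

lemma pot_energy_eq:
  assumes "u \<in> spX" "v \<in> spX"
  shows "pot_energy p r u v = p * (\<integral>x. x\<^sup>2 * u x \<partial>lebesgue) + r * (\<integral>x. x\<^sup>2 * v x \<partial>lebesgue)"
  unfolding pot_energy_def using assms by (simp add: spX_integrable)

text \<open>Half of determinant over trace of the matrix with rows \<open>a b\<close> and
  \<open>b c\<close>: a lower bound for half of its smallest eigenvalue.\<close>

definition coercivity :: "real \<Rightarrow> real \<Rightarrow> real \<Rightarrow> real" where
  "coercivity a b c = (a * c - b * b) / (2 * (a + c))"

lemma quad_coercive:
  assumes "0 < a" "0 < c" "b * b < a * c"
  shows "coercivity a b c * (s\<^sup>2 + t\<^sup>2) \<le> a / 2 * s\<^sup>2 + b * (s * t) + c / 2 * t\<^sup>2"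
proof -
  define \<kappa> where "\<kappa> = coercivity a b c"
  have k: "2 * \<kappa> * (a + c) = a * c - b * b" using assms by (simp add: \<kappa>_def coercivity_def field_simps)
  \<comment> \<open>Subtracting \<open>2 * \<kappa>\<close> from the diagonal leaves a positive
    matrix: the choice of \<open>\<kappa>\<close> makes its determinant \<open>A * C - b * b\<close>
    equal to \<open>(2 * \<kappa>)^2\<close>.\<close>
  define A C where "A = a - 2 * \<kappa>" and "C = c - 2 * \<kappa>"
  have "A * (a + c) = a * a + b * b" using k unfolding A_def by algebra
  then have A: "0 < A" using assms by (metis add_pos_nonneg mult_pos_pos zero_le_square zero_less_mult_pos2 add_pos_pos)
  have "A * C = b * b + (2 * \<kappa>)\<^sup>2" using k unfolding A_def C_def by algebra
  then have AC: "b * b \<le> A * C" by simp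
  have "A * (A * s\<^sup>2 + 2 * b * (s * t) + C * t\<^sup>2) = (A * s + b * t)\<^sup>2 + (A * C - b * b) * t\<^sup>2" by algebra
  also have "0 \<le> \<dots>" using AC by (intro add_nonneg_nonneg mult_nonneg_nonneg) auto
  finally have "0 \<le> A * s\<^sup>2 + 2 * b * (s * t) + C * t\<^sup>2" using A by (simp add: zero_le_mult_iff)
  then show ?thesis unfolding A_def C_def \<kappa>_def[symmetric] by (simp add: algebra_simps)
qed

lemma coercivity_pos: "0 < a \<Longrightarrow> 0 < c \<Longrightarrow> b * b < a * c \<Longrightarrow> 0 < coercivity a b c"
  by (simp add: coercivity_def)

lemma quad_energy_coercive:
  assumes "0 < a" "0 < c" "b * b < a * c" and uv: "u \<in> L2" "v \<in> L2"
  shows "coercivity a b c * ((norm_L2 u)\<^sup>2 + (norm_L2 v)\<^sup>2) \<le> quad_energy a b c u v"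
proof -
  have "coercivity a b c * ((norm_L2 u)\<^sup>2 + (norm_L2 v)\<^sup>2) = (\<integral>x. coercivity a b c * ((u x)\<^sup>2 + (v x)\<^sup>2) \<partial>lebesgue)"
    unfolding norm_L2_sq using uv by (simp add: L2_def)
  also have "\<dots> \<le> quad_energy a b c u v"
    unfolding quad_energy_def
    using uv by (intro integral_mono quad_integrable quad_coercive assms) (auto simp: L2_def)
  finally show ?thesis .
qed

lemma quad_energy_nonneg:
  assumes "0 < a" "0 < c" "b * b < a * c" and uv: "u \<in> L2" "v \<in> L2"
  shows "0 \<le> quad_energy a b c u v"
proof -
  have "0 \<le> coercivity a b c * ((norm_L2 u)\<^sup>2 + (norm_L2 v)\<^sup>2)"
    using coercivity_pos[OF assms(1-3)] by simp
  then show ?thesis using quad_energy_coercive[OF assms] by linarith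
qed

lemma energy_integrable:
  assumes "u \<in> spX" "v \<in> spX"
  shows "integrable lebesgue (\<lambda>x. a / 2 * (u x)\<^sup>2 + b * (u x * v x) + c / 2 * (v x)\<^sup>2 + (p * (x\<^sup>2 * u x) + r * (x\<^sup>2 * v x)))"
  using quad_integrable[of u v a b c] spX_integrable[OF assms(1)] spX_integrable[OF assms(2)] by auto

lemma energy_eq:
  assumes "u \<in> spX" "v \<in> spX"
  shows "energy a b c p r u v =
    (\<integral>x. a / 2 * (u x)\<^sup>2 + b * (u x * v x) + c / 2 * (v x)\<^sup>2 + (p * (x\<^sup>2 * u x) + r * (x\<^sup>2 * v x)) \<partial>lebesgue)"
  unfolding energy_def quad_energy_def pot_energy_def
  using quad_integrable[of u v a b c] spX_integrable[OF assms(1)] spX_integrable[OF assms(2)]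
  by (subst Bochner_Integration.integral_add) auto

section \<open>Energy gap and virial identity\<close>

context stationary
begin

abbreviation "E u v \<equiv> energy a b c p r u v"
abbreviation "Q u v \<equiv> quad_energy a b c u v"

text \<open>The energy is quadratic, so its expansion at \<open>(F, G)\<close> is exact: the first
  variation is the integral of \<open>\<phi>F * (u - F) + \<phi>G * (v - G)\<close> and the
  remainder is \<open>Q\<close>. The multipliers bound the first variation from below, because
  \<open>u \<ge> F\<close> wherever \<open>F\<close> vanishes, and likewise for \<open>G\<close>.
  Equal total masses cancel the constants except for \<open>d = k1 - k2\<close>, the price of moving
  mass of the second component across 0.\<close>

theorem energy_gap:
  assumes K: "b * r \<le> p * c" and FG: "F \<in> setK" "G \<in> setK"
  obtains d where "\<And>u v. u \<in> setK \<Longrightarrow> v \<in> setK \<Longrightarrow>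
    E F G + d * (right_mass v - right_mass G) + Q (\<lambda>x. u x - F x) (\<lambda>x. v x - G x) \<le> E u v"
proof -
  obtain k k1 k2 where k: "\<And>x. k \<le> \<phi>F x" "\<And>x. 0 < F x \<Longrightarrow> \<phi>F x = k"
    and k1: "\<And>x. 0 \<le> x \<Longrightarrow> k1 \<le> \<phi>G x" "\<And>x. 0 \<le> x \<Longrightarrow> 0 < G x \<Longrightarrow> \<phi>G x = k1"
    and k2: "\<And>x. x \<le> 0 \<Longrightarrow> k2 \<le> \<phi>G x" "\<And>x. x \<le> 0 \<Longrightarrow> 0 < G x \<Longrightarrow> \<phi>G x = k2"
    using multipliers[OF K] by blast
  show thesis
  proof (rule that[of "k1 - k2"])
    fix u v assume uv: "u \<in> setK" "v \<in> setK"
    note sp = setK_D(1)[OF FG(1)] setK_D(1)[OF FG(2)] setK_D(1)[OF uv(1)] setK_D(1)[OF uv(2)]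
    note int = setK_integrable[OF FG(1)] setK_integrable[OF FG(2)] setK_integrable[OF uv(1)] setK_integrable[OF uv(2)]
    define I where "I u v x = a / 2 * (u x)\<^sup>2 + b * (u x * v x) + c / 2 * (v x)\<^sup>2 + (p * (x\<^sup>2 * u x) + r * (x\<^sup>2 * v x))" for u v and x :: real
    define J where "J x = a / 2 * (u x - F x)\<^sup>2 + b * ((u x - F x) * (v x - G x)) + c / 2 * (v x - G x)\<^sup>2" for x
    \<comment> \<open>The first variation with the potentials replaced by their constants; the
      constant of \<open>G\<close> is written as \<open>k2\<close> plus a jump
      \<open>k1 - k2\<close> on the right half-line.\<close>
    define L where "L x = k * (u x - F x) + k2 * (v x - G x) + (k1 - k2) * (indicator {0<..} x * (v x - G x))" for x
    have E: "E w z = integral\<^sup>L lebesgue (I w z)" "integrable lebesgue (I w z)" if "w \<in> spX" "z \<in> spX" for w z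
      using energy_eq[OF that] energy_integrable[OF that] by (auto simp: I_def[abs_def])
    have J: "integrable lebesgue J" "Q (\<lambda>x. u x - F x) (\<lambda>x. v x - G x) = integral\<^sup>L lebesgue J"
      unfolding J_def[abs_def] quad_energy_def by (intro quad_integrable L2_diff int refl)+
    have ind: "integrable lebesgue (\<lambda>x. indicator {0<..} x * w x)" if "integrable lebesgue w" for w :: "real \<Rightarrow> real"
      using integrable_mult_indicator[OF _ that, of "{0<..}"] by simp
    have L: "integrable lebesgue L" unfolding L_def[abs_def] using int ind by (auto simp: right_diff_distrib)
    have "integral\<^sup>L lebesgue L = (k1 - k2) * (right_mass v - right_mass G)"
      unfolding L_def right_mass_def using int ind setK_D(3)[OF FG(1)] setK_D(3)[OF FG(2)] setK_D(3)[OF uv(1)] setK_D(3)[OF uv(2)]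
      by (simp add: right_diff_distrib)
    moreover have "integral\<^sup>L lebesgue L \<le> (\<integral>x. I u v x - I F G x - J x \<partial>lebesgue)"
    proof (rule integral_mono_AE)
      show "integrable lebesgue (\<lambda>x. I u v x - I F G x - J x)" using E(2) J(1) sp by auto
      show "AE x in lebesgue. L x \<le> I u v x - I F G x - J x"
        using setK_D(2)[OF uv(1)] setK_D(2)[OF uv(2)]
      proof eventually_elim
        case (elim x)
        have "I u v x - I F G x - J x = \<phi>F x * (u x - F x) + \<phi>G x * (v x - G x)"
          unfolding I_def J_def \<phi>F_def \<phi>G_def by (simp add: power2_eq_square algebra_simps)
        moreover have "k * (u x - F x) \<le> \<phi>F x * (u x - F x)"
          using k[of x] elim(1) F_nonneg[of x] by (cases "0 < F x") (auto intro: mult_right_mono)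
        moreover have "(if 0 < x then k1 else k2) * (v x - G x) \<le> \<phi>G x * (v x - G x)"
          using k1[of x] k2[of x] elim(2) G_nonneg[of x] by (cases "0 < G x") (auto intro: mult_right_mono)
        ultimately show ?case unfolding L_def by (auto simp: indicator_def algebra_simps split: if_splits)
      qed
    qed (rule L)
    moreover have "(\<integral>x. I u v x - I F G x - J x \<partial>lebesgue) = E u v - E F G - Q (\<lambda>x. u x - F x) (\<lambda>x. v x - G x)"
      using E sp J by simp
    ultimately show "E F G + (k1 - k2) * (right_mass v - right_mass G) + Q (\<lambda>x. u x - F x) (\<lambda>x. v x - G x) \<le> E u v"
      by linarith
  qed
qed

lemma dilation_setK:
  assumes "u \<in> setK" "0 < l"
  shows "(\<lambda>x. l * u (l * x)) \<in> setK"
proof -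
  note int = setK_integrable[OF assms(1)]
  have A: "integrable lebesgue (\<lambda>x. h (l * x))" if "integrable lebesgue h" for h :: "real \<Rightarrow> real"
    using lebesgue_integrable_real_affine[OF that, of l 0] assms by simp
  have I: "(\<integral>x. h (l * x) \<partial>lebesgue) = (\<integral>x. h x \<partial>lebesgue) / l" for h :: "real \<Rightarrow> real"
    using lebesgue_integral_real_affine[of l h 0] assms by simp
  have i1: "integrable lebesgue (\<lambda>x. l * u (l * x))" using A[OF int(3)] by simp
  have i3: "integrable lebesgue (\<lambda>x. x\<^sup>2 * (l * u (l * x)))"
  proof -
    have "(\<lambda>x. x\<^sup>2 * (l * u (l * x))) = (\<lambda>x. 1 / l * ((l * x)\<^sup>2 * u (l * x)))"
      using assms(2) by (auto simp: power2_eq_square)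
    then show ?thesis using integrable_mult_right[OF A[OF int(4)], of "1 / l"] by simp
  qed
  have "integrable lebesgue (\<lambda>x. (u x)\<^sup>2)" using int(1) by (simp add: L2_def)
  then have "integrable lebesgue (\<lambda>x. (l * u (l * x))\<^sup>2)"
    using integrable_mult_right[of "l\<^sup>2", OF A[of "\<lambda>x. (u x)\<^sup>2"]] unfolding power_mult_distrib by simp
  then have L: "(\<lambda>x. l * u (l * x)) \<in> L2" using i1 by (simp add: L2_def borel_measurable_integrable)
  show ?thesis
  proof (rule setK_I)
    show "(\<lambda>x. l * u (l * x)) \<in> spX" by (rule spX_I[OF L i1 i3])
    show "(\<integral>x. l * u (l * x) \<partial>lebesgue) = 1" using I[of u] setK_D(3)[OF assms(1)] assms(2) by simp
    \<comment> \<open>Nonnegativity is encoded as the vanishing of the integral of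
      \<open>\<bar>u\<bar> - u\<close>, a form that the affine change of variables
      transports.\<close>
    have ae: "AE x in lebesgue. \<bar>u x\<bar> - u x = 0" using setK_D(2)[OF assms(1)] by auto
    have "(\<integral>x. \<bar>u (l * x)\<bar> - u (l * x) \<partial>lebesgue) = (\<integral>x. \<bar>u x\<bar> - u x \<partial>lebesgue) / l"
      using I[of "\<lambda>x. \<bar>u x\<bar> - u x"] .
    also have "\<dots> = 0" using integral_eq_zero_AE[OF ae] by simp
    finally have "AE x in lebesgue. \<bar>u (l * x)\<bar> - u (l * x) = 0"
      using A[OF int(3)] by (subst (asm) integral_nonneg_eq_0_iff_AE) auto
    then show "AE x in lebesgue. 0 \<le> l * u (l * x)" by eventually_elim (use assms(2) in auto)
  qed
qed

text \<open>Dilations preserve the half-line masses, so \<open>\<lambda> \<mapsto> E\<close> is minimal at \<open>\<lambda> = 1\<close> along them.\<close>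

theorem virial:
  assumes K: "b * r \<le> p * c" and FG: "F \<in> setK" "G \<in> setK"
  shows "quad_energy a b c F G = 2 * pot_energy p r F G"
proof -
  obtain d where d: "\<And>u v. u \<in> setK \<Longrightarrow> v \<in> setK \<Longrightarrow>
    E F G + d * (right_mass v - right_mass G) + Q (\<lambda>x. u x - F x) (\<lambda>x. v x - G x) \<le> E u v"
    using energy_gap[OF assms] by blast
  define q P where "q = quad_energy a b c F G" and "P = pot_energy p r F G"
  \<comment> \<open>A mass-preserving dilation multiplies the quadratic energy by \<open>l\<close>
    and the second moments by \<open>1 / l^2\<close>.\<close>
  have min: "q + P \<le> l * q + P / l\<^sup>2" if l: "0 < l" for l
  proof -
    define u v where "u x = l * F (l * x)" and "v x = l * G (l * x)" for x
    have uv: "u \<in> setK" "v \<in> setK" unfolding u_def[abs_def] v_def[abs_def] by (intro dilation_setK FG l)+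
    have I: "(\<integral>x. h (l * x) \<partial>lebesgue) = (\<integral>x. h x \<partial>lebesgue) / l" for h :: "real \<Rightarrow> real"
      using lebesgue_integral_real_affine[of l h 0] l by simp
    have "right_mass v = (\<integral>x. l * (indicator {0<..} (l * x) * G (l * x)) \<partial>lebesgue)"
      unfolding right_mass_def v_def using l
      by (intro Bochner_Integration.integral_cong) (auto simp: indicator_def zero_less_mult_iff)
    then have rm: "right_mass v = right_mass G"
      using I[of "\<lambda>x. indicator {0<..} x * G x"] l by (simp add: right_mass_def)
    have "quad_energy a b c u v = (\<integral>x. l\<^sup>2 * (a / 2 * (F (l * x))\<^sup>2 + b * (F (l * x) * G (l * x)) + c / 2 * (G (l * x))\<^sup>2) \<partial>lebesgue)"
      unfolding quad_energy_def u_def v_def by (intro Bochner_Integration.integral_cong) (auto simp: power2_eq_square algebra_simps)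
    also have "\<dots> = l * q"
      using I[of "\<lambda>x. a / 2 * (F x)\<^sup>2 + b * (F x * G x) + c / 2 * (G x)\<^sup>2"] l
      by (simp add: q_def quad_energy_def power2_eq_square)
    finally have qe: "quad_energy a b c u v = l * q" .
    have "pot_energy p r u v = (\<integral>x. (1 / l) * (p * ((l * x)\<^sup>2 * F (l * x)) + r * ((l * x)\<^sup>2 * G (l * x))) \<partial>lebesgue)"
      unfolding pot_energy_def u_def v_def using l
      by (intro Bochner_Integration.integral_cong) (auto simp: power2_eq_square field_simps)
    also have "\<dots> = P / l\<^sup>2"
      using I[of "\<lambda>x. p * (x\<^sup>2 * F x) + r * (x\<^sup>2 * G x)"] by (simp add: P_def pot_energy_def power2_eq_square)
    finally have pe: "pot_energy p r u v = P / l\<^sup>2" .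
    have "0 \<le> Q (\<lambda>x. u x - F x) (\<lambda>x. v x - G x)"
      by (intro quad_energy_nonneg pos det L2_diff setK_integrable uv FG)
    then show ?thesis using d[OF uv] rm qe pe by (simp add: energy_def q_def P_def)
  qed
  have "((\<lambda>l. l * q + P / l\<^sup>2) has_real_derivative q - 2 * P) (at 1)"
    by (auto intro!: derivative_eq_intros simp: power2_eq_square)
  then have "q - 2 * P = 0"
    by (rule DERIV_local_min[where d=1]) (use min in auto)
  then show ?thesis by (simp add: q_def P_def)
qed

end

lemma right_mass_cong_AE:
  assumes "AE x in lebesgue. u x = v x" "u \<in> borel_measurable lebesgue" "v \<in> borel_measurable lebesgue"
  shows "right_mass u = right_mass v"
  unfolding right_mass_def using assms by (intro integral_cong_AE) (auto intro!: borel_measurable_times borel_measurable_indicator)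

text \<open>Expand at the middle pair. On a common level the linear term of the gap must be
  nonpositive for a smaller and for a larger half-line mass, so its slope \<open>d\<close> is 0.
  Then the quadratic term is nonpositive as well, and two of the pairs coincide.\<close>

theorem no_three_on_level:
  assumes s: "stationary a b c p r F1 G1" "stationary a b c p r F2 G2" "stationary a b c p r F3 G3"
    and K: "b * r \<le> p * c"
    and FG: "F1 \<in> setK" "G1 \<in> setK" "F2 \<in> setK" "G2 \<in> setK" "F3 \<in> setK" "G3 \<in> setK"
    and e: "energy a b c p r F1 G1 = energy a b c p r F2 G2" "energy a b c p r F3 G3 = energy a b c p r F2 G2"
    and n: "right_mass G1 < right_mass G2" "right_mass G2 < right_mass G3"
  shows False
proof -
  interpret stationary a b c p r F2 G2 by fact
  obtain d where d: "\<And>u v. u \<in> setK \<Longrightarrow> v \<in> setK \<Longrightarrow>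
    E F2 G2 + d * (right_mass v - right_mass G2) + Q (\<lambda>x. u x - F2 x) (\<lambda>x. v x - G2 x) \<le> E u v"
    using energy_gap[OF K FG(3,4)] by blast
  have "0 \<le> Q (\<lambda>x. u x - F2 x) (\<lambda>x. v x - G2 x)" if "u \<in> setK" "v \<in> setK" for u v
    using that by (intro quad_energy_nonneg pos det L2_diff setK_integrable FG) auto
  note q = this[OF FG(1,2)] this[OF FG(5,6)]
  have d13: "d * (right_mass G1 - right_mass G2) + Q (\<lambda>x. F1 x - F2 x) (\<lambda>x. G1 x - G2 x) \<le> 0"
    "d * (right_mass G3 - right_mass G2) + Q (\<lambda>x. F3 x - F2 x) (\<lambda>x. G3 x - G2 x) \<le> 0"
    using d[OF FG(1,2)] d[OF FG(5,6)] e by auto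
  have "d * (right_mass G1 - right_mass G2) \<le> 0" "d * (right_mass G3 - right_mass G2) \<le> 0"
    using d13 q by auto
  then have "d = 0" using n by (auto simp: mult_le_0_iff)
  then have "Q (\<lambda>x. F1 x - F2 x) (\<lambda>x. G1 x - G2 x) \<le> 0" using d13(1) by simp
  then have "coercivity a b c * ((norm_L2 (\<lambda>x. F1 x - F2 x))\<^sup>2 + (norm_L2 (\<lambda>x. G1 x - G2 x))\<^sup>2) \<le> 0"
    using quad_energy_coercive[OF pos(1,3) det L2_diff L2_diff, OF setK_integrable(1) setK_integrable(1) setK_integrable(1) setK_integrable(1), OF FG(1,3,2,4)] by linarith
  then have "(norm_L2 (\<lambda>x. F1 x - F2 x))\<^sup>2 + (norm_L2 (\<lambda>x. G1 x - G2 x))\<^sup>2 \<le> 0"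
    using coercivity_pos[OF pos(1,3) det] by (simp add: mult_le_0_iff)
  then have "(norm_L2 (\<lambda>x. G1 x - G2 x))\<^sup>2 = 0"
    using zero_le_power2[of "norm_L2 (\<lambda>x. F1 x - F2 x)"] zero_le_power2[of "norm_L2 (\<lambda>x. G1 x - G2 x)"] by linarith
  then have "(\<integral>x. (G1 x - G2 x)\<^sup>2 \<partial>lebesgue) = 0" by (simp add: norm_L2_sq)
  moreover have "(\<lambda>x. G1 x - G2 x) \<in> L2" by (intro L2_diff setK_integrable FG)
  ultimately have "AE x in lebesgue. (G1 x - G2 x)\<^sup>2 = 0"
    by (subst (asm) integral_nonneg_eq_0_iff_AE) (auto simp: L2_def)
  then have "right_mass G1 = right_mass G2"
    using setK_integrable(2)[OF FG(2)] setK_integrable(2)[OF FG(4)] by (intro right_mass_cong_AE) auto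
  then show False using n by simp
qed

section \<open>Weak derivatives of stationary pairs\<close>

text \<open>Positivity of stationary profiles is governed by functions of this form, so it changes
  only at finitely many points. The second alternative is not strict in order to include
  \<open>A = B = 0\<close>.\<close>

lemma even_quadratic_sign:
  obtains S :: "real set" where "finite S"
    "\<And>x. x \<notin> S \<Longrightarrow> 0 < A + B * x\<^sup>2 \<or> (\<forall>\<^sub>F y in nhds x. A + B * y\<^sup>2 \<le> 0)"
proof (cases "B = 0")
  case True
  show thesis by (rule that[of "{}"]) (use True in \<open>auto simp: not_le\<close>)
next
  case False
  show thesis
  \<comment> \<open>The candidate roots. If \<open>- A / B\<close> is negative, the set merely
    contains points of no significance and there is no root at all.\<close>
  proof (rule that[of "{sqrt (- A / B), - sqrt (- A / B)}"])
    fix x assume x: "x \<notin> {sqrt (- A / B), - sqrt (- A / B)}"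
    have ne: "A + B * x\<^sup>2 \<noteq> 0"
    proof
      assume "A + B * x\<^sup>2 = 0"
      then have "x\<^sup>2 = - A / B" using False by (simp add: field_simps)
      then have "sqrt (- A / B) = \<bar>x\<bar>" by (metis real_sqrt_abs)
      then show False using x by auto
    qed
    have "\<forall>\<^sub>F y in nhds x. A + B * y\<^sup>2 < 0" if "A + B * x\<^sup>2 < 0"
      using that by (intro eventually_nhds_in_open[of "{y. A + B * y\<^sup>2 < 0}", simplified] open_Collect_less continuous_intros)
    then show "0 < A + B * x\<^sup>2 \<or> (\<forall>\<^sub>F y in nhds x. A + B * y\<^sup>2 \<le> 0)"
      using ne by (cases "A + B * x\<^sup>2 < 0") (auto elim: eventually_mono)
  qed auto
qed

text \<open>A linear complementarity problem with a positive definite matrix with positive entries: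
  \<open>v\<close> is positive exactly if it would be so in the absence of \<open>u\<close> and also
  according to Cramer's rule. With \<open>s\<close> and \<open>t\<close> affine in
  \<open>x^2\<close>, positivity of a profile becomes a pair of quadratic inequalities.\<close>

lemma complementarity_pos_iff:
  fixes a b c :: real
  assumes "0 < a" "0 < b" "0 < c" "b * b < a * c" "0 \<le> u" "0 \<le> v"
    and "s \<le> a * u + b * v" "0 < u \<Longrightarrow> a * u + b * v = s"
    and "t \<le> b * u + c * v" "0 < v \<Longrightarrow> b * u + c * v = t"
  shows "0 < v \<longleftrightarrow> 0 < t \<and> 0 < a * t - b * s"
proof
  assume v: "0 < v"
  have t: "b * u + c * v = t" using assms v by auto
  have "0 < t" using t assms v by (metis add_nonneg_pos mult_nonneg_nonneg mult_pos_pos less_imp_le)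
  moreover have D: "0 < (a * c - b * b) * v" using assms v by simp
  have "0 < a * t - b * s"
  proof (cases "0 < u")
    case True
    have "a * t - b * s = a * (b * u + c * v) - b * (a * u + b * v)" using assms(8)[OF True] t by simp
    also have "\<dots> = (a * c - b * b) * v" by (simp add: algebra_simps)
    finally have "a * t - b * s = (a * c - b * b) * v" .
    then show ?thesis using D by simp
  next
    case False
    then have u: "u = 0" using assms by simp
    then have "b * s \<le> b * (b * v)" using assms by (intro mult_left_mono) auto
    moreover have "a * t = a * (c * v)" using t u by simp
    moreover have "b * (b * v) < a * (c * v)" using D by (simp add: algebra_simps)
    ultimately show ?thesis by linarith
  qed
  ultimately show "0 < t \<and> 0 < a * t - b * s" by simp
next
  assume t: "0 < t \<and> 0 < a * t - b * s"
  show "0 < v"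
  proof (rule ccontr)
    assume "\<not> 0 < v"
    then have v: "v = 0" using assms by simp
    then have tu: "t \<le> b * u" using assms by simp
    then have "0 < b * u" using t by linarith
    then have u: "0 < u" using assms(2) by (simp add: zero_less_mult_iff)
    then have "s = a * u" using assms v by simp
    then have "b * s = a * (b * u)" by simp
    moreover have "a * t \<le> a * (b * u)" using tu assms(1) by simp
    ultimately have "a * t \<le> b * s" by linarith
    then show False using t by simp
  qed
qed

context stationary
begin

text \<open>Outside finitely many points a zero of a component has a whole neighbourhood of zeros,
  so the component is differentiable there in either case. The half-line restriction stems from the
  constant of \<open>\<phi>G\<close>, which is fixed on each side only.\<close>

lemma locally_zero_right:
  assumes K: "b * r \<le> p * c"
  obtains S where "finite S" "\<And>x. x \<notin> S \<Longrightarrow> 0 < x \<Longrightarrow> 0 < F x \<or> (\<forall>\<^sub>F y in nhds x. F y = 0)"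
    "\<And>x. x \<notin> S \<Longrightarrow> 0 < x \<Longrightarrow> 0 < G x \<or> (\<forall>\<^sub>F y in nhds x. G y = 0)"
proof -
  obtain k k1 k2 where k: "\<And>x. k \<le> \<phi>F x" "\<And>x. 0 < F x \<Longrightarrow> \<phi>F x = k"
    and k1: "\<And>x. 0 \<le> x \<Longrightarrow> k1 \<le> \<phi>G x" "\<And>x. 0 \<le> x \<Longrightarrow> 0 < G x \<Longrightarrow> \<phi>G x = k1"
    and k2: "\<And>x. x \<le> 0 \<Longrightarrow> k2 \<le> \<phi>G x" "\<And>x. x \<le> 0 \<Longrightarrow> 0 < G x \<Longrightarrow> \<phi>G x = k2"
    using multipliers[OF K] by blast
  have G: "0 < G x \<longleftrightarrow> 0 < k1 + (- r) * x\<^sup>2 \<and> 0 < (a * k1 - b * k) + (b * p - a * r) * x\<^sup>2" if "0 < x" for x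
  proof -
    have "0 < G x \<longleftrightarrow> 0 < k1 - r * x\<^sup>2 \<and> 0 < a * (k1 - r * x\<^sup>2) - b * (k - p * x\<^sup>2)"
      using k[of x] k1[of x] that F_nonneg[of x] G_nonneg[of x] pos det
      by (intro complementarity_pos_iff[of a b c "F x" "G x"]) (auto simp: \<phi>F_def \<phi>G_def)
    then show ?thesis by (simp add: algebra_simps)
  qed
  have F: "0 < F x \<longleftrightarrow> 0 < k + (- p) * x\<^sup>2 \<and> 0 < (c * k - b * k1) + (b * r - c * p) * x\<^sup>2" if "0 < x" for x
  proof -
    have "0 < F x \<longleftrightarrow> 0 < k - p * x\<^sup>2 \<and> 0 < c * (k - p * x\<^sup>2) - b * (k1 - r * x\<^sup>2)"
      using k[of x] k1[of x] that F_nonneg[of x] G_nonneg[of x] pos det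
      by (intro complementarity_pos_iff[of c b a "G x" "F x"]) (auto simp: \<phi>F_def \<phi>G_def mult.commute)
    then show ?thesis by (simp add: algebra_simps)
  qed
  obtain S1 where S1: "finite S1" "\<And>x. x \<notin> S1 \<Longrightarrow> 0 < k1 + (- r) * x\<^sup>2 \<or> (\<forall>\<^sub>F y in nhds x. k1 + (- r) * y\<^sup>2 \<le> 0)"
    using even_quadratic_sign by blast
  obtain S2 where S2: "finite S2" "\<And>x. x \<notin> S2 \<Longrightarrow> 0 < (a * k1 - b * k) + (b * p - a * r) * x\<^sup>2 \<or> (\<forall>\<^sub>F y in nhds x. (a * k1 - b * k) + (b * p - a * r) * y\<^sup>2 \<le> 0)"
    using even_quadratic_sign by blast
  obtain S3 where S3: "finite S3" "\<And>x. x \<notin> S3 \<Longrightarrow> 0 < k + (- p) * x\<^sup>2 \<or> (\<forall>\<^sub>F y in nhds x. k + (- p) * y\<^sup>2 \<le> 0)"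
    using even_quadratic_sign by blast
  obtain S4 where S4: "finite S4" "\<And>x. x \<notin> S4 \<Longrightarrow> 0 < (c * k - b * k1) + (b * r - c * p) * x\<^sup>2 \<or> (\<forall>\<^sub>F y in nhds x. (c * k - b * k1) + (b * r - c * p) * y\<^sup>2 \<le> 0)"
    using even_quadratic_sign by blast
  have ev: "\<forall>\<^sub>F y in nhds x. H y = 0"
    if H: "\<And>y. 0 < y \<Longrightarrow> 0 < H y \<longleftrightarrow> 0 < A y \<and> 0 < B y" "\<And>y. 0 \<le> H y" "0 < x"
      and "(\<forall>\<^sub>F y in nhds x. A y \<le> 0) \<or> (\<forall>\<^sub>F y in nhds x. B y \<le> 0)" for H A B :: "real \<Rightarrow> real" and x
  proof -
    have "\<forall>\<^sub>F y in nhds x. 0 < y" using \<open>0 < x\<close> eventually_nhds_in_open[of "{0<..}" x] by simp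
    moreover have "\<forall>\<^sub>F y in nhds x. A y \<le> 0 \<or> B y \<le> 0" using that(4) by (auto elim: eventually_mono)
    ultimately show ?thesis
    proof eventually_elim
      case (elim y)
      then show ?case using H(1)[of y] H(2)[of y] by auto
    qed
  qed
  show thesis
  proof (rule that[of "S1 \<union> S2 \<union> S3 \<union> S4"])
    fix x assume x: "x \<notin> S1 \<union> S2 \<union> S3 \<union> S4" "0 < x"
    show "0 < G x \<or> (\<forall>\<^sub>F y in nhds x. G y = 0)"
    proof (cases "0 < G x")
      case False
      have "x \<notin> S1" "x \<notin> S2" using x(1) by auto
      then have "(\<forall>\<^sub>F y in nhds x. k1 + - r * y\<^sup>2 \<le> 0) \<or> (\<forall>\<^sub>F y in nhds x. a * k1 - b * k + (b * p - a * r) * y\<^sup>2 \<le> 0)"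
        using S1(2) S2(2) G[OF x(2)] False by meson
      from ev[OF G G_nonneg x(2) this] show ?thesis by simp
    qed simp
    show "0 < F x \<or> (\<forall>\<^sub>F y in nhds x. F y = 0)"
    proof (cases "0 < F x")
      case False
      have "x \<notin> S3" "x \<notin> S4" using x(1) by auto
      then have "(\<forall>\<^sub>F y in nhds x. k + - p * y\<^sup>2 \<le> 0) \<or> (\<forall>\<^sub>F y in nhds x. c * k - b * k1 + (b * r - c * p) * y\<^sup>2 \<le> 0)"
        using S3(2) S4(2) F[OF x(2)] False by meson
      from ev[OF F F_nonneg x(2) this] show ?thesis by simp
    qed simp
  qed (use S1 S2 S3 S4 in auto)
qed

text \<open>The derivative of the profile: from \<open>both_const\<close> where both components are
  positive, and from constancy of \<open>a * F + p * x^2\<close> where only \<open>F\<close>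
  is.\<close>

definition "VF x = (if 0 < F x then if 0 < G x then - 2 * (p * c - b * r) / (a * c - b * b) * x else - 2 * p / a * x else 0)"
definition "VG x = (if 0 < G x then if 0 < F x then - 2 * (a * r - b * p) / (a * c - b * b) * x else - 2 * r / c * x else 0)"

lemma DERIV_if_locally_const:
  assumes \<phi>: "\<forall>\<^sub>F y in nhds x. A * u y + B * y\<^sup>2 = k" and "A \<noteq> 0"
  shows "(u has_real_derivative - 2 * B / A * x) (at x)"
proof -
  have "((\<lambda>y. (k - B * y\<^sup>2) / A) has_real_derivative - 2 * B / A * x) (at x)"
    using assms(2) by (auto intro!: derivative_eq_intros simp: field_simps)
  moreover have "\<forall>\<^sub>F y in nhds x. u y = (k - B * y\<^sup>2) / A"
    using \<phi> by eventually_elim (use assms(2) in \<open>auto simp: field_simps\<close>)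
  ultimately show ?thesis by (subst DERIV_cong_ev[OF refl _ refl]) auto
qed

lemma derivs:
  assumes K: "b * r \<le> p * c"
  obtains S where "finite S" "\<And>x. x \<notin> S \<Longrightarrow> (F has_real_derivative VF x) (at x)"
    "\<And>x. x \<notin> S \<Longrightarrow> (G has_real_derivative VG x) (at x)"
proof -
  interpret s: stationary a b c p r "\<lambda>x. F (- x)" "\<lambda>x. G (- x)" by (rule reflect)
  obtain S1 where S1: "finite S1" "\<And>x. x \<notin> S1 \<Longrightarrow> 0 < x \<Longrightarrow> 0 < F x \<or> (\<forall>\<^sub>F y in nhds x. F y = 0)"
    "\<And>x. x \<notin> S1 \<Longrightarrow> 0 < x \<Longrightarrow> 0 < G x \<or> (\<forall>\<^sub>F y in nhds x. G y = 0)" using locally_zero_right[OF K] by metis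
  obtain S2 where S2: "finite S2" "\<And>x. x \<notin> S2 \<Longrightarrow> 0 < x \<Longrightarrow> 0 < F (- x) \<or> (\<forall>\<^sub>F y in nhds x. F (- y) = 0)"
    "\<And>x. x \<notin> S2 \<Longrightarrow> 0 < x \<Longrightarrow> 0 < G (- x) \<or> (\<forall>\<^sub>F y in nhds x. G (- y) = 0)" using s.locally_zero_right[OF K] by metis
  \<comment> \<open>The point 0 is added because the constant of \<open>\<phi>G\<close> may jump
    there.\<close>
  define S where "S = S1 \<union> uminus ` S2 \<union> {0}"
  have refl: "\<forall>\<^sub>F y in nhds x. H y = 0" if "\<forall>\<^sub>F y in nhds (- x). H (- y) = 0" for H :: "real \<Rightarrow> real" and x
    using eventually_compose_filterlim[OF that tendsto_minus[OF filterlim_ident]] by simp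
  have zero: "0 < F x \<or> (\<forall>\<^sub>F y in nhds x. F y = 0)" "0 < G x \<or> (\<forall>\<^sub>F y in nhds x. G y = 0)" if "x \<notin> S" for x
  proof -
    have "x \<noteq> 0" "x \<notin> S1" "- x \<notin> S2" using that by (auto simp: S_def image_iff)
    have "(0 < F x \<or> (\<forall>\<^sub>F y in nhds x. F y = 0)) \<and> (0 < G x \<or> (\<forall>\<^sub>F y in nhds x. G y = 0))"
    proof (cases "0 < x")
      case True
      then show ?thesis using S1(2,3)[OF \<open>x \<notin> S1\<close>] by blast
    next
      case False
      then have "0 < - x" using \<open>x \<noteq> 0\<close> by simp
      from S2(2,3)[OF \<open>- x \<notin> S2\<close> this] show ?thesis
        using refl[of F x] refl[of G x] by (simp only: minus_minus) blast
    qed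
    then show "0 < F x \<or> (\<forall>\<^sub>F y in nhds x. F y = 0)" "0 < G x \<or> (\<forall>\<^sub>F y in nhds x. G y = 0)"
      by blast+
  qed
  have pF: "\<forall>\<^sub>F y in nhds x. 0 < F y" if "0 < F x" for x
    using that eventually_nhds_in_open[OF open_Collect_less[OF continuous_on_const contF], of x 0] by simp
  have pG: "\<forall>\<^sub>F y in nhds x. 0 < G y" if "0 < G x" for x
    using that eventually_nhds_in_open[OF open_Collect_less[OF continuous_on_const contG], of x 0] by simp
  obtain k k1 k2 where "\<And>x. k \<le> \<phi>F x" and k: "\<And>x. 0 < F x \<Longrightarrow> \<phi>F x = k"
    and "\<And>x. 0 \<le> x \<Longrightarrow> k1 \<le> \<phi>G x" and k1: "\<And>x. 0 \<le> x \<Longrightarrow> 0 < G x \<Longrightarrow> \<phi>G x = k1"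
    and "\<And>x. x \<le> 0 \<Longrightarrow> k2 \<le> \<phi>G x" and k2: "\<And>x. x \<le> 0 \<Longrightarrow> 0 < G x \<Longrightarrow> \<phi>G x = k2"
    using multipliers[OF K] by blast
  note k1 = k1 k2
  have evG: "\<forall>\<^sub>F y in nhds x. \<phi>G y = (if 0 < x then k1 else k2)" if "0 < G x" "x \<noteq> 0" for x
  proof -
    have "open {y. 0 < x * y}" by (intro open_Collect_less continuous_intros)
    then have "\<forall>\<^sub>F y in nhds x. 0 < x * y"
      using that(2) eventually_nhds_in_open[of "{y. 0 < x * y}" x] by (simp add: zero_less_mult_iff linorder_neq_iff disj_commute)
    then show ?thesis using pG[OF that(1)] by eventually_elim (use k1 in \<open>auto simp: zero_less_mult_iff\<close>)
  qed
  have evF: "\<forall>\<^sub>F y in nhds x. \<phi>F y = k" if "0 < F x" for x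
    using pF[OF that] by eventually_elim (use k in auto)
  have D0: "a * c - b * b \<noteq> 0" using det by simp
  show thesis
  proof (rule that[of S])
    show "finite S" using S1 S2 by (simp add: S_def)
    fix x assume x: "x \<notin> S"
    then have x0: "x \<noteq> 0" by (auto simp: S_def)
    define kk where "kk = (if 0 < x then k1 else k2)"
    have z: "(u has_real_derivative 0) (at x)" if "\<forall>\<^sub>F y in nhds x. u y = 0" for u
      using DERIV_if_locally_const[of 1 u 0 0 x] that by simp
    show "(F has_real_derivative VF x) (at x)"
    proof (cases "0 < F x")
      case F: True
      show ?thesis
      proof (cases "0 < G x")
        case True
        have "\<forall>\<^sub>F y in nhds x. (a * c - b * b) * F y + (p * c - b * r) * y\<^sup>2 = c * k - b * kk"
          using evF[OF F] evG[OF True x0] unfolding kk_def[symmetric]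
        proof eventually_elim
          case (elim y)
          have "(a * c - b * b) * F y + (p * c - b * r) * y\<^sup>2 = c * \<phi>F y - b * \<phi>G y"
            by (simp add: \<phi>F_def \<phi>G_def algebra_simps)
          then show ?case using elim by simp
        qed
        from DERIV_if_locally_const[OF this D0] show ?thesis using F True by (simp add: VF_def)
      next
        case False
        then have "\<forall>\<^sub>F y in nhds x. G y = 0" using zero(2)[OF x] by simp
        then have "\<forall>\<^sub>F y in nhds x. a * F y + p * y\<^sup>2 = k"
          using evF[OF F] by eventually_elim (simp add: \<phi>F_def)
        from DERIV_if_locally_const[OF this] show ?thesis using F False pos by (simp add: VF_def)
      qed
    next
      case False
      then show ?thesis using zero(1)[OF x] z[of F] by (auto simp: VF_def)
    qed
    show "(G has_real_derivative VG x) (at x)"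
    proof (cases "0 < G x")
      case G: True
      show ?thesis
      proof (cases "0 < F x")
        case True
        have "\<forall>\<^sub>F y in nhds x. (a * c - b * b) * G y + (a * r - b * p) * y\<^sup>2 = a * kk - b * k"
          using evF[OF True] evG[OF G x0] unfolding kk_def[symmetric]
        proof eventually_elim
          case (elim y)
          have "(a * c - b * b) * G y + (a * r - b * p) * y\<^sup>2 = a * \<phi>G y - b * \<phi>F y"
            by (simp add: \<phi>F_def \<phi>G_def algebra_simps)
          then show ?case using elim by simp
        qed
        from DERIV_if_locally_const[OF this D0] show ?thesis using G True by (simp add: VG_def)
      next
        case False
        then have "\<forall>\<^sub>F y in nhds x. F y = 0" using zero(1)[OF x] by simp
        then have "\<forall>\<^sub>F y in nhds x. c * G y + r * y\<^sup>2 = kk"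
          using evG[OF G x0] by eventually_elim (simp add: \<phi>G_def kk_def)
        from DERIV_if_locally_const[OF this] show ?thesis using G False pos by (simp add: VG_def)
      qed
    next
      case False
      then show ?thesis using zero(2)[OF x] z[of G] by (auto simp: VG_def)
    qed
  qed
qed

text \<open>On the support of a component its potential equals one of finitely many constants and
  dominates \<open>p * x^2\<close> or \<open>r * x^2\<close>, the remaining terms being
  nonnegative.\<close>

lemma bounded_support:
  assumes K: "b * r \<le> p * c"
  obtains A where "0 < A" "\<And>x. A < \<bar>x\<bar> \<Longrightarrow> F x = 0 \<and> G x = 0"
proof -
  obtain k k1 k2 where "\<And>x. k \<le> \<phi>F x" and k: "\<And>x. 0 < F x \<Longrightarrow> \<phi>F x = k"
    and "\<And>x. 0 \<le> x \<Longrightarrow> k1 \<le> \<phi>G x" and k1: "\<And>x. 0 \<le> x \<Longrightarrow> 0 < G x \<Longrightarrow> \<phi>G x = k1"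
    and "\<And>x. x \<le> 0 \<Longrightarrow> k2 \<le> \<phi>G x" and k2: "\<And>x. x \<le> 0 \<Longrightarrow> 0 < G x \<Longrightarrow> \<phi>G x = k2"
    using multipliers[OF K] by blast
  note k1 = k1 k2
  define M where "M = \<bar>k\<bar> / p + (\<bar>k1\<bar> + \<bar>k2\<bar>) / r"
  have M: "x\<^sup>2 \<le> M" if "0 < F x \<or> 0 < G x" for x
    using that
  proof
    assume F: "0 < F x"
    have "0 \<le> a * F x" "0 \<le> b * G x" using pos F_nonneg G_nonneg by auto
    then have "p * x\<^sup>2 \<le> \<bar>k\<bar>" using k[OF F] by (simp add: \<phi>F_def)
    then have "x\<^sup>2 \<le> \<bar>k\<bar> / p" using pos by (simp add: field_simps)
    then show ?thesis using pos by (simp add: M_def add_increasing2)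
  next
    assume G: "0 < G x"
    have "0 \<le> b * F x" "0 \<le> c * G x" using pos F_nonneg G_nonneg by auto
    then have "r * x\<^sup>2 \<le> \<bar>k1\<bar> + \<bar>k2\<bar>" using k1[of x] G by (cases "0 \<le> x") (auto simp: \<phi>G_def)
    then have "x\<^sup>2 \<le> (\<bar>k1\<bar> + \<bar>k2\<bar>) / r" using pos by (simp add: field_simps)
    then show ?thesis using pos by (simp add: M_def add_increasing)
  qed
  have M0: "0 \<le> M" using pos by (simp add: M_def)
  show thesis
  proof (rule that[of "M + 1"])
    fix x assume x: "M + 1 < \<bar>x\<bar>"
    have "M < x\<^sup>2"
    proof -
      have "M < \<bar>x\<bar> * 1" using x by simp
      also have "\<dots> \<le> \<bar>x\<bar> * \<bar>x\<bar>" using x M0 by (intro mult_left_mono) auto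
      finally show ?thesis by (simp add: power2_eq_square)
    qed
    then show "F x = 0 \<and> G x = 0" using M[of x] F_nonneg[of x] G_nonneg[of x] by force
  qed (use M0 in auto)
qed

text \<open>The factors \<open>F x\<close> and \<open>G x\<close> select exactly the cases in which
  \<open>VF\<close> and \<open>VG\<close> were found by solving the corresponding equation, so the
  identities hold at every \<open>x\<close>, also at the exceptional points.\<close>

theorem weak_derivs:
  assumes K: "b * r \<le> p * c"
  obtains U V where "has_weak_deriv F U" "has_weak_deriv G V" "U \<in> L2" "V \<in> L2"
    "\<And>x. F x * (a * U x + b * V x + 2 * p * x) = 0" "\<And>x. G x * (b * U x + c * V x + 2 * r * x) = 0"
proof -
  obtain S where S: "finite S" "\<And>x. x \<notin> S \<Longrightarrow> (F has_real_derivative VF x) (at x)"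
    "\<And>x. x \<notin> S \<Longrightarrow> (G has_real_derivative VG x) (at x)" using derivs[OF K] by blast
  obtain A where A: "0 < A" "\<And>x. A < \<bar>x\<bar> \<Longrightarrow> F x = 0 \<and> G x = 0" using bounded_support[OF K] by blast
  have [measurable]: "F \<in> borel_measurable lebesgue" "G \<in> borel_measurable lebesgue"
    by (intro continuous_lebesgue_measurable contF contG)+
  have [measurable]: "(\<lambda>x::real. x) \<in> borel_measurable lebesgue"
    by (intro continuous_lebesgue_measurable continuous_intros)
  have L: "v \<in> L2" if m: "v \<in> borel_measurable lebesgue" and B: "\<And>x. \<bar>v x\<bar> \<le> B * \<bar>x\<bar>" "\<And>x. A < \<bar>x\<bar> \<Longrightarrow> v x = 0" for v B
  proof -
    have "integrable lebesgue (\<lambda>x. (B * A)\<^sup>2 * indicator {-A..A} x)"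
      by (intro integrable_mult_right integrable_real_indicator) (auto simp: emeasure_lborel_Icc_eq)
    then have "integrable lebesgue (\<lambda>x. (v x)\<^sup>2)"
    proof (rule Bochner_Integration.integrable_bound)
      show "AE x in lebesgue. norm ((v x)\<^sup>2) \<le> norm ((B * A)\<^sup>2 * indicator {-A..A} x)"
      proof (rule AE_I2)
        fix x
        show "norm ((v x)\<^sup>2) \<le> norm ((B * A)\<^sup>2 * indicator {-A..A} x)"
        proof (cases "x \<in> {-A..A}")
          case True
          have "0 \<le> B" using B(1)[of 1] by simp
          then have "\<bar>v x\<bar> \<le> B * A" using B(1)[of x] True by (meson abs_le_iff atLeastAtMost_iff minus_le_iff mult_left_mono order_trans)
          then have "\<bar>v x\<bar>\<^sup>2 \<le> (B * A)\<^sup>2" by (intro power_mono) auto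
          then show ?thesis using True by simp
        next
          case False
          then have "v x = 0" by (intro B(2)) auto
          then show ?thesis by simp
        qed
      qed
    qed (use m in measurable)
    then show ?thesis using m by (simp add: L2_def)
  qed
  have VF: "VF \<in> L2"
  proof (rule L)
    show "VF \<in> borel_measurable lebesgue" unfolding VF_def[abs_def] by measurable
    show "\<bar>VF x\<bar> \<le> (\<bar>- 2 * (p * c - b * r) / (a * c - b * b)\<bar> + \<bar>- 2 * p / a\<bar>) * \<bar>x\<bar>" for x
      unfolding VF_def by (auto simp: abs_mult[symmetric] distrib_right)
  qed (use A(2) in \<open>auto simp: VF_def\<close>)
  have VG: "VG \<in> L2"
  proof (rule L)
    show "VG \<in> borel_measurable lebesgue" unfolding VG_def[abs_def] by measurable
    show "\<bar>VG x\<bar> \<le> (\<bar>- 2 * (a * r - b * p) / (a * c - b * b)\<bar> + \<bar>- 2 * r / c\<bar>) * \<bar>x\<bar>" for x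
      unfolding VG_def by (auto simp: abs_mult[symmetric] distrib_right)
  qed (use A(2) in \<open>auto simp: VG_def\<close>)
  define D where "D = a * c - b * b"
  have D0: "D \<noteq> 0" using det by (simp add: D_def)
  have e1: "a * (- 2 * (p * c - b * r) / D * x) + b * (- 2 * (a * r - b * p) / D * x) + 2 * p * x = 0" for x
    using D0 by (simp add: field_simps) (simp add: D_def algebra_simps)
  have e2: "b * (- 2 * (p * c - b * r) / D * x) + c * (- 2 * (a * r - b * p) / D * x) + 2 * r * x = 0" for x
    using D0 by (simp add: field_simps) (simp add: D_def algebra_simps)
  show thesis
  proof (rule that[of VF VG])
    show "has_weak_deriv F VF" by (rule has_weak_deriv_if_DERIV[OF contF L2_locally_integrable[OF VF] S(1,2)])
    show "has_weak_deriv G VG" by (rule has_weak_deriv_if_DERIV[OF contG L2_locally_integrable[OF VG] S(1,3)])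
    show "F x * (a * VF x + b * VG x + 2 * p * x) = 0" for x
      using e1[of x] F_nonneg[of x] G_nonneg[of x] pos unfolding VF_def VG_def D_def by (auto simp: not_less)
    show "G x * (b * VF x + c * VG x + 2 * r * x) = 0" for x
      using e2[of x] F_nonneg[of x] G_nonneg[of x] pos unfolding VF_def VG_def D_def by (auto simp: not_less)
  qed (rule VF VG)+
qed

end

section \<open>Measurability in time\<close>

text \<open>Rests on completeness of the measure. It lets quantities that are identified only almost
  everywhere in time inherit measurability.\<close>

lemma lebesgue_measurable_AE_eq:
  fixes h h' :: "real \<Rightarrow> 'b::topological_space"
  assumes h: "h \<in> borel_measurable lebesgue" and ae: "AE t in lebesgue. h t = h' t"
  shows "h' \<in> borel_measurable lebesgue"
proof (rule measurableI)
  fix B :: "'b set" assume B: "B \<in> sets borel"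
  obtain Z where Z: "Z \<in> null_sets lebesgue" "{t. h t \<noteq> h' t} \<subseteq> Z"
    using ae by (auto simp: eventually_ae_filter)
  have "h -` B \<inter> space lebesgue \<in> sets lebesgue" by (rule measurable_sets[OF h B])
  moreover have "Z \<inter> h' -` B \<in> null_sets lebesgue"
    using Z(1) by (rule null_sets_completion_subset[rotated]) auto
  moreover have "h' -` B \<inter> space lebesgue = (h -` B \<inter> space lebesgue - Z) \<union> (Z \<inter> h' -` B)"
  proof -
    have "h t = h' t" if "t \<notin> Z" for t using Z(2) that by blast
    then show ?thesis by auto
  qed
  ultimately show "h' -` B \<inter> space lebesgue \<in> sets lebesgue"
    using Z(1) by (metis null_setsD2 sets.Diff sets.Un)
qed simp

text \<open>The functional is evaluated on the simple approximations, where finite range makes it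
  measurable without any structure on the function space, and sequential continuity in the norm then
  passes to the limit for almost every time.\<close>

lemma bochner_functional_measurable:
  fixes \<Phi> :: "(real \<Rightarrow> real) \<Rightarrow> (real \<Rightarrow> real) \<Rightarrow> real"
  assumes I: "I \<in> sets lebesgue"
    and u: "bochner_measurable I V N u" and v: "bochner_measurable I V N v"
    and cont: "\<And>s r u0 v0. (\<And>n::nat. s n \<in> V) \<Longrightarrow> (\<And>n. r n \<in> V) \<Longrightarrow> u0 \<in> V \<Longrightarrow> v0 \<in> V \<Longrightarrow>
      (\<lambda>n. N (\<lambda>x. s n x - u0 x)) \<longlonglongrightarrow> 0 \<Longrightarrow> (\<lambda>n. N (\<lambda>x. r n x - v0 x)) \<longlonglongrightarrow> 0 \<Longrightarrow>
      (\<lambda>n. \<Phi> (s n) (r n)) \<longlonglongrightarrow> \<Phi> u0 v0"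
  shows "(\<lambda>t. if t \<in> I then \<Phi> (u t) (v t) else 0) \<in> borel_measurable lebesgue"
proof -
  have AEI: "(AE t in lebesgue_on I. P t) \<longleftrightarrow> (AE t in lebesgue. t \<in> I \<longrightarrow> P t)" for P
    using I by (simp add: AE_restrict_space_iff)
  obtain s where s: "\<And>n. finite (s n ` I)" "\<And>n. s n ` I \<subseteq> V" "\<And>n w. {t \<in> I. s n t = w} \<in> sets lebesgue"
    "AE t in lebesgue. t \<in> I \<longrightarrow> (\<lambda>n. N (\<lambda>x. s n t x - u t x)) \<longlonglongrightarrow> 0"
  proof -
    from u obtain s where "\<forall>n. finite (s n ` I) \<and> s n ` I \<subseteq> V \<and> (\<forall>w. {t \<in> I. s n t = w} \<in> sets lebesgue)"
      and l: "AE t in lebesgue_on I. (\<lambda>n::nat. N (\<lambda>x. s n t x - u t x)) \<longlonglongrightarrow> 0"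
      unfolding bochner_measurable_def by blast
    then show thesis using l[unfolded AEI] by (intro that[of s]) auto
  qed
  obtain r where r: "\<And>n. finite (r n ` I)" "\<And>n. r n ` I \<subseteq> V" "\<And>n w. {t \<in> I. r n t = w} \<in> sets lebesgue"
    "AE t in lebesgue. t \<in> I \<longrightarrow> (\<lambda>n. N (\<lambda>x. r n t x - v t x)) \<longlonglongrightarrow> 0"
  proof -
    from v obtain s where "\<forall>n. finite (s n ` I) \<and> s n ` I \<subseteq> V \<and> (\<forall>w. {t \<in> I. s n t = w} \<in> sets lebesgue)"
      and l: "AE t in lebesgue_on I. (\<lambda>n::nat. N (\<lambda>x. s n t x - v t x)) \<longlonglongrightarrow> 0"
      unfolding bochner_measurable_def by blast
    then show thesis using l[unfolded AEI] by (intro that[of s]) auto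
  qed
  have uv: "AE t in lebesgue. t \<in> I \<longrightarrow> u t \<in> V" "AE t in lebesgue. t \<in> I \<longrightarrow> v t \<in> V"
    using u v unfolding bochner_measurable_def AEI by auto
  define h where "h n t = (if t \<in> I then \<Phi> (s n t) (r n t) else 0)" for n t
  have hm: "h n \<in> borel_measurable lebesgue" for n
  proof -
    have sf: "simple_function (lebesgue_on I) (s n)" "simple_function (lebesgue_on I) (r n)"
      unfolding simple_function_def using s(1,3)[of n] r(1,3)[of n] I
      by (auto simp: vimage_def Int_def sets_restrict_space_iff conj_commute)
    have "simple_function (lebesgue_on I) (\<lambda>t. (\<lambda>(x, y). \<Phi> x y) (s n t, r n t))"
      by (intro simple_function_compose1[OF simple_function_Pair] sf)
    then have "(\<lambda>t. \<Phi> (s n t) (r n t)) \<in> borel_measurable (lebesgue_on I)"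
      by (intro borel_measurable_simple_function) simp
    then show ?thesis unfolding h_def[abs_def] using I by (intro borel_measurable_if_I) auto
  qed
  define l where "l t = (if t \<in> I then \<Phi> (u t) (v t) else 0)" for t
  have conv: "AE t in lebesgue. (\<lambda>n. h n t) \<longlonglongrightarrow> l t"
    using s(4) r(4) uv
  proof eventually_elim
    case (elim t)
    show ?case
    proof (cases "t \<in> I")
      case True
      have "s n t \<in> V" "r n t \<in> V" for n using s(2)[of n] r(2)[of n] True by auto
      then show ?thesis using cont[of "\<lambda>n. s n t" "\<lambda>n. r n t" "u t" "v t"] elim True by (simp add: h_def l_def)
    qed (simp add: h_def l_def)
  qed
  have "(\<lambda>t. lim (\<lambda>n. h n t)) \<in> borel_measurable lebesgue" using hm by (rule borel_measurable_lim_metric)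
  moreover have "AE t in lebesgue. lim (\<lambda>n. h n t) = l t" using conv by eventually_elim (rule limI)
  ultimately show ?thesis unfolding l_def[symmetric] by (rule lebesgue_measurable_AE_eq)
qed

section \<open>Norm continuity of energies and flux functionals\<close>

lemma L2_inner_tendsto:
  assumes L: "\<And>n. u n \<in> L2" "\<And>n. v n \<in> L2" "F \<in> L2" "G \<in> L2"
    and lim: "((\<lambda>n. norm_L2 (\<lambda>x. u n x - F x)) \<longlongrightarrow> 0) X" "((\<lambda>n. norm_L2 (\<lambda>x. v n x - G x)) \<longlongrightarrow> 0) X"
  shows "((\<lambda>n. \<integral>x. u n x * v n x \<partial>lebesgue) \<longlongrightarrow> (\<integral>x. F x * G x \<partial>lebesgue)) X"
proof -
  have nrm: "((\<lambda>n. norm_L2 (v n)) \<longlongrightarrow> norm_L2 G) X"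
  proof -
    have "((\<lambda>n. norm_L2 (v n) - norm_L2 G) \<longlongrightarrow> 0) X"
      by (rule Lim_null_comparison[OF _ lim(2)]) (use norm_L2_triangle_diff[OF L(2,4)] in auto)
    then show ?thesis by (simp add: LIM_zero_iff)
  qed
  have "((\<lambda>n. (\<integral>x. u n x * v n x \<partial>lebesgue) - (\<integral>x. F x * G x \<partial>lebesgue)) \<longlongrightarrow> 0) X"
  proof (rule Lim_null_comparison)
    have "\<bar>(\<integral>x. u n x * v n x \<partial>lebesgue) - (\<integral>x. F x * G x \<partial>lebesgue)\<bar>
      \<le> norm_L2 (\<lambda>x. u n x - F x) * norm_L2 (v n) + norm_L2 F * norm_L2 (\<lambda>x. v n x - G x)" for n
    proof -
      note i = L2_mult_integrable[OF L(1,2)] L2_mult_integrable[OF L(3,4)] L2_mult_integrable[OF L(3,2)]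
      have "(\<integral>x. u n x * v n x \<partial>lebesgue) - (\<integral>x. F x * G x \<partial>lebesgue)
        = (\<integral>x. (u n x - F x) * v n x \<partial>lebesgue) + (\<integral>x. F x * (v n x - G x) \<partial>lebesgue)"
        using i by (simp add: left_diff_distrib right_diff_distrib)
      then show ?thesis
        using L2_Cauchy_Schwarz[OF L2_diff[OF L(1,3)] L(2), of n n] L2_Cauchy_Schwarz[OF L(3) L2_diff[OF L(2,4)], of n] by linarith
    qed
    then show "\<forall>\<^sub>F n in X. norm ((\<integral>x. u n x * v n x \<partial>lebesgue) - (\<integral>x. F x * G x \<partial>lebesgue))
      \<le> norm_L2 (\<lambda>x. u n x - F x) * norm_L2 (v n) + norm_L2 F * norm_L2 (\<lambda>x. v n x - G x)" by simp
    have "((\<lambda>n. norm_L2 (\<lambda>x. u n x - F x) * norm_L2 (v n) + norm_L2 F * norm_L2 (\<lambda>x. v n x - G x)) \<longlongrightarrow> 0 * norm_L2 G + norm_L2 F * 0) X"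
      by (intro tendsto_intros lim nrm)
    then show "((\<lambda>n. norm_L2 (\<lambda>x. u n x - F x) * norm_L2 (v n) + norm_L2 F * norm_L2 (\<lambda>x. v n x - G x)) \<longlongrightarrow> 0) X" by simp
  qed
  then show ?thesis by (simp add: LIM_zero_iff)
qed

lemma norm_L2_tendsto:
  assumes L: "\<And>n. v n \<in> L2" "G \<in> L2" and lim: "((\<lambda>n. norm_L2 (\<lambda>x. v n x - G x)) \<longlongrightarrow> 0) X"
  shows "((\<lambda>n. norm_L2 (v n)) \<longlongrightarrow> norm_L2 G) X"
proof -
  have "((\<lambda>n. norm_L2 (v n) - norm_L2 G) \<longlongrightarrow> 0) X"
    by (rule Lim_null_comparison[OF _ lim]) (use norm_L2_triangle_diff[OF L] in auto)
  then show ?thesis by (simp add: LIM_zero_iff)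
qed

lemma quad_energy_tendsto:
  assumes L: "\<And>n. u n \<in> L2" "\<And>n. v n \<in> L2" "F \<in> L2" "G \<in> L2"
    and lim: "((\<lambda>n. norm_L2 (\<lambda>x. u n x - F x)) \<longlongrightarrow> 0) X" "((\<lambda>n. norm_L2 (\<lambda>x. v n x - G x)) \<longlongrightarrow> 0) X"
  shows "((\<lambda>n. quad_energy a b c (u n) (v n)) \<longlongrightarrow> quad_energy a b c F G) X"
  unfolding quad_energy_eq[OF L(1,2)] quad_energy_eq[OF L(3,4)]
  by (intro tendsto_intros norm_L2_tendsto L2_inner_tendsto L lim)

lemma spX_diff: "u \<in> spX \<Longrightarrow> v \<in> spX \<Longrightarrow> (\<lambda>x. u x - v x) \<in> spX"
  by (auto simp: spX_def right_diff_distrib intro: L2_diff)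

lemma norm_X_bounds:
  assumes "w \<in> spX"
  shows "norm_L2 w \<le> norm_X w" "\<bar>\<integral>x. x\<^sup>2 * w x \<partial>lebesgue\<bar> \<le> norm_X w"
proof -
  have i: "integrable lebesgue (\<lambda>x. (1 + x\<^sup>2) * \<bar>w x\<bar>)"
    using assms integrable_abs[of lebesgue "\<lambda>x. (1 + x\<^sup>2) * w x"] by (simp add: spX_def abs_mult)
  have "0 \<le> (\<integral>x. (1 + x\<^sup>2) * \<bar>w x\<bar> \<partial>lebesgue)" by (intro integral_nonneg_AE AE_I2) simp
  then show "norm_L2 w \<le> norm_X w" by (simp add: norm_X_def)
  have "\<bar>\<integral>x. x\<^sup>2 * w x \<partial>lebesgue\<bar> \<le> (\<integral>x. \<bar>x\<^sup>2 * w x\<bar> \<partial>lebesgue)" by (rule integral_abs_bound)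
  also have "\<dots> \<le> (\<integral>x. (1 + x\<^sup>2) * \<bar>w x\<bar> \<partial>lebesgue)"
    using spX_integrable(4)[OF assms] i by (intro integral_mono integrable_abs) (auto simp: abs_mult intro: mult_right_mono)
  also have "\<dots> \<le> norm_X w" by (simp add: norm_X_def)
  finally show "\<bar>\<integral>x. x\<^sup>2 * w x \<partial>lebesgue\<bar> \<le> norm_X w" .
qed

lemma pot_energy_tendsto:
  assumes S: "\<And>n. u n \<in> spX" "\<And>n. v n \<in> spX" "F \<in> spX" "G \<in> spX"
    and lim: "((\<lambda>n. norm_X (\<lambda>x. u n x - F x)) \<longlongrightarrow> 0) X" "((\<lambda>n. norm_X (\<lambda>x. v n x - G x)) \<longlongrightarrow> 0) X"
  shows "((\<lambda>n. pot_energy p r (u n) (v n)) \<longlongrightarrow> pot_energy p r F G) X"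
proof -
  have m: "((\<lambda>n. \<integral>x. x\<^sup>2 * w n x \<partial>lebesgue) \<longlongrightarrow> (\<integral>x. x\<^sup>2 * W x \<partial>lebesgue)) X"
    if w: "\<And>n. w n \<in> spX" "W \<in> spX" "((\<lambda>n. norm_X (\<lambda>x. w n x - W x)) \<longlongrightarrow> 0) X" for w W
  proof -
    have "\<bar>(\<integral>x. x\<^sup>2 * w n x \<partial>lebesgue) - (\<integral>x. x\<^sup>2 * W x \<partial>lebesgue)\<bar> \<le> norm_X (\<lambda>x. w n x - W x)" for n
      using norm_X_bounds(2)[OF spX_diff[OF w(1,2)], of n] spX_integrable(4)[OF w(1)] spX_integrable(4)[OF w(2)]
      by (simp add: right_diff_distrib)
    then have "((\<lambda>n. (\<integral>x. x\<^sup>2 * w n x \<partial>lebesgue) - (\<integral>x. x\<^sup>2 * W x \<partial>lebesgue)) \<longlongrightarrow> 0) X"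
      by (intro Lim_null_comparison[OF _ w(3)]) auto
    then show ?thesis by (simp add: LIM_zero_iff)
  qed
  show ?thesis
    unfolding pot_energy_eq[OF S(1,2)] pot_energy_eq[OF S(3,4)] by (intro tendsto_intros m S lim)
qed

lemma norm_X_imp_norm_L2:
  assumes S: "\<And>n. u n \<in> spX" "F \<in> spX" and lim: "((\<lambda>n. norm_X (\<lambda>x. u n x - F x)) \<longlongrightarrow> 0) X"
  shows "((\<lambda>n. norm_L2 (\<lambda>x. u n x - F x)) \<longlongrightarrow> 0) X"
  by (rule Lim_null_comparison[OF _ lim]) (use norm_X_bounds(1)[OF spX_diff[OF S]] in auto)

lemma energy_measurable:
  assumes "I \<in> sets lebesgue" "bochner_measurable I spX norm_X u" "bochner_measurable I spX norm_X v"
  shows "(\<lambda>t. if t \<in> I then energy a b c p r (u t) (v t) else 0) \<in> borel_measurable lebesgue"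
    "(\<lambda>t. if t \<in> I then pot_energy p r (u t) (v t) else 0) \<in> borel_measurable lebesgue"
proof -
  show "(\<lambda>t. if t \<in> I then pot_energy p r (u t) (v t) else 0) \<in> borel_measurable lebesgue"
    by (rule bochner_functional_measurable[OF assms]) (rule pot_energy_tendsto)
  show "(\<lambda>t. if t \<in> I then energy a b c p r (u t) (v t) else 0) \<in> borel_measurable lebesgue"
    by (rule bochner_functional_measurable[OF assms])
      (auto simp: energy_def intro!: tendsto_add pot_energy_tendsto quad_energy_tendsto spX_integrable(1) norm_X_imp_norm_L2)
qed

lemma norm_H_1_bounds: "norm_L2 w \<le> norm_H 1 w" "norm_L2 (weak_deriv w) \<le> norm_H 1 w"
  unfolding norm_H_1 by (auto intro!: real_le_rsqrt)

lemma norm_H_1_tendsto: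
  assumes S: "\<And>n. u n \<in> sobolev 1" "F \<in> sobolev 1" and lim: "((\<lambda>n. norm_H 1 (\<lambda>x. u n x - F x)) \<longlongrightarrow> 0) X"
  shows "((\<lambda>n. norm_L2 (\<lambda>x. u n x - F x)) \<longlongrightarrow> 0) X"
    "((\<lambda>n. norm_L2 (\<lambda>x. weak_deriv (u n) x - weak_deriv F x)) \<longlongrightarrow> 0) X"
proof -
  show "((\<lambda>n. norm_L2 (\<lambda>x. u n x - F x)) \<longlongrightarrow> 0) X"
    by (rule Lim_null_comparison[OF _ lim]) (use norm_H_1_bounds(1) in auto)
  have "norm_L2 (\<lambda>x. weak_deriv (u n) x - weak_deriv F x) = norm_L2 (weak_deriv (\<lambda>x. u n x - F x))" for n
  proof (rule norm_L2_cong_AE)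
    note l = sobolev_1_lincomb[OF S(1)[of n] S(2), of 1 "-1"]
    show "AE x in lebesgue. weak_deriv (u n) x - weak_deriv F x = weak_deriv (\<lambda>x. u n x - F x) x"
      using l(2) by (auto elim!: eventually_mono)
    have "(\<lambda>x. u n x - F x) \<in> sobolev 1" using l(1) by simp
    then show "weak_deriv (\<lambda>x. u n x - F x) \<in> borel_measurable lebesgue"
      unfolding sobolev_1_iff by (auto simp: L2_def)
    show "(\<lambda>x. weak_deriv (u n) x - weak_deriv F x) \<in> borel_measurable lebesgue"
      using S(1)[of n] S(2) unfolding sobolev_1_iff by (auto simp: L2_def)
  qed
  then show "((\<lambda>n. norm_L2 (\<lambda>x. weak_deriv (u n) x - weak_deriv F x)) \<longlongrightarrow> 0) X"
    using norm_H_1_bounds(2) by (intro Lim_null_comparison[OF _ lim]) auto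
qed

lemma sobolev_1_L2: "u \<in> sobolev 1 \<Longrightarrow> u \<in> L2" "u \<in> sobolev 1 \<Longrightarrow> weak_deriv u \<in> L2"
  unfolding sobolev_1_iff by auto

lemma deriv_energy_measurable:
  assumes "I \<in> sets lebesgue" "bochner_measurable I (sobolev 1) (norm_H 1) u" "bochner_measurable I (sobolev 1) (norm_H 1) v"
  shows "(\<lambda>t. if t \<in> I then quad_energy a b c (weak_deriv (u t)) (weak_deriv (v t)) else 0) \<in> borel_measurable lebesgue"
  by (rule bochner_functional_measurable[OF assms])
    (intro quad_energy_tendsto sobolev_1_L2 norm_H_1_tendsto(2), assumption+)

text \<open>The gradient of the pressure \<open>\<alpha> * u + \<beta> * v + x^2 / 6\<close>,
  written through the derivatives of \<open>u\<close> and \<open>v\<close> so that convergence in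
  H^1 controls it directly.\<close>

definition slope :: "real \<Rightarrow> real \<Rightarrow> (real \<Rightarrow> real) \<Rightarrow> (real \<Rightarrow> real) \<Rightarrow> real \<Rightarrow> real" where
  "slope \<alpha> \<beta> u v x = \<alpha> * weak_deriv u x + \<beta> * weak_deriv v x + x / 3"

lemma cutoff_L2:
  assumes w: "w \<in> L2" and \<zeta>: "\<zeta> \<in> borel_measurable lebesgue" "\<And>x. \<bar>\<zeta> x\<bar> \<le> B"
  shows "(\<lambda>x. \<zeta> x * w x) \<in> L2" "norm_L2 (\<lambda>x. \<zeta> x * w x) \<le> B * norm_L2 w"
proof -
  have B: "0 \<le> B" using \<zeta>(2)[of 0] by linarith
  have [measurable]: "\<zeta> \<in> borel_measurable lebesgue" "w \<in> borel_measurable lebesgue" using w \<zeta> by (auto simp: L2_def)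
  have le: "(\<zeta> x * w x)\<^sup>2 \<le> B\<^sup>2 * (w x)\<^sup>2" for x
    using power_mono[OF \<zeta>(2)[of x], of 2] by (simp add: power_mult_distrib mult_right_mono)
  have iB: "integrable lebesgue (\<lambda>x. B\<^sup>2 * (w x)\<^sup>2)" using w by (simp add: L2_def)
  have i: "integrable lebesgue (\<lambda>x. (\<zeta> x * w x)\<^sup>2)"
    by (rule Bochner_Integration.integrable_bound[OF iB]) (use le in auto)
  then show "(\<lambda>x. \<zeta> x * w x) \<in> L2" by (simp add: L2_def)
  have "(norm_L2 (\<lambda>x. \<zeta> x * w x))\<^sup>2 \<le> (\<integral>x. B\<^sup>2 * (w x)\<^sup>2 \<partial>lebesgue)"
    unfolding norm_L2_sq by (intro integral_mono i iB le)
  also have "\<dots> = (B * norm_L2 w)\<^sup>2" by (simp add: norm_L2_sq power_mult_distrib)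
  finally show "norm_L2 (\<lambda>x. \<zeta> x * w x) \<le> B * norm_L2 w"
    by (rule power2_le_imp_le) (use B in simp)
qed

text \<open>The drift \<open>x / 3\<close> is not square integrable on the line; a bounded cutoff of
  compact support repairs this.\<close>

lemma cutoff_slope_L2:
  assumes S: "u \<in> sobolev 1" "v \<in> sobolev 1"
    and \<zeta>: "\<zeta> \<in> borel_measurable lebesgue" "\<And>x. \<bar>\<zeta> x\<bar> \<le> B" "\<And>x. A < \<bar>x\<bar> \<Longrightarrow> \<zeta> x = 0"
  shows "(\<lambda>x. \<zeta> x * slope \<alpha> \<beta> u v x) \<in> L2"
proof -
  have [measurable]: "(\<lambda>x::real. x) \<in> borel_measurable lebesgue"
    by (intro continuous_lebesgue_measurable continuous_intros)
  have [measurable]: "\<zeta> \<in> borel_measurable lebesgue" by fact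
  have B: "0 \<le> B" using \<zeta>(2)[of 0] by linarith
  have "integrable lebesgue (\<lambda>x. (B * \<bar>A\<bar>)\<^sup>2 * indicator {-\<bar>A\<bar>..\<bar>A\<bar>} x)"
    by (intro integrable_mult_right integrable_real_indicator) (auto simp: emeasure_lborel_Icc_eq)
  then have "integrable lebesgue (\<lambda>x. (\<zeta> x * x)\<^sup>2)"
  proof (rule Bochner_Integration.integrable_bound)
    have "\<bar>\<zeta> x * x\<bar>\<^sup>2 \<le> (B * \<bar>A\<bar>)\<^sup>2 * indicator {-\<bar>A\<bar>..\<bar>A\<bar>} x" for x
    proof (cases "x \<in> {-\<bar>A\<bar>..\<bar>A\<bar>}")
      case True
      then have "\<bar>\<zeta> x * x\<bar> \<le> B * \<bar>A\<bar>" unfolding abs_mult using \<zeta>(2)[of x] B by (intro mult_mono) auto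
      then show ?thesis using True power_mono[of "\<bar>\<zeta> x * x\<bar>" "B * \<bar>A\<bar>" 2] by simp
    next
      case False
      then have "\<zeta> x = 0" by (intro \<zeta>(3)) auto
      then show ?thesis by simp
    qed
    then show "AE x in lebesgue. norm ((\<zeta> x * x)\<^sup>2) \<le> norm ((B * \<bar>A\<bar>)\<^sup>2 * indicator {-\<bar>A\<bar>..\<bar>A\<bar>} x)" by simp
  qed measurable
  then have x: "(\<lambda>x. \<zeta> x * x) \<in> L2" by (simp add: L2_def)
  have "(\<lambda>x. 1 * (\<zeta> x * (\<alpha> * weak_deriv u x + \<beta> * weak_deriv v x)) + 1 / 3 * (\<zeta> x * x)) \<in> L2"
    by (intro L2_lincomb cutoff_L2(1)[OF _ \<zeta>(1,2)] sobolev_1_L2 S x)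
  then show ?thesis by (simp add: slope_def algebra_simps)
qed

text \<open>The signed integral is the one in the weak formulation, with \<open>\<zeta>\<close> the
  derivative of a test function. The one with absolute values, with \<open>\<zeta>\<close> an
  indicator, approximates \<open>slope_mass\<close> from below.\<close>

lemma slope_functional_tendsto:
  assumes S: "\<And>n. s n \<in> sobolev 1" "\<And>n. q n \<in> sobolev 1" "u \<in> sobolev 1" "v \<in> sobolev 1"
    and lim: "(\<lambda>n::nat. norm_H 1 (\<lambda>x. s n x - u x)) \<longlonglongrightarrow> 0" "(\<lambda>n. norm_H 1 (\<lambda>x. q n x - v x)) \<longlonglongrightarrow> 0"
    and \<zeta>: "\<zeta> \<in> borel_measurable lebesgue" "\<And>x. \<bar>\<zeta> x\<bar> \<le> B" "\<And>x. A < \<bar>x\<bar> \<Longrightarrow> \<zeta> x = 0"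
    and w: "\<And>n. w n \<in> sobolev 1" "W \<in> sobolev 1" "(\<lambda>n::nat. norm_H 1 (\<lambda>x. w n x - W x)) \<longlonglongrightarrow> 0"
  shows "(\<lambda>n. \<integral>x. w n x * (\<zeta> x * slope \<alpha> \<beta> (s n) (q n) x) \<partial>lebesgue) \<longlonglongrightarrow> (\<integral>x. W x * (\<zeta> x * slope \<alpha> \<beta> u v x) \<partial>lebesgue)"
    "(\<lambda>n. \<integral>x. \<bar>w n x\<bar> * \<bar>\<zeta> x * slope \<alpha> \<beta> (s n) (q n) x\<bar> \<partial>lebesgue) \<longlonglongrightarrow> (\<integral>x. \<bar>W x\<bar> * \<bar>\<zeta> x * slope \<alpha> \<beta> u v x\<bar> \<partial>lebesgue)"
proof -
  have B: "0 \<le> B" using \<zeta>(2)[of 0] by linarith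
  note dL = norm_H_1_tendsto(2)[OF S(1,3) lim(1)] norm_H_1_tendsto(2)[OF S(2,4) lim(2)]
  define D where "D n x = \<alpha> * (weak_deriv (s n) x - weak_deriv u x) + \<beta> * (weak_deriv (q n) x - weak_deriv v x)" for n x
  have DL: "D n \<in> L2" for n unfolding D_def[abs_def] by (intro L2_lincomb L2_diff sobolev_1_L2 S)
  have Dn: "(\<lambda>n. norm_L2 (D n)) \<longlonglongrightarrow> 0"
  proof (rule Lim_null_comparison)
    have "norm_L2 (D n) \<le> \<bar>\<alpha>\<bar> * norm_L2 (\<lambda>x. weak_deriv (s n) x - weak_deriv u x) + \<bar>\<beta>\<bar> * norm_L2 (\<lambda>x. weak_deriv (q n) x - weak_deriv v x)" for n
    proof -
      have l: "(\<lambda>x. \<gamma> * (weak_deriv f x - weak_deriv g x)) \<in> L2" if "f \<in> sobolev 1" "g \<in> sobolev 1" for \<gamma> f g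
      proof -
        have d: "(\<lambda>x. weak_deriv f x - weak_deriv g x) \<in> L2" by (intro L2_diff sobolev_1_L2 that)
        show ?thesis using L2_lincomb[OF d d, of \<gamma> 0] by simp
      qed
      show ?thesis unfolding D_def[abs_def]
        using norm_L2_triangle[OF l[OF S(1)[of n] S(3), of \<alpha>] l[OF S(2)[of n] S(4), of \<beta>]] by (simp add: norm_L2_cmult)
    qed
    then show "\<forall>\<^sub>F n in sequentially. norm (norm_L2 (D n)) \<le> \<bar>\<alpha>\<bar> * norm_L2 (\<lambda>x. weak_deriv (s n) x - weak_deriv u x) + \<bar>\<beta>\<bar> * norm_L2 (\<lambda>x. weak_deriv (q n) x - weak_deriv v x)" by simp
    have "(\<lambda>n. \<bar>\<alpha>\<bar> * norm_L2 (\<lambda>x. weak_deriv (s n) x - weak_deriv u x) + \<bar>\<beta>\<bar> * norm_L2 (\<lambda>x. weak_deriv (q n) x - weak_deriv v x)) \<longlonglongrightarrow> \<bar>\<alpha>\<bar> * 0 + \<bar>\<beta>\<bar> * 0"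
      by (intro tendsto_intros dL)
    then show "(\<lambda>n. \<bar>\<alpha>\<bar> * norm_L2 (\<lambda>x. weak_deriv (s n) x - weak_deriv u x) + \<bar>\<beta>\<bar> * norm_L2 (\<lambda>x. weak_deriv (q n) x - weak_deriv v x)) \<longlonglongrightarrow> 0" by simp
  qed
  let ?y = "\<lambda>n x. \<zeta> x * slope \<alpha> \<beta> (s n) (q n) x" and ?z = "\<lambda>x. \<zeta> x * slope \<alpha> \<beta> u v x"
  have yL: "?y n \<in> L2" "?z \<in> L2" for n
    using cutoff_slope_L2[OF S(1,2) \<zeta>] cutoff_slope_L2[OF S(3,4) \<zeta>] by blast+
  have "(\<lambda>x. ?y n x - ?z x) = (\<lambda>x. \<zeta> x * D n x)" for n by (auto simp: D_def slope_def algebra_simps)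
  then have yn: "(\<lambda>n. norm_L2 (\<lambda>x. ?y n x - ?z x)) \<longlonglongrightarrow> 0"
  proof -
    have "(\<lambda>n. B * norm_L2 (D n)) \<longlonglongrightarrow> 0" using tendsto_mult[OF tendsto_const Dn, of B] by simp
    then have "(\<lambda>n. norm_L2 (\<lambda>x. \<zeta> x * D n x)) \<longlonglongrightarrow> 0"
      by (rule Lim_null_comparison[rotated]) (use cutoff_L2(2)[OF DL \<zeta>(1,2)] in simp)
    then show ?thesis using \<open>\<And>n. (\<lambda>x. ?y n x - ?z x) = (\<lambda>x. \<zeta> x * D n x)\<close> by simp
  qed
  note wn = norm_H_1_tendsto(1)[OF w]
  show "(\<lambda>n. \<integral>x. w n x * (\<zeta> x * slope \<alpha> \<beta> (s n) (q n) x) \<partial>lebesgue) \<longlonglongrightarrow> (\<integral>x. W x * (\<zeta> x * slope \<alpha> \<beta> u v x) \<partial>lebesgue)"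
    by (intro L2_inner_tendsto sobolev_1_L2 w yL wn yn)
  have absn: "(\<lambda>n. norm_L2 (\<lambda>x. \<bar>y n x\<bar> - \<bar>z x\<bar>)) \<longlonglongrightarrow> 0"
    if y: "\<And>n. y n \<in> L2" "z \<in> L2" "(\<lambda>n. norm_L2 (\<lambda>x. y n x - z x)) \<longlonglongrightarrow> 0" for y :: "nat \<Rightarrow> real \<Rightarrow> real" and z
  proof (rule Lim_null_comparison[OF _ y(3)])
    have "norm_L2 (\<lambda>x. \<bar>y n x\<bar> - \<bar>z x\<bar>) \<le> norm_L2 (\<lambda>x. y n x - z x)" for n
      unfolding norm_L2_def
    proof (intro real_sqrt_le_mono integral_mono)
      show "integrable lebesgue (\<lambda>x. (\<bar>y n x\<bar> - \<bar>z x\<bar>)\<^sup>2)" using L2_diff[OF L2_abs[OF y(1)] L2_abs[OF y(2)]] by (simp add: L2_def)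
      show "integrable lebesgue (\<lambda>x. (y n x - z x)\<^sup>2)" using L2_diff[OF y(1,2)] by (simp add: L2_def)
      show "(\<bar>y n x\<bar> - \<bar>z x\<bar>)\<^sup>2 \<le> (y n x - z x)\<^sup>2" for x
        by (intro abs_le_square_iff[THEN iffD1] abs_triangle_ineq3)
    qed
    then show "\<forall>\<^sub>F n in sequentially. norm (norm_L2 (\<lambda>x. \<bar>y n x\<bar> - \<bar>z x\<bar>)) \<le> norm_L2 (\<lambda>x. y n x - z x)" by simp
  qed
  show "(\<lambda>n. \<integral>x. \<bar>w n x\<bar> * \<bar>\<zeta> x * slope \<alpha> \<beta> (s n) (q n) x\<bar> \<partial>lebesgue) \<longlonglongrightarrow> (\<integral>x. \<bar>W x\<bar> * \<bar>\<zeta> x * slope \<alpha> \<beta> u v x\<bar> \<partial>lebesgue)"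
    by (rule L2_inner_tendsto[OF L2_abs L2_abs L2_abs L2_abs absn absn, OF sobolev_1_L2(1)[OF w(1)] yL(1) sobolev_1_L2(1)[OF w(2)] yL(2)
          sobolev_1_L2(1)[OF w(1)] sobolev_1_L2(1)[OF w(2)] wn yL yn])
qed

lemma slope_functional_measurable:
  assumes b: "I \<in> sets lebesgue" "bochner_measurable I (sobolev 1) (norm_H 1) u" "bochner_measurable I (sobolev 1) (norm_H 1) v"
    and \<zeta>: "\<zeta> \<in> borel_measurable lebesgue" "\<And>x. \<bar>\<zeta> x\<bar> \<le> B" "\<And>x. A < \<bar>x\<bar> \<Longrightarrow> \<zeta> x = 0"
  shows "(\<lambda>t. if t \<in> I then \<integral>x. u t x * (\<zeta> x * slope \<alpha> \<beta> (u t) (v t) x) \<partial>lebesgue else 0) \<in> borel_measurable lebesgue"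
    "(\<lambda>t. if t \<in> I then \<integral>x. v t x * (\<zeta> x * slope \<alpha> \<beta> (u t) (v t) x) \<partial>lebesgue else 0) \<in> borel_measurable lebesgue"
    "(\<lambda>t. if t \<in> I then \<integral>x. \<bar>u t x\<bar> * \<bar>\<zeta> x * slope \<alpha> \<beta> (u t) (v t) x\<bar> \<partial>lebesgue else 0) \<in> borel_measurable lebesgue"
    "(\<lambda>t. if t \<in> I then \<integral>x. \<bar>v t x\<bar> * \<bar>\<zeta> x * slope \<alpha> \<beta> (u t) (v t) x\<bar> \<partial>lebesgue else 0) \<in> borel_measurable lebesgue"
  by (rule bochner_functional_measurable[OF b], rule slope_functional_tendsto[OF _ _ _ _ _ _ \<zeta>], assumption+)+

section \<open>Compactness\<close>

definition holder_half :: "real \<Rightarrow> (real \<Rightarrow> real) \<Rightarrow> bool" where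
  "holder_half C u \<longleftrightarrow> (\<forall>x y. x \<le> y \<longrightarrow> \<bar>u y - u x\<bar> \<le> C * sqrt (y - x))"

lemma holder_halfD: "holder_half C u \<Longrightarrow> \<bar>u y - u x\<bar> \<le> C * sqrt \<bar>y - x\<bar>"
  unfolding holder_half_def by (cases "x \<le> y") (auto dest: spec2[of _ x y] spec2[of _ y x] simp: abs_minus_commute[of "u y" "u x"])

lemma holder_half_continuous:
  assumes "holder_half C u"
  shows "continuous_on UNIV u"
proof -
  have "(u \<longlongrightarrow> u x) (at x)" for x
  proof -
    have "((\<lambda>y. C * sqrt \<bar>y - x\<bar>) \<longlongrightarrow> C * sqrt \<bar>x - x\<bar>) (at x)" by (intro tendsto_intros)
    then have "((\<lambda>y. C * sqrt \<bar>y - x\<bar>) \<longlongrightarrow> 0) (at x)" by simp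
    then have "((\<lambda>y. u y - u x) \<longlongrightarrow> 0) (at x)"
      by (rule Lim_null_comparison[rotated]) (simp add: holder_halfD[OF assms])
    then show ?thesis by (simp add: LIM_zero_iff)
  qed
  then show ?thesis by (simp add: continuous_on_eq_continuous_at isCont_def)
qed

text \<open>On \<open>[x, x + 1]\<close> the function stays above \<open>u x - C\<close>, while its
  total mass is 1.\<close>

lemma holder_half_bound:
  assumes h: "holder_half C u" and u: "\<And>x. 0 \<le> u x" "integrable lebesgue u" "(\<integral>x. u x \<partial>lebesgue) = 1" and C: "0 \<le> C"
  shows "u x \<le> 1 + C"
proof -
  have i: "integrable lebesgue (\<lambda>z. indicator {x..x+1} z * (u x - C))" "integrable lebesgue (\<lambda>z. indicator {x..x+1} z :: real)"
    by (intro integrable_mult_left integrable_real_indicator; simp add: emeasure_lborel_Icc_eq)+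
  have "u x - C = (\<integral>z. indicator {x..x+1} z * (u x - C) \<partial>lebesgue)"
    by simp
  also have "\<dots> \<le> (\<integral>z. u z \<partial>lebesgue)"
  proof (rule integral_mono[OF i(1) u(2)])
    fix z
    show "indicator {x..x+1} z * (u x - C) \<le> u z"
    proof (cases "z \<in> {x..x+1}")
      case True
      then have "\<bar>u z - u x\<bar> \<le> C * sqrt (z - x)" using h by (auto simp: holder_half_def)
      also have "\<dots> \<le> C * 1" using True C by (intro mult_left_mono) auto
      finally show ?thesis using True by simp
    qed (use u(1) in simp)
  qed
  finally show ?thesis using u(3) by simp
qed

text \<open>Pointwise Arzela-Ascoli on the whole line. Diagonal extraction on the rationals is
  applied to pairs of values so that one subsequence serves both components; the common Hoelder
  modulus carries the Cauchy property from rationals to all reals.\<close>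

lemma equicontinuous_pair_subsequence:
  assumes h: "\<And>n. holder_half C (U n)" "\<And>n. holder_half C (V n)"
    and b: "\<And>n x. \<bar>U n x\<bar> \<le> B" "\<And>n x. \<bar>V n x\<bar> \<le> B"
  obtains k :: "nat \<Rightarrow> nat" and F G where "strict_mono k" "\<And>x. (\<lambda>n. U (k n) x) \<longlonglongrightarrow> F x" "\<And>x. (\<lambda>n. V (k n) x) \<longlonglongrightarrow> G x"
proof -
  have "norm (U n x, V n x) \<le> 2 * B" for n x
    using norm_Pair_le[of "U n x" "V n x"] b(1)[of n x] b(2)[of n x] by simp
  then obtain k :: "nat \<Rightarrow> nat" where k: "strict_mono k" "\<And>x. x \<in> \<rat> \<Longrightarrow> \<exists>l. (\<lambda>n. (U (k n) x, V (k n) x)) \<longlonglongrightarrow> l"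
    using function_convergent_subsequence[OF countable_rat, of "\<lambda>n x. (U n x, V n x)" "2 * B"] by blast
  have conv: "convergent (\<lambda>n. W (k n) x)"
    if W: "\<And>n. holder_half C (W n)" "\<And>q. q \<in> \<rat> \<Longrightarrow> convergent (\<lambda>n. W (k n) q)" for W :: "nat \<Rightarrow> real \<Rightarrow> real" and x
  proof -
    have "Cauchy (\<lambda>n. W (k n) x)"
    proof (rule CauchyI)
      fix e :: real assume e: "0 < e"
      have "((\<lambda>y. C * sqrt \<bar>y - x\<bar>) \<longlongrightarrow> C * sqrt \<bar>x - x\<bar>) (at_right x)" by (intro tendsto_intros)
      then have "\<forall>\<^sub>F y in at_right x. C * sqrt \<bar>y - x\<bar> < e / 3" using e by (auto dest!: order_tendstoD(2)[of _ _ _ "e / 3"])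
      then obtain d where d: "x < d" "\<And>y. x < y \<Longrightarrow> y < d \<Longrightarrow> C * sqrt \<bar>y - x\<bar> < e / 3"
        by (auto simp: eventually_at_right_field)
      obtain q where q: "q \<in> \<rat>" "x < q" "q < d" using Rats_dense_in_real[OF d(1)] by blast
      then have near: "\<bar>W n q - W n x\<bar> < e / 3" for n
        using holder_halfD[OF W(1), of n q x] d(2)[of q] by linarith
      have "Cauchy (\<lambda>n. W (k n) q)" using W(2)[OF q(1)] by (rule convergent_Cauchy)
      then obtain N where N: "\<And>m n. N \<le> m \<Longrightarrow> N \<le> n \<Longrightarrow> \<bar>W (k m) q - W (k n) q\<bar> < e / 3"
        using CauchyD[of "\<lambda>n. W (k n) q" "e / 3"] e by auto
      show "\<exists>M. \<forall>m\<ge>M. \<forall>n\<ge>M. norm (W (k m) x - W (k n) x) < e"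
      proof (intro exI[of _ N] allI impI)
        fix m n assume mn: "N \<le> m" "N \<le> n"
        show "norm (W (k m) x - W (k n) x) < e"
          using N[OF mn] near[of "k m"] near[of "k n"] unfolding real_norm_def by arith
      qed
    qed
    then show ?thesis by (rule Cauchy_convergent)
  qed
  have kq: "convergent (\<lambda>n. U (k n) q)" "convergent (\<lambda>n. V (k n) q)" if q: "q \<in> \<rat>" for q
  proof -
    obtain l where "(\<lambda>n. (U (k n) q, V (k n) q)) \<longlonglongrightarrow> l" using k(2)[OF q] by blast
    from tendsto_fst[OF this] tendsto_snd[OF this]
    show "convergent (\<lambda>n. U (k n) q)" "convergent (\<lambda>n. V (k n) q)" by (auto simp: convergent_def)
  qed
  have "convergent (\<lambda>n. U (k n) x)" for x by (rule conv) (rule h kq, assumption?)+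
  moreover have "convergent (\<lambda>n. V (k n) x)" for x by (rule conv) (rule h kq, assumption?)+
  ultimately have "convergent (\<lambda>n. U (k n) x)" "convergent (\<lambda>n. V (k n) x)" for x by blast+
  then show thesis
    by (intro that[OF k(1), of "\<lambda>x. lim (\<lambda>n. U (k n) x)" "\<lambda>x. lim (\<lambda>n. V (k n) x)"]) (simp_all add: convergent_LIMSEQ_iff)
qed

lemma holder_half_limit:
  assumes "\<And>n. holder_half C (U n)" "\<And>x. (\<lambda>n. U n x) \<longlonglongrightarrow> F x"
  shows "holder_half C F"
  unfolding holder_half_def
proof (intro allI impI)
  fix x y :: real assume "x \<le> y"
  have "(\<lambda>n. \<bar>U n y - U n x\<bar>) \<longlonglongrightarrow> \<bar>F y - F x\<bar>" by (intro tendsto_intros assms)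
  then show "\<bar>F y - F x\<bar> \<le> C * sqrt (y - x)"
    by (rule LIMSEQ_le_const2) (use assms(1) \<open>x \<le> y\<close> in \<open>auto simp: holder_half_def\<close>)
qed

lemma abs_pos_part: "\<bar>s - t\<bar> = s - t + 2 * max 0 (t - s :: real)"
  by (simp add: max_def abs_if)

text \<open>Chebyshev's inequality in pointwise form.\<close>

lemma weighted_tail_le:
  fixes A x w :: real
  assumes "0 < A" "0 \<le> w"
  shows "w \<le> indicator {-A..A} x * w + (1 / A\<^sup>2) * (x\<^sup>2 * w)"
proof (cases "x \<in> {-A..A}")
  case True
  then show ?thesis using assms by simp
next
  case False
  then have "A\<^sup>2 \<le> x\<^sup>2" using assms by (auto simp: abs_le_square_iff[symmetric])
  then have "1 * w \<le> x\<^sup>2 / A\<^sup>2 * w" using assms by (intro mult_right_mono) auto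
  then show ?thesis using False by simp
qed

text \<open>Bounded second moments give tightness: outside \<open>[-A, A]\<close> the L1 error is at
  most \<open>2 * M / A^2\<close>, inside the uniform bound allows dominated convergence. L2
  convergence follows by interpolation with the uniform bound. Convergence of the second moments is
  deliberately absent, since they may drop in the limit.\<close>

lemma setK_limit:
  assumes U: "\<And>n. U n \<in> setK" "\<And>n x. 0 \<le> U n x" "\<And>n x. U n x \<le> B"
    and M: "\<And>n. (\<integral>x. x\<^sup>2 * U n x \<partial>lebesgue) \<le> M"
    and lim: "\<And>x. (\<lambda>n. U n x) \<longlonglongrightarrow> F x"
  shows "F \<in> setK" "(\<lambda>n. \<integral>x. \<bar>U n x - F x\<bar> \<partial>lebesgue) \<longlonglongrightarrow> 0" "(\<lambda>n. norm_L2 (\<lambda>x. U n x - F x)) \<longlonglongrightarrow> 0"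
proof -
  note int = setK_integrable[OF U(1)]
  have F: "0 \<le> F x" "F x \<le> B" for x
    using LIMSEQ_le_const[OF lim, of 0 x] LIMSEQ_le_const2[OF lim, of x B] U by auto
  have B0: "0 \<le> B" using F[of 0] by linarith
  have [measurable]: "F \<in> borel_measurable lebesgue" "\<And>n. U n \<in> borel_measurable lebesgue"
    using borel_measurable_LIMSEQ_real[OF lim int(2)] int(2) by auto
  have [measurable]: "(\<lambda>x::real. x\<^sup>2) \<in> borel_measurable lebesgue"
    by (intro continuous_lebesgue_measurable continuous_intros)
  \<comment> \<open>Fatou yields integrability and upper bounds only; that the mass is exactly 1
    follows later from L1 convergence.\<close>
  have fatou: "integrable lebesgue (\<lambda>x. h x * F x) \<and> (\<integral>x. h x * F x \<partial>lebesgue) \<le> K"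
    if h[measurable]: "h \<in> borel_measurable lebesgue" and h0: "\<And>x. 0 \<le> h x"
      and i: "\<And>n. integrable lebesgue (\<lambda>x. h x * U n x)" and K: "\<And>n. (\<integral>x. h x * U n x \<partial>lebesgue) \<le> K" for h :: "real \<Rightarrow> real" and K
  proof -
    have K0: "0 \<le> K"
    proof -
      have "0 \<le> (\<integral>x. h x * U 0 x \<partial>lebesgue)"
        by (intro Bochner_Integration.integral_nonneg mult_nonneg_nonneg h0 U(2))
      then show ?thesis using K[of 0] by linarith
    qed
    have "(\<integral>\<^sup>+x. ennreal (h x * F x) \<partial>lebesgue) = (\<integral>\<^sup>+x. liminf (\<lambda>n. ennreal (h x * U n x)) \<partial>lebesgue)"
    proof (intro nn_integral_cong)
      fix x
      have "(\<lambda>n. ennreal (h x * U n x)) \<longlonglongrightarrow> ennreal (h x * F x)" by (intro tendsto_ennrealI tendsto_intros lim)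
      then show "ennreal (h x * F x) = liminf (\<lambda>n. ennreal (h x * U n x))" by (simp add: lim_imp_Liminf)
    qed
    also have "\<dots> \<le> liminf (\<lambda>n. \<integral>\<^sup>+x. ennreal (h x * U n x) \<partial>lebesgue)"
      by (intro nn_integral_liminf) measurable
    also have "\<dots> \<le> liminf (\<lambda>n. ennreal K)"
      using i K h0 U(2) by (intro Liminf_mono always_eventually allI) (simp add: nn_integral_eq_integral ennreal_leI)
    also have "\<dots> = ennreal K" by (simp add: Liminf_const)
    finally have le: "(\<integral>\<^sup>+x. ennreal (h x * F x) \<partial>lebesgue) \<le> ennreal K" .
    have ih: "integrable lebesgue (\<lambda>x. h x * F x)"
      by (rule integrableI_bounded) (use le h0 F in \<open>auto simp: abs_mult le_less_trans\<close>)
    moreover have "(\<integral>x. h x * F x \<partial>lebesgue) \<le> K"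
      using le ih h0 F K0 by (simp add: nn_integral_eq_integral)
    ultimately show ?thesis by simp
  qed
  have F1: "integrable lebesgue F"
    using fatou[of "\<lambda>_. 1" 1] int(3) setK_D(3)[OF U(1)] by simp
  have F2: "integrable lebesgue (\<lambda>x. x\<^sup>2 * F x)" "(\<integral>x. x\<^sup>2 * F x \<partial>lebesgue) \<le> M"
    using fatou[of "\<lambda>x. x\<^sup>2" M] int(4) M by simp_all
  have M0: "0 \<le> M"
  proof -
    have "0 \<le> (\<integral>x. x\<^sup>2 * U 0 x \<partial>lebesgue)"
      by (intro Bochner_Integration.integral_nonneg mult_nonneg_nonneg U(2)) simp
    then show ?thesis using M[of 0] by linarith
  qed
  have "integrable lebesgue (\<lambda>x. B * F x)" using F1 by simp
  then have "integrable lebesgue (\<lambda>x. (F x)\<^sup>2)"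
    by (rule Bochner_Integration.integrable_bound) (use F B0 in \<open>auto simp: power2_eq_square intro!: mult_right_mono\<close>)
  then have FL2: "F \<in> L2" by (simp add: L2_def)
  have FX: "F \<in> spX" by (rule spX_I[OF FL2 F1 F2(1)])
  define d where "d n = (\<integral>x. \<bar>U n x - F x\<bar> \<partial>lebesgue)" for n
  have di: "integrable lebesgue (\<lambda>x. \<bar>U n x - F x\<bar>)" for n using int(3) F1 by auto
  show d0: "(\<lambda>n. \<integral>x. \<bar>U n x - F x\<bar> \<partial>lebesgue) \<longlonglongrightarrow> 0"
  proof (rule LIMSEQ_I)
    fix e :: real assume e: "0 < e"
    \<comment> \<open>The witness \<open>4 * M / e + 1\<close> is at least 1, hence bounded by its
      square, which reduces the quadratic condition on \<open>A\<close> to a linear one.\<close>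
    obtain A where A: "0 < A" "2 * M / A\<^sup>2 < e / 2"
    proof
      have "1 \<le> 4 * M / e + 1" using e M0 by simp
      then have "4 * M / e + 1 \<le> (4 * M / e + 1)\<^sup>2" by (simp add: power2_eq_square)
      then have "4 * M / e < (4 * M / e + 1)\<^sup>2" by linarith
      then have "4 * M < e * (4 * M / e + 1)\<^sup>2" using e by (simp add: field_simps)
      moreover have "0 < (4 * M / e + 1)\<^sup>2" using e M0 by (intro zero_less_power) (auto intro: add_nonneg_pos)
      ultimately show "2 * M / (4 * M / e + 1)\<^sup>2 < e / 2" by (simp add: pos_divide_less_eq)
      show "0 < 4 * M / e + 1" using e M0 by (auto intro: add_nonneg_pos)
    qed
    have ii: "integrable lebesgue (\<lambda>x. indicator {-A..A} x * \<bar>U n x - F x\<bar>)" for n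
      using integrable_mult_indicator[OF _ di[of n], of "{-A..A}"] by simp
    have "(\<lambda>n. \<integral>x. indicator {-A..A} x * \<bar>U n x - F x\<bar> \<partial>lebesgue) \<longlonglongrightarrow> (\<integral>x. (0::real) \<partial>(lebesgue :: real measure))"
    proof (rule integral_dominated_convergence)
      show "integrable lebesgue (\<lambda>x. B * indicator {-A..A} x)"
        by (intro integrable_mult_right integrable_real_indicator) (auto simp: emeasure_lborel_Icc_eq)
      show "AE x in lebesgue. (\<lambda>n. indicator {-A..A} x * \<bar>U n x - F x\<bar>) \<longlonglongrightarrow> 0"
      proof (rule AE_I2)
        fix x
        have "(\<lambda>n. indicator {-A..A} x * \<bar>U n x - F x\<bar>) \<longlonglongrightarrow> indicator {-A..A} x * \<bar>F x - F x\<bar>"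
          by (intro tendsto_intros lim)
        then show "(\<lambda>n. indicator {-A..A} x * \<bar>U n x - F x\<bar>) \<longlonglongrightarrow> 0" by simp
      qed
      have "\<bar>U n x - F x\<bar> \<le> B" for n x using U(2,3)[of n x] F[of x] unfolding abs_le_iff by linarith
      then show "AE x in lebesgue. norm (indicator {-A..A} x * \<bar>U n x - F x\<bar>) \<le> B * indicator {-A..A} x" for n
        by (auto simp: indicator_def)
      show "(\<lambda>x. indicator {-A..A} x * \<bar>U n x - F x\<bar>) \<in> borel_measurable lebesgue" for n using ii by auto
    qed simp
    then have "(\<lambda>n. \<integral>x. indicator {-A..A} x * \<bar>U n x - F x\<bar> \<partial>lebesgue) \<longlonglongrightarrow> 0" by simp
    then obtain N where N: "\<And>n. N \<le> n \<Longrightarrow> \<bar>\<integral>x. indicator {-A..A} x * \<bar>U n x - F x\<bar> \<partial>lebesgue\<bar> < e / 2"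
      using LIMSEQ_D[of _ 0 "e / 2"] e by fastforce
    show "\<exists>N. \<forall>n\<ge>N. norm ((\<integral>x. \<bar>U n x - F x\<bar> \<partial>lebesgue) - 0) < e"
    proof (intro exI[of _ N] allI impI)
      fix n assume n: "N \<le> n"
      let ?R = "\<lambda>x. indicator {-A..A} x * \<bar>U n x - F x\<bar> + 1 / A\<^sup>2 * (x\<^sup>2 * U n x + x\<^sup>2 * F x)"
      have "(\<integral>x. \<bar>U n x - F x\<bar> \<partial>lebesgue) \<le> (\<integral>x. ?R x \<partial>lebesgue)"
      proof (rule integral_mono[OF di])
        show "integrable lebesgue ?R" using ii int(4) F2(1) by auto
        show "\<bar>U n x - F x\<bar> \<le> ?R x" for x
        proof -
          have "x\<^sup>2 * \<bar>U n x - F x\<bar> \<le> x\<^sup>2 * (U n x + F x)" using U(2)[of n x] F(1)[of x] by (intro mult_left_mono) auto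
          then have "1 / A\<^sup>2 * (x\<^sup>2 * \<bar>U n x - F x\<bar>) \<le> 1 / A\<^sup>2 * (x\<^sup>2 * U n x + x\<^sup>2 * F x)"
            using A by (intro mult_left_mono) (auto simp: distrib_left)
          then show ?thesis using weighted_tail_le[OF A(1) abs_ge_zero, of "U n x - F x" x] by linarith
        qed
      qed
      also have "\<dots> = (\<integral>x. indicator {-A..A} x * \<bar>U n x - F x\<bar> \<partial>lebesgue)
          + 1 / A\<^sup>2 * ((\<integral>x. x\<^sup>2 * U n x \<partial>lebesgue) + (\<integral>x. x\<^sup>2 * F x \<partial>lebesgue))"
        using ii int(4) F2(1) by simp
      also have "\<dots> \<le> (\<integral>x. indicator {-A..A} x * \<bar>U n x - F x\<bar> \<partial>lebesgue) + 1 / A\<^sup>2 * (M + M)"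
        using M F2(2) by (intro add_left_mono mult_left_mono add_mono) auto
      also have "\<dots> < e" using N[OF n] A(2) by simp
      finally show "norm ((\<integral>x. \<bar>U n x - F x\<bar> \<partial>lebesgue) - 0) < e" by simp
    qed
  qed
  have "(\<lambda>n. (\<integral>x. U n x \<partial>lebesgue) - (\<integral>x. F x \<partial>lebesgue)) \<longlonglongrightarrow> 0"
  proof (rule Lim_null_comparison[OF _ d0])
    have "\<bar>(\<integral>x. U n x \<partial>lebesgue) - (\<integral>x. F x \<partial>lebesgue)\<bar> \<le> (\<integral>x. \<bar>U n x - F x\<bar> \<partial>lebesgue)" for n
      using integral_abs_bound[of lebesgue "\<lambda>x. U n x - F x"] int(3) F1 by simp
    then show "\<forall>\<^sub>F n in sequentially. norm ((\<integral>x. U n x \<partial>lebesgue) - (\<integral>x. F x \<partial>lebesgue)) \<le> (\<integral>x. \<bar>U n x - F x\<bar> \<partial>lebesgue)"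
      by simp
  qed
  then have "(\<integral>x. F x \<partial>lebesgue) = 1" using setK_D(3)[OF U(1)] by (simp add: LIMSEQ_const_iff)
  then show FK: "F \<in> setK" using F by (intro setK_I FX) auto
  show "(\<lambda>n. norm_L2 (\<lambda>x. U n x - F x)) \<longlonglongrightarrow> 0"
  proof -
    have "(norm_L2 (\<lambda>x. U n x - F x))\<^sup>2 \<le> B * d n" for n
    proof -
      have "(norm_L2 (\<lambda>x. U n x - F x))\<^sup>2 \<le> (\<integral>x. B * \<bar>U n x - F x\<bar> \<partial>lebesgue)"
        unfolding norm_L2_sq
      proof (rule integral_mono)
        show "integrable lebesgue (\<lambda>x. (U n x - F x)\<^sup>2)" using L2_diff[OF int(1) FL2] by (simp add: L2_def)
        show "integrable lebesgue (\<lambda>x. B * \<bar>U n x - F x\<bar>)" using di by simp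
        fix x
        have "\<bar>U n x - F x\<bar> \<le> B" using U(2,3)[of n x] F[of x] unfolding abs_le_iff by linarith
        then have "\<bar>U n x - F x\<bar> * \<bar>U n x - F x\<bar> \<le> B * \<bar>U n x - F x\<bar>" by (intro mult_right_mono) auto
        then show "(U n x - F x)\<^sup>2 \<le> B * \<bar>U n x - F x\<bar>" by (simp add: power2_eq_square)
      qed
      then show ?thesis by (simp add: d_def)
    qed
    then have "norm_L2 (\<lambda>x. U n x - F x) \<le> sqrt (B * d n)" for n
      by (rule real_le_rsqrt)
    then have "\<forall>\<^sub>F n in sequentially. norm (norm_L2 (\<lambda>x. U n x - F x)) \<le> sqrt (B * d n)" by simp
    moreover have "(\<lambda>n. sqrt (B * d n)) \<longlonglongrightarrow> sqrt (B * 0)"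
      using d0 by (intro tendsto_intros) (simp add: d_def)
    then have "(\<lambda>n. sqrt (B * d n)) \<longlonglongrightarrow> 0" by simp
    ultimately show ?thesis by (rule Lim_null_comparison)
  qed
qed

text \<open>Where the limit of a component is positive, the approximations are eventually bounded
  below on a fixed neighbourhood, by the common Hoelder modulus. There the increments of the
  potential are at most \<open>\<kappa> n / \<delta>\<close> and vanish in the limit. Local
  constancy spreads over the interval by connectedness and to its end points by continuity.\<close>

lemma stationary_pair_limit:
  assumes h: "\<And>n. holder_half C (U n)" "\<And>n. holder_half C (V n)"
    and nn: "\<And>n x. 0 \<le> U n x" "\<And>n x. 0 \<le> V n x"
    and lim: "\<And>x. (\<lambda>n. U n x) \<longlonglongrightarrow> F x" "\<And>x. (\<lambda>n. V n x) \<longlonglongrightarrow> G x"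
    and \<kappa>: "\<kappa> \<longlonglongrightarrow> 0"
    and dF: "\<And>n \<delta> x y. 0 < \<delta> \<Longrightarrow> x \<le> y \<Longrightarrow> (\<And>z. x \<le> z \<Longrightarrow> z \<le> y \<Longrightarrow> \<delta> \<le> U n z) \<Longrightarrow>
      \<bar>(a * U n y + b * V n y + p * y\<^sup>2) - (a * U n x + b * V n x + p * x\<^sup>2)\<bar> \<le> \<kappa> n / \<delta>"
    and dG: "\<And>n \<delta> x y. 0 < \<delta> \<Longrightarrow> x \<le> y \<Longrightarrow> (\<And>z. x \<le> z \<Longrightarrow> z \<le> y \<Longrightarrow> \<delta> \<le> V n z) \<Longrightarrow>
      \<bar>(b * U n y + c * V n y + r * y\<^sup>2) - (b * U n x + c * V n x + r * x\<^sup>2)\<bar> \<le> \<kappa> n / \<delta>"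
  shows "stationary_pair a b c p r F G"
proof -
  have hF: "holder_half C F" "holder_half C G" using holder_half_limit h lim by blast+
  note cont = hF[THEN holder_half_continuous]
  have const: "\<Phi> x = \<Phi> y"
    if W: "\<And>n. holder_half C (W n)" "\<And>x. (\<lambda>n. W n x) \<longlonglongrightarrow> H x"
      and P: "\<And>x. (\<lambda>n. P n x) \<longlonglongrightarrow> \<Phi> x" and cP: "continuous_on UNIV \<Phi>"
      and d: "\<And>n \<delta> x y. 0 < \<delta> \<Longrightarrow> x \<le> y \<Longrightarrow> (\<And>z. x \<le> z \<Longrightarrow> z \<le> y \<Longrightarrow> \<delta> \<le> W n z) \<Longrightarrow> \<bar>P n y - P n x\<bar> \<le> \<kappa> n / \<delta>"
      and xy: "x < y" "\<And>z. z \<in> {x<..<y} \<Longrightarrow> 0 < H z"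
    for W P :: "nat \<Rightarrow> real \<Rightarrow> real" and H \<Phi> x y
  proof -
    have loc: "\<forall>\<^sub>F w in at z. \<Phi> z = \<Phi> w" if z: "0 < H z" for z
    proof -
      \<comment> \<open>Of the limit value \<open>3 * \<delta>\<close>, one third is spent on the
        convergence at \<open>z\<close> and one third on the oscillation near
        \<open>z\<close>.\<close>
      define \<delta> where "\<delta> = H z / 3"
      have \<delta>: "0 < \<delta>" using z by (simp add: \<delta>_def)
      have ev: "\<forall>\<^sub>F n in sequentially. 2 * \<delta> < W n z"
        using order_tendstoD(1)[OF W(2)[of z], of "2 * \<delta>"] z by (simp add: \<delta>_def)
      have "((\<lambda>w. C * sqrt \<bar>w - z\<bar>) \<longlongrightarrow> C * sqrt \<bar>z - z\<bar>) (at z)" by (intro tendsto_intros)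
      then have "\<forall>\<^sub>F w in at z. C * sqrt \<bar>w - z\<bar> < \<delta>" using \<delta> by (auto dest!: order_tendstoD(2)[of _ _ _ \<delta>])
      then obtain s where s: "0 < s" "\<And>w. w \<noteq> z \<Longrightarrow> \<bar>w - z\<bar> < s \<Longrightarrow> C * sqrt \<bar>w - z\<bar> < \<delta>"
        by (auto simp: eventually_at dist_real_def)
      have "\<Phi> z = \<Phi> w" if w: "\<bar>w - z\<bar> < s" for w
      proof -
        have "\<forall>\<^sub>F n in sequentially. \<bar>P n w - P n z\<bar> \<le> \<kappa> n / \<delta>"
          using ev
        proof eventually_elim
          case (elim n)
          have low: "\<delta> \<le> W n q" if "\<bar>q - z\<bar> < s" for q
            using holder_halfD[OF W(1), of n q z] s(2)[of q] that elim \<delta> by (cases "q = z") auto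
          show ?case
          proof (cases "w \<le> z")
            case True
            have "\<bar>P n z - P n w\<bar> \<le> \<kappa> n / \<delta>"
              by (rule d[OF \<delta> True]) (rule low, use w in auto)
            then show ?thesis by (simp add: abs_minus_commute)
          next
            case False
            then show ?thesis using w by (intro d[OF \<delta>]) (auto intro!: low)
          qed
        qed
        then have "\<forall>\<^sub>F n in sequentially. norm (P n w - P n z) \<le> \<kappa> n / \<delta>" by simp
        moreover have "(\<lambda>n. \<kappa> n / \<delta>) \<longlonglongrightarrow> 0" using tendsto_divide[OF \<kappa> tendsto_const, of \<delta>] \<delta> by simp
        ultimately have "(\<lambda>n. P n w - P n z) \<longlonglongrightarrow> 0" by (rule Lim_null_comparison)
        moreover have "(\<lambda>n. P n w - P n z) \<longlonglongrightarrow> \<Phi> w - \<Phi> z" by (intro tendsto_diff P)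
        ultimately have "0 = \<Phi> w - \<Phi> z" by (rule LIMSEQ_unique)
        then show ?thesis by simp
      qed
      then show ?thesis using s(1) by (auto simp: eventually_at dist_real_def)
    qed
    define m where "m = (x + y) / 2"
    have m: "m \<in> {x<..<y}" using xy(1) by (auto simp: m_def)
    have "\<forall>\<^sub>F w in at z within {x<..<y}. \<Phi> z = \<Phi> w" if "z \<in> {x<..<y}" for z
      using loc[OF xy(2)[OF that]] by (rule filter_leD[OF at_le[OF subset_UNIV]])
    then have "\<Phi> z = \<Phi> m" if "z \<in> {x<..<y}" for z
      using connected_local_const[OF connected_Ioo that m] by blast
    then have "\<Phi> z = \<Phi> m" if "z \<in> closure {x<..<y}" for z
      using continuous_constant_on_closure[of "{x<..<y}" \<Phi> "\<Phi> m" z] continuous_on_subset[OF cP] that by auto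
    then have "\<Phi> z = \<Phi> m" if "z \<in> {x..y}" for z
      using that xy(1) by (simp add: closure_greaterThanLessThan)
    then show "\<Phi> x = \<Phi> y" using xy(1) by simp
  qed
  show ?thesis
    unfolding stationary_pair_def
  proof (intro conjI allI impI)
    show "continuous_on UNIV F" "continuous_on UNIV G" by (rule cont)+
    show "0 \<le> F x" "0 \<le> G x" for x
      using LIMSEQ_le_const[OF lim(1), of 0 x] LIMSEQ_le_const[OF lim(2), of 0 x] nn by auto
    fix x y :: real assume xy: "x < y"
    show "a * F x + b * G x + p * x\<^sup>2 = a * F y + b * G y + p * y\<^sup>2" if "\<forall>z\<in>{x<..<y}. 0 < F z"
      using h(1) lim(1) _ _ dF xy
      by (rule const[of U F "\<lambda>n x. a * U n x + b * V n x + p * x\<^sup>2" "\<lambda>x. a * F x + b * G x + p * x\<^sup>2"])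
        (use that in \<open>auto intro!: tendsto_intros continuous_intros cont lim\<close>)
    show "b * F x + c * G x + r * x\<^sup>2 = b * F y + c * G y + r * y\<^sup>2" if "\<forall>z\<in>{x<..<y}. 0 < G z"
      using h(2) lim(2) _ _ dG xy
      by (rule const[of V G "\<lambda>n x. b * U n x + c * V n x + r * x\<^sup>2" "\<lambda>x. b * F x + c * G x + r * x\<^sup>2"])
        (use that in \<open>auto intro!: tendsto_intros continuous_intros cont lim\<close>)
  qed
qed

section \<open>Convergence of slowly varying sequences and trajectories\<close>

lemma frequently_close_subseq:
  fixes q :: "nat \<Rightarrow> real"
  assumes "\<And>e N. 0 < e \<Longrightarrow> \<exists>n\<ge>N. \<bar>q n - \<gamma>\<bar> < e"
  obtains k :: "nat \<Rightarrow> nat" where "strict_mono k" "(\<lambda>n. q (k n)) \<longlonglongrightarrow> \<gamma>"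
proof -
  have "\<exists>k. \<forall>n. \<bar>q (k n) - \<gamma>\<bar> < inverse (real (Suc n)) \<and> k n < k (Suc n)"
  proof (rule dependent_nat_choice)
    show "\<exists>x. \<bar>q x - \<gamma>\<bar> < inverse (real (Suc 0))" using assms[of 1 0] by auto
    fix x n
    show "\<exists>y. \<bar>q y - \<gamma>\<bar> < inverse (real (Suc (Suc n))) \<and> x < y"
      using assms[of "inverse (real (Suc (Suc n)))" "Suc x"] by (auto simp: Suc_le_eq)
  qed
  then obtain k where k: "\<And>n. \<bar>q (k n) - \<gamma>\<bar> < inverse (real (Suc n))" "\<And>n. k n < k (Suc n)" by blast
  have "(\<lambda>n. q (k n) - \<gamma>) \<longlonglongrightarrow> 0"
    by (rule Lim_null_comparison[OF _ LIMSEQ_inverse_real_of_nat]) (use k(1) in \<open>auto intro!: always_eventually less_imp_le\<close>)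
  then show thesis using that[of k] k(2) by (simp add: strict_mono_Suc_iff LIM_zero_iff)
qed

text \<open>A discrete intermediate value theorem. After a visit below \<open>\<gamma>\<close>, the
  first index with a value at or above \<open>\<gamma>\<close> overshoots by less than one step, and
  the steps tend to 0. Visits to both sides recur, so this happens arbitrarily late.\<close>

lemma slow_intermediate:
  fixes q :: "nat \<Rightarrow> real"
  assumes step: "(\<lambda>n. q (Suc n) - q n) \<longlonglongrightarrow> 0"
    and k: "strict_mono k" "(\<lambda>n. q (k n)) \<longlonglongrightarrow> \<alpha>" "strict_mono l" "(\<lambda>n. q (l n)) \<longlonglongrightarrow> \<beta>"
    and \<gamma>: "\<alpha> < \<gamma>" "\<gamma> < \<beta>"
  obtains m :: "nat \<Rightarrow> nat" where "strict_mono m" "(\<lambda>n. q (m n)) \<longlonglongrightarrow> \<gamma>"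
proof (rule frequently_close_subseq[of q \<gamma>])
  fix e :: real and N :: nat assume e: "0 < e"
  obtain N0 where N0: "\<And>n. N0 \<le> n \<Longrightarrow> \<bar>q (Suc n) - q n\<bar> < e"
    using LIMSEQ_D[OF step e] by auto
  have "\<forall>\<^sub>F n in sequentially. q (k n) < \<gamma> \<and> max N N0 \<le> k n"
    using order_tendstoD(2)[OF k(2) \<gamma>(1)] filterlim_subseq[OF k(1), unfolded filterlim_at_top, rule_format, of "max N N0"]
    by (rule eventually_conj)
  from eventually_happens'[OF sequentially_bot this]
  obtain n1 where n1: "q n1 < \<gamma>" "max N N0 \<le> n1" by blast
  have "\<forall>\<^sub>F n in sequentially. \<gamma> < q (l n) \<and> n1 \<le> l n"
    using order_tendstoD(1)[OF k(4) \<gamma>(2)] filterlim_subseq[OF k(3), unfolded filterlim_at_top, rule_format, of n1]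
    by (rule eventually_conj)
  from eventually_happens'[OF sequentially_bot this]
  obtain n2 where n2: "\<gamma> < q n2" "n1 \<le> n2" by blast
  define m where "m = (LEAST m. n1 \<le> m \<and> \<gamma> \<le> q m)"
  have m: "n1 \<le> m" "\<gamma> \<le> q m"
    unfolding m_def using LeastI[of "\<lambda>m. n1 \<le> m \<and> \<gamma> \<le> q m" n2] n2 by auto
  have "m \<noteq> n1" using m n1 by auto
  then obtain j where j: "m = Suc j" "n1 \<le> j" using m(1) by (cases m) auto
  have "q j < \<gamma>"
    using not_less_Least[of j "\<lambda>m. n1 \<le> m \<and> \<gamma> \<le> q m"] j unfolding m_def[symmetric] by auto
  moreover have "\<bar>q m - q j\<bar> < e" using N0[of j] j n1 by auto
  ultimately have "\<bar>q m - \<gamma>\<bar> < e" using m(2) by linarith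
  then show "\<exists>n\<ge>N. \<bar>q n - \<gamma>\<bar> < e" using m(1) n1(2) by (intro exI[of _ m]) auto
qed (rule that)

text \<open>Two different cluster values would make every number between them a cluster value, hence
  produce three admissible ones. Boundedness supplies at least one.\<close>

lemma slow_convergent:
  fixes q :: "nat \<Rightarrow> real"
  assumes step: "(\<lambda>n. q (Suc n) - q n) \<longlonglongrightarrow> 0" and bd: "\<And>n. \<bar>q n\<bar> \<le> B"
    and three: "\<And>x y z. P x \<Longrightarrow> P y \<Longrightarrow> P z \<Longrightarrow> x < y \<Longrightarrow> y < z \<Longrightarrow> False"
    and P: "\<And>k \<gamma>. strict_mono k \<Longrightarrow> (\<lambda>n. q (k n)) \<longlonglongrightarrow> \<gamma> \<Longrightarrow> P \<gamma>"
  shows "convergent q"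
proof -
  have sub: "\<exists>l m. strict_mono m \<and> (\<lambda>n. q (k (m n))) \<longlonglongrightarrow> l" for k :: "nat \<Rightarrow> nat"
  proof -
    have "bounded (range (\<lambda>n. q (k n)))" using bd by (auto simp: bounded_iff)
    then show ?thesis using bounded_imp_convergent_subsequence[of "\<lambda>n. q (k n)"] by (auto simp: o_def)
  qed
  obtain \<alpha> m where m: "strict_mono m" "(\<lambda>n. q (m n)) \<longlonglongrightarrow> \<alpha>" using sub[of "\<lambda>n. n"] by auto
  have no: False if "strict_mono k" "(\<lambda>n. q (k n)) \<longlonglongrightarrow> x" "strict_mono l" "(\<lambda>n. q (l n)) \<longlonglongrightarrow> y" "x < y" for k l x y
  proof -
    have "P \<gamma>" if "x < \<gamma>" "\<gamma> < y" for \<gamma>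
      using slow_intermediate[OF step \<open>strict_mono k\<close> \<open>(\<lambda>n. q (k n)) \<longlonglongrightarrow> x\<close> \<open>strict_mono l\<close> \<open>(\<lambda>n. q (l n)) \<longlonglongrightarrow> y\<close> that] P by metis
    then show False
      using three[of "x + (y - x) / 4" "x + (y - x) / 2" "x + (y - x) * 3 / 4"] \<open>x < y\<close> by (simp add: field_simps)
  qed
  have "q \<longlonglongrightarrow> \<alpha>"
  proof (rule ccontr)
    assume "\<not> q \<longlonglongrightarrow> \<alpha>"
    then obtain e where e: "0 < e" "\<And>N. \<exists>n\<ge>N. e \<le> \<bar>q n - \<alpha>\<bar>"
      by (auto simp: lim_sequentially dist_real_def not_less)
    have "\<exists>k. \<forall>n. e \<le> \<bar>q (k n) - \<alpha>\<bar> \<and> k n < k (Suc n)"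
    proof (rule dependent_nat_choice)
      show "\<exists>y. e \<le> \<bar>q y - \<alpha>\<bar> \<and> x < y" for x n :: nat using e(2)[of "Suc x"] by (auto simp: Suc_le_eq)
    qed (use e(2)[of 0] in auto)
    then obtain k where k: "\<And>n. e \<le> \<bar>q (k n) - \<alpha>\<bar>" "\<And>n. k n < k (Suc n)" by blast
    obtain \<beta> l where l: "strict_mono l" "(\<lambda>n. q (k (l n))) \<longlonglongrightarrow> \<beta>" using sub[of k] by auto
    have kl: "strict_mono (\<lambda>n. k (l n))"
      using strict_mono_o[of k l] l(1) k(2) by (simp add: strict_mono_Suc_iff o_def)
    have "e \<le> \<bar>\<beta> - \<alpha>\<bar>"
      by (rule LIMSEQ_le_const[OF tendsto_rabs[OF tendsto_diff[OF l(2) tendsto_const]]]) (use k(1) in auto)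
    then show False
      using no[OF m kl l(2)] no[OF kl l(2) m] e(1) by (cases "\<alpha> < \<beta>") auto
  qed
  then show ?thesis by (auto simp: convergent_def)
qed

text \<open>The indicator of a half-line neither decays nor is smooth at 0. The far part is small by
  the second moment and the smoothing error by its L2 norm, both uniformly over densities with
  bounded L2 norm and second moment.\<close>

lemma right_mass_test_approx:
  assumes e: "0 < e"
  obtains \<xi> where "\<xi> \<in> test_functions"
    "\<And>v. v \<in> setK \<Longrightarrow> norm_L2 v \<le> M \<Longrightarrow> (\<integral>x. x\<^sup>2 * v x \<partial>lebesgue) \<le> M \<Longrightarrow> \<bar>right_mass v - (\<integral>x. v x * \<xi> x \<partial>lebesgue)\<bar> \<le> e"
proof -
  obtain A where A: "0 < A" "\<bar>M\<bar> / A\<^sup>2 \<le> e / 2"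
  proof
    have "1 \<le> 2 * \<bar>M\<bar> / e + 1" using e by simp
    then have "2 * \<bar>M\<bar> / e + 1 \<le> (2 * \<bar>M\<bar> / e + 1)\<^sup>2" by (simp add: power2_eq_square)
    then have "2 * \<bar>M\<bar> / e \<le> (2 * \<bar>M\<bar> / e + 1)\<^sup>2" by linarith
    then have "2 * \<bar>M\<bar> \<le> e * (2 * \<bar>M\<bar> / e + 1)\<^sup>2" using e by (simp add: field_simps)
    moreover have "0 < (2 * \<bar>M\<bar> / e + 1)\<^sup>2" using e by (intro zero_less_power) (auto intro: add_nonneg_pos)
    ultimately show "\<bar>M\<bar> / (2 * \<bar>M\<bar> / e + 1)\<^sup>2 \<le> e / 2" by (simp add: pos_divide_le_eq)
    show "0 < 2 * \<bar>M\<bar> / e + 1" using e by (auto intro: add_nonneg_pos)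
  qed
  \<comment> \<open>The smoothing error of the plateau. It is dominated by an integrable indicator
    and tends to 0 pointwise, hence in L2.\<close>
  define D where "D m x = indicator {0<..<A} x - plateau 0 A m x" for m x
  have Dm: "D m \<in> borel_measurable lebesgue" for m
    unfolding D_def[abs_def] by (intro borel_measurable_diff test_measurable plateau_test borel_measurable_indicator) simp
  have D01: "0 \<le> D m x" "D m x \<le> indicator {0..A} x" for m x
    using plateau_le_indicator[of 0 A m x] plateau_nonneg[of 0 A m x] by (auto simp: D_def indicator_def)
  have i: "integrable lebesgue (\<lambda>x. indicator {0..A} x :: real)"
    by (intro integrable_real_indicator) (auto simp: emeasure_lborel_Icc_eq)
  have D2: "(D m x)\<^sup>2 \<le> indicator {0..A} x" for m x
    using D01[of m x] by (auto simp: indicator_def power_le_one split: if_splits)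
  have DL: "D m \<in> L2" for m
  proof -
    have "integrable lebesgue (\<lambda>x. (D m x)\<^sup>2)"
      by (rule Bochner_Integration.integrable_bound[OF i]) (use D2 Dm in auto)
    then show ?thesis using Dm by (simp add: L2_def)
  qed
  have "(\<lambda>m. \<integral>x. (D m x)\<^sup>2 \<partial>lebesgue) \<longlonglongrightarrow> (\<integral>x. (0::real) \<partial>(lebesgue :: real measure))"
  proof (rule integral_dominated_convergence[OF _ _ i])
    show "AE x in lebesgue. (\<lambda>m. (D m x)\<^sup>2) \<longlonglongrightarrow> 0"
    proof (rule AE_I2)
      fix x
      have "(\<lambda>m. (D m x)\<^sup>2) \<longlonglongrightarrow> (indicator {0<..<A} x - indicator {0<..<A} x)\<^sup>2"
        unfolding D_def by (intro tendsto_intros plateau_tendsto)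
      then show "(\<lambda>m. (D m x)\<^sup>2) \<longlonglongrightarrow> 0" by simp
    qed
  qed (use D2 Dm in auto)
  then have "(\<lambda>m. norm_L2 (D m)) \<longlonglongrightarrow> 0"
    unfolding norm_L2_def using tendsto_real_sqrt[of "\<lambda>m. \<integral>x. (D m x)\<^sup>2 \<partial>lebesgue" 0] by simp
  moreover have "0 < e / (2 * (\<bar>M\<bar> + 1))" using e by (intro divide_pos_pos) auto
  ultimately have "\<forall>\<^sub>F m in sequentially. norm_L2 (D m) < e / (2 * (\<bar>M\<bar> + 1))" by (rule order_tendstoD(2))
  then obtain m where m: "norm_L2 (D m) < e / (2 * (\<bar>M\<bar> + 1))" by (metis eventually_happens' sequentially_bot)
  show thesis
  proof (rule that[of "plateau 0 A m"])
    show "plateau 0 A m \<in> test_functions" by (rule plateau_test)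
    fix v assume v: "v \<in> setK" "norm_L2 v \<le> M" "(\<integral>x. x\<^sup>2 * v x \<partial>lebesgue) \<le> M"
    note int = setK_integrable[OF v(1)]
    have i1: "integrable lebesgue (\<lambda>x. indicator {0<..} x * v x)"
      using integrable_mult_indicator[OF _ int(3), of "{0<..}"] by simp
    have i2: "integrable lebesgue (\<lambda>x. v x * plateau 0 A m x)"
      by (intro locally_integrable_mult_test L2_locally_integrable int plateau_test)
    have i3: "integrable lebesgue (\<lambda>x. D m x * v x)" by (intro L2_mult_integrable DL int)
    have "(\<integral>x. 1 / A\<^sup>2 * (x\<^sup>2 * v x) \<partial>lebesgue) = 1 / A\<^sup>2 * (\<integral>x. x\<^sup>2 * v x \<partial>lebesgue)" by simp
    also have "\<dots> \<le> 1 / A\<^sup>2 * \<bar>M\<bar>" using v(3) by (intro mult_left_mono) auto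
    also have "1 / A\<^sup>2 * \<bar>M\<bar> = \<bar>M\<bar> / A\<^sup>2" by simp
    also have "\<dots> \<le> e / 2" by (rule A(2))
    finally have tail: "(\<integral>x. 1 / A\<^sup>2 * (x\<^sup>2 * v x) \<partial>lebesgue) \<le> e / 2" .
    have "\<bar>\<integral>x. D m x * v x \<partial>lebesgue\<bar> \<le> norm_L2 (D m) * norm_L2 v" by (rule L2_Cauchy_Schwarz[OF DL int(1)])
    also have "\<dots> \<le> e / (2 * (\<bar>M\<bar> + 1)) * (\<bar>M\<bar> + 1)"
      using m v(2) e by (intro mult_mono) auto
    also have "\<dots> = e / 2" by (simp add: field_simps)
    finally have mid: "(\<integral>x. D m x * v x \<partial>lebesgue) \<le> e / 2" by linarith
    have eq: "right_mass v - (\<integral>x. v x * plateau 0 A m x \<partial>lebesgue) = (\<integral>x. indicator {0<..} x * v x - v x * plateau 0 A m x \<partial>lebesgue)"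
      unfolding right_mass_def using i1 i2 by simp
    have ae: "AE x in lebesgue. 0 \<le> indicator {0<..} x * v x - v x * plateau 0 A m x \<and>
        indicator {0<..} x * v x - v x * plateau 0 A m x \<le> D m x * v x + 1 / A\<^sup>2 * (x\<^sup>2 * v x)"
      using setK_D(2)[OF v(1)]
    proof eventually_elim
      case (elim x)
      have "indicator {0<..<A} x \<le> (indicator {0<..} x :: real)" by (simp add: indicator_def)
      then have p: "plateau 0 A m x \<le> indicator {0<..} x" by (rule order_trans[OF plateau_le_indicator])
      have "indicator {0<..} x * v x - v x * plateau 0 A m x \<le> D m x * v x + 1 / A\<^sup>2 * (x\<^sup>2 * v x)"
      proof (cases "A \<le> x")
        case True
        then have x: "0 < x" "x \<notin> {0<..<A}" using A(1) by auto
        have "A\<^sup>2 \<le> x\<^sup>2" using True A(1) by (intro power_mono) auto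
        then have "1 * v x \<le> x\<^sup>2 / A\<^sup>2 * v x" using A(1) elim by (intro mult_right_mono) auto
        then show ?thesis using x plateau_outside[OF x(2)] by (simp add: D_def)
      next
        case False
        have "0 \<le> 1 / A\<^sup>2 * (x\<^sup>2 * v x)" using elim by simp
        then show ?thesis using False by (auto simp: D_def indicator_def algebra_simps)
      qed
      moreover have "0 \<le> (indicator {0<..} x - plateau 0 A m x) * v x" using p elim by (intro mult_nonneg_nonneg) auto
      ultimately show ?case by (simp add: algebra_simps)
    qed
    have "0 \<le> right_mass v - (\<integral>x. v x * plateau 0 A m x \<partial>lebesgue)"
      unfolding eq using ae by (intro integral_nonneg_AE) auto
    moreover have "right_mass v - (\<integral>x. v x * plateau 0 A m x \<partial>lebesgue) \<le> (\<integral>x. D m x * v x + 1 / A\<^sup>2 * (x\<^sup>2 * v x) \<partial>lebesgue)"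
      unfolding eq using ae i1 i2 i3 int(4) by (intro integral_mono_AE) auto
    moreover have "(\<integral>x. D m x * v x + 1 / A\<^sup>2 * (x\<^sup>2 * v x) \<partial>lebesgue) \<le> e"
    proof -
      have "(\<integral>x. D m x * v x + 1 / A\<^sup>2 * (x\<^sup>2 * v x) \<partial>lebesgue) = (\<integral>x. D m x * v x \<partial>lebesgue) + (\<integral>x. 1 / A\<^sup>2 * (x\<^sup>2 * v x) \<partial>lebesgue)"
        by (intro Bochner_Integration.integral_add i3 integrable_mult_right int(4))
      then show ?thesis using mid tail by linarith
    qed
    ultimately show "\<bar>right_mass v - (\<integral>x. v x * plateau 0 A m x \<partial>lebesgue)\<bar> \<le> e" by linarith
  qed
qed

text \<open>The window length 2 is enough to bridge consecutive sampling times \<open>s k\<close>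
  and \<open>s (Suc k)\<close>, and to reach any late time from an earlier sampling time.\<close>

definition slowly_varying :: "(real \<Rightarrow> real) \<Rightarrow> bool" where
  "slowly_varying q \<longleftrightarrow> (\<forall>e>0. \<exists>T. \<forall>t t'. T \<le> t \<longrightarrow> t \<le> t' \<longrightarrow> t' \<le> t + 2 \<longrightarrow> \<bar>q t' - q t\<bar> \<le> e)"

text \<open>What the convergence argument uses of a solution, in a form symmetric under exchange of
  the components, so that the orientation can be chosen. \<open>dissF\<close> and
  \<open>dissG\<close> express small dissipation at the times \<open>s k\<close>: a potential hardly
  varies where its component stays above \<open>\<delta>\<close>.\<close>

locale flow =
  fixes a b c p r :: real and f g :: "real \<Rightarrow> real \<Rightarrow> real" and s :: "nat \<Rightarrow> real"
    and U V :: "nat \<Rightarrow> real \<Rightarrow> real" and C :: real and \<kappa> :: "nat \<Rightarrow> real" and Einf :: real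
  assumes pos: "0 < a" "0 < b" "0 < c" "0 < p" "0 < r"
    and det: "b * b < a * c"
    and setK: "\<And>t. 0 \<le> t \<Longrightarrow> f t \<in> setK" "\<And>t. 0 \<le> t \<Longrightarrow> g t \<in> setK"
    and s: "\<And>k. real k \<le> s k" "\<And>k. s k \<le> real k + 1"
    and rep: "\<And>k. AE x in lebesgue. f (s k) x = U k x" "\<And>k. AE x in lebesgue. g (s k) x = V k x"
    and holder: "\<And>k. holder_half C (U k)" "\<And>k. holder_half C (V k)" and C: "0 \<le> C"
    and dissF: "\<And>k \<delta> x y. 0 < \<delta> \<Longrightarrow> x \<le> y \<Longrightarrow> (\<And>z. x \<le> z \<Longrightarrow> z \<le> y \<Longrightarrow> \<delta> \<le> U k z) \<Longrightarrow>
      \<bar>(a * U k y + b * V k y + p * y\<^sup>2) - (a * U k x + b * V k x + p * x\<^sup>2)\<bar> \<le> \<kappa> k / \<delta>"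
    and dissG: "\<And>k \<delta> x y. 0 < \<delta> \<Longrightarrow> x \<le> y \<Longrightarrow> (\<And>z. x \<le> z \<Longrightarrow> z \<le> y \<Longrightarrow> \<delta> \<le> V k z) \<Longrightarrow>
      \<bar>(b * U k y + c * V k y + r * y\<^sup>2) - (b * U k x + c * V k x + r * x\<^sup>2)\<bar> \<le> \<kappa> k / \<delta>"
    and \<kappa>: "\<kappa> \<longlonglongrightarrow> 0"
    and decr: "\<And>k t. s k \<le> t \<Longrightarrow> energy a b c p r (f t) (g t) \<le> energy a b c p r (f (s k)) (g (s k))"
    and Elim: "(\<lambda>k. energy a b c p r (f (s k)) (g (s k))) \<longlonglongrightarrow> Einf"
    and Plim: "(\<lambda>k. pot_energy p r (f (s k)) (g (s k))) \<longlonglongrightarrow> Einf / 3"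
    and slow: "\<And>\<xi>. \<xi> \<in> test_functions \<Longrightarrow> slowly_varying (\<lambda>t. \<integral>x. f t x * \<xi> x \<partial>lebesgue)"
      "\<And>\<xi>. \<xi> \<in> test_functions \<Longrightarrow> slowly_varying (\<lambda>t. \<integral>x. g t x * \<xi> x \<partial>lebesgue)"
begin

lemma energy_swap: "energy c b a r p v u = energy a b c p r u v"
  by (simp add: energy_def quad_energy_def pot_energy_def algebra_simps)

lemma pot_energy_swap: "pot_energy r p v u = pot_energy p r u v"
  by (simp add: pot_energy_def algebra_simps)

lemma swap: "flow c b a r p g f s V U C \<kappa> Einf"
proof unfold_locales
  show "b * b < c * a" using det by (simp add: mult.commute)
  show "\<bar>c * V k y + b * U k y + r * y\<^sup>2 - (c * V k x + b * U k x + r * x\<^sup>2)\<bar> \<le> \<kappa> k / \<delta>"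
    if "0 < \<delta>" "x \<le> y" "\<And>z. x \<le> z \<Longrightarrow> z \<le> y \<Longrightarrow> \<delta> \<le> V k z" for k \<delta> x y
    using dissG[OF that] by (simp add: add.commute)
  show "\<bar>b * V k y + a * U k y + p * y\<^sup>2 - (b * V k x + a * U k x + p * x\<^sup>2)\<bar> \<le> \<kappa> k / \<delta>"
    if "0 < \<delta>" "x \<le> y" "\<And>z. x \<le> z \<Longrightarrow> z \<le> y \<Longrightarrow> \<delta> \<le> U k z" for k \<delta> x y
    using dissF[OF that] by (simp add: add.commute)
  show "energy c b a r p (g t) (f t) \<le> energy c b a r p (g (s k)) (f (s k))" if "s k \<le> t" for k t
    using decr[OF that] by (simp add: energy_swap)
  show "(\<lambda>k. energy c b a r p (g (s k)) (f (s k))) \<longlonglongrightarrow> Einf" using Elim by (simp add: energy_swap)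
  show "(\<lambda>k. pot_energy r p (g (s k)) (f (s k))) \<longlonglongrightarrow> Einf / 3" using Plim by (simp add: pot_energy_swap)
qed (use pos setK s rep holder C \<kappa> slow in auto)

lemma s_nonneg: "0 \<le> s k"
  using s(1)[of k] by (meson of_nat_0_le_iff order_trans)

lemma bounds:
  obtains M where "0 \<le> M" "\<forall>u\<in>setK. \<forall>v\<in>setK. energy a b c p r u v \<le> E \<longrightarrow>
    norm_L2 u \<le> M \<and> norm_L2 v \<le> M \<and> (\<integral>x. x\<^sup>2 * u x \<partial>lebesgue) \<le> M \<and> (\<integral>x. x\<^sup>2 * v x \<partial>lebesgue) \<le> M"
proof -
  let ?k = "coercivity a b c"
  have k: "0 < ?k" by (intro coercivity_pos pos det)
  define M where "M = sqrt (\<bar>E\<bar> / ?k) + \<bar>E\<bar> / p + \<bar>E\<bar> / r"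
  have M0: "0 \<le> \<bar>E\<bar> / p" "0 \<le> \<bar>E\<bar> / r" "0 \<le> sqrt (\<bar>E\<bar> / ?k)" using pos k by auto
  show thesis
  proof (rule that[of M])
    show "0 \<le> M" using M0 by (simp add: M_def)
    show "\<forall>u\<in>setK. \<forall>v\<in>setK. energy a b c p r u v \<le> E \<longrightarrow> norm_L2 u \<le> M \<and> norm_L2 v \<le> M \<and> (\<integral>x. x\<^sup>2 * u x \<partial>lebesgue) \<le> M \<and> (\<integral>x. x\<^sup>2 * v x \<partial>lebesgue) \<le> M"
    proof (intro ballI impI)
    fix u v assume uv: "u \<in> setK" "v \<in> setK" and E: "energy a b c p r u v \<le> E"
    have q: "?k * ((norm_L2 u)\<^sup>2 + (norm_L2 v)\<^sup>2) \<le> quad_energy a b c u v"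
      by (intro quad_energy_coercive pos det setK_integrable uv)
    have pe: "pot_energy p r u v = p * (\<integral>x. x\<^sup>2 * u x \<partial>lebesgue) + r * (\<integral>x. x\<^sup>2 * v x \<partial>lebesgue)"
      by (intro pot_energy_eq setK_D uv)
    have nn: "0 \<le> p * (\<integral>x. x\<^sup>2 * u x \<partial>lebesgue)" "0 \<le> r * (\<integral>x. x\<^sup>2 * v x \<partial>lebesgue)"
      using moment_nonneg uv pos by auto
    have k2: "0 \<le> ?k * (norm_L2 u)\<^sup>2" "0 \<le> ?k * (norm_L2 v)\<^sup>2" using k by auto
    have kE: "?k * (norm_L2 u)\<^sup>2 \<le> \<bar>E\<bar>" "?k * (norm_L2 v)\<^sup>2 \<le> \<bar>E\<bar>"
      "p * (\<integral>x. x\<^sup>2 * u x \<partial>lebesgue) \<le> \<bar>E\<bar>" "r * (\<integral>x. x\<^sup>2 * v x \<partial>lebesgue) \<le> \<bar>E\<bar>"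
      using q pe nn k2 E unfolding energy_def distrib_left by linarith+
    have "(norm_L2 u)\<^sup>2 \<le> \<bar>E\<bar> / ?k" "(norm_L2 v)\<^sup>2 \<le> \<bar>E\<bar> / ?k"
      "(\<integral>x. x\<^sup>2 * u x \<partial>lebesgue) \<le> \<bar>E\<bar> / p" "(\<integral>x. x\<^sup>2 * v x \<partial>lebesgue) \<le> \<bar>E\<bar> / r"
      using kE k pos by (simp_all add: pos_le_divide_eq mult.commute)
    then show "norm_L2 u \<le> M \<and> norm_L2 v \<le> M \<and> (\<integral>x. x\<^sup>2 * u x \<partial>lebesgue) \<le> M \<and> (\<integral>x. x\<^sup>2 * v x \<partial>lebesgue) \<le> M"
      using real_le_rsqrt[of "norm_L2 u" "\<bar>E\<bar> / ?k"] real_le_rsqrt[of "norm_L2 v" "\<bar>E\<bar> / ?k"] M0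
      unfolding M_def by (intro conjI) linarith+
    qed
  qed
qed

lemma UV_nonneg: "0 \<le> U k x" "0 \<le> V k x"
proof -
  have *: "0 \<le> W x" if W: "holder_half C W" and "AE x in lebesgue. w x = W x" "w \<in> setK" for w W x
  proof -
    have "closed {x. 0 \<le> W x}" by (intro closed_Collect_le continuous_intros holder_half_continuous[OF W])
    moreover have "AE x in lebesgue. x \<in> {x. 0 \<le> W x}"
      using that(2) setK_D(2)[OF that(3)] by eventually_elim auto
    ultimately show ?thesis using mem_closed_if_AE_lebesgue by blast
  qed
  show "0 \<le> U k x" "0 \<le> V k x"
    using *[OF holder(1) rep(1) setK(1)] *[OF holder(2) rep(2) setK(2)] s_nonneg by auto
qed

lemma setK_cong_AE:
  assumes "u \<in> setK" "AE x in lebesgue. u x = W x" "W \<in> borel_measurable lebesgue"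
  shows "W \<in> setK"
proof (rule setK_I)
  note int = setK_integrable[OF assms(1)]
  have [measurable]: "(\<lambda>x::real. x\<^sup>2) \<in> borel_measurable lebesgue"
    by (intro continuous_lebesgue_measurable continuous_intros)
  have "integrable lebesgue W" by (rule integrable_cong_AE_imp[OF int(3) assms(3,2)])
  moreover have "integrable lebesgue (\<lambda>x. x\<^sup>2 * W x)"
    by (rule integrable_cong_AE_imp[OF int(4)]) (use assms in auto)
  ultimately show "W \<in> spX" using L2_cong_AE[OF assms(2) int(1) assms(3)] by (intro spX_I)
  show "AE x in lebesgue. 0 \<le> W x" using assms(2) setK_D(2)[OF assms(1)] by eventually_elim auto
  have "(\<integral>x. W x \<partial>lebesgue) = (\<integral>x. u x \<partial>lebesgue)" using assms int(2) by (intro integral_cong_AE) auto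
  then show "(\<integral>x. W x \<partial>lebesgue) = 1" using setK_D(3)[OF assms(1)] by simp
qed

lemma UV_measurable: "U k \<in> borel_measurable lebesgue" "V k \<in> borel_measurable lebesgue"
  using holder holder_half_continuous continuous_lebesgue_measurable by blast+

lemma UV_setK: "U k \<in> setK" "V k \<in> setK"
  using setK_cong_AE[OF setK(1)[OF s_nonneg] rep(1) UV_measurable(1)]
    setK_cong_AE[OF setK(2)[OF s_nonneg] rep(2) UV_measurable(2)] by auto

lemma UV_quad: "quad_energy a b c (f (s k)) (g (s k)) = quad_energy a b c (U k) (V k)"
  unfolding quad_energy_def
proof (rule integral_cong_AE)
  have [measurable]: "f (s k) \<in> borel_measurable lebesgue" "g (s k) \<in> borel_measurable lebesgue"
    using setK_integrable(2) setK s_nonneg by auto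
  note [measurable] = UV_measurable[of k]
  show "(\<lambda>x. a / 2 * (f (s k) x)\<^sup>2 + b * (f (s k) x * g (s k) x) + c / 2 * (g (s k) x)\<^sup>2) \<in> borel_measurable lebesgue"
    "(\<lambda>x. a / 2 * (U k x)\<^sup>2 + b * (U k x * V k x) + c / 2 * (V k x)\<^sup>2) \<in> borel_measurable lebesgue"
    by measurable
  show "AE x in lebesgue. a / 2 * (f (s k) x)\<^sup>2 + b * (f (s k) x * g (s k) x) + c / 2 * (g (s k) x)\<^sup>2
    = a / 2 * (U k x)\<^sup>2 + b * (U k x * V k x) + c / 2 * (V k x)\<^sup>2"
    using rep(1)[of k] rep(2)[of k] by eventually_elim simp
qed

lemma UV_right_mass: "right_mass (g (s k)) = right_mass (V k)"
  using rep(2)[of k] setK_integrable(2)[OF setK(2)[OF s_nonneg[of k]]] UV_measurable(2)[of k]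
  by (intro right_mass_cong_AE) auto

lemma UV_moment:
  "(\<integral>x. x\<^sup>2 * f (s k) x \<partial>lebesgue) = (\<integral>x. x\<^sup>2 * U k x \<partial>lebesgue)"
  "(\<integral>x. x\<^sup>2 * g (s k) x \<partial>lebesgue) = (\<integral>x. x\<^sup>2 * V k x \<partial>lebesgue)"
proof -
  have [measurable]: "f (s k) \<in> borel_measurable lebesgue" "g (s k) \<in> borel_measurable lebesgue"
    using setK_integrable(2) setK s_nonneg by auto
  have [measurable]: "(\<lambda>x::real. x\<^sup>2) \<in> borel_measurable lebesgue"
    by (intro continuous_lebesgue_measurable continuous_intros)
  note [measurable] = UV_measurable[of k]
  show "(\<integral>x. x\<^sup>2 * f (s k) x \<partial>lebesgue) = (\<integral>x. x\<^sup>2 * U k x \<partial>lebesgue)"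
    "(\<integral>x. x\<^sup>2 * g (s k) x \<partial>lebesgue) = (\<integral>x. x\<^sup>2 * V k x \<partial>lebesgue)"
    using rep(1)[of k] rep(2)[of k] by (intro integral_cong_AE; force elim: eventually_mono)+
qed

text \<open>Stated for an arbitrary subsequence \<open>k0\<close> so that it identifies every
  cluster value of the half-line mass, not just one.\<close>

lemma limit_pair:
  fixes k0 :: "nat \<Rightarrow> nat"
  assumes K: "b * r \<le> p * c" and k0: "strict_mono k0"
  obtains k F G where "strict_mono k" "stationary a b c p r F G" "F \<in> setK" "G \<in> setK"
    "energy a b c p r F G = Einf" "pot_energy p r F G = Einf / 3" "(\<lambda>n. right_mass (g (s (k0 (k n))))) \<longlonglongrightarrow> right_mass G"
proof -
  have "bounded (range (\<lambda>k. energy a b c p r (f (s k)) (g (s k))))"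
    using Elim by (rule convergent_imp_bounded)
  then obtain E where "\<And>k. \<bar>energy a b c p r (f (s k)) (g (s k))\<bar> \<le> E" by (auto simp: bounded_iff)
  then have E: "energy a b c p r (f (s k)) (g (s k)) \<le> E" for k by (smt (verit))
  obtain M where M: "\<forall>u\<in>setK. \<forall>v\<in>setK. energy a b c p r u v \<le> E \<longrightarrow>
    norm_L2 u \<le> M \<and> norm_L2 v \<le> M \<and> (\<integral>x. x\<^sup>2 * u x \<partial>lebesgue) \<le> M \<and> (\<integral>x. x\<^sup>2 * v x \<partial>lebesgue) \<le> M"
    by (rule bounds[of E]) (rule that)
  have M: "(\<integral>x. x\<^sup>2 * U k x \<partial>lebesgue) \<le> M" "(\<integral>x. x\<^sup>2 * V k x \<partial>lebesgue) \<le> M" for k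
    using M setK[OF s_nonneg[of k]] E[of k] unfolding UV_moment[symmetric] by blast+
  define B where "B = 1 + C"
  have B: "U k x \<le> B" "V k x \<le> B" for k x
    unfolding B_def by (intro holder_half_bound holder UV_nonneg setK_integrable(3) setK_D(3) UV_setK C)+
  obtain k F G where k: "strict_mono k" and lim: "\<And>x. (\<lambda>n. U (k0 (k n)) x) \<longlonglongrightarrow> F x" "\<And>x. (\<lambda>n. V (k0 (k n)) x) \<longlonglongrightarrow> G x"
  proof (rule equicontinuous_pair_subsequence[of C "\<lambda>n. U (k0 n)" "\<lambda>n. V (k0 n)" B])
    show "\<bar>U (k0 n) x\<bar> \<le> B" "\<bar>V (k0 n) x\<bar> \<le> B" for n x using B UV_nonneg by simp_all
  qed (rule holder | rule that; assumption)+
  define j where "j n = k0 (k n)" for n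
  have j: "strict_mono j" using strict_mono_o[OF k0 k] by (simp add: j_def[abs_def] o_def)
  note lim = lim[folded j_def]
  have F: "F \<in> setK" "(\<lambda>n. \<integral>x. \<bar>U (j n) x - F x\<bar> \<partial>lebesgue) \<longlonglongrightarrow> 0" "(\<lambda>n. norm_L2 (\<lambda>x. U (j n) x - F x)) \<longlonglongrightarrow> 0"
    using setK_limit[of "\<lambda>n. U (j n)" B M F] UV_setK UV_nonneg B M lim by auto
  have G: "G \<in> setK" "(\<lambda>n. \<integral>x. \<bar>V (j n) x - G x\<bar> \<partial>lebesgue) \<longlonglongrightarrow> 0" "(\<lambda>n. norm_L2 (\<lambda>x. V (j n) x - G x)) \<longlonglongrightarrow> 0"
    using setK_limit[of "\<lambda>n. V (j n)" B M G] UV_setK UV_nonneg B M lim by auto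
  have "stationary_pair a b c p r F G"
    by (rule stationary_pair_limit[of C "\<lambda>n. U (j n)" "\<lambda>n. V (j n)" F G "\<lambda>n. \<kappa> (j n)"])
      (use holder UV_nonneg lim LIMSEQ_subseq_LIMSEQ[OF \<kappa> j] dissF dissG in \<open>auto simp: o_def\<close>)
  then have st: "stationary a b c p r F G" using pos det by unfold_locales
  interpret stationary a b c p r F G by fact
  have "(\<lambda>n. quad_energy a b c (U (j n)) (V (j n))) \<longlonglongrightarrow> quad_energy a b c F G"
    by (intro quad_energy_tendsto setK_integrable(1) UV_setK F G)
  moreover have "(\<lambda>n. quad_energy a b c (U (j n)) (V (j n))) \<longlonglongrightarrow> Einf - Einf / 3"
  proof -
    have "(\<lambda>k. energy a b c p r (f (s k)) (g (s k)) - pot_energy p r (f (s k)) (g (s k))) \<longlonglongrightarrow> Einf - Einf / 3"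
      by (intro tendsto_diff Elim Plim)
    then have "(\<lambda>k. quad_energy a b c (U k) (V k)) \<longlonglongrightarrow> Einf - Einf / 3" by (simp add: energy_def UV_quad)
    then show ?thesis using LIMSEQ_subseq_LIMSEQ[OF _ j] by (auto simp: o_def)
  qed
  ultimately have q: "quad_energy a b c F G = Einf - Einf / 3" by (rule LIMSEQ_unique)
  \<comment> \<open>Only the quadratic energy passes to the limit directly, whereas second moments
    might have dropped. The virial identity fixes the potential energy of the limit as half of
    \<open>Einf - Einf / 3\<close>, which excludes a loss.\<close>
  then have pe: "pot_energy p r F G = Einf / 3" using virial[OF K F(1) G(1)] by simp
  have "(\<lambda>n. right_mass (V (j n)) - right_mass G) \<longlonglongrightarrow> 0"
  proof (rule Lim_null_comparison[OF _ G(2)])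
    have "\<bar>right_mass (V (j n)) - right_mass G\<bar> \<le> (\<integral>x. \<bar>V (j n) x - G x\<bar> \<partial>lebesgue)" for n
    proof -
      have i: "integrable lebesgue (V (j n))" "integrable lebesgue G" using setK_integrable(3) UV_setK G(1) by auto
      have i': "integrable lebesgue (\<lambda>x. indicator {0<..} x * V (j n) x)" "integrable lebesgue (\<lambda>x. indicator {0<..} x * G x)"
        using integrable_mult_indicator[OF _ i(1), of "{0<..}"] integrable_mult_indicator[OF _ i(2), of "{0<..}"] by auto
      have "right_mass (V (j n)) - right_mass G = (\<integral>x. indicator {0<..} x * V (j n) x - indicator {0<..} x * G x \<partial>lebesgue)"
        unfolding right_mass_def using i' by simp
      also have "\<bar>\<dots>\<bar> \<le> (\<integral>x. \<bar>indicator {0<..} x * V (j n) x - indicator {0<..} x * G x\<bar> \<partial>lebesgue)"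
        by (rule integral_abs_bound)
      also have "\<dots> \<le> (\<integral>x. \<bar>V (j n) x - G x\<bar> \<partial>lebesgue)"
        using i i' by (intro integral_mono) (auto simp: indicator_def)
      finally show ?thesis .
    qed
    then show "\<forall>\<^sub>F n in sequentially. norm (right_mass (V (j n)) - right_mass G) \<le> (\<integral>x. \<bar>V (j n) x - G x\<bar> \<partial>lebesgue)" by simp
  qed
  then have "(\<lambda>n. right_mass (g (s (j n)))) \<longlonglongrightarrow> right_mass G" by (simp add: UV_right_mass LIM_zero_iff)
  then show thesis using that[OF k st F(1) G(1) _ pe] q pe by (simp add: energy_def j_def)
qed

text \<open>Slow variation is given against fixed test functions only. The energy bound makes the
  approximation of the half-line mass by one test function uniform in time.\<close>

lemma right_mass_slow: "slowly_varying (\<lambda>t. right_mass (g t))"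
  unfolding slowly_varying_def
proof (intro allI impI)
  fix e :: real assume e: "0 < e"
  obtain M where M: "\<forall>u\<in>setK. \<forall>v\<in>setK. energy a b c p r u v \<le> energy a b c p r (f (s 0)) (g (s 0)) \<longrightarrow>
    norm_L2 u \<le> M \<and> norm_L2 v \<le> M \<and> (\<integral>x. x\<^sup>2 * u x \<partial>lebesgue) \<le> M \<and> (\<integral>x. x\<^sup>2 * v x \<partial>lebesgue) \<le> M"
    by (rule bounds[of "energy a b c p r (f (s 0)) (g (s 0))"]) (rule that)
  obtain \<xi> where \<xi>: "\<xi> \<in> test_functions"
    "\<And>v. v \<in> setK \<Longrightarrow> norm_L2 v \<le> M \<Longrightarrow> (\<integral>x. x\<^sup>2 * v x \<partial>lebesgue) \<le> M \<Longrightarrow> \<bar>right_mass v - (\<integral>x. v x * \<xi> x \<partial>lebesgue)\<bar> \<le> e / 3"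
    using right_mass_test_approx[of "e / 3" M] e by auto
  have near: "\<bar>right_mass (g t) - (\<integral>x. g t x * \<xi> x \<partial>lebesgue)\<bar> \<le> e / 3" if "s 0 \<le> t" for t
  proof -
    have "0 \<le> t" using that s_nonneg[of 0] by linarith
    then show ?thesis using M setK[of t] decr[OF that] by (intro \<xi>(2)) blast+
  qed
  obtain T where T: "\<And>t t'. T \<le> t \<Longrightarrow> t \<le> t' \<Longrightarrow> t' \<le> t + 2 \<Longrightarrow> \<bar>(\<integral>x. g t' x * \<xi> x \<partial>lebesgue) - (\<integral>x. g t x * \<xi> x \<partial>lebesgue)\<bar> \<le> e / 3"
    using slow(2)[OF \<xi>(1)] e unfolding slowly_varying_def by (meson divide_pos_pos zero_less_numeral)
  show "\<exists>T. \<forall>t t'. T \<le> t \<longrightarrow> t \<le> t' \<longrightarrow> t' \<le> t + 2 \<longrightarrow> \<bar>right_mass (g t') - right_mass (g t)\<bar> \<le> e"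
  proof (intro exI[of _ "max T (s 0)"] allI impI)
    fix t t' assume "max T (s 0) \<le> t" "t \<le> t'" "t' \<le> t + 2"
    then show "\<bar>right_mass (g t') - right_mass (g t)\<bar> \<le> e" using T[of t t'] near[of t] near[of t'] by linarith
  qed
qed

lemma right_mass_bound: "v \<in> setK \<Longrightarrow> \<bar>right_mass v\<bar> \<le> 1"
proof -
  assume v: "v \<in> setK"
  have i: "integrable lebesgue v" by (rule setK_integrable(3)[OF v])
  then have i': "integrable lebesgue (\<lambda>x. indicator {0<..} x * v x)" using integrable_mult_indicator[OF _ i, of "{0<..}"] by simp
  have "0 \<le> right_mass v" unfolding right_mass_def using setK_D(2)[OF v] by (intro integral_nonneg_AE) (auto elim!: eventually_mono)
  moreover have "right_mass v \<le> (\<integral>x. v x \<partial>lebesgue)"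
    unfolding right_mass_def using setK_D(2)[OF v] i i' by (intro integral_mono_AE) (auto elim!: eventually_mono simp: indicator_def)
  ultimately show ?thesis using setK_D(3)[OF v] by simp
qed

text \<open>The admissible cluster values are the half-line masses of stationary pairs of energy
  \<open>Einf\<close>, at most two by \<open>no_three_on_level\<close>. Slow variation is used
  twice: between consecutive samples, and from the samples to all times.\<close>

lemma right_mass_convergent:
  assumes K: "b * r \<le> p * c"
  obtains n where "(\<lambda>k. right_mass (g (s k))) \<longlonglongrightarrow> n" "((\<lambda>t. right_mass (g t)) \<longlongrightarrow> n) at_top"
proof -
  define q where "q k = right_mass (g (s k))" for k
  note sv = right_mass_slow[unfolded slowly_varying_def, rule_format]
  have "convergent q"
  proof (rule slow_convergent)
    show "(\<lambda>n. q (Suc n) - q n) \<longlonglongrightarrow> 0"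
    proof (rule LIMSEQ_I)
      fix e :: real assume e: "0 < e"
      obtain T where T: "\<And>t t'. T \<le> t \<Longrightarrow> t \<le> t' \<Longrightarrow> t' \<le> t + 2 \<Longrightarrow> \<bar>right_mass (g t') - right_mass (g t)\<bar> \<le> e / 2"
        using sv[of "e / 2"] e by auto
      obtain N where N: "T \<le> real N" using real_arch_simple by blast
      show "\<exists>N. \<forall>n\<ge>N. norm (q (Suc n) - q n - 0) < e"
      proof (intro exI[of _ N] allI impI)
        fix n assume "N \<le> n"
        then have "T \<le> s n" using N s(1)[of n] by (meson of_nat_le_iff order_trans)
        moreover have "s n \<le> s (Suc n)" "s (Suc n) \<le> s n + 2"
          using s(1)[of "Suc n"] s(2)[of n] s(2)[of "Suc n"] s(1)[of n] by auto
        ultimately have "\<bar>right_mass (g (s (Suc n))) - right_mass (g (s n))\<bar> \<le> e / 2" by (intro T)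
        then show "norm (q (Suc n) - q n - 0) < e" using e by (simp add: q_def)
      qed
    qed
    show "\<bar>q n\<bar> \<le> 1" for n unfolding q_def by (intro right_mass_bound setK s_nonneg)
    let ?P = "\<lambda>x. \<exists>F G. stationary a b c p r F G \<and> F \<in> setK \<and> G \<in> setK \<and> energy a b c p r F G = Einf \<and> right_mass G = x"
    show False if "?P x" "?P y" "?P z" "x < y" "y < z" for x y z
      using that no_three_on_level[OF _ _ _ K] by metis
    show "?P \<gamma>" if k: "strict_mono k" and lim: "(\<lambda>n. q (k n)) \<longlonglongrightarrow> \<gamma>" for k \<gamma>
    proof -
      obtain l F G where l: "strict_mono l" "stationary a b c p r F G" "F \<in> setK" "G \<in> setK"
        "energy a b c p r F G = Einf" "(\<lambda>n. right_mass (g (s (k (l n))))) \<longlonglongrightarrow> right_mass G"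
        using limit_pair[OF K k] by metis
      have "(\<lambda>n. right_mass (g (s (k (l n))))) \<longlonglongrightarrow> \<gamma>"
        using LIMSEQ_subseq_LIMSEQ[OF lim l(1)] by (simp add: o_def q_def)
      then have "right_mass G = \<gamma>" using l(6) LIMSEQ_unique by blast
      then show ?thesis using l by blast
    qed
  qed
  then obtain n where n: "q \<longlonglongrightarrow> n" by (auto simp: convergent_def)
  have "((\<lambda>t. right_mass (g t)) \<longlongrightarrow> n) at_top"
  proof (rule tendstoI)
    fix e :: real assume e: "0 < e"
    obtain T where T: "\<And>t t'. T \<le> t \<Longrightarrow> t \<le> t' \<Longrightarrow> t' \<le> t + 2 \<Longrightarrow> \<bar>right_mass (g t') - right_mass (g t)\<bar> \<le> e / 2"
      using sv[of "e / 2"] e by auto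
    obtain N where N: "\<And>k. N \<le> k \<Longrightarrow> \<bar>q k - n\<bar> < e / 2" using LIMSEQ_D[OF n, of "e / 2"] e by auto
    obtain N' where N': "T \<le> real N'" using real_arch_simple by blast
    show "\<forall>\<^sub>F t in at_top. dist (right_mass (g t)) n < e"
    proof (rule eventually_at_top_linorderI[of "real (max N N') + 1"])
      fix t assume t: "real (max N N') + 1 \<le> t"
      \<comment> \<open>Rounding \<open>t - 1\<close> down gives
        \<open>s k \<le> k + 1 \<le> t\<close> and \<open>t < k + 2 \<le> s k + 2\<close>, so
        \<open>t\<close> lies in the window of \<open>s k\<close>.\<close>
      define k where "k = nat \<lfloor>t - 1\<rfloor>"
      have t1: "0 \<le> t - 1" using t by linarith
      have k: "real k \<le> t - 1" "t - 1 < real k + 1" using t1 by (auto simp: k_def)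
      have "max N N' \<le> k" unfolding k_def using t by (intro le_nat_floor) simp
      then have "N \<le> k" "T \<le> s k" using N' s(1)[of k] by (auto intro: order_trans[OF _ order_trans[OF _ s(1)]])
      moreover have "s k \<le> t" "t \<le> s k + 2" using k s(1)[of k] s(2)[of k] by auto
      ultimately have "\<bar>right_mass (g t) - q k\<bar> \<le> e / 2" "\<bar>q k - n\<bar> < e / 2" unfolding q_def using T N[unfolded q_def] by auto
      then show "dist (right_mass (g t)) n < e" unfolding dist_real_def by linarith
    qed
  qed
  then show thesis using that n by (simp add: q_def[abs_def])
qed

text \<open>\<open>energy_gap\<close> at the limit pair bounds the squared L2 distance by the energy
  excess over \<open>Einf\<close> minus \<open>d\<close> times the change of half-line mass, and
  both are controlled at all late times, not only at the samples. For the weighted norm, the excess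
  of potential energy is the excess of energy minus the change of quadratic energy, and the latter
  is now known to vanish.\<close>

theorem oriented_convergence:
  assumes K: "b * r \<le> p * c"
  obtains F G where "stationary a b c p r F G" "F \<in> setK" "G \<in> setK"
    "((\<lambda>t. norm_X (\<lambda>x. f t x - F x)) \<longlongrightarrow> 0) at_top" "((\<lambda>t. norm_X (\<lambda>x. g t x - G x)) \<longlongrightarrow> 0) at_top"
proof -
  obtain k F G where k: "strict_mono k" and st: "stationary a b c p r F G" and FG: "F \<in> setK" "G \<in> setK"
    and E: "energy a b c p r F G = Einf" and pe: "pot_energy p r F G = Einf / 3"
    and nk: "(\<lambda>n. right_mass (g (s (k n)))) \<longlonglongrightarrow> right_mass G"
    using limit_pair[OF K strict_mono_id] by (auto simp: id_def)
  obtain n where n: "(\<lambda>k. right_mass (g (s k))) \<longlonglongrightarrow> n" "((\<lambda>t. right_mass (g t)) \<longlongrightarrow> n) at_top"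
    using right_mass_convergent[OF K] by blast
  have nG: "n = right_mass G"
    using LIMSEQ_unique[OF LIMSEQ_subseq_LIMSEQ[OF n(1) k] ] nk by (simp add: o_def)
  interpret st: stationary a b c p r F G by fact
  obtain d where d: "\<And>u v. u \<in> setK \<Longrightarrow> v \<in> setK \<Longrightarrow>
    energy a b c p r F G + d * (right_mass v - right_mass G) + quad_energy a b c (\<lambda>x. u x - F x) (\<lambda>x. v x - G x) \<le> energy a b c p r u v"
    using st.energy_gap[OF K FG] by blast
  note L = setK_integrable(1)[OF FG(1)] setK_integrable(1)[OF FG(2)]
  have ev0: "\<forall>\<^sub>F t in at_top. 0 \<le> (t::real)" by (rule eventually_ge_at_top)
  have Eup: "\<forall>\<^sub>F t in at_top. energy a b c p r (f t) (g t) \<le> Einf + e" if "0 < e" for e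
  proof -
    have "\<forall>\<^sub>F k in sequentially. energy a b c p r (f (s k)) (g (s k)) < Einf + e"
      using order_tendstoD(2)[OF Elim] that by simp
    from eventually_happens'[OF sequentially_bot this]
    obtain k where "energy a b c p r (f (s k)) (g (s k)) < Einf + e" by blast
    then have "energy a b c p r (f t) (g t) \<le> Einf + e" if "s k \<le> t" for t using decr[OF that] by simp
    then show ?thesis by (auto simp: eventually_at_top_linorder)
  qed
  define z where "z t = (norm_L2 (\<lambda>x. f t x - F x))\<^sup>2 + (norm_L2 (\<lambda>x. g t x - G x))\<^sup>2" for t
  let ?c = "coercivity a b c"
  have c: "0 < ?c" by (intro coercivity_pos pos det)
  have z0: "(z \<longlongrightarrow> 0) at_top"
  proof (rule tendstoI)
    \<comment> \<open>Of the available amount \<open>?c * e\<close> the mass term takes at most one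
      half and the energy excess one quarter, which leaves the final inequality strict.\<close>
    fix e :: real assume e: "0 < e"
    have "((\<lambda>t. d * (right_mass (g t) - right_mass G)) \<longlongrightarrow> d * (n - n)) at_top"
      unfolding nG[symmetric] by (intro tendsto_intros n)
    then have "((\<lambda>t. d * (right_mass (g t) - right_mass G)) \<longlongrightarrow> 0) at_top" by simp
    moreover have "- (?c * e / 2) < 0" using e c by simp
    ultimately have "\<forall>\<^sub>F t in at_top. - (?c * e / 2) < d * (right_mass (g t) - right_mass G)"
      by (rule order_tendstoD(1))
    moreover have "0 < ?c * e / 4" using e c by simp
    note Eup[OF this]
    ultimately show "\<forall>\<^sub>F t in at_top. dist (z t) 0 < e"
      using \<open>\<forall>\<^sub>F t in at_top. energy a b c p r (f t) (g t) \<le> Einf + ?c * e / 4\<close> ev0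
    proof eventually_elim
      case (elim t)
      have "?c * z t \<le> quad_energy a b c (\<lambda>x. f t x - F x) (\<lambda>x. g t x - G x)"
        unfolding z_def by (intro quad_energy_coercive pos det L2_diff L setK_integrable(1) setK elim)
      also have "\<dots> < ?c * e"
        using d[OF setK(1) setK(2), of t t] elim E mult_pos_pos[OF c e] by linarith
      finally have "z t < e" using c by simp
      moreover have "0 \<le> z t" by (simp add: z_def)
      ultimately show ?case by simp
    qed
  qed
  have nF: "((\<lambda>t. norm_L2 (\<lambda>x. f t x - F x)) \<longlongrightarrow> 0) at_top" and nG': "((\<lambda>t. norm_L2 (\<lambda>x. g t x - G x)) \<longlongrightarrow> 0) at_top"
  proof -
    have s0: "((\<lambda>t. sqrt (z t)) \<longlongrightarrow> 0) at_top" using tendsto_real_sqrt[OF z0] by simp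
    show "((\<lambda>t. norm_L2 (\<lambda>x. f t x - F x)) \<longlongrightarrow> 0) at_top"
      by (rule Lim_null_comparison[OF _ s0]) (auto simp: z_def intro!: always_eventually real_le_rsqrt)
    show "((\<lambda>t. norm_L2 (\<lambda>x. g t x - G x)) \<longlongrightarrow> 0) at_top"
      by (rule Lim_null_comparison[OF _ s0]) (auto simp: z_def intro!: always_eventually real_le_rsqrt)
  qed
  obtain A where A: "0 < A" "\<And>x. A < \<bar>x\<bar> \<Longrightarrow> F x = 0 \<and> G x = 0" using st.bounded_support[OF K] by blast
  define Kc where "Kc = (1 + A\<^sup>2) * sqrt (2 * A)"
  text \<open>Since \<open>H\<close> has compact support, the negative part of \<open>w - H\<close> is controlled in \<open>L\<^sub>2\<close>.\<close>
  have neg: "0 \<le> (\<integral>x. (1 + x\<^sup>2) * max 0 (H x - w x) \<partial>lebesgue) \<and> (\<integral>x. (1 + x\<^sup>2) * max 0 (H x - w x) \<partial>lebesgue) \<le> Kc * norm_L2 (\<lambda>x. w x - H x) \<and>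
      (\<integral>x. (1 + x\<^sup>2) * \<bar>w x - H x\<bar> \<partial>lebesgue) = (\<integral>x. x\<^sup>2 * w x \<partial>lebesgue) - (\<integral>x. x\<^sup>2 * H x \<partial>lebesgue) + 2 * (\<integral>x. (1 + x\<^sup>2) * max 0 (H x - w x) \<partial>lebesgue)"
    if w: "w \<in> setK" and H: "H \<in> setK" "\<And>x. A < \<bar>x\<bar> \<Longrightarrow> H x = 0" for w H
  proof -
    note iw = setK_integrable[OF w] and iH = setK_integrable[OF H(1)]
    have [measurable]: "w \<in> borel_measurable lebesgue" "H \<in> borel_measurable lebesgue" by (rule iw iH)+
    have [measurable]: "(\<lambda>x::real. x\<^sup>2) \<in> borel_measurable lebesgue"
      by (intro continuous_lebesgue_measurable continuous_intros)
    have iX: "integrable lebesgue (\<lambda>x. (1 + x\<^sup>2) * w x)" "integrable lebesgue (\<lambda>x. (1 + x\<^sup>2) * H x)"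
      using w H(1) by (auto simp: setK_def spX_def)
    have iabs: "integrable lebesgue (\<lambda>x. (1 + x\<^sup>2) * \<bar>w x - H x\<bar>)"
      using integrable_abs[OF Bochner_Integration.integrable_diff[OF iX]]
      by (simp add: right_diff_distrib[symmetric] abs_mult)
    have imax: "integrable lebesgue (\<lambda>x. (1 + x\<^sup>2) * max 0 (H x - w x))"
      by (rule Bochner_Integration.integrable_bound[OF iabs]) (auto intro!: AE_I2 mult_left_mono simp: abs_mult)
    have D: "(\<lambda>x. w x - H x) \<in> L2" by (intro L2_diff iw iH)
    have iD: "integrable lebesgue (\<lambda>x. (1 + A\<^sup>2) * \<bar>indicator {-A..A} x * (w x - H x)\<bar>)"
      using L2_mult_integrable[OF L2_indicator D] by auto
    have "(\<integral>x. (1 + x\<^sup>2) * max 0 (H x - w x) \<partial>lebesgue) \<le> (\<integral>x. (1 + A\<^sup>2) * \<bar>indicator {-A..A} x * (w x - H x)\<bar> \<partial>lebesgue)"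
    proof (rule integral_mono_AE[OF imax iD])
      show "AE x in lebesgue. (1 + x\<^sup>2) * max 0 (H x - w x) \<le> (1 + A\<^sup>2) * \<bar>indicator {-A..A} x * (w x - H x)\<bar>"
        using setK_D(2)[OF w]
      proof eventually_elim
        case (elim x)
        show ?case
        proof (cases "x \<in> {-A..A}")
          case True
          then have "x\<^sup>2 \<le> A\<^sup>2" using A(1) by (intro abs_le_square_iff[THEN iffD1]) auto
          then show ?thesis using True by (intro mult_mono) auto
        next
          case False
          then have "H x = 0" by (intro H(2)) auto
          then show ?thesis using False elim by simp
        qed
      qed
    qed
    also have "\<dots> = (1 + A\<^sup>2) * (\<integral>x. \<bar>indicator {-A..A} x * (w x - H x)\<bar> \<partial>lebesgue)" by simp
    also have "\<dots> \<le> (1 + A\<^sup>2) * (sqrt (2 * A) * norm_L2 (\<lambda>x. w x - H x))"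
      using L2_Cauchy_Schwarz_abs[OF L2_indicator D, of "-A" A] norm_L2_indicator[of "-A" A] A(1)
      by (intro mult_left_mono) auto
    finally have le: "(\<integral>x. (1 + x\<^sup>2) * max 0 (H x - w x) \<partial>lebesgue) \<le> Kc * norm_L2 (\<lambda>x. w x - H x)"
      by (simp add: Kc_def mult.assoc)
    have "(\<integral>x. (1 + x\<^sup>2) * \<bar>w x - H x\<bar> \<partial>lebesgue)
      = (\<integral>x. (w x + x\<^sup>2 * w x) - (H x + x\<^sup>2 * H x) + 2 * ((1 + x\<^sup>2) * max 0 (H x - w x)) \<partial>lebesgue)"
      by (intro Bochner_Integration.integral_cong refl) (simp add: abs_pos_part algebra_simps)
    also have "\<dots> = (\<integral>x. x\<^sup>2 * w x \<partial>lebesgue) - (\<integral>x. x\<^sup>2 * H x \<partial>lebesgue) + 2 * (\<integral>x. (1 + x\<^sup>2) * max 0 (H x - w x) \<partial>lebesgue)"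
      using iw iH imax setK_D(3)[OF w] setK_D(3)[OF H(1)] by simp
    finally show ?thesis using le by (auto intro!: integral_nonneg_AE AE_I2)
  qed
  have Kc: "0 \<le> Kc" using A by (simp add: Kc_def)
  \<comment> \<open>With the weights \<open>p\<close> and \<open>r\<close> the signed second moments
    of the two components combine to a difference of potential energies.\<close>
  define W where "W u v = p * (\<integral>x. (1 + x\<^sup>2) * \<bar>u x - F x\<bar> \<partial>lebesgue) + r * (\<integral>x. (1 + x\<^sup>2) * \<bar>v x - G x\<bar> \<partial>lebesgue)" for u v
  define y where "y t = \<bar>quad_energy a b c (f t) (g t) - quad_energy a b c F G\<bar>
      + 2 * (p * (Kc * norm_L2 (\<lambda>x. f t x - F x)) + r * (Kc * norm_L2 (\<lambda>x. g t x - G x)))" for t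
  have q: "((\<lambda>t. quad_energy a b c (f t) (g t)) \<longlongrightarrow> quad_energy a b c F G) at_top"
  proof -
    \<comment> \<open>Times before 0 are frozen at 0, because \<open>quad_energy_tendsto\<close>
      asks for membership in L2 at every index.\<close>
    define f' g' where "f' t = f (max 0 t)" and "g' t = g (max 0 t)" for t
    have e: "\<forall>\<^sub>F t in at_top. f' t = f t" "\<forall>\<^sub>F t in at_top. g' t = g t"
      using ev0 by (eventually_elim, simp add: f'_def g'_def)+
    have "((\<lambda>t. quad_energy a b c (f' t) (g' t)) \<longlongrightarrow> quad_energy a b c F G) at_top"
    proof (rule quad_energy_tendsto)
      show "((\<lambda>t. norm_L2 (\<lambda>x. f' t x - F x)) \<longlongrightarrow> 0) at_top"
        by (rule Lim_transform_eventually[OF nF]) (use e(1) in \<open>eventually_elim, simp\<close>)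
      show "((\<lambda>t. norm_L2 (\<lambda>x. g' t x - G x)) \<longlongrightarrow> 0) at_top"
        by (rule Lim_transform_eventually[OF nG']) (use e(2) in \<open>eventually_elim, simp\<close>)
    qed (use L setK setK_integrable(1) in \<open>auto simp: f'_def g'_def\<close>)
    then show ?thesis
      by (rule Lim_transform_eventually) (use e in \<open>eventually_elim, simp\<close>)
  qed
  have y0: "(y \<longlongrightarrow> 0) at_top"
  proof -
    have "(y \<longlongrightarrow> \<bar>quad_energy a b c F G - quad_energy a b c F G\<bar> + 2 * (p * (Kc * 0) + r * (Kc * 0))) at_top"
      unfolding y_def[abs_def] by (intro tendsto_intros q nF nG')
    then show ?thesis by simp
  qed
  have W0: "((\<lambda>t. W (f t) (g t)) \<longlongrightarrow> 0) at_top"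
  proof (rule tendstoI)
    fix e :: real assume e: "0 < e"
    have "\<forall>\<^sub>F t in at_top. y t < e / 2" using order_tendstoD(2)[OF y0, of "e / 2"] e by simp
    moreover have "\<forall>\<^sub>F t in at_top. energy a b c p r (f t) (g t) \<le> Einf + e / 2" using e by (intro Eup) simp
    ultimately show "\<forall>\<^sub>F t in at_top. dist (W (f t) (g t)) 0 < e"
      using ev0
    proof eventually_elim
      case (elim t)
      note nf = neg[OF setK(1)[OF elim(3)] FG(1)] and ng = neg[OF setK(2)[OF elim(3)] FG(2)]
      define mf where "mf = (\<integral>x. (1 + x\<^sup>2) * max 0 (F x - f t x) \<partial>lebesgue)"
      define mg where "mg = (\<integral>x. (1 + x\<^sup>2) * max 0 (G x - g t x) \<partial>lebesgue)"
      have mf: "mf \<le> Kc * norm_L2 (\<lambda>x. f t x - F x)" "(\<integral>x. (1 + x\<^sup>2) * \<bar>f t x - F x\<bar> \<partial>lebesgue) = (\<integral>x. x\<^sup>2 * f t x \<partial>lebesgue) - (\<integral>x. x\<^sup>2 * F x \<partial>lebesgue) + 2 * mf"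
        using nf A(2) by (auto simp: mf_def)
      have mg: "mg \<le> Kc * norm_L2 (\<lambda>x. g t x - G x)" "(\<integral>x. (1 + x\<^sup>2) * \<bar>g t x - G x\<bar> \<partial>lebesgue) = (\<integral>x. x\<^sup>2 * g t x \<partial>lebesgue) - (\<integral>x. x\<^sup>2 * G x \<partial>lebesgue) + 2 * mg"
        using ng A(2) by (auto simp: mg_def)
      have "W (f t) (g t) = pot_energy p r (f t) (g t) - pot_energy p r F G + 2 * (p * mf + r * mg)"
        unfolding W_def mf(2) mg(2) pot_energy_eq[OF setK_D(1) setK_D(1), OF setK(1)[OF elim(3)] setK(2)[OF elim(3)]] pot_energy_eq[OF setK_D(1) setK_D(1), OF FG]
        by (simp add: algebra_simps)
      also have "\<dots> \<le> pot_energy p r (f t) (g t) - pot_energy p r F G + 2 * (p * (Kc * norm_L2 (\<lambda>x. f t x - F x)) + r * (Kc * norm_L2 (\<lambda>x. g t x - G x)))"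
        using mf(1) mg(1) pos by (intro add_left_mono mult_left_mono add_mono) auto
      also have "\<dots> < e"
        using elim(1,2) E unfolding y_def energy_def by linarith
      finally have "W (f t) (g t) < e" .
      moreover have "0 \<le> W (f t) (g t)"
        unfolding W_def using pos by (intro add_nonneg_nonneg mult_nonneg_nonneg integral_nonneg_AE AE_I2) auto
      ultimately show ?case by simp
    qed
  qed
  have wF: "((\<lambda>t. \<integral>x. (1 + x\<^sup>2) * \<bar>f t x - F x\<bar> \<partial>lebesgue) \<longlongrightarrow> 0) at_top"
  proof (rule Lim_null_comparison)
    have "norm (\<integral>x. (1 + x\<^sup>2) * \<bar>f t x - F x\<bar> \<partial>lebesgue) \<le> W (f t) (g t) / p" for t
    proof -
      have nn: "0 \<le> (\<integral>x. (1 + x\<^sup>2) * \<bar>f t x - F x\<bar> \<partial>lebesgue)" "0 \<le> (\<integral>x. (1 + x\<^sup>2) * \<bar>g t x - G x\<bar> \<partial>lebesgue)"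
        by (auto intro!: integral_nonneg_AE AE_I2)
      then have "0 \<le> r * (\<integral>x. (1 + x\<^sup>2) * \<bar>g t x - G x\<bar> \<partial>lebesgue)" using pos by simp
      then show ?thesis using pos nn by (simp add: W_def field_simps)
    qed
    then show "\<forall>\<^sub>F t in at_top. norm (\<integral>x. (1 + x\<^sup>2) * \<bar>f t x - F x\<bar> \<partial>lebesgue) \<le> W (f t) (g t) / p" by simp
    show "((\<lambda>t. W (f t) (g t) / p) \<longlongrightarrow> 0) at_top" using tendsto_divide[OF W0 tendsto_const, of p] pos by simp
  qed
  have wG: "((\<lambda>t. \<integral>x. (1 + x\<^sup>2) * \<bar>g t x - G x\<bar> \<partial>lebesgue) \<longlongrightarrow> 0) at_top"
  proof (rule Lim_null_comparison)
    have "norm (\<integral>x. (1 + x\<^sup>2) * \<bar>g t x - G x\<bar> \<partial>lebesgue) \<le> W (f t) (g t) / r" for t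
    proof -
      have nn: "0 \<le> (\<integral>x. (1 + x\<^sup>2) * \<bar>f t x - F x\<bar> \<partial>lebesgue)" "0 \<le> (\<integral>x. (1 + x\<^sup>2) * \<bar>g t x - G x\<bar> \<partial>lebesgue)"
        by (auto intro!: integral_nonneg_AE AE_I2)
      then have "0 \<le> p * (\<integral>x. (1 + x\<^sup>2) * \<bar>f t x - F x\<bar> \<partial>lebesgue)" using pos by simp
      then show ?thesis using pos nn by (simp add: W_def field_simps)
    qed
    then show "\<forall>\<^sub>F t in at_top. norm (\<integral>x. (1 + x\<^sup>2) * \<bar>g t x - G x\<bar> \<partial>lebesgue) \<le> W (f t) (g t) / r" by simp
    show "((\<lambda>t. W (f t) (g t) / r) \<longlongrightarrow> 0) at_top" using tendsto_divide[OF W0 tendsto_const, of r] pos by simp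
  qed
  show thesis
    by (rule that[OF st FG]) (use tendsto_add[OF wF nF] tendsto_add[OF wG nG'] in \<open>simp_all add: norm_X_def\<close>)
qed

text \<open>If both \<open>p c < b r\<close> and \<open>a r < b p\<close> held, then \<open>a c < b\<^sup>2\<close>; so one orientation always applies.\<close>

theorem convergence:
  obtains F G where "stationary a b c p r F G" "b * r \<le> p * c \<or> b * p \<le> r * a" "F \<in> setK" "G \<in> setK"
    "((\<lambda>t. norm_X (\<lambda>x. f t x - F x)) \<longlongrightarrow> 0) at_top" "((\<lambda>t. norm_X (\<lambda>x. g t x - G x)) \<longlongrightarrow> 0) at_top"
proof (cases "b * r \<le> p * c")
  case True
  obtain F G where FG: "stationary a b c p r F G" "F \<in> setK" "G \<in> setK"
    "((\<lambda>t. norm_X (\<lambda>x. f t x - F x)) \<longlongrightarrow> 0) at_top" "((\<lambda>t. norm_X (\<lambda>x. g t x - G x)) \<longlongrightarrow> 0) at_top"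
    by (rule oriented_convergence[OF True]) (rule that)
  then show thesis using that[OF FG(1) _ FG(2-5)] True by simp
next
  case False
  have o: "b * p \<le> r * a"
  proof (rule ccontr)
    assume "\<not> b * p \<le> r * a"
    then have 1: "r * a \<le> b * p" by simp
    have 2: "p * c \<le> b * r" "0 \<le> b * r" "0 \<le> r * a" using False pos by (simp_all add: less_imp_le)
    have "(p * c) * (r * a) \<le> (b * r) * (b * p)" by (rule mult_mono[OF 2(1) 1 2(2,3)])
    then have "(p * r) * (a * c) \<le> (p * r) * (b * b)" by (simp add: mult_ac)
    then show False using det pos by (simp add: mult_le_cancel_left)
  qed
  interpret sw: flow c b a r p g f s V U C \<kappa> Einf by (rule swap)
  obtain G F where GF: "stationary c b a r p G F" "G \<in> setK" "F \<in> setK"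
    "((\<lambda>t. norm_X (\<lambda>x. g t x - G x)) \<longlongrightarrow> 0) at_top" "((\<lambda>t. norm_X (\<lambda>x. f t x - F x)) \<longlongrightarrow> 0) at_top"
    by (rule sw.oriented_convergence[OF o]) (rule that)
  then show thesis using that[OF stationary.swap[OF GF(1)] _ GF(3,2,5,4)] o by auto
qed

end

section \<open>Entropy bounds and relaxation of the second moment\<close>

lemma integrable_inverse_1_plus_square: "integrable lebesgue (\<lambda>x::real. 1 / (1 + x\<^sup>2))"
proof -
  let ?f = "\<lambda>x::real. 1 / (1 + x\<^sup>2)"
  have m: "?f \<in> borel_measurable borel" by measurable
  have F: "(\<integral>\<^sup>+x. ennreal (?f x) * indicator {0..} x \<partial>lborel) = ennreal (pi / 2 - arctan 0)"
  proof (rule nn_integral_FTC_atLeast[OF m])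
    show "DERIV arctan x :> ?f x" for x using DERIV_arctan[of x] by (simp add: divide_inverse)
    show "0 \<le> ?f x" for x by simp
    show "(arctan \<longlongrightarrow> pi / 2) at_top" by (rule tendsto_arctan_at_top)
  qed
  have "(\<integral>\<^sup>+x. ennreal (norm (?f x * indicator {0..} x)) \<partial>lborel) = (\<integral>\<^sup>+x. ennreal (?f x) * indicator {0..} x \<partial>lborel)"
    by (intro nn_integral_cong) (simp add: indicator_def)
  then have "(\<integral>\<^sup>+x. ennreal (norm (?f x * indicator {0..} x)) \<partial>lborel) < \<infinity>" using F by simp
  then have "integrable lborel (\<lambda>x. ?f x * indicator {0..} x)"
    using m by (intro integrableI_bounded) auto
  then have i1: "integrable lebesgue (\<lambda>x. ?f x * indicator {0..} x)"
    by (subst integrable_completion) (auto simp: borel_measurable_integrable)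
  then have "integrable lebesgue (\<lambda>x. ?f x * indicator {0..} (- x))"
    using lebesgue_integrable_real_affine[OF i1, of "- 1" 0] by simp
  with i1 have "integrable lebesgue (\<lambda>x. ?f x * indicator {0..} x + ?f x * indicator {0..} (- x))" by simp
  then show ?thesis
    by (rule Bochner_Integration.integrable_bound) (auto simp: indicator_def intro!: AE_I2 measurable_completion)
qed

text \<open>For small \<open>u\<close> the negative part is compared with the density
  \<open>1 / (1 + q)\<close>: apply \<open>ln y \<le> y - 1\<close> to
  \<open>y = 1 / ((1 + q) * u)\<close> and use \<open>ln (1 + q) \<le> q\<close>. For
  \<open>q = x^2\<close> every term on the right is integrable.\<close>

lemma abs_mult_ln_le:
  fixes u y :: real
  assumes "0 \<le> u" "0 \<le> q"
  shows "\<bar>u * ln u\<bar> \<le> u\<^sup>2 + 1 / (1 + q) + q * u"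
proof (cases "u = 0")
  case True
  then show ?thesis using assms by simp
next
  case False
  then have u: "0 < u" using assms by simp
  have up: "u * ln u \<le> u\<^sup>2" using u ln_le_minus_one[OF u] by (simp add: power2_eq_square mult_left_mono)
  have "ln (1 / ((1 + q) * u)) \<le> 1 / ((1 + q) * u) - 1" using u assms by (intro ln_le_minus_one) auto
  then have "- ln u - ln (1 + q) \<le> 1 / ((1 + q) * u)" using u assms by (simp add: ln_div ln_mult)
  moreover have "ln (1 + q) \<le> q" using assms by (intro ln_add_one_self_le_self) auto
  ultimately have "- ln u \<le> 1 / ((1 + q) * u) + q" by linarith
  then have "u * (- ln u) \<le> u * (1 / ((1 + q) * u) + q)" using u by (intro mult_left_mono) auto
  also have "\<dots> = u * (1 / ((1 + q) * u)) + u * q" by (rule distrib_left)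
  also have "u * (1 / ((1 + q) * u)) = 1 / (1 + q)" using u by simp
  also have "1 / (1 + q) + u * q = 1 / (1 + q) + q * u" by (simp only: mult.commute)
  finally have low: "- (u * ln u) \<le> 1 / (1 + q) + q * u" by simp
  have "0 \<le> u\<^sup>2" "0 \<le> 1 / (1 + q)" "0 \<le> q * u" using u assms by auto
  then show ?thesis using up low unfolding abs_le_iff by linarith
qed

lemma entropy_bound:
  assumes u: "u \<in> setK"
  shows "integrable lebesgue (\<lambda>x. u x * ln (u x))"
    "\<bar>\<integral>x. u x * ln (u x) \<partial>lebesgue\<bar> \<le> (norm_L2 u)\<^sup>2 + (\<integral>x. 1 / (1 + x\<^sup>2) \<partial>lebesgue) + (\<integral>x. x\<^sup>2 * u x \<partial>lebesgue)"
proof -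
  note int = setK_integrable[OF u]
  let ?R = "\<lambda>x. (u x)\<^sup>2 + 1 / (1 + x\<^sup>2) + x\<^sup>2 * u x"
  have [measurable]: "u \<in> borel_measurable lebesgue" by (rule int(2))
  have i2: "integrable lebesgue (\<lambda>x. (u x)\<^sup>2)" using int(1) by (simp add: L2_def)
  have iR: "integrable lebesgue ?R"
    using i2 int(4) integrable_inverse_1_plus_square by auto
  have le: "AE x in lebesgue. \<bar>u x * ln (u x)\<bar> \<le> ?R x"
    using setK_D(2)[OF u] by eventually_elim (intro abs_mult_ln_le, auto)
  show i: "integrable lebesgue (\<lambda>x. u x * ln (u x))"
    by (rule Bochner_Integration.integrable_bound[OF iR]) (use le in auto)
  have "\<bar>\<integral>x. u x * ln (u x) \<partial>lebesgue\<bar> \<le> (\<integral>x. \<bar>u x * ln (u x)\<bar> \<partial>lebesgue)" by (rule integral_abs_bound)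
  also have "\<dots> \<le> (\<integral>x. ?R x \<partial>lebesgue)" using le i iR by (intro integral_mono_AE) auto
  also have "\<dots> = (norm_L2 u)\<^sup>2 + (\<integral>x. 1 / (1 + x\<^sup>2) \<partial>lebesgue) + (\<integral>x. x\<^sup>2 * u x \<partial>lebesgue)"
    using i2 int(4) integrable_inverse_1_plus_square by (simp add: norm_L2_sq)
  finally show "\<bar>\<integral>x. u x * ln (u x) \<partial>lebesgue\<bar> \<le> (norm_L2 u)\<^sup>2 + (\<integral>x. 1 / (1 + x\<^sup>2) \<partial>lebesgue) + (\<integral>x. x\<^sup>2 * u x \<partial>lebesgue)" .
qed

text \<open>The integrated form of \<open>n' \<le> - n + e\<close>: while
  \<open>n \<ge> 2 * e\<close> it falls at rate at least \<open>e\<close>. Being bounded it must get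
  down to \<open>2 * e\<close>, and it cannot exceed that level again, since from the last time at
  or below the level it could only fall.\<close>

lemma relaxation_upper:
  fixes n :: "real \<Rightarrow> real"
  assumes e: "0 < e" and cont: "continuous_on {T..} n"
    and ineq: "\<And>s t. T \<le> s \<Longrightarrow> s \<le> t \<Longrightarrow> n t \<le> n s - integral {s..t} n + e * (t - s)"
    and B: "\<And>t. T \<le> t \<Longrightarrow> \<bar>n t\<bar> \<le> B"
  shows "\<exists>T'. \<forall>t\<ge>T'. n t \<le> 2 * e"
proof -
  have B0: "0 \<le> B" using B[of T] by linarith
  have int: "n integrable_on {s..t}" if "T \<le> s" for s t
    using that by (intro integrable_continuous_real continuous_on_subset[OF cont]) auto
  have drop: "n t \<le> n s - e * (t - s)" if "T \<le> s" "s \<le> t" "\<And>x. s < x \<Longrightarrow> x \<le> t \<Longrightarrow> 2 * e \<le> n x" for s t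
  proof -
    \<comment> \<open>The lower bound is available only for \<open>x > s\<close>; changing the value
      at the single point \<open>s\<close> leaves the integral unchanged.\<close>
    let ?n = "\<lambda>x. if x = s then 2 * e else n x"
    have "?n integrable_on {s..t}" by (rule integrable_spike[OF int[OF that(1)], of "{s}"]) auto
    then have "integral {s..t} (\<lambda>_. 2 * e) \<le> integral {s..t} ?n"
      using that(3) by (intro integral_le) auto
    also have "\<dots> = integral {s..t} n" by (rule integral_spike[of "{s}"]) auto
    finally have "integral {s..t} (\<lambda>_. 2 * e) \<le> integral {s..t} n" .
    then have "2 * (e * (t - s)) \<le> integral {s..t} n" using that(2) by (simp add: mult_ac)
    then show ?thesis using ineq[OF that(1,2)] by linarith
  qed
  have "\<exists>s\<ge>T. n s \<le> 2 * e"
  proof (rule ccontr)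
    assume "\<not> (\<exists>s\<ge>T. n s \<le> 2 * e)"
    then have big: "2 * e \<le> n x" if "T \<le> x" for x using that by force
    \<comment> \<open>Long enough for a fall by \<open>2 * B + 1\<close>, more than the bound on
      \<open>n\<close> permits.\<close>
    define L where "L = (2 * B + 1) / e"
    have L: "0 \<le> L" "e * L = 2 * B + 1" using e B0 by (auto simp: L_def)
    have "n (T + L) \<le> n T - e * L" using drop[of T "T + L"] big L by simp
    then show False using B[of T] B[of "T + L"] L B0 by auto
  qed
  then obtain s where s: "T \<le> s" "n s \<le> 2 * e" by blast
  have "n t \<le> 2 * e" if t: "s \<le> t" for t
  proof (rule ccontr)
    assume nt: "\<not> n t \<le> 2 * e"
    let ?S = "{s..t} \<inter> {x. n x \<le> 2 * e}"
    have "closedin (top_of_set {s..t}) ({s..t} \<inter> n -` {..2 * e})"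
      using s by (intro continuous_closedin_preimage continuous_on_subset[OF cont]) auto
    moreover have "{s..t} \<inter> n -` {..2 * e} = ?S" by auto
    ultimately have "compact ?S" by (metis closedin_compact_eq compact_Icc)
    moreover have "s \<in> ?S" using s t by auto
    ultimately obtain m where m: "m \<in> ?S" "\<And>x. x \<in> ?S \<Longrightarrow> x \<le> m" using compact_attains_sup[of ?S] by blast
    have "n t \<le> n m - e * (t - m)"
    proof (rule drop)
      fix x assume "m < x" "x \<le> t"
      then have "x \<notin> ?S" using m(2)[of x] by auto
      moreover have "x \<in> {s..t}" using m(1) \<open>m < x\<close> \<open>x \<le> t\<close> by auto
      ultimately have "x \<notin> ?S \<and> x \<in> {s..t}" by blast
      then show "2 * e \<le> n x" by auto
    qed (use m s in auto)
    also have "\<dots> \<le> 2 * e"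
    proof -
      have "0 \<le> e * (t - m)" using e m by (intro mult_nonneg_nonneg) auto
      then show ?thesis using m(1) by auto
    qed
    finally show False using nt by simp
  qed
  then show ?thesis by blast
qed

lemma set_integral_abs_le_const:
  fixes n :: "real \<Rightarrow> real"
  assumes "set_integrable lebesgue {s..t} n" "s \<le> t" "AE x in lebesgue. x \<in> {s..t} \<longrightarrow> \<bar>n x\<bar> \<le> B"
  shows "\<bar>LINT x:{s..t}|lebesgue. n x\<bar> \<le> B * (t - s)"
proof -
  have i: "integrable lebesgue (\<lambda>x. B * indicator {s..t} x)"
    by (intro integrable_mult_right integrable_real_indicator) (auto simp: emeasure_lborel_Icc_eq)
  have "\<bar>LINT x:{s..t}|lebesgue. n x\<bar> \<le> (\<integral>x. \<bar>indicator {s..t} x *\<^sub>R n x\<bar> \<partial>lebesgue)"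
    unfolding set_lebesgue_integral_def by (rule integral_abs_bound)
  also have "\<dots> \<le> (\<integral>x. B * indicator {s..t} x \<partial>lebesgue)"
    using assms(1,3) i unfolding set_integrable_def
    by (intro integral_mono_AE integrable_abs) (auto elim!: eventually_mono simp: indicator_def)
  also have "\<dots> = B * (t - s)" using assms(2) by simp
  finally show ?thesis .
qed

lemma null_set_avoid:
  assumes "N \<in> null_sets lebesgue" "a < (b::real)"
  obtains x where "a < x" "x < b" "x \<notin> N"
proof -
  have "\<not> {a<..<b} \<subseteq> N"
  proof
    assume "{a<..<b} \<subseteq> N"
    then have "{a<..<b} \<in> null_sets lebesgue" using assms(1) null_sets_completion_subset by blast
    then have "emeasure lebesgue {a<..<b} = 0" by (rule null_setsD1)
    then show False using assms(2) by simp
  qed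
  then obtain x where "x \<in> {a<..<b}" "x \<notin> N" by blast
  then show thesis by (intro that[of x]) auto
qed

text \<open>The hypothesis is \<open>P' + P = E / 3\<close> in integrated form, so \<open>P\<close>
  is driven to the limit of \<open>E / 3\<close>. The two bounds come from
  \<open>relaxation_upper\<close> for \<open>P - Einf / 3\<close> and for its negative.\<close>

lemma relaxation:
  fixes P E :: "real \<Rightarrow> real"
  assumes N: "N \<in> null_sets lebesgue"
    and eq: "\<And>s t. 0 < s \<Longrightarrow> s \<notin> N \<Longrightarrow> s \<le> t \<Longrightarrow>
      P t + (LINT x:{s..t}|lebesgue. P x) = P s + 1 / 3 * (LINT x:{s..t}|lebesgue. E x)"
    and int: "\<And>s t. 0 < s \<Longrightarrow> set_integrable lebesgue {s..t} P" "\<And>s t. 0 < s \<Longrightarrow> set_integrable lebesgue {s..t} E"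
    and B: "\<And>t. 0 < t \<Longrightarrow> \<bar>P t\<bar> \<le> B" "\<And>t. 0 < t \<Longrightarrow> \<bar>E t\<bar> \<le> B"
    and lim: "\<And>e. 0 < e \<Longrightarrow> \<exists>T. \<forall>t\<ge>T. t \<notin> N \<longrightarrow> \<bar>E t - Einf\<bar> \<le> e"
  shows "(P \<longlongrightarrow> Einf / 3) at_top"
proof -
  have aeN: "AE x in lebesgue. x \<notin> N" using N by (rule AE_not_in)
  define n where "n t = P t - Einf / 3" for t
  have B0: "0 \<le> B" using B(1)[of 1] by linarith
  \<comment> \<open>The identity may start only outside \<open>N\<close>. The difference of two
    instances with the common start \<open>s0\<close> gives it between arbitrary times from 1 on,
    which also makes \<open>P\<close> Lipschitz there.\<close>
  obtain s0 where s0: "0 < s0" "s0 < 1" "s0 \<notin> N"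
    using null_set_avoid[OF N, of 0 1] by auto
  have comb: "(LINT x:{a..b}|lebesgue. h x) + (LINT x:{b..c}|lebesgue. h x) = (LINT x:{a..c}|lebesgue. h x)"
    if "\<And>s t. 0 < s \<Longrightarrow> set_integrable lebesgue {s..t} h" "0 < a" "a \<le> b" "b \<le> c" for h :: "real \<Rightarrow> real" and a b c
    using that by (simp add: set_lebesgue_integral_eq_integral Henstock_Kurzweil_Integration.integral_combine)
  have eq': "P t - P s = - (LINT x:{s..t}|lebesgue. P x) + 1 / 3 * (LINT x:{s..t}|lebesgue. E x)" if "1 \<le> s" "s \<le> t" for s t
    using eq[of s0 s] eq[of s0 t] comb[OF int(1), of s0 s t] comb[OF int(2), of s0 s t] s0 that by (simp add: algebra_simps)
  have lip: "\<bar>n t - n s\<bar> \<le> 2 * B * (t - s)" if "1 \<le> s" "s \<le> t" for s t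
  proof -
    have "\<bar>LINT x:{s..t}|lebesgue. P x\<bar> \<le> B * (t - s)" "\<bar>LINT x:{s..t}|lebesgue. E x\<bar> \<le> B * (t - s)"
      using that B int by (auto intro!: set_integral_abs_le_const AE_I2)
    moreover have "0 \<le> B * (t - s)" using B0 that by simp
    ultimately show ?thesis using eq'[OF that] unfolding n_def unfolding abs_le_iff by linarith
  qed
  have cont: "continuous_on {1..} n"
    unfolding continuous_on_iff
  proof (intro ballI allI impI)
    fix x e :: real assume x: "x \<in> {1..}" and e: "0 < e"
    show "\<exists>d>0. \<forall>x'\<in>{1..}. dist x' x < d \<longrightarrow> dist (n x') (n x) < e"
    proof (intro exI[of _ "e / (2 * B + 1)"] conjI ballI impI)
      show "0 < e / (2 * B + 1)" using e B0 by simp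
      fix y :: real assume y: "y \<in> {1..}" "dist y x < e / (2 * B + 1)"
      have "\<bar>n y - n x\<bar> \<le> 2 * B * \<bar>y - x\<bar>"
        using lip[of x y] lip[of y x] x y by (cases "x \<le> y") (auto simp: abs_minus_commute)
      also have "\<dots> \<le> (2 * B + 1) * \<bar>y - x\<bar>" by (intro mult_right_mono) auto
      also have "\<dots> < e" using y(2) B0 by (simp add: dist_real_def pos_less_divide_eq mult.commute)
      finally show "dist (n y) (n x) < e" by (simp add: dist_real_def)
    qed
  qed
  have nP: "integral {s..t} n = (LINT x:{s..t}|lebesgue. P x) - Einf / 3 * (t - s)" if "1 \<le> s" "s \<le> t" for s t
  proof -
    have "P integrable_on {s..t}" "(LINT x:{s..t}|lebesgue. P x) = integral {s..t} P"
      using int(1)[of s t] that by (auto simp: set_lebesgue_integral_eq_integral)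
    then show ?thesis unfolding n_def[abs_def] using that
      by (subst Henstock_Kurzweil_Integration.integral_diff) (auto simp: mult.commute)
  qed
  have key: "\<exists>T. 1 \<le> T \<and> (\<forall>s t. T \<le> s \<longrightarrow> s \<le> t \<longrightarrow> \<bar>n t - n s + integral {s..t} n\<bar> \<le> e * (t - s))" if e: "0 < e" for e
  proof -
    obtain T where T: "\<And>t. T \<le> t \<Longrightarrow> t \<notin> N \<Longrightarrow> \<bar>E t - Einf\<bar> \<le> e" using lim[OF e] by blast
    show ?thesis
    proof (intro exI[of _ "max 1 T"] conjI allI impI)
      fix s t assume st: "max 1 T \<le> s" "s \<le> t"
      have c: "set_integrable lebesgue {s..t} (\<lambda>_. Einf)"
        unfolding set_integrable_def real_scaleR_def
        by (intro integrable_mult_left integrable_real_indicator) (auto simp: emeasure_lborel_Icc_eq)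
      have i: "set_integrable lebesgue {s..t} (\<lambda>x. E x - Einf)"
        using int(2)[of s t] c st by (intro set_integral_diff) auto
      have "\<bar>LINT x:{s..t}|lebesgue. E x - Einf\<bar> \<le> e * (t - s)"
      proof (rule set_integral_abs_le_const[OF i st(2)])
        show "AE x in lebesgue. x \<in> {s..t} \<longrightarrow> \<bar>E x - Einf\<bar> \<le> e"
          using aeN by eventually_elim (use T st in auto)
      qed
      moreover have "(LINT x:{s..t}|lebesgue. E x - Einf) = (LINT x:{s..t}|lebesgue. E x) - Einf * (t - s)"
        using int(2)[of s t] c st by (subst set_integral_diff) (auto simp: set_lebesgue_integral_def mult.commute)
      moreover have "n t - n s + integral {s..t} n = 1 / 3 * ((LINT x:{s..t}|lebesgue. E x) - Einf * (t - s))"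
      proof -
        have "Einf / 3 * (t - s) = Einf * (t - s) / 3" by simp
        then show ?thesis using nP[of s t] eq'[of s t] st unfolding n_def by auto
      qed
      moreover have "0 \<le> e * (t - s)" using e st by simp
      moreover have "\<bar>1 / 3 * q\<bar> \<le> d" if "\<bar>q\<bar> \<le> d" "0 \<le> d" for q d :: real using that by linarith
      ultimately show "\<bar>n t - n s + integral {s..t} n\<bar> \<le> e * (t - s)" by metis
    qed simp
  qed
  have "((\<lambda>t. n t) \<longlongrightarrow> 0) at_top"
  proof (rule tendstoI)
    fix d :: real assume d: "0 < d"
    define e where "e = d / 3"
    have e: "0 < e" using d by (simp add: e_def)
    obtain T where T: "1 \<le> T" "\<And>s t. T \<le> s \<Longrightarrow> s \<le> t \<Longrightarrow> \<bar>n t - n s + integral {s..t} n\<bar> \<le> e * (t - s)" using key[OF e] by blast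
    have bd: "\<bar>n t\<bar> \<le> B + \<bar>Einf / 3\<bar>" if "T \<le> t" for t using B(1)[of t] that T(1) unfolding n_def by linarith
    have c: "continuous_on {T..} n" using T by (intro continuous_on_subset[OF cont]) auto
    have "\<exists>T'. \<forall>t\<ge>T'. n t \<le> 2 * e"
    proof (rule relaxation_upper[OF e c _ bd])
      show "n t \<le> n s - integral {s..t} n + e * (t - s)" if "T \<le> s" "s \<le> t" for s t
        using T(2)[OF that] by (simp add: abs_le_iff)
    qed
    then obtain T1 where T1: "\<And>t. T1 \<le> t \<Longrightarrow> n t \<le> 2 * e" by blast
    have "\<exists>T'. \<forall>t\<ge>T'. - n t \<le> 2 * e"
    proof (rule relaxation_upper[OF e])
      show "continuous_on {T..} (\<lambda>t. - n t)" by (intro continuous_intros c)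
      show "\<bar>- n t\<bar> \<le> B + \<bar>Einf / 3\<bar>" if "T \<le> t" for t using bd[OF that] by simp
      show "- n t \<le> - n s - integral {s..t} (\<lambda>t. - n t) + e * (t - s)" if "T \<le> s" "s \<le> t" for s t
        using T(2)[OF that] by (simp add: abs_le_iff)
    qed
    then obtain T2 where T2: "\<And>t. T2 \<le> t \<Longrightarrow> - n t \<le> 2 * e" by blast
    show "\<forall>\<^sub>F t in at_top. dist (n t) 0 < d"
    proof (rule eventually_at_top_linorderI[of "max T1 T2"])
      fix t assume "max T1 T2 \<le> t"
      then have "n t \<le> 2 * e" "- n t \<le> 2 * e" using T1[of t] T2[of t] by auto
      then have "\<bar>n t\<bar> \<le> 2 * e" by linarith
      then show "dist (n t) 0 < d" using d by (simp add: e_def)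
    qed
  qed
  then have "((\<lambda>t. n t + Einf / 3) \<longlongrightarrow> 0 + Einf / 3) at_top" by (intro tendsto_intros)
  then show ?thesis by (simp add: n_def)
qed

section \<open>Dissipation\<close>

text \<open>The L1 norm of the flux, with extended values because its finiteness at a single time is
  not known beforehand.\<close>

definition slope_mass :: "real \<Rightarrow> real \<Rightarrow> (real \<Rightarrow> real) \<Rightarrow> (real \<Rightarrow> real) \<Rightarrow> (real \<Rightarrow> real) \<Rightarrow> ennreal" where
  "slope_mass \<alpha> \<beta> w u v = (\<integral>\<^sup>+x. ennreal \<bar>w x * slope \<alpha> \<beta> u v x\<bar> \<partial>lebesgue)"

definition dissipation :: "real \<Rightarrow> real \<Rightarrow> (real \<Rightarrow> real) \<Rightarrow> (real \<Rightarrow> real) \<Rightarrow> (real \<Rightarrow> real) \<Rightarrow> ennreal" where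
  "dissipation \<alpha> \<beta> w u v = (\<integral>\<^sup>+x. ennreal (w x * (slope \<alpha> \<beta> u v x)\<^sup>2) \<partial>lebesgue)"

lemma slope_measurable:
  assumes "u \<in> sobolev 1" "v \<in> sobolev 1"
  shows "slope \<alpha> \<beta> u v \<in> borel_measurable lebesgue"
proof -
  have [measurable]: "(\<lambda>x::real. x) \<in> borel_measurable lebesgue"
    by (intro continuous_lebesgue_measurable continuous_intros)
  have [measurable]: "weak_deriv u \<in> borel_measurable lebesgue" "weak_deriv v \<in> borel_measurable lebesgue"
    using sobolev_1_L2(2)[OF assms(1)] sobolev_1_L2(2)[OF assms(2)] by (auto simp: L2_def)
  show ?thesis unfolding slope_def[abs_def] by measurable
qed

text \<open>Young's inequality \<open>\<bar>z\<bar> \<le> e / 2 + z^2 / (2 * e)\<close>, averaged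
  against the probability density \<open>w\<close>.\<close>

lemma slope_mass_le:
  assumes w: "w \<in> setK" and uv: "u \<in> sobolev 1" "v \<in> sobolev 1" and e: "0 < e"
  shows "slope_mass \<alpha> \<beta> w u v \<le> ennreal (e / 2) + ennreal (1 / (2 * e)) * dissipation \<alpha> \<beta> w u v"
proof -
  note [measurable] = slope_measurable[OF uv, of \<alpha> \<beta>] setK_integrable(2)[OF w]
  let ?z = "slope \<alpha> \<beta> u v"
  have "slope_mass \<alpha> \<beta> w u v \<le> (\<integral>\<^sup>+x. ennreal (e / 2) * ennreal (w x) + ennreal (1 / (2 * e)) * ennreal (w x * (?z x)\<^sup>2) \<partial>lebesgue)"
    unfolding slope_mass_def
  proof (rule nn_integral_mono_AE)
    show "AE x in lebesgue. ennreal \<bar>w x * ?z x\<bar> \<le> ennreal (e / 2) * ennreal (w x) + ennreal (1 / (2 * e)) * ennreal (w x * (?z x)\<^sup>2)"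
      using setK_D(2)[OF w]
    proof eventually_elim
      case (elim x)
      have "0 \<le> (\<bar>?z x\<bar> - e)\<^sup>2" by simp
      then have "2 * e * \<bar>?z x\<bar> \<le> e * e + (?z x)\<^sup>2" by (simp add: power2_eq_square algebra_simps)
      then have "\<bar>?z x\<bar> \<le> e / 2 + 1 / (2 * e) * (?z x)\<^sup>2" using e by (simp add: field_simps power2_eq_square)
      then have "w x * \<bar>?z x\<bar> \<le> w x * (e / 2 + 1 / (2 * e) * (?z x)\<^sup>2)" using elim by (rule mult_left_mono)
      then have "\<bar>w x * ?z x\<bar> \<le> e / 2 * w x + 1 / (2 * e) * (w x * (?z x)\<^sup>2)"
        using elim by (simp add: abs_mult algebra_simps)
      then have "ennreal \<bar>w x * ?z x\<bar> \<le> ennreal (e / 2 * w x + 1 / (2 * e) * (w x * (?z x)\<^sup>2))" by (rule ennreal_leI)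
      also have "\<dots> = ennreal (e / 2 * w x) + ennreal (1 / (2 * e) * (w x * (?z x)\<^sup>2))"
        using elim e by (intro ennreal_plus) auto
      also have "\<dots> = ennreal (e / 2) * ennreal (w x) + ennreal (1 / (2 * e)) * ennreal (w x * (?z x)\<^sup>2)"
        using elim e by (subst (1 2) ennreal_mult) auto
      finally show ?case .
    qed
  qed
  also have "\<dots> = ennreal (e / 2) * (\<integral>\<^sup>+x. ennreal (w x) \<partial>lebesgue) + ennreal (1 / (2 * e)) * dissipation \<alpha> \<beta> w u v"
    unfolding dissipation_def by (subst nn_integral_add) (auto simp: nn_integral_cmult)
  also have "(\<integral>\<^sup>+x. ennreal (w x) \<partial>lebesgue) = 1"
    using nn_integral_eq_integral[OF setK_integrable(3)[OF w] setK_D(2)[OF w]] setK_D(3)[OF w] by simp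
  finally show ?thesis by simp
qed

text \<open>Truncation to \<open>[-m, m]\<close> makes the integrals finite and continuous in the
  H^1 norm, hence measurable in time. Monotone convergence recovers the whole L1 norm.\<close>

lemma slope_mass_SUP:
  assumes uv: "u \<in> sobolev 1" "v \<in> sobolev 1" and w: "w \<in> L2"
  shows "slope_mass \<alpha> \<beta> w u v = (SUP m. ennreal (\<integral>x. \<bar>w x\<bar> * \<bar>indicator {-real m..real m} x * slope \<alpha> \<beta> u v x\<bar> \<partial>lebesgue))"
proof -
  note [measurable] = slope_measurable[OF uv, of \<alpha> \<beta>]
  have [measurable]: "w \<in> borel_measurable lebesgue" using w by (simp add: L2_def)
  let ?h = "\<lambda>m x. ennreal (\<bar>w x\<bar> * \<bar>indicator {-real m..real m} x * slope \<alpha> \<beta> u v x\<bar>)"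
  have i: "integrable lebesgue (\<lambda>x. \<bar>w x\<bar> * \<bar>indicator {-real m..real m} x * slope \<alpha> \<beta> u v x\<bar>)" for m
  proof -
    have "(\<lambda>x. indicator {-real m..real m} x * slope \<alpha> \<beta> u v x) \<in> L2"
      by (rule cutoff_slope_L2[OF uv, where B=1 and A="real m"]) (auto intro: borel_measurable_indicator split: split_indicator)
    then show ?thesis by (intro L2_mult_integrable L2_abs w)
  qed
  have m: "(\<lambda>x. ?h m x) \<in> borel_measurable lebesgue" for m using i by auto
  have "slope_mass \<alpha> \<beta> w u v = (\<integral>\<^sup>+x. (SUP m. ?h m x) \<partial>lebesgue)"
    unfolding slope_mass_def
  proof (intro nn_integral_cong)
    fix x
    obtain M where M: "\<bar>x\<bar> \<le> real M" using real_arch_simple by blast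
    have "(SUP m. ?h m x) = ennreal \<bar>w x * slope \<alpha> \<beta> u v x\<bar>"
    proof (rule antisym)
      show "(SUP m. ?h m x) \<le> ennreal \<bar>w x * slope \<alpha> \<beta> u v x\<bar>"
        by (intro SUP_least ennreal_leI) (auto simp: abs_mult indicator_def)
      have "ennreal \<bar>w x * slope \<alpha> \<beta> u v x\<bar> = ?h M x" using M by (auto simp: abs_mult indicator_def)
      also have "\<dots> \<le> (SUP m. ?h m x)" by (rule SUP_upper) simp
      finally show "ennreal \<bar>w x * slope \<alpha> \<beta> u v x\<bar> \<le> (SUP m. ?h m x)" .
    qed
    then show "ennreal \<bar>w x * slope \<alpha> \<beta> u v x\<bar> = (SUP m. ?h m x)" by simp
  qed
  also have "\<dots> = (SUP m. \<integral>\<^sup>+x. ?h m x \<partial>lebesgue)"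
  proof (rule nn_integral_monotone_convergence_SUP)
    show "incseq (\<lambda>m x. ?h m x)"
      by (auto simp: incseq_def le_fun_def indicator_def intro!: ennreal_leI)
  qed (rule m)
  also have "\<dots> = (SUP m. ennreal (\<integral>x. \<bar>w x\<bar> * \<bar>indicator {-real m..real m} x * slope \<alpha> \<beta> u v x\<bar> \<partial>lebesgue))"
    using i by (intro SUP_cong refl nn_integral_eq_integral) auto
  finally show ?thesis .
qed

lemma slope_mass_measurable:
  assumes b: "I \<in> sets lebesgue" "bochner_measurable I (sobolev 1) (norm_H 1) u" "bochner_measurable I (sobolev 1) (norm_H 1) v"
  shows "(\<lambda>t. if t \<in> I then slope_mass \<alpha> \<beta> (u t) (u t) (v t) else 0) \<in> borel_measurable lebesgue"
    "(\<lambda>t. if t \<in> I then slope_mass \<alpha> \<beta> (v t) (u t) (v t) else 0) \<in> borel_measurable lebesgue"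
proof -
  have S: "AE t in lebesgue. t \<in> I \<longrightarrow> u t \<in> sobolev 1 \<and> v t \<in> sobolev 1"
    using b unfolding bochner_measurable_def by (auto simp: AE_restrict_space_iff)
  have ind: "(\<lambda>x. indicator {-real m..real m} x :: real) \<in> borel_measurable lebesgue" "\<bar>indicator {-real m..real m} x :: real\<bar> \<le> 1"
    "real m < \<bar>x\<bar> \<Longrightarrow> (indicator {-real m..real m} x :: real) = 0" for m x
    by (auto intro: borel_measurable_indicator split: split_indicator)
  note M = slope_functional_measurable(3,4)[OF b ind, where \<alpha>=\<alpha> and \<beta>=\<beta>]
  have "(\<lambda>t. SUP m. ennreal (if t \<in> I then \<integral>x. \<bar>u t x\<bar> * \<bar>indicator {-real m..real m} x * slope \<alpha> \<beta> (u t) (v t) x\<bar> \<partial>lebesgue else 0)) \<in> borel_measurable lebesgue"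
    by (intro borel_measurable_SUP measurable_compose[OF M(1) measurable_ennreal]) auto
  then show "(\<lambda>t. if t \<in> I then slope_mass \<alpha> \<beta> (u t) (u t) (v t) else 0) \<in> borel_measurable lebesgue"
  proof (rule lebesgue_measurable_AE_eq)
    show "AE t in lebesgue. (SUP m. ennreal (if t \<in> I then \<integral>x. \<bar>u t x\<bar> * \<bar>indicator {-real m..real m} x * slope \<alpha> \<beta> (u t) (v t) x\<bar> \<partial>lebesgue else 0))
      = (if t \<in> I then slope_mass \<alpha> \<beta> (u t) (u t) (v t) else 0)"
      using S by eventually_elim (auto simp: slope_mass_SUP sobolev_1_L2)
  qed
  have "(\<lambda>t. SUP m. ennreal (if t \<in> I then \<integral>x. \<bar>v t x\<bar> * \<bar>indicator {-real m..real m} x * slope \<alpha> \<beta> (u t) (v t) x\<bar> \<partial>lebesgue else 0)) \<in> borel_measurable lebesgue"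
    by (intro borel_measurable_SUP measurable_compose[OF M(2) measurable_ennreal]) auto
  then show "(\<lambda>t. if t \<in> I then slope_mass \<alpha> \<beta> (v t) (u t) (v t) else 0) \<in> borel_measurable lebesgue"
  proof (rule lebesgue_measurable_AE_eq)
    show "AE t in lebesgue. (SUP m. ennreal (if t \<in> I then \<integral>x. \<bar>v t x\<bar> * \<bar>indicator {-real m..real m} x * slope \<alpha> \<beta> (u t) (v t) x\<bar> \<partial>lebesgue else 0))
      = (if t \<in> I then slope_mass \<alpha> \<beta> (v t) (u t) (v t) else 0)"
      using S by eventually_elim (auto simp: slope_mass_SUP sobolev_1_L2)
  qed
qed

text \<open>
  The dissipation is not known to be measurable in time, so its integral is only a lower integral;
  the linearised form \<open>slope_mass\<close> is measurable and inherits the bound.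
\<close>

lemma slope_mass_time_integral:
  assumes m: "(\<lambda>t. if t \<in> {0<..<T} then slope_mass \<alpha> \<beta> (w t) (u t) (v t) else 0) \<in> borel_measurable lebesgue"
    and S: "AE \<sigma> in lebesgue. \<sigma> \<in> {0<..<T} \<longrightarrow> u \<sigma> \<in> sobolev 1 \<and> v \<sigma> \<in> sobolev 1"
    and w: "\<And>t. 0 \<le> t \<Longrightarrow> w t \<in> setK"
    and st: "0 \<le> s" "s \<le> t" "t < T" and e: "0 < e" and d: "0 \<le> d"
    and D: "(\<integral>\<^sup>+\<sigma>\<in>{s..t}. dissipation \<alpha> \<beta> (w \<sigma>) (u \<sigma>) (v \<sigma>) \<partial>lebesgue) \<le> ennreal d"
  shows "(\<integral>\<^sup>+\<sigma>\<in>{s..t}. slope_mass \<alpha> \<beta> (w \<sigma>) (u \<sigma>) (v \<sigma>) \<partial>lebesgue) \<le> ennreal (e / 2 * (t - s) + d / (2 * e))"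
proof -
  define h where "h \<sigma> = (if \<sigma> \<in> {0<..<T} then slope_mass \<alpha> \<beta> (w \<sigma>) (u \<sigma>) (v \<sigma>) else 0)" for \<sigma>
  have [measurable]: "h \<in> borel_measurable lebesgue" using m by (simp add: h_def[abs_def])
  have ne0: "AE \<sigma> in lebesgue. \<sigma> \<noteq> (0::real)" using AE_completion[OF AE_lborel_singleton[of "0::real"]] .
  have [measurable]: "{s..t} \<in> sets lebesgue" by simp
  \<comment> \<open>The constant is moved to the measurable side by truncated subtraction, because
    only monotonicity of the integral may be used for the dissipation; additivity is applied to
    measurable functions alone.\<close>
  have X: "ennreal (2 * e) * (\<integral>\<^sup>+\<sigma>. (h \<sigma> - ennreal (e / 2)) * indicator {s..t} \<sigma> \<partial>lebesgue) \<le> ennreal d"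
  proof -
    have "ennreal (2 * e) * (\<integral>\<^sup>+\<sigma>. (h \<sigma> - ennreal (e / 2)) * indicator {s..t} \<sigma> \<partial>lebesgue)
      = (\<integral>\<^sup>+\<sigma>. ennreal (2 * e) * ((h \<sigma> - ennreal (e / 2)) * indicator {s..t} \<sigma>) \<partial>lebesgue)"
      by (rule nn_integral_cmult[symmetric]) measurable
    also have "\<dots> \<le> (\<integral>\<^sup>+\<sigma>\<in>{s..t}. dissipation \<alpha> \<beta> (w \<sigma>) (u \<sigma>) (v \<sigma>) \<partial>lebesgue)"
    proof (rule nn_integral_mono_AE)
      show "AE \<sigma> in lebesgue. ennreal (2 * e) * ((h \<sigma> - ennreal (e / 2)) * indicator {s..t} \<sigma>) \<le> dissipation \<alpha> \<beta> (w \<sigma>) (u \<sigma>) (v \<sigma>) * indicator {s..t} \<sigma>"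
        using ne0 S
      proof eventually_elim
        case (elim \<sigma>)
        show ?case
        proof (cases "\<sigma> \<in> {s..t}")
          case True
          then have I: "\<sigma> \<in> {0<..<T}" using elim st by auto
          let ?D = "dissipation \<alpha> \<beta> (w \<sigma>) (u \<sigma>) (v \<sigma>)"
          have "h \<sigma> \<le> ennreal (e / 2) + ennreal (1 / (2 * e)) * ?D"
            using slope_mass_le[OF w, of \<sigma> "u \<sigma>" "v \<sigma>" e \<alpha> \<beta>] elim I e by (simp add: h_def)
          then have "h \<sigma> - ennreal (e / 2) \<le> ennreal (1 / (2 * e)) * ?D"
            by (simp add: ennreal_minus_le_iff)
          then have "ennreal (2 * e) * (h \<sigma> - ennreal (e / 2)) \<le> ennreal (2 * e) * (ennreal (1 / (2 * e)) * ?D)"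
            by (rule mult_left_mono) simp
          also have "\<dots> = ?D" using e by (simp add: mult.assoc[symmetric] ennreal_mult[symmetric])
          finally show ?thesis using True by simp
        qed simp
      qed
    qed
    also have "\<dots> \<le> ennreal d" by (rule D)
    finally show ?thesis .
  qed
  have Y: "(\<integral>\<^sup>+\<sigma>. (h \<sigma> - ennreal (e / 2)) * indicator {s..t} \<sigma> \<partial>lebesgue) \<le> ennreal (d / (2 * e))"
  proof -
    let ?X = "\<integral>\<^sup>+\<sigma>. (h \<sigma> - ennreal (e / 2)) * indicator {s..t} \<sigma> \<partial>lebesgue"
    have "?X = ennreal (1 / (2 * e)) * (ennreal (2 * e) * ?X)"
      using e by (simp add: mult.assoc[symmetric] ennreal_mult[symmetric])
    also have "\<dots> \<le> ennreal (1 / (2 * e)) * ennreal d" by (rule mult_left_mono[OF X]) simp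
    also have "\<dots> = ennreal (d / (2 * e))" using e d by (simp add: ennreal_mult[symmetric])
    finally show ?thesis .
  qed
  have "(\<integral>\<^sup>+\<sigma>\<in>{s..t}. slope_mass \<alpha> \<beta> (w \<sigma>) (u \<sigma>) (v \<sigma>) \<partial>lebesgue)
    \<le> (\<integral>\<^sup>+\<sigma>. (h \<sigma> - ennreal (e / 2)) * indicator {s..t} \<sigma> + ennreal (e / 2) * indicator {s..t} \<sigma> \<partial>lebesgue)"
  proof (rule nn_integral_mono_AE)
    show "AE \<sigma> in lebesgue. slope_mass \<alpha> \<beta> (w \<sigma>) (u \<sigma>) (v \<sigma>) * indicator {s..t} \<sigma>
      \<le> (h \<sigma> - ennreal (e / 2)) * indicator {s..t} \<sigma> + ennreal (e / 2) * indicator {s..t} \<sigma>"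
      using ne0
    proof eventually_elim
      case (elim \<sigma>)
      show ?case
      proof (cases "\<sigma> \<in> {s..t}")
        case True
        then have "\<sigma> \<in> {0<..<T}" using elim st by auto
        then have "slope_mass \<alpha> \<beta> (w \<sigma>) (u \<sigma>) (v \<sigma>) = h \<sigma>" by (simp add: h_def)
        moreover have "h \<sigma> \<le> (h \<sigma> - ennreal (e / 2)) + ennreal (e / 2)"
          by (metis add.commute ennreal_minus_le_iff order_refl)
        ultimately show ?thesis using True by simp
      qed simp
    qed
  qed
  also have "\<dots> = (\<integral>\<^sup>+\<sigma>. (h \<sigma> - ennreal (e / 2)) * indicator {s..t} \<sigma> \<partial>lebesgue) + ennreal (e / 2) * emeasure lebesgue {s..t}"
    by (subst nn_integral_add) (auto simp: nn_integral_cmult_indicator)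
  also have "emeasure lebesgue {s..t} = ennreal (t - s)" using st by simp
  also have "(\<integral>\<^sup>+\<sigma>. (h \<sigma> - ennreal (e / 2)) * indicator {s..t} \<sigma> \<partial>lebesgue) + ennreal (e / 2) * ennreal (t - s)
    \<le> ennreal (d / (2 * e)) + ennreal (e / 2) * ennreal (t - s)" by (rule add_right_mono[OF Y])
  also have "\<dots> = ennreal (e / 2 * (t - s) + d / (2 * e))"
    using e d st by (simp add: ennreal_mult[symmetric] ennreal_plus[symmetric] add.commute del: ennreal_plus)
  finally show ?thesis .
qed

text \<open>Where the density is at least \<open>\<delta>\<close>, the gradient of the pressure is
  at most \<open>1 / \<delta>\<close> times the flux, and its integral over \<open>[x, y]\<close> is
  the increment. This is how small dissipation becomes a statement without derivatives.\<close>

lemma slope_mass_bounds_increment: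
  assumes S: "u \<in> sobolev 1" "v \<in> sobolev 1"
    and rep: "\<And>x y. x \<le> y \<Longrightarrow> U y - U x = (LINT t:{x..y}|lebesgue. weak_deriv u t)"
      "\<And>x y. x \<le> y \<Longrightarrow> V y - V x = (LINT t:{x..y}|lebesgue. weak_deriv v t)"
    and w: "AE x in lebesgue. w x = W x" "w \<in> L2"
    and \<delta>: "0 < \<delta>" "x \<le> y" "\<And>z. x \<le> z \<Longrightarrow> z \<le> y \<Longrightarrow> \<delta> \<le> W z"
    and K: "slope_mass \<alpha> \<beta> w u v \<le> ennreal k" "0 \<le> k"
  shows "\<bar>(\<alpha> * U y + \<beta> * V y + y\<^sup>2 / 6) - (\<alpha> * U x + \<beta> * V x + x\<^sup>2 / 6)\<bar> \<le> k / \<delta>"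
proof -
  let ?z = "slope \<alpha> \<beta> u v"
  note [measurable] = slope_measurable[OF S, of \<alpha> \<beta>]
  have [measurable]: "w \<in> borel_measurable lebesgue" using w(2) by (simp add: L2_def)
  have i: "set_integrable lebesgue {x..y} (weak_deriv u)" "set_integrable lebesgue {x..y} (weak_deriv v)"
    using L2_locally_integrable[OF sobolev_1_L2(2)] S by (auto simp: locally_integrable_def)
  have i3: "set_integrable lebesgue {x..y} (\<lambda>t. t / 3)"
  proof -
    have "locally_integrable (\<lambda>t. t / 3)" by (intro locally_integrable_continuous continuous_intros) auto
    then show ?thesis by (simp add: locally_integrable_def)
  qed
  have iz: "set_integrable lebesgue {x..y} ?z"
    unfolding slope_def[abs_def] using i i3 by (intro set_integral_add set_integrable_mult_right) auto
  have "(LINT t:{x..y}|lebesgue. t / 3) = integral {x..y} (\<lambda>t. t / 3)"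
    using i3 by (rule set_lebesgue_integral_eq_integral(2))
  also have "\<dots> = y\<^sup>2 / 6 - x\<^sup>2 / 6"
    using \<delta>(2) by (intro integral_unique fundamental_theorem_of_calculus)
      (auto simp: has_real_derivative_iff_has_vector_derivative[symmetric] intro!: derivative_eq_intros)
  finally have "(\<alpha> * U y + \<beta> * V y + y\<^sup>2 / 6) - (\<alpha> * U x + \<beta> * V x + x\<^sup>2 / 6) = (LINT t:{x..y}|lebesgue. ?z t)"
    unfolding slope_def using i i3 rep[OF \<delta>(2)]
    by (simp add: algebra_simps set_integral_add(2) set_integral_mult_right)
  also have "ennreal \<bar>\<dots>\<bar> \<le> (\<integral>\<^sup>+t. ennreal (norm (indicator {x..y} t *\<^sub>R ?z t)) \<partial>lebesgue)"
    unfolding set_lebesgue_integral_def using integral_norm_bound_ennreal[OF iz[unfolded set_integrable_def]] by simp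
  also have "\<dots> \<le> (\<integral>\<^sup>+t. ennreal (1 / \<delta>) * ennreal \<bar>w t * ?z t\<bar> \<partial>lebesgue)"
  proof (rule nn_integral_mono_AE)
    show "AE t in lebesgue. ennreal (norm (indicator {x..y} t *\<^sub>R ?z t)) \<le> ennreal (1 / \<delta>) * ennreal \<bar>w t * ?z t\<bar>"
      using w(1)
    proof eventually_elim
      case (elim t)
      have "\<bar>indicator {x..y} t * ?z t\<bar> \<le> 1 / \<delta> * \<bar>w t * ?z t\<bar>"
      proof (cases "t \<in> {x..y}")
        case True
        then have "\<delta> \<le> w t" using \<delta>(3) elim by simp
        then have "\<delta> * \<bar>?z t\<bar> \<le> \<bar>w t\<bar> * \<bar>?z t\<bar>" by (intro mult_right_mono) auto
        then show ?thesis using True \<delta>(1) by (simp add: abs_mult field_simps)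
      qed (use \<delta>(1) in simp)
      then show ?case using \<delta>(1) by (simp add: ennreal_mult[symmetric] ennreal_leI)
    qed
  qed
  also have "\<dots> = ennreal (1 / \<delta>) * slope_mass \<alpha> \<beta> w u v" unfolding slope_mass_def by (rule nn_integral_cmult) measurable
  also have "\<dots> \<le> ennreal (1 / \<delta>) * ennreal k" by (rule mult_left_mono[OF K(1)]) simp
  also have "\<dots> = ennreal (k / \<delta>)" using \<delta>(1) K(2) by (simp add: ennreal_mult[symmetric])
  finally show ?thesis using \<delta>(1) K(2) by (simp add: ennreal_le_iff)
qed

section \<open>From weak solutions to flows\<close>

text \<open>The origin of the coefficients: expanding the square, the cross term contributes
  \<open>R\<close>, and the diagonal receives \<open>R * \<eta>^2\<close>, added to the separate
  \<open>\<eta>^2\<close>, and \<open>R / \<eta>^2\<close>. The moment term contributes the weights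
  \<open>1 / 6\<close> and \<open>\<Theta> / 6\<close>.\<close>

lemma Estar_eq_energy:
  assumes "u \<in> spX" "v \<in> spX" "\<eta> > 0"
  shows "Estar R R\<^sub>\<mu> \<eta> u v = energy (\<eta>\<^sup>2 * (1 + R)) R (R / \<eta>\<^sup>2) (1 / 6) (Theta R R\<^sub>\<mu> \<eta> / 6) u v"
    "M2 R R\<^sub>\<mu> \<eta> u v = 6 * pot_energy (1 / 6) (Theta R R\<^sub>\<mu> \<eta> / 6) u v"
proof -
  note L = spX_integrable(1)[OF assms(1)] spX_integrable(1)[OF assms(2)]
  have "M2 R R\<^sub>\<mu> \<eta> u v = (\<integral>x. 6 * (1 / 6 * (x\<^sup>2 * u x) + Theta R R\<^sub>\<mu> \<eta> / 6 * (x\<^sup>2 * v x)) \<partial>lebesgue)"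
    unfolding M2_def by (intro Bochner_Integration.integral_cong refl) (simp add: algebra_simps)
  then show m: "M2 R R\<^sub>\<mu> \<eta> u v = 6 * pot_energy (1 / 6) (Theta R R\<^sub>\<mu> \<eta> / 6) u v"
    unfolding pot_energy_def by (simp only: integral_mult_right_zero)
  have i: "integrable lebesgue (\<lambda>x. (u x)\<^sup>2)" "integrable lebesgue (\<lambda>x. (v x)\<^sup>2)" using L by (auto simp: L2_def)
  have "(norm_L2 (\<lambda>x. \<eta> * u x + inverse \<eta> * v x))\<^sup>2 = (\<integral>x. \<eta>\<^sup>2 * (u x)\<^sup>2 + 2 * (u x * v x) + inverse (\<eta>\<^sup>2) * (v x)\<^sup>2 \<partial>lebesgue)"
    unfolding norm_L2_sq
  proof (intro Bochner_Integration.integral_cong refl)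
    fix x show "(\<eta> * u x + inverse \<eta> * v x)\<^sup>2 = \<eta>\<^sup>2 * (u x)\<^sup>2 + 2 * (u x * v x) + inverse (\<eta>\<^sup>2) * (v x)\<^sup>2"
      using assms(3) by (simp add: power2_eq_square field_simps)
  qed
  also have "\<dots> = \<eta>\<^sup>2 * (norm_L2 u)\<^sup>2 + 2 * (\<integral>x. u x * v x \<partial>lebesgue) + inverse (\<eta>\<^sup>2) * (norm_L2 v)\<^sup>2"
    using i L2_mult_integrable[OF L] by (simp add: norm_L2_sq)
  finally have n: "(norm_L2 (\<lambda>x. \<eta> * u x + inverse \<eta> * v x))\<^sup>2 = \<eta>\<^sup>2 * (norm_L2 u)\<^sup>2 + 2 * (\<integral>x. u x * v x \<partial>lebesgue) + inverse (\<eta>\<^sup>2) * (norm_L2 v)\<^sup>2" .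
  show "Estar R R\<^sub>\<mu> \<eta> u v = energy (\<eta>\<^sup>2 * (1 + R)) R (R / \<eta>\<^sup>2) (1 / 6) (Theta R R\<^sub>\<mu> \<eta> / 6) u v"
  proof -
    have "h / 2 * A + R / 2 * (h * A + 2 * I + k * B) + 1 / 6 * (6 * Q) = (h * (1 + R) / 2 * A + R * I + R * k / 2 * B) + Q"
      for h k A B I Q :: real by (simp add: field_simps)
    then show ?thesis unfolding Estar_def energy_def quad_energy_eq[OF L] n m divide_inverse[of R "\<eta>\<^sup>2"] .
  qed
qed

text \<open>The entropy dissipation is twice the same quadratic form, now in the derivatives, so
  coercivity turns it into L2 bounds for both derivatives.\<close>

lemma deriv_energy_eq:
  assumes "u \<in> L2" "v \<in> L2" "\<eta> > 0"
  shows "\<eta>\<^sup>2 * (norm_L2 u)\<^sup>2 + R * inverse (\<eta>\<^sup>2) * (norm_L2 (\<lambda>x. \<eta>\<^sup>2 * u x + v x))\<^sup>2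
    = 2 * quad_energy (\<eta>\<^sup>2 * (1 + R)) R (R / \<eta>\<^sup>2) u v"
proof -
  have i: "integrable lebesgue (\<lambda>x. (u x)\<^sup>2)" "integrable lebesgue (\<lambda>x. (v x)\<^sup>2)" using assms by (auto simp: L2_def)
  have "(norm_L2 (\<lambda>x. \<eta>\<^sup>2 * u x + v x))\<^sup>2 = (\<integral>x. (\<eta>\<^sup>2)\<^sup>2 * (u x)\<^sup>2 + 2 * \<eta>\<^sup>2 * (u x * v x) + (v x)\<^sup>2 \<partial>lebesgue)"
    unfolding norm_L2_sq
    by (intro Bochner_Integration.integral_cong refl) (simp add: power2_eq_square algebra_simps)
  also have "\<dots> = (\<eta>\<^sup>2)\<^sup>2 * (norm_L2 u)\<^sup>2 + 2 * \<eta>\<^sup>2 * (\<integral>x. u x * v x \<partial>lebesgue) + (norm_L2 v)\<^sup>2"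
    using i L2_mult_integrable[OF assms(1,2)] by (simp add: norm_L2_sq)
  finally have n: "(norm_L2 (\<lambda>x. \<eta>\<^sup>2 * u x + v x))\<^sup>2 = (\<eta>\<^sup>2)\<^sup>2 * (norm_L2 u)\<^sup>2 + 2 * \<eta>\<^sup>2 * (\<integral>x. u x * v x \<partial>lebesgue) + (norm_L2 v)\<^sup>2" .
  show ?thesis
    unfolding n quad_energy_eq[OF assms(1,2)] using assms(3) by (simp add: power2_eq_square field_simps)
qed

lemma quad_energy_upper:
  assumes "u \<in> L2" "v \<in> L2" "0 \<le> b"
  shows "quad_energy a b c u v \<le> (\<bar>a\<bar> + b) * (norm_L2 u)\<^sup>2 + (\<bar>c\<bar> + b) * (norm_L2 v)\<^sup>2"
proof -
  have "2 * \<bar>\<integral>x. u x * v x \<partial>lebesgue\<bar> \<le> 2 * (norm_L2 u * norm_L2 v)" using L2_Cauchy_Schwarz[OF assms(1,2)] by simp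
  also have "\<dots> \<le> (norm_L2 u)\<^sup>2 + (norm_L2 v)\<^sup>2" using sum_squares_bound[of "norm_L2 u" "norm_L2 v"] by simp
  finally have "b * (2 * (\<integral>x. u x * v x \<partial>lebesgue)) \<le> b * ((norm_L2 u)\<^sup>2 + (norm_L2 v)\<^sup>2)"
    using assms(3) by (intro mult_left_mono) auto
  moreover have "a * (norm_L2 u)\<^sup>2 \<le> \<bar>a\<bar> * (norm_L2 u)\<^sup>2" "c * (norm_L2 v)\<^sup>2 \<le> \<bar>c\<bar> * (norm_L2 v)\<^sup>2"
    by (intro mult_right_mono; simp)+
  moreover have "0 \<le> \<bar>a\<bar> * (norm_L2 u)\<^sup>2" "0 \<le> \<bar>c\<bar> * (norm_L2 v)\<^sup>2" "0 \<le> b * (norm_L2 u)\<^sup>2" "0 \<le> b * (norm_L2 v)\<^sup>2"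
    using assms(3) by auto
  moreover have "a / 2 * (norm_L2 u)\<^sup>2 = a * (norm_L2 u)\<^sup>2 / 2" "c / 2 * (norm_L2 v)\<^sup>2 = c * (norm_L2 v)\<^sup>2 / 2" by simp_all
  ultimately show ?thesis unfolding quad_energy_eq[OF assms(1,2)] distrib_left distrib_right mult.left_commute[of b 2] by linarith
qed

lemma energy_nonneg:
  assumes "u \<in> setK" "v \<in> setK" "0 < a" "0 < c" "b * b < a * c" "0 \<le> p" "0 \<le> r"
  shows "0 \<le> energy a b c p r u v" "0 \<le> pot_energy p r u v" "pot_energy p r u v \<le> energy a b c p r u v"
proof -
  show p: "0 \<le> pot_energy p r u v"
    unfolding pot_energy_eq[OF setK_D(1)[OF assms(1)] setK_D(1)[OF assms(2)]] using assms moment_nonneg by simp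
  have q: "0 \<le> quad_energy a b c u v" by (intro quad_energy_nonneg assms setK_integrable)
  show "0 \<le> energy a b c p r u v" "pot_energy p r u v \<le> energy a b c p r u v" using p q by (auto simp: energy_def)
qed

lemma ennreal_add_le_D:
  assumes "ennreal x + A \<le> ennreal y" "0 \<le> x" "0 \<le> y"
  shows "x \<le> y" "A \<le> ennreal (y - x)"
proof -
  have "ennreal x \<le> ennreal y" using assms(1) by (meson le_iff_add order_trans)
  then show xy: "x \<le> y" using assms by simp
  have "ennreal x + A \<le> ennreal x + ennreal (y - x)"
    using assms xy by (simp add: ennreal_plus[symmetric] del: ennreal_plus)
  then show "A \<le> ennreal (y - x)" by (simp add: ennreal_add_left_cancel_le)
qed

section \<open>Energy, dissipation and fluxes along a weak solution\<close>

locale weak_flow =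
  fixes R R\<^sub>\<mu> \<eta> :: real and f\<^sub>0 g\<^sub>0 :: "real \<Rightarrow> real" and f g :: "real \<Rightarrow> real \<Rightarrow> real" and N :: "real set"
  assumes R: "0 < R" and R\<mu>: "0 < R\<^sub>\<mu>" and \<eta>: "0 < \<eta>"
    and fK: "\<And>t. 0 \<le> t \<Longrightarrow> f t \<in> setK" and gK: "\<And>t. 0 \<le> t \<Longrightarrow> g t \<in> setK"
    and mX: "bochner_measurable {0<..} spX norm_X f" "bochner_measurable {0<..} spX norm_X g"
    and L2H: "\<And>t. 0 < t \<Longrightarrow> bochner_L2 {0<..<t} (sobolev 1) (norm_H 1) f" "\<And>t. 0 < t \<Longrightarrow> bochner_L2 {0<..<t} (sobolev 1) (norm_H 1) g"
    and weak: "\<And>\<xi> t. \<xi> \<in> test_functions \<Longrightarrow> 0 \<le> t \<Longrightarrow>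
      (\<integral>x. f t x * \<xi> x \<partial>lebesgue) - (\<integral>x. f\<^sub>0 x * \<xi> x \<partial>lebesgue)
        + (LINT \<sigma>:{0..t}|lebesgue. (\<integral>x. f \<sigma> x * weak_deriv (press_f R \<eta> (f \<sigma>) (g \<sigma>)) x * deriv \<xi> x \<partial>lebesgue)) = 0"
      "\<And>\<xi> t. \<xi> \<in> test_functions \<Longrightarrow> 0 \<le> t \<Longrightarrow>
      (\<integral>x. g t x * \<xi> x \<partial>lebesgue) - (\<integral>x. g\<^sub>0 x * \<xi> x \<partial>lebesgue)
        + (LINT \<sigma>:{0..t}|lebesgue. (\<integral>x. g \<sigma> x * weak_deriv (press_g R\<^sub>\<mu> \<eta> (f \<sigma>) (g \<sigma>)) x * deriv \<xi> x \<partial>lebesgue)) = 0"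
    and N: "N \<in> null_sets lebesgue" "N \<subseteq> {0<..}"
    and entropy: "\<And>s t. 0 \<le> s \<Longrightarrow> s \<notin> N \<Longrightarrow> s \<le> t \<Longrightarrow> entropy_ineq R R\<^sub>\<mu> \<eta> f g s t"
    and energyi: "\<And>s t. 0 \<le> s \<Longrightarrow> s \<notin> N \<Longrightarrow> s \<le> t \<Longrightarrow> energy_ineq R R\<^sub>\<mu> \<eta> f g s t"
    and moment: "\<And>s t. 0 \<le> s \<Longrightarrow> s \<notin> N \<Longrightarrow> s \<le> t \<Longrightarrow> moment_eq R R\<^sub>\<mu> \<eta> f g s t"
begin

definition "\<Theta> = Theta R R\<^sub>\<mu> \<eta>"
definition "a = \<eta>\<^sup>2 * (1 + R)"
definition "c = R / \<eta>\<^sup>2"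
abbreviation "E t \<equiv> energy a R c (1 / 6) (\<Theta> / 6) (f t) (g t)"
abbreviation "P t \<equiv> pot_energy (1 / 6) (\<Theta> / 6) (f t) (g t)"
abbreviation "Kf \<sigma> \<equiv> slope_mass a R (f \<sigma>) (f \<sigma>) (g \<sigma>)"
abbreviation "Kg \<sigma> \<equiv> slope_mass (\<eta>\<^sup>2 * R\<^sub>\<mu>) R\<^sub>\<mu> (g \<sigma>) (f \<sigma>) (g \<sigma>)"
abbreviation "Df \<sigma> \<equiv> dissipation a R (f \<sigma>) (f \<sigma>) (g \<sigma>)"
abbreviation "Dg \<sigma> \<equiv> dissipation (\<eta>\<^sup>2 * R\<^sub>\<mu>) R\<^sub>\<mu> (g \<sigma>) (f \<sigma>) (g \<sigma>)"

lemma \<Theta>: "0 < \<Theta>" and a: "0 < a" and c: "0 < c" and det: "R * R < a * c"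
proof -
  show "0 < \<Theta>" "0 < a" "0 < c" using R R\<mu> \<eta> by (auto simp: \<Theta>_def a_def c_def Theta_def)
  have "a * c = (1 + R) * R" using \<eta> by (simp add: a_def c_def)
  then show "R * R < a * c" using R by (simp add: algebra_simps)
qed

lemma E_eq: "0 \<le> t \<Longrightarrow> Estar R R\<^sub>\<mu> \<eta> (f t) (g t) = E t" "0 \<le> t \<Longrightarrow> M2 R R\<^sub>\<mu> \<eta> (f t) (g t) = 6 * P t"
  using Estar_eq_energy[OF setK_D(1)[OF fK] setK_D(1)[OF gK] \<eta>] by (auto simp: \<Theta>_def a_def c_def)

lemma E_nonneg: "0 \<le> t \<Longrightarrow> 0 \<le> E t" and P_nonneg: "0 \<le> t \<Longrightarrow> 0 \<le> P t" and P_le_E: "0 \<le> t \<Longrightarrow> P t \<le> E t"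
  using energy_nonneg[OF fK gK a c det, of t t "1 / 6" "\<Theta> / 6"] \<Theta> by auto

lemma energy_D:
  assumes "0 \<le> s" "s \<notin> N" "s \<le> t"
  shows "E t \<le> E s"
    "(\<integral>\<^sup>+\<sigma>\<in>{s..t}. Df \<sigma> \<partial>lebesgue) \<le> ennreal (2 * (E s - E t))"
    "(\<integral>\<^sup>+\<sigma>\<in>{s..t}. Dg \<sigma> \<partial>lebesgue) \<le> ennreal (2 / \<Theta> * (E s - E t))"
proof -
  let ?X = "\<integral>\<^sup>+\<sigma>\<in>{s..t}. Df \<sigma> \<partial>lebesgue" and ?Y = "\<integral>\<^sup>+\<sigma>\<in>{s..t}. Dg \<sigma> \<partial>lebesgue"
  have le: "ennreal (E t) + (ennreal (1 / 2) * ?X + ennreal (\<Theta> / 2) * ?Y) \<le> ennreal (E s)"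
    using energyi[OF assms] E_eq(1)[of s] E_eq(1)[of t] assms
    unfolding energy_ineq_def dissipation_def slope_def a_def \<Theta>_def[symmetric] by (simp add: add.assoc)
  have nn: "0 \<le> E t" "0 \<le> E s" using E_nonneg assms by auto
  show ts: "E t \<le> E s" by (rule ennreal_add_le_D(1)[OF le nn])
  have sum: "ennreal (1 / 2) * ?X + ennreal (\<Theta> / 2) * ?Y \<le> ennreal (E s - E t)" by (rule ennreal_add_le_D(2)[OF le nn])
  have sc: "Z \<le> ennreal (1 / k * d)" if "ennreal k * Z \<le> ennreal d" "0 < k" "0 \<le> d" for k d Z
  proof -
    have "Z = ennreal (1 / k) * (ennreal k * Z)" using that by (simp add: mult.assoc[symmetric] ennreal_mult[symmetric])
    also have "\<dots> \<le> ennreal (1 / k) * ennreal d" by (rule mult_left_mono[OF that(1)]) simp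
    also have "\<dots> = ennreal (1 / k * d)" by (rule ennreal_mult[symmetric]) (use that in auto)
    finally show ?thesis .
  qed
  have "ennreal (1 / 2) * ?X \<le> ennreal (E s - E t)" "ennreal (\<Theta> / 2) * ?Y \<le> ennreal (E s - E t)"
    using order_trans[OF add_increasing2[OF zero_le order_refl] sum] order_trans[OF add_increasing[OF zero_le order_refl] sum] by blast+
  from sc[OF this(1)] sc[OF this(2)] show "?X \<le> ennreal (2 * (E s - E t))" "?Y \<le> ennreal (2 / \<Theta> * (E s - E t))"
    using ts \<Theta> by auto
qed

lemma mH: "0 < t \<Longrightarrow> bochner_measurable {0<..<t} (sobolev 1) (norm_H 1) f" "0 < t \<Longrightarrow> bochner_measurable {0<..<t} (sobolev 1) (norm_H 1) g"
  using L2H unfolding bochner_L2_def by auto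

lemma sobolev_AE: "AE \<sigma> in lebesgue. 0 < \<sigma> \<longrightarrow> f \<sigma> \<in> sobolev 1 \<and> g \<sigma> \<in> sobolev 1"
proof -
  have "AE \<sigma> in lebesgue. \<sigma> \<in> {0<..<T} \<longrightarrow> f \<sigma> \<in> sobolev 1 \<and> g \<sigma> \<in> sobolev 1" if "0 < T" for T
  proof -
    have I: "{0<..<T} \<in> sets lebesgue" by simp
    note b = I mH[OF that]
    show ?thesis using b unfolding bochner_measurable_def by (auto simp: AE_restrict_space_iff)
  qed
  then have "AE \<sigma> in lebesgue. \<sigma> \<in> {0<..<real (Suc n)} \<longrightarrow> f \<sigma> \<in> sobolev 1 \<and> g \<sigma> \<in> sobolev 1" for n
    using of_nat_0_less_iff zero_less_Suc by blast
  then have "AE \<sigma> in lebesgue. \<forall>n. \<sigma> \<in> {0<..<real (Suc n)} \<longrightarrow> f \<sigma> \<in> sobolev 1 \<and> g \<sigma> \<in> sobolev 1"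
    unfolding AE_all_countable by blast
  then show ?thesis
  proof eventually_elim
    case (elim \<sigma>)
    obtain n where "\<sigma> < real n" using reals_Archimedean2 by blast
    then have "\<sigma> < real (Suc n)" by simp
    then show ?case using elim by auto
  qed
qed

lemma K_measurable:
  "(\<lambda>t. if t \<in> {0<..<T} then Kf t else 0) \<in> borel_measurable lebesgue"
  "(\<lambda>t. if t \<in> {0<..<T} then Kg t else 0) \<in> borel_measurable lebesgue"
proof -
  have I: "{0<..<T} \<in> sets lebesgue" by simp
  have "(\<lambda>t. if t \<in> {0<..<T} then Kf t else 0) \<in> borel_measurable lebesgue \<and> (\<lambda>t. if t \<in> {0<..<T} then Kg t else 0) \<in> borel_measurable lebesgue"
  proof (cases "0 < T")
    case True
    show ?thesis using slope_mass_measurable(1)[OF I mH(1)[OF True] mH(2)[OF True]] slope_mass_measurable(2)[OF I mH(1)[OF True] mH(2)[OF True]] by blast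
  next
    case False
    then have "{0<..<T} = {}" by auto
    then show ?thesis by simp
  qed
  then show "(\<lambda>t. if t \<in> {0<..<T} then Kf t else 0) \<in> borel_measurable lebesgue"
    "(\<lambda>t. if t \<in> {0<..<T} then Kg t else 0) \<in> borel_measurable lebesgue" by auto
qed

lemma K_integral:
  assumes "0 \<le> s" "s \<le> t" "0 < e" "0 \<le> d"
  shows "(\<integral>\<^sup>+\<sigma>\<in>{s..t}. Df \<sigma> \<partial>lebesgue) \<le> ennreal d \<Longrightarrow> (\<integral>\<^sup>+\<sigma>\<in>{s..t}. Kf \<sigma> \<partial>lebesgue) \<le> ennreal (e / 2 * (t - s) + d / (2 * e))"
    "(\<integral>\<^sup>+\<sigma>\<in>{s..t}. Dg \<sigma> \<partial>lebesgue) \<le> ennreal d \<Longrightarrow> (\<integral>\<^sup>+\<sigma>\<in>{s..t}. Kg \<sigma> \<partial>lebesgue) \<le> ennreal (e / 2 * (t - s) + d / (2 * e))"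
proof -
  have S: "AE \<sigma> in lebesgue. \<sigma> \<in> {0<..<t + 1} \<longrightarrow> f \<sigma> \<in> sobolev 1 \<and> g \<sigma> \<in> sobolev 1"
    using sobolev_AE by eventually_elim auto
  show "(\<integral>\<^sup>+\<sigma>\<in>{s..t}. Df \<sigma> \<partial>lebesgue) \<le> ennreal d \<Longrightarrow> (\<integral>\<^sup>+\<sigma>\<in>{s..t}. Kf \<sigma> \<partial>lebesgue) \<le> ennreal (e / 2 * (t - s) + d / (2 * e))"
    by (rule slope_mass_time_integral[OF K_measurable(1)[of "t + 1"] S fK assms(1,2) _ assms(3,4)]) auto
  show "(\<integral>\<^sup>+\<sigma>\<in>{s..t}. Dg \<sigma> \<partial>lebesgue) \<le> ennreal d \<Longrightarrow> (\<integral>\<^sup>+\<sigma>\<in>{s..t}. Kg \<sigma> \<partial>lebesgue) \<le> ennreal (e / 2 * (t - s) + d / (2 * e))"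
    by (rule slope_mass_time_integral[OF K_measurable(2)[of "t + 1"] S gK assms(1,2) _ assms(3,4)]) auto
qed

text \<open>The infimum runs over times outside \<open>N\<close> because only these may start the
  energy inequality. At a time in \<open>N\<close> the energy is bounded by that at earlier good
  times, but no lower comparison with later times is at hand.\<close>

definition "Einf = Inf (E ` ({0..} - N))"

lemma Einf_le: "0 \<le> t \<Longrightarrow> t \<notin> N \<Longrightarrow> Einf \<le> E t"
  unfolding Einf_def by (rule cInf_lower) (auto intro!: bdd_belowI[of _ 0] E_nonneg)

lemma E_near_Einf:
  assumes "0 < e"
  obtains T where "0 < T" "T \<notin> N" "\<And>t. T \<le> t \<Longrightarrow> E t \<le> Einf + e"
proof -
  have "0 \<notin> N" using N(2) by auto
  then have "E ` ({0..} - N) \<noteq> {}" by auto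
  then obtain y where "y \<in> E ` ({0..} - N)" "y < Einf + e"
    using cInf_lessD[of "E ` ({0..} - N)" "Einf + e"] assms by (auto simp: Einf_def)
  then obtain s where s: "0 \<le> s" "s \<notin> N" "E s < Einf + e" by auto
  \<comment> \<open>A later good time, so that the threshold is positive and lies outside
    \<open>N\<close> even if \<open>s = 0\<close>.\<close>
  obtain T where T: "s < T" "T < s + 1" "T \<notin> N" using null_set_avoid[OF N(1), of s "s + 1"] by auto
  show thesis
  proof (rule that[of T])
    fix t assume "T \<le> t"
    then show "E t \<le> Einf + e" using energy_D(1)[OF s(1,2), of t] s(3) T by simp
  qed (use T s in auto)
qed

lemma K_tail:
  assumes e: "0 < e"
  shows "\<exists>T>0. \<forall>t t'. T \<le> t \<longrightarrow> t \<le> t' \<longrightarrow> t' \<le> t + 2 \<longrightarrow>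
    (\<integral>\<^sup>+\<sigma>\<in>{t..t'}. Kf \<sigma> \<partial>lebesgue) \<le> ennreal e \<and> (\<integral>\<^sup>+\<sigma>\<in>{t..t'}. Kg \<sigma> \<partial>lebesgue) \<le> ennreal e"
proof -
  \<comment> \<open>With Young parameter \<open>e / 2\<close> on a window of length at most 2, both
    contributions in \<open>K_integral\<close> are at most \<open>e / 2\<close>.\<close>
  define d where "d = e\<^sup>2 / 2"
  have d: "0 < d" using e by (simp add: d_def)
  \<comment> \<open>An energy drop of at most \<open>h\<close> keeps both dissipation integrals,
    whose constants are 2 and \<open>2 / \<Theta>\<close>, below \<open>d\<close>.\<close>
  define h where "h = min (d / 2) (d * \<Theta> / 2)"
  have h: "0 < h" using d \<Theta> by (simp add: h_def)
  obtain T where T: "0 < T" "T \<notin> N" "\<And>t. T \<le> t \<Longrightarrow> E t \<le> Einf + h" using h by (rule E_near_Einf) blast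
  have dd: "e / 2 / 2 * 2 + d / (2 * (e / 2)) = e" using e by (simp add: d_def power2_eq_square)
  show ?thesis
  proof (intro exI[of _ T] conjI[OF T(1)] allI impI)
    fix t t' assume t: "T \<le> t" "t \<le> t'" "t' \<le> t + 2"
    \<comment> \<open>The comparison \<open>Einf \<le> E t'\<close> may fail if \<open>t'\<close> is
      in \<open>N\<close>; a good time shortly after \<open>t'\<close> takes its place.\<close>
    obtain q where q: "t' < q" "q < t' + 1" "q \<notin> N" using null_set_avoid[OF N(1), of t' "t' + 1"] by auto
    have "E T - E q \<le> h" using T(3)[of T] Einf_le[of q] q t T(1) by auto
    then have h2: "2 * (E T - E q) \<le> d" "2 / \<Theta> * (E T - E q) \<le> d"
      using \<Theta> by (auto simp: h_def field_simps)
    have sub: "(\<integral>\<^sup>+\<sigma>\<in>{t..t'}. D \<sigma> \<partial>lebesgue) \<le> (\<integral>\<^sup>+\<sigma>\<in>{T..q}. D \<sigma> \<partial>lebesgue)" for D :: "real \<Rightarrow> ennreal"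
      using t q by (intro nn_integral_mono) (auto simp: indicator_def)
    have D: "(\<integral>\<^sup>+\<sigma>\<in>{t..t'}. Df \<sigma> \<partial>lebesgue) \<le> ennreal d" "(\<integral>\<^sup>+\<sigma>\<in>{t..t'}. Dg \<sigma> \<partial>lebesgue) \<le> ennreal d"
      using order_trans[OF sub order_trans[OF energy_D(2) ennreal_leI[OF h2(1)]]]
        order_trans[OF sub order_trans[OF energy_D(3) ennreal_leI[OF h2(2)]]] T t q by auto
    have le: "e / 2 / 2 * (t' - t) + d / (2 * (e / 2)) \<le> e"
    proof -
      have "e / 2 / 2 * (t' - t) \<le> e / 2 / 2 * 2" using t e by (intro mult_left_mono) auto
      then show ?thesis using dd by linarith
    qed
    have pos: "0 \<le> t" "0 < e / 2" "0 \<le> d" using t T e d by auto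
    show "(\<integral>\<^sup>+\<sigma>\<in>{t..t'}. Kf \<sigma> \<partial>lebesgue) \<le> ennreal e \<and> (\<integral>\<^sup>+\<sigma>\<in>{t..t'}. Kg \<sigma> \<partial>lebesgue) \<le> ennreal e"
      using order_trans[OF K_integral(1)[OF pos(1) t(2) pos(2,3) D(1)] ennreal_leI[OF le]]
        order_trans[OF K_integral(2)[OF pos(1) t(2) pos(2,3) D(2)] ennreal_leI[OF le]] by blast
  qed
qed

lemma K_finite:
  assumes "0 \<le> t"
  shows "(\<integral>\<^sup>+\<sigma>\<in>{0..t}. Kf \<sigma> \<partial>lebesgue) < \<infinity>" "(\<integral>\<^sup>+\<sigma>\<in>{0..t}. Kg \<sigma> \<partial>lebesgue) < \<infinity>"
proof -
  have 0: "0 \<notin> N" using N(2) by auto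
  have "0 \<le> E 0 - E t" using energy_D(1)[OF _ 0 assms] by simp
  then have "0 \<le> 2 * (E 0 - E t)" "0 \<le> 2 / \<Theta> * (E 0 - E t)" using \<Theta> by auto
  note * = K_integral(1)[OF _ assms zero_less_one this(1) energy_D(2)[OF _ 0 assms]] K_integral(2)[OF _ assms zero_less_one this(2) energy_D(3)[OF _ 0 assms]]
  show "(\<integral>\<^sup>+\<sigma>\<in>{0..t}. Kf \<sigma> \<partial>lebesgue) < \<infinity>" "(\<integral>\<^sup>+\<sigma>\<in>{0..t}. Kg \<sigma> \<partial>lebesgue) < \<infinity>"
    using *[THEN le_less_trans[OF _ ennreal_less_top]] by auto
qed

lemma press_slope:
  assumes "f \<sigma> \<in> sobolev 1" "g \<sigma> \<in> sobolev 1"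
  shows "AE x in lebesgue. weak_deriv (press_f R \<eta> (f \<sigma>) (g \<sigma>)) x = slope a R (f \<sigma>) (g \<sigma>) x"
    "AE x in lebesgue. weak_deriv (press_g R\<^sub>\<mu> \<eta> (f \<sigma>) (g \<sigma>)) x = slope (\<eta>\<^sup>2 * R\<^sub>\<mu>) R\<^sub>\<mu> (f \<sigma>) (g \<sigma>) x"
proof -
  have "has_weak_deriv (f \<sigma>) (weak_deriv (f \<sigma>))" "has_weak_deriv (g \<sigma>) (weak_deriv (g \<sigma>))"
    using assms unfolding sobolev_1_iff by auto
  note w = weak_deriv_pressure[OF this]
  show "AE x in lebesgue. weak_deriv (press_f R \<eta> (f \<sigma>) (g \<sigma>)) x = slope a R (f \<sigma>) (g \<sigma>) x"
    using weak_deriv_AE[OF w[of a R]] by (simp add: press_f_def slope_def a_def)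
  show "AE x in lebesgue. weak_deriv (press_g R\<^sub>\<mu> \<eta> (f \<sigma>) (g \<sigma>)) x = slope (\<eta>\<^sup>2 * R\<^sub>\<mu>) R\<^sub>\<mu> (f \<sigma>) (g \<sigma>) x"
    using weak_deriv_AE[OF w[of "\<eta>\<^sup>2 * R\<^sub>\<mu>" R\<^sub>\<mu>]] by (simp add: press_g_def slope_def)
qed

text \<open>The weak formulation expresses an increment against \<open>\<xi>\<close> as a time
  integral of the flux paired with \<open>deriv \<xi>\<close>, which a bound for
  \<open>deriv \<xi>\<close> and the tail of \<open>slope_mass\<close> control. The generic
  component \<open>w\<close> and gradient \<open>W\<close> let one proof serve both
  equations.\<close>

lemma flux_slow:
  fixes w :: "real \<Rightarrow> real \<Rightarrow> real" and w0 :: "real \<Rightarrow> real" and W :: "real \<Rightarrow> real \<Rightarrow> real"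
  assumes \<xi>: "\<xi> \<in> test_functions"
    and eq: "\<And>t. 0 \<le> t \<Longrightarrow> (\<integral>x. w t x * \<xi> x \<partial>lebesgue) - (\<integral>x. w0 x * \<xi> x \<partial>lebesgue)
        + (LINT \<sigma>:{0..t}|lebesgue. (\<integral>x. w \<sigma> x * W \<sigma> x * deriv \<xi> x \<partial>lebesgue)) = 0"
    and W: "\<And>\<sigma>. f \<sigma> \<in> sobolev 1 \<Longrightarrow> g \<sigma> \<in> sobolev 1 \<Longrightarrow> AE x in lebesgue. W \<sigma> x = slope \<alpha> \<beta> (f \<sigma>) (g \<sigma>) x"
    and wS: "\<And>\<sigma>. f \<sigma> \<in> sobolev 1 \<Longrightarrow> g \<sigma> \<in> sobolev 1 \<Longrightarrow> w \<sigma> \<in> sobolev 1"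
    and m: "\<And>T \<zeta> B A. 0 < T \<Longrightarrow> \<zeta> \<in> borel_measurable lebesgue \<Longrightarrow> (\<And>x. \<bar>\<zeta> x\<bar> \<le> B) \<Longrightarrow> (\<And>x. A < \<bar>x\<bar> \<Longrightarrow> \<zeta> x = 0) \<Longrightarrow>
      (\<lambda>t. if t \<in> {0<..<T} then \<integral>x. w t x * (\<zeta> x * slope \<alpha> \<beta> (f t) (g t) x) \<partial>lebesgue else 0) \<in> borel_measurable lebesgue"
    and mK: "\<And>T. (\<lambda>t. if t \<in> {0<..<T} then slope_mass \<alpha> \<beta> (w t) (f t) (g t) else 0) \<in> borel_measurable lebesgue"
    and fin: "\<And>t. 0 \<le> t \<Longrightarrow> (\<integral>\<^sup>+\<sigma>\<in>{0..t}. slope_mass \<alpha> \<beta> (w \<sigma>) (f \<sigma>) (g \<sigma>) \<partial>lebesgue) < \<infinity>"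
    and tail: "\<And>e. 0 < e \<Longrightarrow> \<exists>T>0. \<forall>t t'. T \<le> t \<longrightarrow> t \<le> t' \<longrightarrow> t' \<le> t + 2 \<longrightarrow>
      (\<integral>\<^sup>+\<sigma>\<in>{t..t'}. slope_mass \<alpha> \<beta> (w \<sigma>) (f \<sigma>) (g \<sigma>) \<partial>lebesgue) \<le> ennreal e"
  shows "slowly_varying (\<lambda>t. \<integral>x. w t x * \<xi> x \<partial>lebesgue)"
proof -
  define J where "J \<sigma> = (\<integral>x. w \<sigma> x * W \<sigma> x * deriv \<xi> x \<partial>lebesgue)" for \<sigma>
  let ?K = "\<lambda>\<sigma>. slope_mass \<alpha> \<beta> (w \<sigma>) (f \<sigma>) (g \<sigma>)"
  note \<xi>' = test_deriv[OF \<xi>]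
  have m\<xi>: "deriv \<xi> \<in> borel_measurable lebesgue" by (rule test_measurable[OF \<xi>'])
  obtain B where B: "0 < B" "\<And>x. \<bar>deriv \<xi> x\<bar> \<le> B" using test_bounded[OF \<xi>'] by metis
  obtain A where A: "\<And>x. A \<le> \<bar>x\<bar> \<Longrightarrow> deriv \<xi> x = 0" using test_support[OF \<xi>'] by metis
  have J_eq: "J \<sigma> = (\<integral>x. w \<sigma> x * (deriv \<xi> x * slope \<alpha> \<beta> (f \<sigma>) (g \<sigma>) x) \<partial>lebesgue) \<and> ennreal \<bar>J \<sigma>\<bar> \<le> ennreal B * ?K \<sigma>"
    if S: "f \<sigma> \<in> sobolev 1" "g \<sigma> \<in> sobolev 1" for \<sigma>
  proof -
    have L: "w \<sigma> \<in> L2" by (rule sobolev_1_L2(1)[OF wS[OF S]])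
    have [measurable]: "w \<sigma> \<in> borel_measurable lebesgue" using L by (simp add: L2_def)
    note [measurable] = slope_measurable[OF S, of \<alpha> \<beta>] m\<xi>
    have mW: "W \<sigma> \<in> borel_measurable lebesgue"
      by (rule lebesgue_measurable_AE_eq[OF slope_measurable[OF S, of \<alpha> \<beta>]]) (use W[OF S] in \<open>auto elim: eventually_mono\<close>)
    have eqJ: "J \<sigma> = (\<integral>x. w \<sigma> x * (deriv \<xi> x * slope \<alpha> \<beta> (f \<sigma>) (g \<sigma>) x) \<partial>lebesgue)"
      unfolding J_def
    proof (rule integral_cong_AE)
      show "AE x in lebesgue. w \<sigma> x * W \<sigma> x * deriv \<xi> x = w \<sigma> x * (deriv \<xi> x * slope \<alpha> \<beta> (f \<sigma>) (g \<sigma>) x)"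
        using W[OF S] by eventually_elim simp
      show "(\<lambda>x. w \<sigma> x * W \<sigma> x * deriv \<xi> x) \<in> borel_measurable lebesgue" using mW by measurable
    qed measurable
    have "(\<lambda>x. deriv \<xi> x * slope \<alpha> \<beta> (f \<sigma>) (g \<sigma>) x) \<in> L2"
      by (rule cutoff_slope_L2[OF S m\<xi> B(2), where A=A]) (use A in auto)
    then have "integrable lebesgue (\<lambda>x. w \<sigma> x * (deriv \<xi> x * slope \<alpha> \<beta> (f \<sigma>) (g \<sigma>) x))" by (rule L2_mult_integrable[OF L])
    then have "ennreal \<bar>J \<sigma>\<bar> \<le> (\<integral>\<^sup>+x. ennreal (norm (w \<sigma> x * (deriv \<xi> x * slope \<alpha> \<beta> (f \<sigma>) (g \<sigma>) x))) \<partial>lebesgue)"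
      unfolding eqJ real_norm_def[symmetric] by (rule integral_norm_bound_ennreal)
    also have "\<dots> \<le> (\<integral>\<^sup>+x. ennreal B * ennreal \<bar>w \<sigma> x * slope \<alpha> \<beta> (f \<sigma>) (g \<sigma>) x\<bar> \<partial>lebesgue)"
    proof (intro nn_integral_mono)
      fix x
      have "\<bar>w \<sigma> x * (deriv \<xi> x * slope \<alpha> \<beta> (f \<sigma>) (g \<sigma>) x)\<bar> = \<bar>deriv \<xi> x\<bar> * \<bar>w \<sigma> x * slope \<alpha> \<beta> (f \<sigma>) (g \<sigma>) x\<bar>"
        by (simp add: abs_mult)
      also have "\<dots> \<le> B * \<bar>w \<sigma> x * slope \<alpha> \<beta> (f \<sigma>) (g \<sigma>) x\<bar>" by (intro mult_right_mono B) simp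
      finally show "ennreal (norm (w \<sigma> x * (deriv \<xi> x * slope \<alpha> \<beta> (f \<sigma>) (g \<sigma>) x))) \<le> ennreal B * ennreal \<bar>w \<sigma> x * slope \<alpha> \<beta> (f \<sigma>) (g \<sigma>) x\<bar>"
        using B(1) by (simp add: ennreal_mult[symmetric] ennreal_leI)
    qed
    also have "\<dots> = ennreal B * ?K \<sigma>" unfolding slope_mass_def by (rule nn_integral_cmult) measurable
    finally show ?thesis using eqJ by blast
  qed
  have ne0: "AE \<sigma> in lebesgue. \<sigma> \<noteq> (0::real)" using AE_completion[OF AE_lborel_singleton[of "0::real"]] .
  have bound: "(\<integral>\<^sup>+\<sigma>. ennreal (norm (indicator {s..t} \<sigma> *\<^sub>R J \<sigma>)) \<partial>lebesgue) \<le> ennreal B * (\<integral>\<^sup>+\<sigma>\<in>{s..t}. ?K \<sigma> \<partial>lebesgue)"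
    if st: "0 \<le> s" "s \<le> t" for s t
  proof -
    \<comment> \<open>\<open>slope_mass\<close> cut to a bounded open time interval, where its
      measurability is known; the end point 0 is a null set.\<close>
    define h where "h \<sigma> = (if \<sigma> \<in> {0<..<t + 1} then ?K \<sigma> else 0)" for \<sigma>
    have [measurable]: "h \<in> borel_measurable lebesgue" using mK[of "t + 1"] by (simp add: h_def[abs_def])
    have [measurable]: "{s..t} \<in> sets lebesgue" by simp
    have hK: "AE \<sigma> in lebesgue. h \<sigma> * indicator {s..t} \<sigma> = ?K \<sigma> * indicator {s..t} \<sigma>"
      using ne0 by eventually_elim (use st in \<open>auto simp: h_def indicator_def\<close>)
    have "(\<integral>\<^sup>+\<sigma>. ennreal (norm (indicator {s..t} \<sigma> *\<^sub>R J \<sigma>)) \<partial>lebesgue) \<le> (\<integral>\<^sup>+\<sigma>. ennreal B * (h \<sigma> * indicator {s..t} \<sigma>) \<partial>lebesgue)"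
    proof (rule nn_integral_mono_AE)
      show "AE \<sigma> in lebesgue. ennreal (norm (indicator {s..t} \<sigma> *\<^sub>R J \<sigma>)) \<le> ennreal B * (h \<sigma> * indicator {s..t} \<sigma>)"
        using sobolev_AE ne0 hK
      proof eventually_elim
        case (elim \<sigma>)
        show ?case
        proof (cases "\<sigma> \<in> {s..t}")
          case True
          then have "0 < \<sigma>" using elim st by auto
          then show ?thesis using J_eq[of \<sigma>] elim True by (auto simp: indicator_def)
        qed simp
      qed
    qed
    also have "\<dots> = ennreal B * (\<integral>\<^sup>+\<sigma>. h \<sigma> * indicator {s..t} \<sigma> \<partial>lebesgue)" by (rule nn_integral_cmult) measurable
    also have "(\<integral>\<^sup>+\<sigma>. h \<sigma> * indicator {s..t} \<sigma> \<partial>lebesgue) = (\<integral>\<^sup>+\<sigma>\<in>{s..t}. ?K \<sigma> \<partial>lebesgue)" by (rule nn_integral_cong_AE[OF hK])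
    finally show ?thesis .
  qed
  \<comment> \<open>Splitting the time integral at \<open>t\<close> requires integrability: a
    divergent integral would take the default value 0, and the two instances of the weak formulation
    could not be subtracted.\<close>
  have Jint: "set_integrable lebesgue {0..t} J" if t: "0 \<le> t" for t
    unfolding set_integrable_def
  proof (rule integrableI_bounded)
    have "(\<lambda>\<sigma>. indicator {0..t} \<sigma> * (if \<sigma> \<in> {0<..<t + 1} then \<integral>x. w \<sigma> x * (deriv \<xi> x * slope \<alpha> \<beta> (f \<sigma>) (g \<sigma>) x) \<partial>lebesgue else 0)) \<in> borel_measurable lebesgue"
      by (intro borel_measurable_times borel_measurable_indicator m[OF _ m\<xi> B(2), where A=A]) (use t A in auto)
    then show "(\<lambda>\<sigma>. indicator {0..t} \<sigma> *\<^sub>R J \<sigma>) \<in> borel_measurable lebesgue"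
    proof (rule lebesgue_measurable_AE_eq)
      show "AE \<sigma> in lebesgue. indicator {0..t} \<sigma> * (if \<sigma> \<in> {0<..<t + 1} then \<integral>x. w \<sigma> x * (deriv \<xi> x * slope \<alpha> \<beta> (f \<sigma>) (g \<sigma>) x) \<partial>lebesgue else 0) = indicator {0..t} \<sigma> *\<^sub>R J \<sigma>"
        using sobolev_AE ne0
      proof eventually_elim
        case (elim \<sigma>)
        show ?case
        proof (cases "\<sigma> \<in> {0..t}")
          case True
          then have "0 < \<sigma>" "\<sigma> \<in> {0<..<t + 1}" using elim by auto
          then show ?thesis using J_eq[of \<sigma>] elim True by simp
        qed simp
      qed
    qed
    have "ennreal B * (\<integral>\<^sup>+\<sigma>\<in>{0..t}. ?K \<sigma> \<partial>lebesgue) < \<infinity>" using fin[OF t] by (simp add: ennreal_mult_less_top)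
    then show "(\<integral>\<^sup>+\<sigma>. ennreal (norm (indicator {0..t} \<sigma> *\<^sub>R J \<sigma>)) \<partial>lebesgue) < \<infinity>"
      using bound[OF order_refl t] by (rule le_less_trans[rotated])
  qed
  show ?thesis
    unfolding slowly_varying_def
  proof (intro allI impI)
    fix e :: real assume e: "0 < e"
    have "0 < e / B" using e B by simp
    then obtain T where T: "0 < T" "\<And>t t'. T \<le> t \<Longrightarrow> t \<le> t' \<Longrightarrow> t' \<le> t + 2 \<Longrightarrow> (\<integral>\<^sup>+\<sigma>\<in>{t..t'}. ?K \<sigma> \<partial>lebesgue) \<le> ennreal (e / B)"
      using tail by blast
    show "\<exists>T. \<forall>t t'. T \<le> t \<longrightarrow> t \<le> t' \<longrightarrow> t' \<le> t + 2 \<longrightarrow> \<bar>(\<integral>x. w t' x * \<xi> x \<partial>lebesgue) - (\<integral>x. w t x * \<xi> x \<partial>lebesgue)\<bar> \<le> e"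
    proof (intro exI[of _ T] allI impI)
      fix t t' assume t: "T \<le> t" "t \<le> t'" "t' \<le> t + 2"
      have t0: "0 \<le> t" "0 \<le> t'" using t T by auto
      have i: "set_integrable lebesgue {t..t'} J" by (rule set_integrable_subset[OF Jint[OF t0(2)]]) (use t0 in auto)
      have "(LINT \<sigma>:{0..t}|lebesgue. J \<sigma>) + (LINT \<sigma>:{t..t'}|lebesgue. J \<sigma>) = (LINT \<sigma>:{0..t'}|lebesgue. J \<sigma>)"
        using Jint[OF t0(1)] Jint[OF t0(2)] i t t0
        by (simp add: set_lebesgue_integral_eq_integral Henstock_Kurzweil_Integration.integral_combine)
      then have d: "(\<integral>x. w t' x * \<xi> x \<partial>lebesgue) - (\<integral>x. w t x * \<xi> x \<partial>lebesgue) = - (LINT \<sigma>:{t..t'}|lebesgue. J \<sigma>)"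
        using eq[OF t0(1)] eq[OF t0(2)] unfolding J_def[symmetric] by linarith
      have "ennreal \<bar>LINT \<sigma>:{t..t'}|lebesgue. J \<sigma>\<bar> \<le> (\<integral>\<^sup>+\<sigma>. ennreal (norm (indicator {t..t'} \<sigma> *\<^sub>R J \<sigma>)) \<partial>lebesgue)"
        unfolding set_lebesgue_integral_def using integral_norm_bound_ennreal[OF i[unfolded set_integrable_def]] by simp
      also have "\<dots> \<le> ennreal B * (\<integral>\<^sup>+\<sigma>\<in>{t..t'}. ?K \<sigma> \<partial>lebesgue)" by (rule bound[OF t0(1) t(2)])
      also have "\<dots> \<le> ennreal B * ennreal (e / B)" by (rule mult_left_mono[OF T(2)[OF t]]) simp
      also have "\<dots> = ennreal e" using B(1) e by (simp add: ennreal_mult[symmetric])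
      finally have "\<bar>LINT \<sigma>:{t..t'}|lebesgue. J \<sigma>\<bar> \<le> e" using e by simp
      then show "\<bar>(\<integral>x. w t' x * \<xi> x \<partial>lebesgue) - (\<integral>x. w t x * \<xi> x \<partial>lebesgue)\<bar> \<le> e" unfolding d by simp
    qed
  qed
qed

lemma slow:
  assumes \<xi>: "\<xi> \<in> test_functions"
  shows "slowly_varying (\<lambda>t. \<integral>x. f t x * \<xi> x \<partial>lebesgue)" "slowly_varying (\<lambda>t. \<integral>x. g t x * \<xi> x \<partial>lebesgue)"
proof -
  have I: "{0<..<T} \<in> sets lebesgue" for T :: real by simp
  note m = slope_functional_measurable(1,2)[OF I mH]
  show "slowly_varying (\<lambda>t. \<integral>x. f t x * \<xi> x \<partial>lebesgue)"
  proof (rule flux_slow[OF \<xi> weak(1)[OF \<xi>] press_slope(1) _ m(1) K_measurable(1) K_finite(1)])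
    fix e :: real assume "0 < e"
    show "\<exists>T>0. \<forall>t t'. T \<le> t \<longrightarrow> t \<le> t' \<longrightarrow> t' \<le> t + 2 \<longrightarrow> (\<integral>\<^sup>+\<sigma>\<in>{t..t'}. Kf \<sigma> \<partial>lebesgue) \<le> ennreal e"
      using K_tail[OF \<open>0 < e\<close>] by blast
  qed
  show "slowly_varying (\<lambda>t. \<integral>x. g t x * \<xi> x \<partial>lebesgue)"
  proof (rule flux_slow[OF \<xi> weak(2)[OF \<xi>] press_slope(2) _ m(2) K_measurable(2) K_finite(2)])
    fix e :: real assume "0 < e"
    show "\<exists>T>0. \<forall>t t'. T \<le> t \<longrightarrow> t \<le> t' \<longrightarrow> t' \<le> t + 2 \<longrightarrow> (\<integral>\<^sup>+\<sigma>\<in>{t..t'}. Kg \<sigma> \<partial>lebesgue) \<le> ennreal e"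
      using K_tail[OF \<open>0 < e\<close>] by blast
  qed
qed

lemma E_bound: "0 \<le> t \<Longrightarrow> E t \<le> E 0"
  using energy_D(1)[of 0 t] N(2) by auto

lemma E_P_set_integrable:
  assumes "0 < s"
  shows "set_integrable lebesgue {s..t} E" "set_integrable lebesgue {s..t} P"
proof -
  have I: "{0<..} \<in> sets (lebesgue :: real measure)" by simp
  have i: "integrable lebesgue (\<lambda>x. E 0 * indicator {s..t} x)"
    by (intro integrable_mult_right integrable_real_indicator) (auto simp: emeasure_lborel_Icc_eq)
  have *: "set_integrable lebesgue {s..t} h"
    if m: "(\<lambda>t. if t \<in> {0<..} then h t else 0) \<in> borel_measurable lebesgue" and h: "\<And>t. 0 \<le> t \<Longrightarrow> \<bar>h t\<bar> \<le> E 0" for h :: "real \<Rightarrow> real"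
    unfolding set_integrable_def
  proof (rule Bochner_Integration.integrable_bound[OF i])
    have "(\<lambda>x. indicator {s..t} x * (if x \<in> {0<..} then h x else 0)) \<in> borel_measurable lebesgue"
      by (intro borel_measurable_times borel_measurable_indicator m) simp
    moreover have "(\<lambda>x. indicator {s..t} x * (if x \<in> {0<..} then h x else 0)) = (\<lambda>x. indicator {s..t} x *\<^sub>R h x)"
      using assms by (auto simp: indicator_def)
    ultimately show "(\<lambda>x. indicator {s..t} x *\<^sub>R h x) \<in> borel_measurable lebesgue" by simp
    show "AE x in lebesgue. norm (indicator {s..t} x *\<^sub>R h x) \<le> norm (E 0 * indicator {s..t} x)"
      using h assms E_nonneg[of 0] by (auto simp: indicator_def intro!: AE_I2)
  qed
  note em = energy_measurable(1)[OF I mX, of a R c "1 / 6" "\<Theta> / 6"] energy_measurable(2)[OF I mX, of "1 / 6" "\<Theta> / 6"]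
  show "set_integrable lebesgue {s..t} E" by (rule *[OF em(1)]) (use E_bound E_nonneg in auto)
  show "set_integrable lebesgue {s..t} P"
  proof (rule *[OF em(2)])
    fix t :: real assume "0 \<le> t"
    then show "\<bar>P t\<bar> \<le> E 0" using P_nonneg[of t] P_le_E[of t] E_bound[of t] by linarith
  qed
qed

text \<open>Since \<open>M2\<close> is six times the potential energy, the moment identity divided
  by 6 is exactly the relaxation equation. Energies converge off the null set \<open>N\<close>,
  which the relaxation tolerates.\<close>

lemma P_tendsto: "(P \<longlongrightarrow> Einf / 3) at_top"
proof (rule relaxation[OF N(1)])
  fix s t :: real assume st: "0 < s" "s \<notin> N" "s \<le> t"
  have cong: "(LINT \<sigma>:{s..t}|lebesgue. M2 R R\<^sub>\<mu> \<eta> (f \<sigma>) (g \<sigma>)) = (LINT \<sigma>:{s..t}|lebesgue. 6 * P \<sigma>)"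
    "(LINT \<sigma>:{s..t}|lebesgue. Estar R R\<^sub>\<mu> \<eta> (f \<sigma>) (g \<sigma>)) = (LINT \<sigma>:{s..t}|lebesgue. E \<sigma>)"
    using st E_eq by (intro set_lebesgue_integral_cong; auto)+
  show "P t + (LINT x:{s..t}|lebesgue. P x) = P s + 1 / 3 * (LINT x:{s..t}|lebesgue. E x)"
    using moment[of s t] st E_eq(2)[of s] E_eq(2)[of t] unfolding moment_eq_def cong by simp
next
  fix e :: real assume "0 < e"
  then obtain T where T: "0 < T" "\<And>t. T \<le> t \<Longrightarrow> E t \<le> Einf + e" by (rule E_near_Einf) blast
  have "\<bar>E t - Einf\<bar> \<le> e" if "T \<le> t" "t \<notin> N" for t using T(2)[OF that(1)] Einf_le[of t] that T(1) \<open>0 < e\<close> by auto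
  then show "\<exists>T. \<forall>t\<ge>T. t \<notin> N \<longrightarrow> \<bar>E t - Einf\<bar> \<le> e" by blast
next
  fix t :: real assume t: "0 < t"
  show "\<bar>P t\<bar> \<le> E 0" using P_nonneg[of t] P_le_E[of t] E_bound[of t] t by linarith
  show "\<bar>E t\<bar> \<le> E 0" using E_nonneg[of t] E_bound[of t] t by linarith
qed (rule E_P_set_integrable; assumption)+

section \<open>Entropy bound for the derivatives and choice of good times\<close>

abbreviation "H\<sigma> \<sigma> \<equiv> quad_energy a R c (weak_deriv (f \<sigma>)) (weak_deriv (g \<sigma>))"

text \<open>Integrability in time, taken from the H^1 regularity, rules out that the integral in the
  entropy inequality is the default value 0 of a divergent one, in which case the inequality would
  not bound the derivatives.\<close>

lemma H_integrable:
  assumes "0 < s" "s \<le> t"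
  shows "set_integrable lebesgue {s..t} H\<sigma>"
    "(LINT \<sigma>:{s..t}|lebesgue. \<eta>\<^sup>2 * (norm_L2 (weak_deriv (f \<sigma>)))\<^sup>2 + R * inverse (\<eta>\<^sup>2)
            * (norm_L2 (\<lambda>x. \<eta>\<^sup>2 * weak_deriv (f \<sigma>) x + weak_deriv (g \<sigma>) x))\<^sup>2) = 2 * (LINT \<sigma>:{s..t}|lebesgue. H\<sigma> \<sigma>)"
proof -
  define T where "T = t + 1"
  have T: "0 < T" using assms by (simp add: T_def)
  have I: "{0<..<T} \<in> sets lebesgue" by simp
  have sub: "\<sigma> \<in> {0<..<T}" if "\<sigma> \<in> {s..t}" for \<sigma> using that assms by (auto simp: T_def)
  have ii: "integrable lebesgue (\<lambda>\<sigma>. indicator {0<..<T} \<sigma> * (norm_H 1 (w \<sigma>))\<^sup>2)"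
    if "bochner_L2 {0<..<T} (sobolev 1) (norm_H 1) w" for w
    using that integrable_restrict_space[of "{0<..<T}" lebesgue "\<lambda>\<sigma>. (norm_H 1 (w \<sigma>))\<^sup>2"] by (simp add: bochner_L2_def)
  let ?B = "\<lambda>\<sigma>. (\<bar>a\<bar> + R) * (indicator {0<..<T} \<sigma> * (norm_H 1 (f \<sigma>))\<^sup>2) + (\<bar>c\<bar> + R) * (indicator {0<..<T} \<sigma> * (norm_H 1 (g \<sigma>))\<^sup>2)"
  have iB: "integrable lebesgue ?B" using ii[OF L2H(1)[OF T]] ii[OF L2H(2)[OF T]] by auto
  have meas: "(\<lambda>\<sigma>. indicator {s..t} \<sigma> *\<^sub>R H\<sigma> \<sigma>) \<in> borel_measurable lebesgue"
  proof -
    have "(\<lambda>\<sigma>. indicator {s..t} \<sigma> * (if \<sigma> \<in> {0<..<T} then H\<sigma> \<sigma> else 0)) \<in> borel_measurable lebesgue"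
      by (intro borel_measurable_times borel_measurable_indicator deriv_energy_measurable[OF I mH(1)[OF T] mH(2)[OF T]]) simp
    moreover have "(\<lambda>\<sigma>. indicator {s..t} \<sigma> * (if \<sigma> \<in> {0<..<T} then H\<sigma> \<sigma> else 0)) = (\<lambda>\<sigma>. indicator {s..t} \<sigma> *\<^sub>R H\<sigma> \<sigma>)"
      using sub by (auto simp: indicator_def fun_eq_iff)
    ultimately show ?thesis by simp
  qed
  have bd: "AE \<sigma> in lebesgue. norm (indicator {s..t} \<sigma> *\<^sub>R H\<sigma> \<sigma>) \<le> norm (?B \<sigma>)"
    using sobolev_AE
  proof eventually_elim
    case (elim \<sigma>)
    show ?case
    proof (cases "\<sigma> \<in> {s..t}")
      case True
      then have S: "f \<sigma> \<in> sobolev 1" "g \<sigma> \<in> sobolev 1" using elim assms by auto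
      note L = sobolev_1_L2(2)[OF S(1)] sobolev_1_L2(2)[OF S(2)]
      have "0 \<le> H\<sigma> \<sigma>" by (intro quad_energy_nonneg a c det L)
      moreover have "H\<sigma> \<sigma> \<le> (\<bar>a\<bar> + R) * (norm_L2 (weak_deriv (f \<sigma>)))\<^sup>2 + (\<bar>c\<bar> + R) * (norm_L2 (weak_deriv (g \<sigma>)))\<^sup>2"
        using R by (intro quad_energy_upper L) simp
      moreover have "\<dots> \<le> (\<bar>a\<bar> + R) * (norm_H 1 (f \<sigma>))\<^sup>2 + (\<bar>c\<bar> + R) * (norm_H 1 (g \<sigma>))\<^sup>2"
        using R by (intro add_mono mult_left_mono power_mono norm_H_1_bounds) auto
      ultimately show ?thesis using True sub[OF True] by simp
    qed simp
  qed
  show "set_integrable lebesgue {s..t} H\<sigma>"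
    unfolding set_integrable_def by (rule Bochner_Integration.integrable_bound[OF iB meas bd])
  let ?h = "\<lambda>\<sigma>. \<eta>\<^sup>2 * (norm_L2 (weak_deriv (f \<sigma>)))\<^sup>2 + R * inverse (\<eta>\<^sup>2)
            * (norm_L2 (\<lambda>x. \<eta>\<^sup>2 * weak_deriv (f \<sigma>) x + weak_deriv (g \<sigma>) x))\<^sup>2"
  have ae: "AE \<sigma> in lebesgue. indicator {s..t} \<sigma> *\<^sub>R (2 * H\<sigma> \<sigma>) = indicator {s..t} \<sigma> *\<^sub>R ?h \<sigma>"
    using sobolev_AE
  proof eventually_elim
    case (elim \<sigma>)
    show ?case
    proof (cases "\<sigma> \<in> {s..t}")
      case True
      then have S: "f \<sigma> \<in> sobolev 1" "g \<sigma> \<in> sobolev 1" using elim assms by auto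
      show ?thesis using deriv_energy_eq[OF sobolev_1_L2(2)[OF S(1)] sobolev_1_L2(2)[OF S(2)] \<eta>, of R] by (simp add: a_def c_def)
    qed simp
  qed
  have "(\<lambda>\<sigma>. indicator {s..t} \<sigma> *\<^sub>R (2 * H\<sigma> \<sigma>)) = (\<lambda>\<sigma>. 2 * (indicator {s..t} \<sigma> *\<^sub>R H\<sigma> \<sigma>))" by auto
  then have m2: "(\<lambda>\<sigma>. indicator {s..t} \<sigma> *\<^sub>R (2 * H\<sigma> \<sigma>)) \<in> borel_measurable lebesgue" using meas by simp
  have "(LINT \<sigma>:{s..t}|lebesgue. ?h \<sigma>) = (LINT \<sigma>:{s..t}|lebesgue. 2 * H\<sigma> \<sigma>)"
    unfolding set_lebesgue_integral_def
    by (rule integral_cong_AE[OF lebesgue_measurable_AE_eq[OF m2 ae] m2]) (use ae in \<open>auto elim: eventually_mono\<close>)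
  then show "(LINT \<sigma>:{s..t}|lebesgue. ?h \<sigma>) = 2 * (LINT \<sigma>:{s..t}|lebesgue. H\<sigma> \<sigma>)" by simp
qed

text \<open>The lower bound is the essential half: it turns the entropy inequality into a bound for
  the time integral of the derivative energy. It holds because the energy bounds the second moments,
  which prevents spreading.\<close>

lemma entropy_bounded:
  obtains C where "\<And>t. 0 \<le> t \<Longrightarrow> \<bar>Hfun R R\<^sub>\<mu> \<eta> (f t) (g t)\<bar> \<le> C"
proof -
  let ?k = "coercivity a R c"
  have k: "0 < ?k" by (intro coercivity_pos a c det)
  define Q :: real where "Q = (\<integral>x. 1 / (1 + x\<^sup>2) \<partial>lebesgue)"
  define M where "M = E 0 / ?k + 6 * E 0"
  define M' where "M' = E 0 / ?k + 6 * E 0 / \<Theta>"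
  show thesis
  proof (rule that[of "(M + Q) + \<Theta> * (M' + Q)"])
    fix t :: real assume t: "0 \<le> t"
    note K = fK[OF t] gK[OF t]
    have q: "?k * ((norm_L2 (f t))\<^sup>2 + (norm_L2 (g t))\<^sup>2) \<le> quad_energy a R c (f t) (g t)"
      by (intro quad_energy_coercive a c det setK_integrable K)
    have E: "quad_energy a R c (f t) (g t) \<le> E 0" "P t \<le> E 0"
      using E_bound[OF t] P_nonneg[OF t] P_le_E[OF t] by (auto simp: energy_def)
    have "(norm_L2 (f t))\<^sup>2 + (norm_L2 (g t))\<^sup>2 \<le> E 0 / ?k" using q E k by (simp add: pos_le_divide_eq mult.commute)
    then have n: "(norm_L2 (f t))\<^sup>2 \<le> E 0 / ?k" "(norm_L2 (g t))\<^sup>2 \<le> E 0 / ?k"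
      using zero_le_power2[of "norm_L2 (f t)"] zero_le_power2[of "norm_L2 (g t)"] by linarith+
    have Pe: "1 / 6 * (\<integral>x. x\<^sup>2 * f t x \<partial>lebesgue) + \<Theta> / 6 * (\<integral>x. x\<^sup>2 * g t x \<partial>lebesgue) \<le> E 0"
      using E(2) pot_energy_eq[OF setK_D(1)[OF K(1)] setK_D(1)[OF K(2)]] by simp
    have "0 \<le> \<Theta> / 6 * (\<integral>x. x\<^sup>2 * g t x \<partial>lebesgue)" using moment_nonneg[OF K(2)] \<Theta> by simp
    then have mf: "(\<integral>x. x\<^sup>2 * f t x \<partial>lebesgue) \<le> 6 * E 0" and mg': "\<Theta> / 6 * (\<integral>x. x\<^sup>2 * g t x \<partial>lebesgue) \<le> E 0"
      using Pe moment_nonneg[OF K(1)] by linarith+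
    then have mg: "(\<integral>x. x\<^sup>2 * g t x \<partial>lebesgue) \<le> 6 * E 0 / \<Theta>" using \<Theta> by (simp add: field_simps)
    define hf where "hf = (\<integral>x. f t x * ln (f t x) \<partial>lebesgue)"
    define hg where "hg = (\<integral>x. g t x * ln (g t x) \<partial>lebesgue)"
    have b: "\<bar>hf\<bar> \<le> M + Q" "\<bar>hg\<bar> \<le> M' + Q"
      using entropy_bound(2)[OF K(1)] entropy_bound(2)[OF K(2)] n mf mg unfolding M_def M'_def Q_def hf_def hg_def by linarith+
    have "Hfun R R\<^sub>\<mu> \<eta> (f t) (g t) = hf + \<Theta> * hg"
      unfolding Hfun_def \<Theta>_def[symmetric] hf_def hg_def using entropy_bound(1)[OF K(1)] entropy_bound(1)[OF K(2)] by simp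
    moreover have "\<bar>\<Theta> * hg\<bar> \<le> \<Theta> * (M' + Q)" using b(2) \<Theta> by (simp add: abs_mult)
    ultimately show "\<bar>Hfun R R\<^sub>\<mu> \<eta> (f t) (g t)\<bar> \<le> (M + Q) + \<Theta> * (M' + Q)" using b(1) by linarith
  qed
qed

text \<open>The length \<open>1 / 2\<close> allows the window to start at a good time in the first
  half of \<open>[k, k + 1]\<close> and still fit inside.\<close>

lemma H_integral_bound:
  obtains C where "0 \<le> C" "\<And>s. 0 < s \<Longrightarrow> s \<notin> N \<Longrightarrow> (LINT \<sigma>:{s..s + 1 / 2}|lebesgue. H\<sigma> \<sigma>) \<le> C"
proof -
  obtain C where C: "\<And>t. 0 \<le> t \<Longrightarrow> \<bar>Hfun R R\<^sub>\<mu> \<eta> (f t) (g t)\<bar> \<le> C" using entropy_bounded by blast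
  have C0: "0 \<le> C" using C[of 0] by linarith
  show thesis
  proof (rule that[of "C + (1 + \<Theta>) / 3"])
    show "0 \<le> C + (1 + \<Theta>) / 3" using C0 \<Theta> by simp
    fix s assume s: "0 < s" "s \<notin> N"
    have "2 * (LINT \<sigma>:{s..s + 1 / 2}|lebesgue. H\<sigma> \<sigma>) \<le> 2 * C + (1 + \<Theta>) / 3 * (1 / 2)"
      using entropy[of s "s + 1 / 2"] s C[of s] C[of "s + 1 / 2"] H_integrable(2)[of s "s + 1 / 2"]
      unfolding entropy_ineq_def \<Theta>_def[symmetric] by (simp add: abs_le_iff)
    moreover have "0 \<le> (1 + \<Theta>) / 3" using \<Theta> by simp
    ultimately show "(LINT \<sigma>:{s..s + 1 / 2}|lebesgue. H\<sigma> \<sigma>) \<le> C + (1 + \<Theta>) / 3" by linarith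
  qed
qed

text \<open>Chebyshev's inequality on a window of length \<open>1 / 2\<close>: each of the three
  quantities exceeds its threshold on a set of measure at most \<open>1 / 8\<close>, so some time
  outside null sets avoids all three.\<close>

lemma good_times:
  "\<exists>C. \<forall>(k::nat) \<delta>. 0 < \<delta> \<longrightarrow> (\<integral>\<^sup>+\<sigma>\<in>{real k..real k + 1}. Kf \<sigma> \<partial>lebesgue) \<le> ennreal \<delta> \<longrightarrow>
    (\<integral>\<^sup>+\<sigma>\<in>{real k..real k + 1}. Kg \<sigma> \<partial>lebesgue) \<le> ennreal \<delta> \<longrightarrow>
    (\<exists>\<sigma>. real k \<le> \<sigma> \<and> \<sigma> \<le> real k + 1 \<and> 0 < \<sigma> \<and> \<sigma> \<notin> N \<and> f \<sigma> \<in> sobolev 1 \<and> g \<sigma> \<in> sobolev 1 \<and> H\<sigma> \<sigma> \<le> C \<and>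
      Kf \<sigma> \<le> ennreal (8 * \<delta>) \<and> Kg \<sigma> \<le> ennreal (8 * \<delta>))"
proof -
  obtain C where C: "0 \<le> C" "\<And>s. 0 < s \<Longrightarrow> s \<notin> N \<Longrightarrow> (LINT \<sigma>:{s..s + 1 / 2}|lebesgue. H\<sigma> \<sigma>) \<le> C"
    using H_integral_bound by blast
  \<comment> \<open>The threshold makes \<open>C / C'\<close> at most \<open>1 / 8\<close>; the
    added 1 keeps it positive when \<open>C = 0\<close>.\<close>
  define C' where "C' = 8 * (C + 1)"
  have C': "0 < C'" "C / C' \<le> 1 / 8" using C(1) by (auto simp: C'_def field_simps)
  show ?thesis
  proof (rule exI[of _ C'], intro allI impI)
    fix k :: nat and \<delta> :: real
    assume \<delta>: "0 < \<delta>" and Kf: "(\<integral>\<^sup>+\<sigma>\<in>{real k..real k + 1}. Kf \<sigma> \<partial>lebesgue) \<le> ennreal \<delta>"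
      and Kg: "(\<integral>\<^sup>+\<sigma>\<in>{real k..real k + 1}. Kg \<sigma> \<partial>lebesgue) \<le> ennreal \<delta>"
    obtain s where s: "real k < s" "s < real k + 1 / 2" "s \<notin> N" using null_set_avoid[OF N(1), of "real k" "real k + 1 / 2"] by auto
    have s0: "0 < s" using s(1) by (meson le_less_trans of_nat_0_le_iff)
    let ?I = "{s..s + 1 / 2}"
    have sub: "?I \<subseteq> {real k..real k + 1}" "?I \<subseteq> {0<..<real k + 2}" using s s0 by auto
    define hf where "hf \<sigma> = (if \<sigma> \<in> {0<..<real k + 2} then Kf \<sigma> else 0)" for \<sigma>
    define hg where "hg \<sigma> = (if \<sigma> \<in> {0<..<real k + 2} then Kg \<sigma> else 0)" for \<sigma>
    have [measurable]: "hf \<in> borel_measurable lebesgue" "hg \<in> borel_measurable lebesgue"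
      unfolding hf_def[abs_def] hg_def[abs_def] by (rule K_measurable)+
    have [measurable]: "?I \<in> sets lebesgue" by simp
    have iH: "integrable lebesgue (\<lambda>\<sigma>. indicator ?I \<sigma> *\<^sub>R H\<sigma> \<sigma>)"
      using H_integrable(1)[OF s0, of "s + 1 / 2"] by (simp add: set_integrable_def)
    then have [measurable]: "(\<lambda>\<sigma>. indicator ?I \<sigma> *\<^sub>R H\<sigma> \<sigma>) \<in> borel_measurable lebesgue" by auto
    have If: "(\<integral>\<^sup>+\<sigma>. hf \<sigma> * indicator ?I \<sigma> \<partial>lebesgue) \<le> ennreal \<delta>" "(\<integral>\<^sup>+\<sigma>. hg \<sigma> * indicator ?I \<sigma> \<partial>lebesgue) \<le> ennreal \<delta>"
      by (rule order_trans[OF nn_integral_mono Kf], use sub in \<open>auto simp: hf_def indicator_def\<close>)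
        (rule order_trans[OF nn_integral_mono Kg], use sub in \<open>auto simp: hg_def indicator_def\<close>)
    have Hnn: "AE \<sigma> in lebesgue. 0 \<le> indicator ?I \<sigma> *\<^sub>R H\<sigma> \<sigma>"
      using sobolev_AE
    proof eventually_elim
      case (elim \<sigma>)
      show ?case
      proof (cases "\<sigma> \<in> ?I")
        case True
        then have "f \<sigma> \<in> sobolev 1" "g \<sigma> \<in> sobolev 1" using elim s0 by auto
        then show ?thesis using True by (simp add: quad_energy_nonneg a c det sobolev_1_L2(2))
      qed simp
    qed
    have IH: "(\<integral>\<^sup>+\<sigma>. ennreal (indicator ?I \<sigma> *\<^sub>R H\<sigma> \<sigma>) \<partial>lebesgue) \<le> ennreal C"
      using nn_integral_eq_integral[OF iH Hnn] C(2)[OF s0 s(3)] by (simp add: set_lebesgue_integral_def ennreal_leI)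
    let ?good = "\<lambda>\<sigma>. f \<sigma> \<in> sobolev 1 \<and> g \<sigma> \<in> sobolev 1 \<and> \<sigma> \<notin> N \<and> H\<sigma> \<sigma> \<le> C' \<and> Kf \<sigma> \<le> ennreal (8 * \<delta>) \<and> Kg \<sigma> \<le> ennreal (8 * \<delta>)"
    have "\<exists>\<sigma>\<in>?I. ?good \<sigma>"
    proof (rule ccontr)
      assume none: "\<not> (\<exists>\<sigma>\<in>?I. ?good \<sigma>)"
      \<comment> \<open>The sum of the quantities relative to their thresholds. Without a good time
        it would be at least 1 almost everywhere on the window, although its integral is at most
        \<open>3 / 8\<close>.\<close>
      let ?R = "\<lambda>\<sigma>. ennreal (1 / C') * ennreal (indicator ?I \<sigma> *\<^sub>R H\<sigma> \<sigma>) + ennreal (1 / (8 * \<delta>)) * (hf \<sigma> * indicator ?I \<sigma>)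
          + ennreal (1 / (8 * \<delta>)) * (hg \<sigma> * indicator ?I \<sigma>)"
      have one: "1 \<le> ennreal (1 / (8 * \<delta>)) * z" if "\<not> z \<le> ennreal (8 * \<delta>)" for z
      proof -
        have "1 = ennreal (1 / (8 * \<delta>)) * ennreal (8 * \<delta>)" using \<delta> by (simp add: ennreal_mult[symmetric])
        also have "\<dots> \<le> ennreal (1 / (8 * \<delta>)) * z" using that by (intro mult_left_mono) auto
        finally show ?thesis .
      qed
      have "(\<integral>\<^sup>+\<sigma>. indicator ?I \<sigma> \<partial>lebesgue) \<le> (\<integral>\<^sup>+\<sigma>. ?R \<sigma> \<partial>lebesgue)"
      proof (rule nn_integral_mono_AE)
        show "AE \<sigma> in lebesgue. indicator ?I \<sigma> \<le> ?R \<sigma>"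
          using sobolev_AE AE_not_in[OF N(1)]
        proof eventually_elim
          case (elim \<sigma>)
          show ?case
          proof (cases "\<sigma> \<in> ?I")
            case True
            then have S: "f \<sigma> \<in> sobolev 1" "g \<sigma> \<in> sobolev 1" using elim s0 by auto
            have h: "hf \<sigma> = Kf \<sigma>" "hg \<sigma> = Kg \<sigma>" using True sub(2) by (auto simp: hf_def hg_def)
            have "\<not> H\<sigma> \<sigma> \<le> C' \<or> \<not> Kf \<sigma> \<le> ennreal (8 * \<delta>) \<or> \<not> Kg \<sigma> \<le> ennreal (8 * \<delta>)" using none True S elim by blast
            then have "1 \<le> ?R \<sigma>"
            proof (elim disjE)
              assume "\<not> H\<sigma> \<sigma> \<le> C'"
              then have "1 \<le> ennreal (1 / C' * H\<sigma> \<sigma>)" using C'(1) by (simp add: field_simps ennreal_ge_1)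
              also have "\<dots> = ennreal (1 / C') * ennreal (indicator ?I \<sigma> *\<^sub>R H\<sigma> \<sigma>)" using True C'(1) by (simp add: ennreal_mult'[symmetric])
              also have "\<dots> \<le> ?R \<sigma>" by (simp add: add.assoc)
              finally show ?thesis .
            next
              assume "\<not> Kf \<sigma> \<le> ennreal (8 * \<delta>)"
              from one[OF this] have "1 \<le> ennreal (1 / (8 * \<delta>)) * (hf \<sigma> * indicator ?I \<sigma>)" using True h by simp
              also have "\<dots> \<le> ?R \<sigma>" by (simp add: add.assoc add_increasing add_increasing2)
              finally show ?thesis .
            next
              assume "\<not> Kg \<sigma> \<le> ennreal (8 * \<delta>)"
              from one[OF this] have "1 \<le> ennreal (1 / (8 * \<delta>)) * (hg \<sigma> * indicator ?I \<sigma>)" using True h by simp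
              also have "\<dots> \<le> ?R \<sigma>" by (simp add: add_increasing)
              finally show ?thesis .
            qed
            then show ?thesis using True by simp
          qed simp
        qed
      qed
      also have "\<dots> = ennreal (1 / C') * (\<integral>\<^sup>+\<sigma>. ennreal (indicator ?I \<sigma> *\<^sub>R H\<sigma> \<sigma>) \<partial>lebesgue)
          + ennreal (1 / (8 * \<delta>)) * (\<integral>\<^sup>+\<sigma>. hf \<sigma> * indicator ?I \<sigma> \<partial>lebesgue) + ennreal (1 / (8 * \<delta>)) * (\<integral>\<^sup>+\<sigma>. hg \<sigma> * indicator ?I \<sigma> \<partial>lebesgue)"
        by (simp add: nn_integral_add nn_integral_cmult del: scaleR_conv_of_real real_scaleR_def)
      also have "\<dots> \<le> ennreal (1 / C') * ennreal C + ennreal (1 / (8 * \<delta>)) * ennreal \<delta> + ennreal (1 / (8 * \<delta>)) * ennreal \<delta>"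
        by (intro add_mono mult_left_mono IH If) auto
      also have "\<dots> = ennreal (C / C' + 1 / 8 + 1 / 8)"
        using C(1) C' \<delta> by (simp add: ennreal_mult[symmetric] ennreal_plus[symmetric] del: ennreal_plus)
      also have "\<dots> \<le> ennreal (3 / 8)" using C'(2) by (intro ennreal_leI) simp
      finally have "emeasure lebesgue ?I \<le> ennreal (3 / 8)" by simp
      moreover have "emeasure lebesgue ?I = ennreal (1 / 2)" by simp
      ultimately have "ennreal (1 / 2) \<le> ennreal (3 / 8)" by metis
      then have "(1 / 2 :: real) \<le> 3 / 8" by (subst (asm) ennreal_le_iff) auto
      then show False by simp
    qed
    then obtain \<sigma> where "\<sigma> \<in> ?I" "?good \<sigma>" by blast
    then show "\<exists>\<sigma>. real k \<le> \<sigma> \<and> \<sigma> \<le> real k + 1 \<and> 0 < \<sigma> \<and> \<sigma> \<notin> N \<and> f \<sigma> \<in> sobolev 1 \<and> g \<sigma> \<in> sobolev 1 \<and> H\<sigma> \<sigma> \<le> C' \<and>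
      Kf \<sigma> \<le> ennreal (8 * \<delta>) \<and> Kg \<sigma> \<le> ennreal (8 * \<delta>)"
      using sub s0 by (intro exI[of _ \<sigma>]) auto
  qed
qed

lemma K_sequence:
  "\<exists>\<delta>. \<delta> \<longlonglongrightarrow> (0::real) \<and> (\<forall>k. 0 < \<delta> k) \<and>
    (\<forall>k. (\<integral>\<^sup>+\<sigma>\<in>{real k..real k + 1}. Kf \<sigma> \<partial>lebesgue) \<le> ennreal (\<delta> k)) \<and>
    (\<forall>k. (\<integral>\<^sup>+\<sigma>\<in>{real k..real k + 1}. Kg \<sigma> \<partial>lebesgue) \<le> ennreal (\<delta> k))"
proof -
  define X where "X k = (\<integral>\<^sup>+\<sigma>\<in>{real k..real k + 1}. Kf \<sigma> \<partial>lebesgue)" for k :: nat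
  define Y where "Y k = (\<integral>\<^sup>+\<sigma>\<in>{real k..real k + 1}. Kg \<sigma> \<partial>lebesgue)" for k :: nat
  \<comment> \<open>The added \<open>1 / (k + 1)\<close> makes \<open>\<delta> k\<close> positive,
    as the thresholds in \<open>good_times\<close> must be.\<close>
  define \<delta> where "\<delta> k = enn2real (X k) + enn2real (Y k) + inverse (real (Suc k))" for k
  have fin: "X k < \<infinity>" "Y k < \<infinity>" for k
  proof -
    have sub: "(\<integral>\<^sup>+\<sigma>\<in>{real k..real k + 1}. D \<sigma> \<partial>lebesgue) \<le> (\<integral>\<^sup>+\<sigma>\<in>{0..real k + 1}. D \<sigma> \<partial>lebesgue)" for D :: "real \<Rightarrow> ennreal"
      by (intro nn_integral_mono) (auto simp: indicator_def)
    have "0 \<le> real k + 1" by simp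
    then show "X k < \<infinity>" "Y k < \<infinity>"
      unfolding X_def Y_def using le_less_trans[OF sub K_finite(1)] le_less_trans[OF sub K_finite(2)] by blast+
  qed
  have nn: "0 \<le> enn2real (X k)" "0 \<le> enn2real (Y k)" "0 < inverse (real (Suc k))" for k by auto
  show ?thesis
  proof (intro exI[of _ \<delta>] conjI allI)
    show "0 < \<delta> k" for k using nn[of k] unfolding \<delta>_def by linarith
    show "(\<integral>\<^sup>+\<sigma>\<in>{real k..real k + 1}. Kf \<sigma> \<partial>lebesgue) \<le> ennreal (\<delta> k)" for k
    proof -
      have "X k = ennreal (enn2real (X k))" using fin(1)[of k] by simp
      also have "\<dots> \<le> ennreal (\<delta> k)" using nn[of k] unfolding \<delta>_def by (intro ennreal_leI) linarith
      finally show ?thesis by (simp add: X_def)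
    qed
    show "(\<integral>\<^sup>+\<sigma>\<in>{real k..real k + 1}. Kg \<sigma> \<partial>lebesgue) \<le> ennreal (\<delta> k)" for k
    proof -
      have "Y k = ennreal (enn2real (Y k))" using fin(2)[of k] by simp
      also have "\<dots> \<le> ennreal (\<delta> k)" using nn[of k] unfolding \<delta>_def by (intro ennreal_leI) linarith
      finally show ?thesis by (simp add: Y_def)
    qed
    have XY: "(\<lambda>k. enn2real (X k)) \<longlonglongrightarrow> 0 \<and> (\<lambda>k. enn2real (Y k)) \<longlonglongrightarrow> 0"
    proof -
      have "\<exists>n0. \<forall>n\<ge>n0. norm (enn2real (X n) - 0) < e \<and> norm (enn2real (Y n) - 0) < e" if e: "0 < e" for e
      proof -
        have "0 < e / 2" using e by simp
        then obtain T where T: "0 < T" "\<And>t t'. T \<le> t \<Longrightarrow> t \<le> t' \<Longrightarrow> t' \<le> t + 2 \<Longrightarrow>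
          (\<integral>\<^sup>+\<sigma>\<in>{t..t'}. Kf \<sigma> \<partial>lebesgue) \<le> ennreal (e / 2) \<and> (\<integral>\<^sup>+\<sigma>\<in>{t..t'}. Kg \<sigma> \<partial>lebesgue) \<le> ennreal (e / 2)"
          using K_tail by blast
        obtain n0 where n0: "T \<le> real n0" using real_arch_simple by blast
        show ?thesis
        proof (intro exI[of _ n0] allI impI)
          fix n assume "n0 \<le> n"
          then have "T \<le> real n" using n0 by linarith
          then have "X n \<le> ennreal (e / 2)" "Y n \<le> ennreal (e / 2)" using T(2)[of "real n" "real n + 1"] by (auto simp: X_def Y_def)
          then have "enn2real (X n) \<le> e / 2" "enn2real (Y n) \<le> e / 2" using e by (intro enn2real_leI; simp)+
          then show "norm (enn2real (X n) - 0) < e \<and> norm (enn2real (Y n) - 0) < e" using e by simp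
        qed
      qed
      then show ?thesis unfolding LIMSEQ_iff by meson
    qed
    have "(\<lambda>k. enn2real (X k) + enn2real (Y k) + inverse (real (Suc k))) \<longlonglongrightarrow> 0 + 0 + 0"
      using XY by (intro tendsto_add LIMSEQ_inverse_real_of_nat) auto
    then show "\<delta> \<longlonglongrightarrow> 0" by (simp add: \<delta>_def[abs_def])
  qed
qed

text \<open>At the good times the derivative energy is bounded, so the continuous representatives
  share one Hoelder constant \<open>C\<close>; the smallness of \<open>slope_mass\<close> at these
  times becomes \<open>dissF\<close> and \<open>dissG\<close>.\<close>

theorem flow_exists:
  obtains s U V C \<kappa> where "flow a R c (1 / 6) (\<Theta> / 6) f g s U V C \<kappa> Einf"
proof -
  obtain C1 where C1: "\<And>(k::nat) \<delta>. 0 < \<delta> \<Longrightarrow> (\<integral>\<^sup>+\<sigma>\<in>{real k..real k + 1}. Kf \<sigma> \<partial>lebesgue) \<le> ennreal \<delta> \<Longrightarrow>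
    (\<integral>\<^sup>+\<sigma>\<in>{real k..real k + 1}. Kg \<sigma> \<partial>lebesgue) \<le> ennreal \<delta> \<Longrightarrow>
    \<exists>\<sigma>. real k \<le> \<sigma> \<and> \<sigma> \<le> real k + 1 \<and> 0 < \<sigma> \<and> \<sigma> \<notin> N \<and> f \<sigma> \<in> sobolev 1 \<and> g \<sigma> \<in> sobolev 1 \<and> H\<sigma> \<sigma> \<le> C1 \<and>
      Kf \<sigma> \<le> ennreal (8 * \<delta>) \<and> Kg \<sigma> \<le> ennreal (8 * \<delta>)"
    using good_times by blast
  obtain \<delta> :: "nat \<Rightarrow> real" where \<delta>: "\<delta> \<longlonglongrightarrow> 0" "\<And>k. 0 < \<delta> k"
    "\<And>k. (\<integral>\<^sup>+\<sigma>\<in>{real k..real k + 1}. Kf \<sigma> \<partial>lebesgue) \<le> ennreal (\<delta> k)"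
    "\<And>k. (\<integral>\<^sup>+\<sigma>\<in>{real k..real k + 1}. Kg \<sigma> \<partial>lebesgue) \<le> ennreal (\<delta> k)"
    using K_sequence by blast
  have "\<exists>\<sigma>. real k \<le> \<sigma> \<and> \<sigma> \<le> real k + 1 \<and> 0 < \<sigma> \<and> \<sigma> \<notin> N \<and> f \<sigma> \<in> sobolev 1 \<and> g \<sigma> \<in> sobolev 1 \<and> H\<sigma> \<sigma> \<le> C1 \<and>
      Kf \<sigma> \<le> ennreal (8 * \<delta> k) \<and> Kg \<sigma> \<le> ennreal (8 * \<delta> k)" for k
    by (rule C1[OF \<delta>(2-4)])
  then obtain s where s: "\<And>k. real k \<le> s k" "\<And>k. s k \<le> real k + 1" "\<And>k. 0 < s k" "\<And>k. s k \<notin> N"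
    "\<And>k. f (s k) \<in> sobolev 1" "\<And>k. g (s k) \<in> sobolev 1" "\<And>k. H\<sigma> (s k) \<le> C1"
    "\<And>k. Kf (s k) \<le> ennreal (8 * \<delta> k)" "\<And>k. Kg (s k) \<le> ennreal (8 * \<delta> k)"
    by metis
  let ?k = "coercivity a R c"
  have k: "0 < ?k" by (intro coercivity_pos a c det)
  define C where "C = sqrt (\<bar>C1\<bar> / ?k)"
  have C0: "0 \<le> C" using k by (simp add: C_def)
  have dn: "norm_L2 (weak_deriv (f (s n))) \<le> C \<and> norm_L2 (weak_deriv (g (s n))) \<le> C" for n
  proof -
    note L = sobolev_1_L2(2)[OF s(5)[of n]] sobolev_1_L2(2)[OF s(6)[of n]]
    have "?k * ((norm_L2 (weak_deriv (f (s n))))\<^sup>2 + (norm_L2 (weak_deriv (g (s n))))\<^sup>2) \<le> \<bar>C1\<bar>"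
      using quad_energy_coercive[OF a c det L] s(7)[of n] by linarith
    then have "(norm_L2 (weak_deriv (f (s n))))\<^sup>2 + (norm_L2 (weak_deriv (g (s n))))\<^sup>2 \<le> \<bar>C1\<bar> / ?k"
      using k by (simp add: pos_le_divide_eq mult.commute)
    then have "(norm_L2 (weak_deriv (f (s n))))\<^sup>2 \<le> \<bar>C1\<bar> / ?k" "(norm_L2 (weak_deriv (g (s n))))\<^sup>2 \<le> \<bar>C1\<bar> / ?k"
      using zero_le_power2[of "norm_L2 (weak_deriv (f (s n)))"] zero_le_power2[of "norm_L2 (weak_deriv (g (s n)))"] by linarith+
    then show ?thesis unfolding C_def by (auto intro: real_le_rsqrt)
  qed
  have rep: "\<exists>U. holder_half C U \<and> (AE x in lebesgue. w x = U x) \<and> (\<forall>x y. x \<le> y \<longrightarrow> U y - U x = (LINT t:{x..y}|lebesgue. weak_deriv w t))"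
    if w: "w \<in> sobolev 1" "norm_L2 (weak_deriv w) \<le> C" for w
  proof -
    obtain U where U: "AE x in lebesgue. w x = U x" "\<And>x y. x \<le> y \<Longrightarrow> U y - U x = (LINT t:{x..y}|lebesgue. weak_deriv w t)"
      "\<And>x y. x \<le> y \<Longrightarrow> \<bar>U y - U x\<bar> \<le> sqrt (y - x) * norm_L2 (weak_deriv w)"
      by (rule sobolev_1_continuous_rep[OF w(1)]) blast
    have "holder_half C U"
      unfolding holder_half_def
    proof (intro allI impI)
      fix x y :: real assume xy: "x \<le> y"
      have "sqrt (y - x) * norm_L2 (weak_deriv w) \<le> sqrt (y - x) * C" using xy w(2) by (intro mult_left_mono) auto
      then show "\<bar>U y - U x\<bar> \<le> C * sqrt (y - x)" using U(3)[OF xy] by (simp add: mult.commute)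
    qed
    then show ?thesis using U by blast
  qed
  have "\<exists>U. \<forall>n. holder_half C (U n) \<and> (AE x in lebesgue. f (s n) x = U n x) \<and> (\<forall>x y. x \<le> y \<longrightarrow> U n y - U n x = (LINT t:{x..y}|lebesgue. weak_deriv (f (s n)) t))"
    by (rule choice) (use rep s(5) dn in blast)
  then obtain U where U: "\<And>n. holder_half C (U n)" "\<And>n. AE x in lebesgue. f (s n) x = U n x"
    "\<And>n x y. x \<le> y \<Longrightarrow> U n y - U n x = (LINT t:{x..y}|lebesgue. weak_deriv (f (s n)) t)" by blast
  have "\<exists>V. \<forall>n. holder_half C (V n) \<and> (AE x in lebesgue. g (s n) x = V n x) \<and> (\<forall>x y. x \<le> y \<longrightarrow> V n y - V n x = (LINT t:{x..y}|lebesgue. weak_deriv (g (s n)) t))"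
    by (rule choice) (use rep s(6) dn in blast)
  then obtain V where V: "\<And>n. holder_half C (V n)" "\<And>n. AE x in lebesgue. g (s n) x = V n x"
    "\<And>n x y. x \<le> y \<Longrightarrow> V n y - V n x = (LINT t:{x..y}|lebesgue. weak_deriv (g (s n)) t)" by blast
  \<comment> \<open>The 8 comes from \<open>good_times\<close>; the factor
    \<open>1 + \<Theta>\<close> dominates both 1 and \<open>\<Theta>\<close>, the scalings of the
    two potentials.\<close>
  define \<kappa> where "\<kappa> n = (1 + \<Theta>) * (8 * \<delta> n)" for n
  have \<kappa>1: "8 * \<delta> n \<le> \<kappa> n" "\<Theta> * (8 * \<delta> n) \<le> \<kappa> n" for n using \<delta>(2)[of n] \<Theta> by (auto simp: \<kappa>_def distrib_right)
  have s_inf: "filterlim s at_top sequentially"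
    by (rule filterlim_at_top_mono[OF filterlim_real_sequentially]) (use s(1) in auto)
  have "flow a R c (1 / 6) (\<Theta> / 6) f g s U V C \<kappa> Einf"
  proof unfold_locales
    show "\<bar>(a * U n y + R * V n y + 1 / 6 * y\<^sup>2) - (a * U n x + R * V n x + 1 / 6 * x\<^sup>2)\<bar> \<le> \<kappa> n / d"
      if d: "0 < d" "x \<le> y" "\<And>z. x \<le> z \<Longrightarrow> z \<le> y \<Longrightarrow> d \<le> U n z" for n d x y
    proof -
      have "\<bar>(a * U n y + R * V n y + y\<^sup>2 / 6) - (a * U n x + R * V n x + x\<^sup>2 / 6)\<bar> \<le> 8 * \<delta> n / d"
        using \<delta>(2)[of n] by (intro slope_mass_bounds_increment[OF s(5,6) U(3) V(3) U(2) sobolev_1_L2(1)[OF s(5)] d s(8)]) auto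
      also have "\<dots> \<le> \<kappa> n / d" using \<kappa>1(1)[of n] d(1) by (intro divide_right_mono) auto
      finally show ?thesis by simp
    qed
    show "\<bar>(R * U n y + c * V n y + \<Theta> / 6 * y\<^sup>2) - (R * U n x + c * V n x + \<Theta> / 6 * x\<^sup>2)\<bar> \<le> \<kappa> n / d"
      if d: "0 < d" "x \<le> y" "\<And>z. x \<le> z \<Longrightarrow> z \<le> y \<Longrightarrow> d \<le> V n z" for n d x y
    proof -
      \<comment> \<open>Multiplying the second pressure by \<open>\<Theta>\<close> makes the
        coefficient matrix symmetric, and so turns it into the derivative of the energy in the
        second component.\<close>
      have RT: "R = \<Theta> * (\<eta>\<^sup>2 * R\<^sub>\<mu>)" "c = \<Theta> * R\<^sub>\<mu>" using \<eta> R\<mu> by (auto simp: \<Theta>_def Theta_def c_def)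
      let ?q = "\<lambda>x. \<eta>\<^sup>2 * R\<^sub>\<mu> * U n x + R\<^sub>\<mu> * V n x + x\<^sup>2 / 6"
      have q: "R * U n x + c * V n x + \<Theta> / 6 * x\<^sup>2 = \<Theta> * ?q x" for x
        by (subst RT(1), subst RT(2)) (simp add: algebra_simps)
      have "\<bar>?q y - ?q x\<bar> \<le> 8 * \<delta> n / d"
        using \<delta>(2)[of n] by (intro slope_mass_bounds_increment[OF s(5,6) U(3) V(3) V(2) sobolev_1_L2(1)[OF s(6)] d s(9)]) auto
      then have "\<Theta> * \<bar>?q y - ?q x\<bar> \<le> \<Theta> * (8 * \<delta> n / d)" using \<Theta> by (intro mult_left_mono) auto
      also have "\<dots> \<le> \<kappa> n / d" using divide_right_mono[OF \<kappa>1(2)[of n], of d] d(1) by simp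
      finally show ?thesis unfolding q using \<Theta> by (simp add: abs_mult right_diff_distrib[symmetric])
    qed
    show "\<kappa> \<longlonglongrightarrow> 0"
      using tendsto_mult[OF tendsto_const tendsto_mult[OF tendsto_const \<delta>(1)], of "1 + \<Theta>" 8] by (simp add: \<kappa>_def[abs_def])
    show "E t \<le> E (s n)" if "s n \<le> t" for n t using energy_D(1)[OF _ s(4) that] s(3)[of n] by simp
    show "(\<lambda>n. E (s n)) \<longlonglongrightarrow> Einf"
    proof (rule LIMSEQ_I)
      fix e :: real assume e: "0 < e"
      then have "0 < e / 2" by simp
      then obtain T where T: "0 < T" "\<And>t. T \<le> t \<Longrightarrow> E t \<le> Einf + e / 2" by (rule E_near_Einf) blast
      obtain n0 where n0: "T \<le> real n0" using real_arch_simple by blast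
      show "\<exists>n0. \<forall>n\<ge>n0. norm (E (s n) - Einf) < e"
      proof (intro exI[of _ n0] allI impI)
        fix n assume "n0 \<le> n"
        then have "T \<le> s n" using n0 s(1)[of n] by (meson of_nat_le_iff order_trans)
        then have "E (s n) \<le> Einf + e / 2" by (rule T(2))
        moreover have "Einf \<le> E (s n)" using Einf_le[OF _ s(4)] s(3)[of n] by simp
        ultimately show "norm (E (s n) - Einf) < e" using e by simp
      qed
    qed
    show "(\<lambda>n. P (s n)) \<longlonglongrightarrow> Einf / 3" by (rule filterlim_compose[OF P_tendsto s_inf])
    show "0 < (1 / 6 :: real)" by simp
    show "0 < \<Theta> / 6" using \<Theta> by simp
    show "0 \<le> C" by (rule C0)
  qed (fact a R c det fK gK s(1) s(2) U(1) U(2) V(1) V(2) slow)+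
  then show thesis by (rule that)
qed

end

section \<open>Stationary solutions\<close>

text \<open>The second Euler-Lagrange relation is \<open>\<Theta>\<close> times the pressure
  relation of the system, and \<open>\<Theta>\<close> is positive. The orientation alternative only
  decides whether \<open>weak_derivs\<close> is applied to the pair or to the exchanged
  pair.\<close>

lemma stationary_solution_if_stationary:
  assumes st: "stationary (\<eta>\<^sup>2 * (1 + R)) R (R / \<eta>\<^sup>2) (1 / 6) (Theta R R\<^sub>\<mu> \<eta> / 6) F G"
    and K: "F \<in> setK" "G \<in> setK" and pos: "0 < R" "0 < R\<^sub>\<mu>" "0 < \<eta>"
    and o: "R * (Theta R R\<^sub>\<mu> \<eta> / 6) \<le> 1 / 6 * (R / \<eta>\<^sup>2) \<or> R * (1 / 6) \<le> Theta R R\<^sub>\<mu> \<eta> / 6 * (\<eta>\<^sup>2 * (1 + R))"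
  shows "stationary_solution R R\<^sub>\<mu> \<eta> F G"
proof -
  let ?T = "Theta R R\<^sub>\<mu> \<eta>"
  have T: "0 < ?T" using pos by (simp add: Theta_def)
  interpret stationary "\<eta>\<^sup>2 * (1 + R)" R "R / \<eta>\<^sup>2" "1 / 6" "?T / 6" F G by fact
  obtain U V where UV: "has_weak_deriv F U" "has_weak_deriv G V" "U \<in> L2" "V \<in> L2"
    "\<And>x. F x * (\<eta>\<^sup>2 * (1 + R) * U x + R * V x + 2 * (1 / 6) * x) = 0"
    "\<And>x. G x * (R * U x + R / \<eta>\<^sup>2 * V x + 2 * (?T / 6) * x) = 0"
  proof (cases "R * (?T / 6) \<le> 1 / 6 * (R / \<eta>\<^sup>2)")
    case True
    then show thesis using weak_derivs[OF True] that by blast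
  next
    case False
    then have o': "R * (1 / 6) \<le> ?T / 6 * (\<eta>\<^sup>2 * (1 + R))" using o by blast
    interpret sw: stationary "R / \<eta>\<^sup>2" R "\<eta>\<^sup>2 * (1 + R)" "?T / 6" "1 / 6" G F by (rule swap)
    obtain V U where VU: "has_weak_deriv G V" "has_weak_deriv F U" "V \<in> L2" "U \<in> L2"
      "\<And>x. G x * (R / \<eta>\<^sup>2 * V x + R * U x + 2 * (?T / 6) * x) = 0"
      "\<And>x. F x * (R * V x + \<eta>\<^sup>2 * (1 + R) * U x + 2 * (1 / 6) * x) = 0"
      using sw.weak_derivs[OF o'] by blast
    show thesis by (rule that[OF VU(2,1,4,3)]) (use VU(5,6) in \<open>simp_all add: add.commute\<close>)
  qed
  have S: "F \<in> sobolev 1" "G \<in> sobolev 1"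
    using sobolev_1I[OF setK_integrable(1)[OF K(1)] UV(3,1)] sobolev_1I[OF setK_integrable(1)[OF K(2)] UV(4,2)] by auto
  note w = weak_deriv_AE[OF weak_deriv_pressure[OF UV(1,2)]]
  have "AE x in lebesgue. F x * weak_deriv (press_f R \<eta> F G) x = 0"
    using w[of "\<eta>\<^sup>2 * (1 + R)" R] unfolding press_f_def
  proof eventually_elim
    case (elim x)
    show ?case unfolding elim using UV(5)[of x] by simp
  qed
  moreover have "AE x in lebesgue. G x * weak_deriv (press_g R\<^sub>\<mu> \<eta> F G) x = 0"
    using w[of "\<eta>\<^sup>2 * R\<^sub>\<mu>" R\<^sub>\<mu>] unfolding press_g_def
  proof eventually_elim
    case (elim x)
    have RT: "R = ?T * (\<eta>\<^sup>2 * R\<^sub>\<mu>)" "R / \<eta>\<^sup>2 = ?T * R\<^sub>\<mu>" using pos by (auto simp: Theta_def)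
    have "R * U x + R / \<eta>\<^sup>2 * V x + 2 * (?T / 6) * x = ?T * (\<eta>\<^sup>2 * R\<^sub>\<mu> * U x + R\<^sub>\<mu> * V x + x / 3)"
      unfolding RT(2) by (subst (1) RT(1)) (simp add: algebra_simps)
    then show ?case unfolding elim using UV(6)[of x] T by auto
  qed
  ultimately show ?thesis unfolding stationary_solution_def using K S by simp
qed

text \<open>The L1 asymmetry of \<open>F\<close> is at most twice its L1 distance to any even
  function, and this distance tends to 0 along the even states.\<close>

lemma even_limit:
  fixes w :: "real \<Rightarrow> real \<Rightarrow> real"
  assumes ev: "\<And>t. 0 < t \<Longrightarrow> ae_even (w t)" and K: "\<And>t. 0 \<le> t \<Longrightarrow> w t \<in> spX" "F \<in> spX"
    and lim: "((\<lambda>t. norm_X (\<lambda>x. w t x - F x)) \<longlongrightarrow> 0) at_top"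
  shows "ae_even F"
proof -
  define d where "d = (\<integral>x. \<bar>F (- x) - F x\<bar> \<partial>lebesgue)"
  have refl: "integrable lebesgue (\<lambda>x. h (- x))" "(\<integral>x. h (- x) \<partial>lebesgue) = (\<integral>x. h x \<partial>lebesgue)" if "integrable lebesgue h" for h :: "real \<Rightarrow> real"
    using lebesgue_integrable_real_affine[OF that, of "- 1" 0] lebesgue_integral_real_affine[of "- 1" h 0] by auto
  have F: "integrable lebesgue F" by (rule spX_integrable(3)[OF K(2)])
  have le: "d \<le> 2 * norm_X (\<lambda>x. w t x - F x)" if t: "0 < t" for t
  proof -
    have wi: "integrable lebesgue (w t)" using spX_integrable(3)[OF K(1)] t by simp
    have D: "(\<lambda>x. w t x - F x) \<in> spX" using K(1)[of t] K(2) t by (intro spX_diff) auto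
    have i: "integrable lebesgue (\<lambda>x. \<bar>w t x - F x\<bar>)" using wi F by auto
    have "d \<le> (\<integral>x. \<bar>w t (- x) - F (- x)\<bar> + \<bar>w t x - F x\<bar> \<partial>lebesgue)"
      unfolding d_def
    proof (rule integral_mono_AE)
      show "AE x in lebesgue. \<bar>F (- x) - F x\<bar> \<le> \<bar>w t (- x) - F (- x)\<bar> + \<bar>w t x - F x\<bar>"
        using ev[OF t] unfolding ae_even_def by eventually_elim linarith
    qed (use refl(1)[OF F] refl(1)[OF i] F i in auto)
    also have "\<dots> = 2 * (\<integral>x. \<bar>w t x - F x\<bar> \<partial>lebesgue)" using refl[OF i] i by simp
    also have "(\<integral>x. \<bar>w t x - F x\<bar> \<partial>lebesgue) \<le> (\<integral>x. (1 + x\<^sup>2) * \<bar>w t x - F x\<bar> \<partial>lebesgue)"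
    proof (rule integral_mono[OF i])
      show "integrable lebesgue (\<lambda>x. (1 + x\<^sup>2) * \<bar>w t x - F x\<bar>)"
        using D integrable_abs[of lebesgue "\<lambda>x. (1 + x\<^sup>2) * (w t x - F x)"] by (simp add: spX_def abs_mult)
      show "\<bar>w t x - F x\<bar> \<le> (1 + x\<^sup>2) * \<bar>w t x - F x\<bar>" for x by (simp add: distrib_right)
    qed
    also have "\<dots> \<le> norm_X (\<lambda>x. w t x - F x)" by (simp add: norm_X_def)
    finally show ?thesis by simp
  qed
  have "((\<lambda>t. 2 * norm_X (\<lambda>x. w t x - F x)) \<longlongrightarrow> 2 * 0) at_top" by (intro tendsto_intros lim)
  then have "((\<lambda>t. 2 * norm_X (\<lambda>x. w t x - F x)) \<longlongrightarrow> 0) at_top" by simp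
  then have "d \<le> 0"
  proof (rule tendsto_lowerbound)
    show "\<forall>\<^sub>F t in at_top. d \<le> 2 * norm_X (\<lambda>x. w t x - F x)"
      by (rule eventually_mono[OF eventually_gt_at_top[of "0::real"] le])
  qed simp
  moreover have "0 \<le> d" by (simp add: d_def)
  ultimately have "d = 0" by simp
  then have "AE x in lebesgue. \<bar>F (- x) - F x\<bar> = 0"
    unfolding d_def using refl(1)[OF F] F by (subst (asm) integral_nonneg_eq_0_iff_AE) auto
  then show ?thesis unfolding ae_even_def by simp
qed

lemma ae_even_cong:
  assumes "ae_eq F F'" "ae_even F"
  shows "ae_even F'"
  using assms(1) AE_lebesgue_uminus[OF assms(1)[unfolded ae_eq_def]] assms(2)
  unfolding ae_eq_def ae_even_def by eventually_elim simp

theorem theorem2p2: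
  fixes R R\<^sub>\<mu> \<eta> :: real
    and f\<^sub>0 g\<^sub>0 :: "real \<Rightarrow> real"
    and f g :: "real \<Rightarrow> real \<Rightarrow> real"
  assumes "R > 0" and "R\<^sub>\<mu> > 0" and "\<eta> > 0"
    and "f\<^sub>0 \<in> setK" and "g\<^sub>0 \<in> setK"
    and "weak_solution R R\<^sub>\<mu> \<eta> f\<^sub>0 g\<^sub>0 f g"
  shows "\<exists>F G. stationary_solution R R\<^sub>\<mu> \<eta> F G
    \<and> ((\<lambda>t. norm_X (\<lambda>x. f t x - F x)) \<longlongrightarrow> 0) at_top
    \<and> ((\<lambda>t. norm_X (\<lambda>x. g t x - G x)) \<longlongrightarrow> 0) at_top
    \<and> (\<forall>lm lp Fs Gs. stationary_family R R\<^sub>\<mu> \<eta> lm lp Fs Gs \<longrightarrow>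
          (\<exists>l\<in>{lm..lp}. ae_eq F (Fs l) \<and> ae_eq G (Gs l)
             \<and> (ae_even f\<^sub>0 \<and> ae_even g\<^sub>0 \<longrightarrow> l = 0)))"
proof -
  note ws = assms(6)[unfolded weak_solution_def bochner_Linf_def]
  obtain N where N: "N \<in> null_sets lebesgue" "N \<subseteq> {0<..}" "\<forall>s\<in>{0..} - N. \<forall>t\<ge>s.
        entropy_ineq R R\<^sub>\<mu> \<eta> f g s t \<and> energy_ineq R R\<^sub>\<mu> \<eta> f g s t \<and> moment_eq R R\<^sub>\<mu> \<eta> f g s t"
    using ws by blast
  have weakE: "\<forall>\<xi>\<in>test_functions. \<forall>t\<ge>0.
      (\<integral>x. f t x * \<xi> x \<partial>lebesgue) - (\<integral>x. f\<^sub>0 x * \<xi> x \<partial>lebesgue)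
        + (LINT \<sigma>:{0..t}|lebesgue.
            (\<integral>x. f \<sigma> x * weak_deriv (press_f R \<eta> (f \<sigma>) (g \<sigma>)) x * deriv \<xi> x \<partial>lebesgue)) = 0 \<and>
      (\<integral>x. g t x * \<xi> x \<partial>lebesgue) - (\<integral>x. g\<^sub>0 x * \<xi> x \<partial>lebesgue)
        + (LINT \<sigma>:{0..t}|lebesgue.
            (\<integral>x. g \<sigma> x * weak_deriv (press_g R\<^sub>\<mu> \<eta> (f \<sigma>) (g \<sigma>)) x * deriv \<xi> x \<partial>lebesgue)) = 0"
    using ws by (elim conjE)
  have fgK: "f t \<in> setK" "g t \<in> setK" if "0 \<le> t" for t using ws that by auto
  interpret w: weak_flow R R\<^sub>\<mu> \<eta> f\<^sub>0 g\<^sub>0 f g N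
  proof unfold_locales
    show "bochner_measurable {0<..} spX norm_X f" "bochner_measurable {0<..} spX norm_X g" using ws by auto
    show "bochner_L2 {0<..<t} (sobolev 1) (norm_H 1) f" "bochner_L2 {0<..<t} (sobolev 1) (norm_H 1) g" if "0 < t" for t
      using ws that by (auto simp del: One_nat_def)
    show "(\<integral>x. f t x * \<xi> x \<partial>lebesgue) - (\<integral>x. f\<^sub>0 x * \<xi> x \<partial>lebesgue)
        + (LINT \<sigma>:{0..t}|lebesgue. (\<integral>x. f \<sigma> x * weak_deriv (press_f R \<eta> (f \<sigma>) (g \<sigma>)) x * deriv \<xi> x \<partial>lebesgue)) = 0"
      "(\<integral>x. g t x * \<xi> x \<partial>lebesgue) - (\<integral>x. g\<^sub>0 x * \<xi> x \<partial>lebesgue)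
        + (LINT \<sigma>:{0..t}|lebesgue. (\<integral>x. g \<sigma> x * weak_deriv (press_g R\<^sub>\<mu> \<eta> (f \<sigma>) (g \<sigma>)) x * deriv \<xi> x \<partial>lebesgue)) = 0"
      if "\<xi> \<in> test_functions" "0 \<le> t" for \<xi> t
      using weakE that by blast+
    show "entropy_ineq R R\<^sub>\<mu> \<eta> f g s t" "energy_ineq R R\<^sub>\<mu> \<eta> f g s t" "moment_eq R R\<^sub>\<mu> \<eta> f g s t"
      if "0 \<le> s" "s \<notin> N" "s \<le> t" for s t
      using N(3) that by auto
  qed (use assms fgK N in auto)
  obtain s U V C \<kappa> where "flow w.a R w.c (1 / 6) (w.\<Theta> / 6) f g s U V C \<kappa> w.Einf" using w.flow_exists by blast
  then interpret fl: flow w.a R w.c "1 / 6" "w.\<Theta> / 6" f g s U V C \<kappa> w.Einf .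
  obtain F G where st: "stationary w.a R w.c (1 / 6) (w.\<Theta> / 6) F G" and o: "R * (w.\<Theta> / 6) \<le> 1 / 6 * w.c \<or> R * (1 / 6) \<le> w.\<Theta> / 6 * w.a"
    and K: "F \<in> setK" "G \<in> setK"
    and lim: "((\<lambda>t. norm_X (\<lambda>x. f t x - F x)) \<longlongrightarrow> 0) at_top" "((\<lambda>t. norm_X (\<lambda>x. g t x - G x)) \<longlongrightarrow> 0) at_top"
    by (rule fl.convergence) (rule that)
  have sol: "stationary_solution R R\<^sub>\<mu> \<eta> F G"
    by (rule stationary_solution_if_stationary) (use st o K assms in \<open>simp_all add: w.a_def w.c_def w.\<Theta>_def\<close>)
  have even: "ae_even F \<and> ae_even G" if "ae_even f\<^sub>0 \<and> ae_even g\<^sub>0"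
  proof -
    have "\<forall>t>0. ae_even (f t) \<and> ae_even (g t)" using ws that by blast
    then show ?thesis
      using even_limit[of f F] even_limit[of g G] setK_D(1) fgK K lim by blast
  qed
  have "\<exists>l\<in>{lm..lp}. ae_eq F (Fs l) \<and> ae_eq G (Gs l) \<and> (ae_even f\<^sub>0 \<and> ae_even g\<^sub>0 \<longrightarrow> l = 0)"
    if fam: "stationary_family R R\<^sub>\<mu> \<eta> lm lp Fs Gs" for lm lp Fs Gs
  proof -
    obtain l where l: "l \<in> {lm..lp}" "ae_eq F (Fs l)" "ae_eq G (Gs l)"
      using fam sol unfolding stationary_family_def by blast
    \<comment> \<open>Evenness of the limit passes to the almost everywhere equal family member, and
      within the family only the index 0 has two even components.\<close>
    have "l = 0" if "ae_even f\<^sub>0 \<and> ae_even g\<^sub>0"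
    proof -
      have "ae_even (Fs l) \<and> ae_even (Gs l)" using even[OF that] ae_even_cong l(2,3) by blast
      then show ?thesis using fam l(1) unfolding stationary_family_def by blast
    qed
    then show ?thesis using l by blast
  qed
  then show ?thesis using sol lim by blast
qed

end
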